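(* Let $d\in\{2,3\}$, $r_2=3$, $r_3=4$ and $T>0$. Let $u\in C([0,T];\dot Z_{r_d,r_d}(\mathbb{R}^d))$ be a solution of the initial value problem $$\partial_t u-\mathcal{R}_1\Delta u+u\,\partial_{x_1}u=0,\qquad u(x,0)=u_0(x),\qquad x\in\mathbb{R}^d .$$ If there exist three different times $t_1,t_2,t_3\in[0,T]$ such that $$u(\cdot,t_j)\in Z_{d/2+3,\,d/2+3}(\mathbb{R}^d),\qquad j=1,2,3,$$ then $u(x,t)=0$ for all $x\in\mathbb{R}^d$, $t\in[0,T]$.
   Context: Functions $u=u(x,t)$ are real-valued. $\mathcal{R}_1=-\partial_{x_1}(-\Delta)^{-1/2}$ is the Riesz transform, the Fourier multiplier operator with symbol $-i\xi_1/|\xi|$, where $\widehat f(\xi)=\int_{\mathbb{R}^d}e^{-ix\cdot\xi}f(x)\,dx$. $$Z_{s,r}(\mathbb{R}^d)=H^s(\mathbb{R}^d)\cap L^2(|x|^{2r}dx),\qquad \dot Z_{s,r}(\mathbb{R}^d)=\{f\in Z_{s,r}(\mathbb{R}^d):\ \widehat f(0)=0\},$$ with norm $\|f\|_{H^s}+\||x|^rf\|_{L^2}$. Solutions are understood in the sense of Duhamel's formula $u(t)=e^{t\mathcal{R}_1\Delta}u_0-\int_0^te^{(t-\tau)\mathcal{R}_1\Delta}u(\tau)\partial_{x_1}u(\tau)\,d\tau$, where $e^{t\mathcal{R}_1\Delta}$ has Fourier symbol $e^{it\xi_1|\xi|}$. *)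

theory Defs
  imports "HOL-Analysis.Analysis"
begin

text \<open>
  Elements of \<open>L\<^sup>2\<close> and of the Sobolev spaces below are represented by Borel functions; equality
  of such elements is equality almost everywhere.
\<close>

definition l2_sq :: "('a::euclidean_space \<Rightarrow> complex) \<Rightarrow> ennreal" where
  "l2_sq f = (\<integral>\<^sup>+x. ennreal ((cmod (f x))\<^sup>2) \<partial>lborel)"

definition L2 :: "('a::euclidean_space \<Rightarrow> complex) set" where
  "L2 = {f. f \<in> borel_measurable lborel \<and> l2_sq f < \<infinity>}"

definition fourier :: "('a::euclidean_space \<Rightarrow> complex) \<Rightarrow> 'a \<Rightarrow> complex" where
  "fourier f \<xi> = (LINT x|lborel. exp (- (\<i> * complex_of_real (x \<bullet> \<xi>))) * f x)"

text \<open>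
  The Fourier transform of \<open>f \<in> L\<^sup>2\<close> is the limit in \<open>L\<^sup>2\<close>, as \<open>R \<rightarrow> \<infinity>\<close>, of the transforms of
  the integrable functions \<open>f\<close> restricted to \<open>|x| \<le> R\<close>.
\<close>

definition has_fourier_L2 ::
    "('a::euclidean_space \<Rightarrow> complex) \<Rightarrow> ('a \<Rightarrow> complex) \<Rightarrow> bool" where
  "has_fourier_L2 f F \<longleftrightarrow> f \<in> L2 \<and> F \<in> L2 \<and>
     ((\<lambda>R::real. l2_sq (\<lambda>\<xi>. fourier (\<lambda>x. indicator (cball 0 R) x * f x) \<xi> - F \<xi>)) \<longlongrightarrow> 0) at_top"

definition fourier_L2 :: "('a::euclidean_space \<Rightarrow> complex) \<Rightarrow> 'a \<Rightarrow> complex" where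
  "fourier_L2 f = (SOME F. has_fourier_L2 f F)"

definition bessel_weight :: "real \<Rightarrow> 'a::euclidean_space \<Rightarrow> complex" where
  "bessel_weight s \<xi> = complex_of_real ((1 + (norm \<xi>)\<^sup>2) powr (s / 2))"

text \<open>As a subset of \<open>L\<^sup>2\<close>, this is the Sobolev space \<open>H\<^sup>s\<close> for \<open>s \<ge> 0\<close> only.\<close>

definition sobolev :: "real \<Rightarrow> ('a::euclidean_space \<Rightarrow> complex) set" where
  "sobolev s = {f. \<exists>F. has_fourier_L2 f F \<and> l2_sq (\<lambda>\<xi>. bessel_weight s \<xi> * F \<xi>) < \<infinity>}"

text \<open>The norm is taken without the factor \<open>(2\<pi>)\<close> to the power \<open>-d/2\<close>.\<close>

definition sobolev_norm :: "real \<Rightarrow> ('a::euclidean_space \<Rightarrow> complex) \<Rightarrow> real" where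
  "sobolev_norm s f = sqrt (enn2real (l2_sq (\<lambda>\<xi>. bessel_weight s \<xi> * fourier_L2 f \<xi>)))"

definition Z_space :: "real \<Rightarrow> real \<Rightarrow> ('a::euclidean_space \<Rightarrow> real) set" where
  "Z_space s r = {f. (\<lambda>x. complex_of_real (f x)) \<in> sobolev s \<and>
     l2_sq (\<lambda>x. complex_of_real (norm x powr r * f x)) < \<infinity>}"

definition Z_norm :: "real \<Rightarrow> real \<Rightarrow> ('a::euclidean_space \<Rightarrow> real) \<Rightarrow> real" where
  "Z_norm s r f = sobolev_norm s (\<lambda>x. complex_of_real (f x)) +
     sqrt (enn2real (l2_sq (\<lambda>x. complex_of_real (norm x powr r * f x))))"

text \<open>
  Integrability gives the value of the Fourier transform at the single point \<open>0\<close> a meaning.  It is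
  automatic for members of \<open>Z_space s r\<close> with \<open>s \<ge> 0\<close> and \<open>r > d/2\<close>.
\<close>

definition Z_dot :: "real \<Rightarrow> real \<Rightarrow> ('a::euclidean_space \<Rightarrow> real) set" where
  "Z_dot s r = {f \<in> Z_space s r. integrable lborel f \<and>
     fourier (\<lambda>x. complex_of_real (f x)) 0 = 0}"

definition continuous_in_Z_dot ::
    "real \<Rightarrow> real \<Rightarrow> real \<Rightarrow> (real \<Rightarrow> 'a::euclidean_space \<Rightarrow> real) \<Rightarrow> bool" where
  "continuous_in_Z_dot s r T u \<longleftrightarrow> (\<forall>t\<in>{0..T}. u t \<in> Z_dot s r) \<and>
     (\<forall>t\<in>{0..T}. ((\<lambda>\<tau>. Z_norm s r (\<lambda>x. u \<tau> x - u t x)) \<longlongrightarrow> 0) (at t within {0..T}))"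

text \<open>
  Weak derivative in the direction of the \<open>k\<close>-th coordinate, tested against compactly supported
  functions of class \<open>C\<^sup>1\<close>.
\<close>

definition locally_integrable :: "('a::euclidean_space \<Rightarrow> real) \<Rightarrow> bool" where
  "locally_integrable f \<longleftrightarrow> f \<in> borel_measurable lborel \<and>
     (\<forall>K. compact K \<longrightarrow> set_integrable lborel K f)"

definition has_weak_partial ::
    "'d::finite \<Rightarrow> (real^'d \<Rightarrow> real) \<Rightarrow> (real^'d \<Rightarrow> real) \<Rightarrow> bool" where
  "has_weak_partial k f g \<longleftrightarrow> locally_integrable f \<and> locally_integrable g \<and>
     (\<forall>\<phi> D. (\<forall>x. (\<phi> has_derivative blinfun_apply (D x)) (at x)) \<and> continuous_on UNIV D \<and>
        compact (closure {x. \<phi> x \<noteq> 0}) \<longrightarrow>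
        (LINT x|lborel. f x * blinfun_apply (D x) (axis k 1)) = - (LINT x|lborel. g x * \<phi> x))"

text \<open>\<open>has_multiplier m f g\<close>: the Fourier multiplier operator with symbol \<open>m\<close> maps \<open>f\<close> to \<open>g\<close>.\<close>

definition has_multiplier ::
    "('a::euclidean_space \<Rightarrow> complex) \<Rightarrow> ('a \<Rightarrow> complex) \<Rightarrow> ('a \<Rightarrow> complex) \<Rightarrow> bool" where
  "has_multiplier m f g \<longleftrightarrow> (\<exists>F G. has_fourier_L2 f F \<and> has_fourier_L2 g G \<and>
     (AE \<xi> in lborel. G \<xi> = m \<xi> * F \<xi>))"

text \<open>
  Symbol of the unitary group generated by \<open>R\<^sub>1 \<Delta>\<close>, where the coordinate \<open>k\<close> plays the role of
  \<open>x\<^sub>1\<close>: the Riesz transform has symbol \<open>-i \<xi>\<^sub>k / |\<xi>|\<close> and \<open>\<Delta>\<close> has symbol \<open>-|\<xi>|\<^sup>2\<close>.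
\<close>

definition propagator_symbol :: "'d::finite \<Rightarrow> real \<Rightarrow> real^'d \<Rightarrow> complex" where
  "propagator_symbol k t \<xi> = exp (\<i> * complex_of_real (t * (\<xi> $ k) * norm \<xi>))"

text \<open>
  Riemann integral over \<open>[a, b]\<close> of an \<open>L\<^sup>2\<close>-valued function, as the \<open>L\<^sup>2\<close>-limit of Riemann sums.
  For continuous integrands it exists and is the Bochner integral.
\<close>

definition has_L2_integral ::
    "(real \<Rightarrow> 'a::euclidean_space \<Rightarrow> complex) \<Rightarrow> real \<Rightarrow> real \<Rightarrow> ('a \<Rightarrow> complex) \<Rightarrow> bool" where
  "has_L2_integral w a b J \<longleftrightarrow> (\<forall>\<tau>\<in>{a..b}. w \<tau> \<in> L2) \<and> J \<in> L2 \<and>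
     (\<forall>\<epsilon>::ennreal. \<epsilon> > 0 \<longrightarrow> (\<exists>\<delta>>0. \<forall>p. p tagged_division_of {a..b} \<and> (\<lambda>\<tau>. ball \<tau> \<delta>) fine p \<longrightarrow>
        l2_sq (\<lambda>x. (\<Sum>(\<tau>, K)\<in>p. complex_of_real (measure lborel K) * w \<tau> x) - J x) < \<epsilon>))"

text \<open>
  Duhamel's formula on \<open>[0, T]\<close>: \<open>ux \<tau>\<close> is the derivative of \<open>u(\<tau>)\<close> in the direction \<open>k\<close>, \<open>v\<close> is
  the free evolution of the datum, \<open>w \<tau>\<close> is the group at time \<open>t - \<tau>\<close> applied to the
  nonlinearity at time \<open>\<tau>\<close>, and \<open>J\<close> is the integral of \<open>w\<close> over \<open>[0, t]\<close>.
\<close>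

definition duhamel_solution ::
    "'d::finite \<Rightarrow> real \<Rightarrow> (real^'d \<Rightarrow> real) \<Rightarrow> (real \<Rightarrow> real^'d \<Rightarrow> real) \<Rightarrow> bool" where
  "duhamel_solution k T u0 u \<longleftrightarrow>
     (\<exists>ux. (\<forall>\<tau>\<in>{0..T}. has_weak_partial k (u \<tau>) (ux \<tau>)) \<and>
       (\<forall>t\<in>{0..T}. \<exists>v w J.
          has_multiplier (propagator_symbol k t) (\<lambda>x. complex_of_real (u0 x)) v \<and>
          (\<forall>\<tau>\<in>{0..t}. has_multiplier (propagator_symbol k (t - \<tau>))
             (\<lambda>x. complex_of_real (u \<tau> x * ux \<tau> x)) (w \<tau>)) \<and>
          has_L2_integral w 0 t J \<and>
          (AE x in lborel. complex_of_real (u t x) = v x - J x)))"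

end

theory Submission
  imports Defs "HOL-Probability.Probability"
begin

text \<open>
  Write \<open>h\<close> for \<open>\<xi>\<^sub>k |\<xi>|\<close>, the phase of the free evolution, and \<open>F = u \<partial>\<^sub>k u\<close>.  In terms of Fourier
  transforms, Duhamel's formula between two times \<open>s < t\<close> reads
  \<open>u^(t) - u^(s) = (P(t - s) - 1) u^(s) - \<integral> (P(t - \<tau>) - 1) F^(\<tau>) d\<tau> - \<integral> F^(\<tau>) d\<tau>\<close>, with
  \<open>P(t) = exp (\<i> t h)\<close> and both integrals over \<open>[s, t]\<close>.  The function \<open>h\<close> is homogeneous of degree two
  but not smooth at the origin, so this formula produces singularities of \<open>u^(t)\<close> at \<open>\<xi> = 0\<close>, whereas
  square integrability of \<open>|x|\<^bsup>d/2 + 3\<^esup> u(t)\<close> forbids singularities that are homogeneous of degree three: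
  these just fail to have \<open>d/2 + 3\<close> derivatives in \<open>L\<^sup>2\<close>.
  
  Both \<open>u^(s)\<close> and \<open>F^(\<tau>)\<close> vanish at the origin.  To first order the former is \<open>-\<i> X(\<xi>)\<close> with \<open>X(\<xi>)\<close>
  the integral of \<open>(x \<bullet> \<xi>) u(x, s)\<close>, and the latter is \<open>\<i> \<xi>\<^sub>k E / 2\<close> with \<open>E\<close> the integral of \<open>u\<^sup>2\<close>
  (\<open>integral_moment_advection\<close>).  Since \<open>E\<close> is conserved (\<open>square_integral_conserved\<close>), the part of
  \<open>u^(t) - u^(s)\<close> that is homogeneous of degree three and singular equals
  \<open>(t - s) X(\<xi>) h + (t - s)\<^sup>2 / 4 E \<xi>\<^sub>k h\<close>.  If \<open>u(s)\<close> and \<open>u(t)\<close> have the critical decay, this must vanish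
  (\<open>critical_weight_identity\<close>, for a suitable mean over \<open>\<xi>\<close>).  After division by \<open>t - s\<close> its first term
  does not depend on \<open>t\<close>, so two choices of \<open>t\<close> with the same \<open>s\<close> force \<open>E = 0\<close>, and hence \<open>u = 0\<close>.
  
  The singularity is detected without fractional derivatives.  Averages of \<open>u^(t)\<close> against Gaussians
  of widths \<open>b\<close>, \<open>2 b\<close>, \<open>3 b\<close>, \<open>4 b\<close> are combined with weights that cancel the contributions of orders
  \<open>0\<close>, \<open>2\<close>, \<open>4\<close> in \<open>b\<close> (odd polynomials have mean zero) but not a singular contribution of order \<open>3\<close>.
  Divided by \<open>b\<^sup>3\<close>, the combination tends to zero for functions with the critical decay
  (\<open>cancelling_mean_weighted_tendsto\<close>), and to a nonzero multiple of the Gaussian mean of the homogeneous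
  part in general (\<open>cancelling_mean_homogeneous_tendsto\<close>).
  
  The hypothesis is an identity in \<open>L\<^sup>2\<close>, with transforms defined as limits in \<open>L\<^sup>2\<close> and a weak
  derivative.  Pairing it with Gaussians (\<open>integral_fourier_L2_gauss\<close>, \<open>has_L2_integral_pairing\<close>) yields the
  formula for every \<open>\<xi>\<close> (\<open>duhamel_fourier\<close>), and Fourier inversion makes \<open>u(t)\<close> a function of class \<open>C\<^sup>1\<close>
  almost everywhere, whose classical derivative is the weak one (\<open>weak_partial_eq_partial\<close>).
\<close>

section \<open>Integrals over Euclidean space\<close>

lemma borel_measurable_euclidean_fold:
  "(\<lambda>f. \<Sum>b\<in>Basis. f b *\<^sub>R b) \<in> (\<Pi>\<^sub>M b\<in>Basis. lborel) \<rightarrow>\<^sub>M (borel :: 'a::euclidean_space measure)"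
  by measurable

lemma
  fixes f :: "'a::euclidean_space \<Rightarrow> real \<Rightarrow> 'b::{real_normed_field,banach,second_countable_topology}"
  assumes f: "\<And>b. b \<in> Basis \<Longrightarrow> integrable lborel (f b)"
  shows integrable_lborel_prod_coords: "integrable lborel (\<lambda>x::'a. \<Prod>b\<in>Basis. f b (x \<bullet> b))"
    and integral_lborel_prod_coords:
      "(LINT x|lborel. (\<Prod>b\<in>Basis. f b ((x::'a) \<bullet> b))) = (\<Prod>b\<in>Basis. (LINT y|lborel. f b y))"
proof -
  interpret product_sigma_finite "\<lambda>b::'a. lborel :: real measure" ..
  have mf: "f b \<in> borel_measurable borel" if "b \<in> Basis" for b
    using f[OF that] by auto
  have meas: "(\<lambda>x::'a. \<Prod>b\<in>Basis. f b (x \<bullet> b)) \<in> borel_measurable borel"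
    by (intro borel_measurable_prod measurable_compose[OF _ mf]) auto
  have eq: "(\<Prod>b\<in>Basis. f b ((\<Sum>i\<in>Basis. g i *\<^sub>R i) \<bullet> b)) = (\<Prod>b\<in>Basis. f b (g b))" for g :: "'a \<Rightarrow> real"
    by (intro prod.cong refl) (simp add: inner_sum_left_Basis)
  have "integrable (\<Pi>\<^sub>M b\<in>Basis. lborel) (\<lambda>g. \<Prod>b\<in>Basis. f b (g (b::'a)))"
    using f by (intro product_integrable_prod) auto
  then show "integrable lborel (\<lambda>x::'a. \<Prod>b\<in>Basis. f b (x \<bullet> b))"
    unfolding lborel_eq[where 'a='a]
    by (subst integrable_distr_eq[OF borel_measurable_euclidean_fold meas]) (simp add: eq)
  show "(LINT x|lborel. (\<Prod>b\<in>Basis. f b ((x::'a) \<bullet> b))) = (\<Prod>b\<in>Basis. (LINT y|lborel. f b y))"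
    unfolding lborel_eq[where 'a='a]
    by (subst integral_distr[OF borel_measurable_euclidean_fold meas])
       (simp add: eq product_integral_prod f)
qed

lemma
  fixes f :: "'a::euclidean_space \<Rightarrow> 'b::{real_normed_field,banach,second_countable_topology}"
    and c :: real and a :: 'a
  assumes c: "c \<noteq> 0"
  shows integrable_lborel_affine: "integrable lborel f \<Longrightarrow> integrable lborel (\<lambda>x. f (a + c *\<^sub>R x))"
    and integral_lborel_affine:
      "f \<in> borel_measurable borel \<Longrightarrow>
        (LINT x|lborel. f x) = of_real (\<bar>c\<bar> ^ DIM('a)) * (LINT x|lborel. f (a + c *\<^sub>R x))"
proof -
  have T: "(\<lambda>x. a + c *\<^sub>R x) \<in> lborel \<rightarrow>\<^sub>M borel" by measurable
  have eq: "lborel = density (distr lborel borel (\<lambda>x. a + c *\<^sub>R x)) (\<lambda>_. ennreal (\<bar>c\<bar>^DIM('a)))"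
    using lborel_affine[OF c, of a] by simp
  { assume f: "integrable lborel f"
    then have "integrable (density (distr lborel borel (\<lambda>x. a + c *\<^sub>R x)) (\<lambda>_. ennreal (\<bar>c\<bar>^DIM('a)))) f"
      using eq by simp
    then have "integrable (distr lborel borel (\<lambda>x. a + c *\<^sub>R x)) (\<lambda>x. (\<bar>c\<bar>^DIM('a)) *\<^sub>R f x)"
      using f by (subst (asm) integrable_density) auto
    then have "integrable lborel (\<lambda>x. (\<bar>c\<bar>^DIM('a)) *\<^sub>R f (a + c *\<^sub>R x))"
      using f by (subst (asm) integrable_distr_eq[OF T]) auto
    from integrable_scaleR_right[OF this, of "inverse (\<bar>c\<bar>^DIM('a))"]
    show "integrable lborel (\<lambda>x. f (a + c *\<^sub>R x))"
      using c by simp }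
  { assume f: "f \<in> borel_measurable borel"
    have "(LINT x|lborel. f x)
        = (LINT x|density (distr lborel borel (\<lambda>x. a + c *\<^sub>R x)) (\<lambda>_. ennreal (\<bar>c\<bar>^DIM('a))). f x)"
      using eq by simp
    also have "\<dots> = (LINT x|distr lborel borel (\<lambda>x. a + c *\<^sub>R x). (\<bar>c\<bar>^DIM('a)) *\<^sub>R f x)"
      using f by (subst integral_density) auto
    also have "\<dots> = (LINT x|lborel. (\<bar>c\<bar>^DIM('a)) *\<^sub>R f (a + c *\<^sub>R x))"
      using f by (subst integral_distr[OF T]) auto
    finally show "(LINT x|lborel. f x)
        = of_real (\<bar>c\<bar> ^ DIM('a)) * (LINT x|lborel. f (a + c *\<^sub>R x))"
      by (simp add: scaleR_conv_of_real) }
qed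

lemma
  fixes f :: "'a::euclidean_space \<Rightarrow> 'b::{real_normed_field,banach,second_countable_topology}"
  assumes f: "integrable lborel f"
  shows integrable_lborel_shift: "integrable lborel (\<lambda>x. f (x + a))"
    and integral_lborel_shift: "(LINT x|lborel. f (x + a)) = (LINT x|lborel. f x)"
  using integrable_lborel_affine[OF _ f, of 1 a] integral_lborel_affine[of 1 f a] f by (auto simp: add.commute)

lemma nn_integral_lborel_affine:
  fixes f :: "'a::euclidean_space \<Rightarrow> ennreal" and c :: real
  assumes c: "c \<noteq> 0" and f: "f \<in> borel_measurable borel"
  shows "(\<integral>\<^sup>+x. f x \<partial>lborel) = ennreal (\<bar>c\<bar> ^ DIM('a)) * (\<integral>\<^sup>+x. f (a + c *\<^sub>R x) \<partial>lborel)"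
proof -
  have T: "(\<lambda>x. a + c *\<^sub>R x) \<in> lborel \<rightarrow>\<^sub>M borel" by measurable
  have eq: "lborel = density (distr lborel borel (\<lambda>x. a + c *\<^sub>R x)) (\<lambda>_. ennreal (\<bar>c\<bar>^DIM('a)))"
    using lborel_affine[OF c, of a] by simp
  have "(\<integral>\<^sup>+x. f x \<partial>lborel)
      = (\<integral>\<^sup>+x. f x \<partial>density (distr lborel borel (\<lambda>x. a + c *\<^sub>R x)) (\<lambda>_. ennreal (\<bar>c\<bar>^DIM('a))))"
    using eq by simp
  also have "\<dots> = (\<integral>\<^sup>+x. ennreal (\<bar>c\<bar>^DIM('a)) * f x \<partial>distr lborel borel (\<lambda>x. a + c *\<^sub>R x))"
    using f by (subst nn_integral_density) auto
  also have "\<dots> = (\<integral>\<^sup>+x. ennreal (\<bar>c\<bar>^DIM('a)) * f (a + c *\<^sub>R x) \<partial>lborel)"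
    using f by (subst nn_integral_distr[OF T]) auto
  also have "\<dots> = ennreal (\<bar>c\<bar>^DIM('a)) * (\<integral>\<^sup>+x. f (a + c *\<^sub>R x) \<partial>lborel)"
    using f by (subst nn_integral_cmult) auto
  finally show ?thesis .
qed

lemma integrable_inverse_one_plus_square: "integrable lborel (\<lambda>x::real. 1 / (1 + x\<^sup>2))"
proof -
  have "set_integrable lborel (einterval (-\<infinity>) \<infinity>) (\<lambda>x. inverse (1 + x^2))"
    by (rule integrable_inverse_1_plus_square)
  then show ?thesis
    by (simp add: set_integrable_def inverse_eq_divide)
qed

definition decay_weight :: "'a::euclidean_space \<Rightarrow> real" where
  "decay_weight x = 1 / (1 + (norm x)\<^sup>2) ^ DIM('a)"

lemma decay_weight_pos: "decay_weight x > 0"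
  by (simp add: decay_weight_def add_pos_nonneg)

text \<open>
  The product of the one-dimensional weights \<open>1 / (1 + x\<^sub>b\<^sup>2)\<close> dominates it, because every
  coordinate is bounded by the norm.
\<close>

lemma integrable_decay_weight: "integrable lborel (decay_weight :: 'a::euclidean_space \<Rightarrow> real)"
proof (rule Bochner_Integration.integrable_bound)
  show "integrable lborel (\<lambda>x::'a. \<Prod>b\<in>Basis. 1 / (1 + (x \<bullet> b)\<^sup>2))"
    by (rule integrable_lborel_prod_coords[where f="\<lambda>_ y. 1 / (1 + y\<^sup>2)"])
       (rule integrable_inverse_one_plus_square)
  show "decay_weight \<in> borel_measurable (lborel :: 'a measure)"
    unfolding decay_weight_def by measurable
  show "AE x::'a in lborel. norm (decay_weight x) \<le> norm (\<Prod>b\<in>Basis. 1 / (1 + (x \<bullet> b)\<^sup>2))"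
  proof (rule AE_I2)
    fix x :: 'a
    have "(\<Prod>b\<in>(Basis::'a set). 1 / (1 + (norm x)\<^sup>2)) \<le> (\<Prod>b\<in>Basis. 1 / (1 + (x \<bullet> b)\<^sup>2))"
    proof (rule prod_mono)
      fix b :: 'a assume "b \<in> Basis"
      then have "(x \<bullet> b)\<^sup>2 \<le> (norm x)\<^sup>2"
        using Basis_le_norm by (simp add: abs_le_square_iff[symmetric])
      then show "0 \<le> 1 / (1 + (norm x)\<^sup>2) \<and> 1 / (1 + (norm x)\<^sup>2) \<le> 1 / (1 + (x \<bullet> b)\<^sup>2)"
        by (auto intro!: divide_left_mono add_pos_nonneg mult_pos_pos)
    qed
    also have "(\<Prod>b\<in>(Basis::'a set). 1 / (1 + (norm x)\<^sup>2)) = decay_weight x"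
      by (simp add: decay_weight_def power_divide)
    finally show "norm (decay_weight x) \<le> norm (\<Prod>b\<in>Basis. 1 / (1 + (x \<bullet> b)\<^sup>2))"
      using decay_weight_pos[of x] by (simp add: order_trans[OF _ abs_ge_self])
  qed
qed

section \<open>The Gaussian\<close>

definition gauss :: "'a::euclidean_space \<Rightarrow> real" where
  "gauss z = (\<Prod>b\<in>Basis. std_normal_density (z \<bullet> b))"

lemma gauss_eq: "gauss (z::'a::euclidean_space) = (1 / sqrt (2 * pi)) ^ DIM('a) * exp (- (norm z)\<^sup>2 / 2)"
proof -
  have "gauss z = (\<Prod>b\<in>(Basis::'a set). 1 / sqrt (2 * pi)) * (\<Prod>b\<in>(Basis::'a set). exp (- (z \<bullet> b)\<^sup>2 / 2))"
    unfolding gauss_def std_normal_density_def by (rule prod.distrib)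
  also have "(\<Prod>b\<in>(Basis::'a set). exp (- (z \<bullet> b)\<^sup>2 / 2)) = exp (\<Sum>b\<in>Basis. - (z \<bullet> b)\<^sup>2 / 2)"
    by (simp add: exp_sum)
  also have "(\<Sum>b\<in>(Basis::'a set). - (z \<bullet> b)\<^sup>2 / 2) = - (norm z)\<^sup>2 / 2"
    unfolding power2_norm_eq_inner
    by (subst euclidean_inner) (simp add: power2_eq_square sum_negf sum_divide_distrib)
  finally show ?thesis by simp
qed

lemma gauss_pos: "gauss z > 0"
  by (simp add: gauss_eq)

lemma gauss_nonneg [simp]: "0 \<le> gauss z"
  using gauss_pos[of z] by simp

lemma borel_measurable_gauss [measurable]: "gauss \<in> borel_measurable borel"
  unfolding gauss_eq by measurable

lemma integrable_gauss: "integrable lborel gauss"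
  unfolding gauss_def
  by (rule integrable_lborel_prod_coords[where f="\<lambda>_. std_normal_density"]) simp

lemma integral_gauss: "(LINT z|lborel. gauss z) = 1"
  unfolding gauss_def
  by (subst integral_lborel_prod_coords[where f="\<lambda>_. std_normal_density"]) auto

text \<open>
  Raising \<open>y/n \<le> exp (y/n)\<close> to the power \<open>n\<close> bounds \<open>y\<^sup>n\<close> by a multiple of \<open>exp y\<close>; take
  \<open>y = (1 + |z|\<^sup>2) / 2\<close>.
\<close>

lemma polynomial_gauss_le_decay_weight:
  "\<exists>C. \<forall>z::'a::euclidean_space. (1 + (norm z)\<^sup>2) ^ m * gauss z \<le> C * decay_weight z"
proof -
  define n where "n = m + DIM('a)"
  have n: "n > 0" using DIM_positive[where 'a='a] by (simp add: n_def)
  define c where "c = (1 / sqrt (2 * pi)) ^ DIM('a)"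
  have c: "c > 0" by (simp add: c_def)
  have "(1 + (norm z)\<^sup>2) ^ m * gauss z \<le> c * ((2 * real n) ^ n * exp (1/2)) * decay_weight z" for z :: 'a
  proof -
    define y where "y = (1 + (norm z)\<^sup>2) / 2"
    have y: "y > 0" by (simp add: y_def add_pos_nonneg)
    have "y / n \<le> exp (y / n)"
      using exp_ge_add_one_self[of "y / n"] by linarith
    then have "(y / n) ^ n \<le> exp (y / n) ^ n"
      using y by (intro power_mono) auto
    also have "exp (y / n) ^ n = exp y"
      using n by (simp add: exp_of_nat_mult[symmetric])
    finally have "y ^ n \<le> real n ^ n * exp y"
      using n by (simp add: power_divide divide_le_eq mult.commute)
    then have "(2 * y) ^ n * exp (- y) \<le> (2 * real n) ^ n"
      by (simp add: exp_minus power_mult_distrib field_simps)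
    then have "(2 * y) ^ n * exp (- y) * exp (1/2) \<le> (2 * real n) ^ n * exp (1/2)"
      by (rule mult_right_mono) simp
    moreover have "exp (- (norm z)\<^sup>2 / 2) = exp (- y) * exp (1/2)"
      by (simp add: y_def exp_add[symmetric] field_simps)
    moreover have "2 * y = 1 + (norm z)\<^sup>2" by (simp add: y_def)
    ultimately have *: "(1 + (norm z)\<^sup>2) ^ n * exp (- (norm z)\<^sup>2 / 2) \<le> (2 * real n) ^ n * exp (1/2)"
      by (simp only: mult.assoc)
    have pos: "(1 + (norm z)\<^sup>2) > 0" by (simp add: add_pos_nonneg)
    have "(1 + (norm z)\<^sup>2) ^ m * gauss z
        = c * ((1 + (norm z)\<^sup>2) ^ n * exp (- (norm z)\<^sup>2 / 2)) * decay_weight z"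
      using pos by (simp add: decay_weight_def gauss_eq c_def n_def power_add)
    also have "\<dots> \<le> c * ((2 * real n) ^ n * exp (1/2)) * decay_weight z"
      using c decay_weight_pos[of z] by (intro mult_right_mono mult_left_mono *) auto
    finally show ?thesis .
  qed
  then show ?thesis by blast
qed

lemma integrable_power_norm_gauss:
  "integrable lborel (\<lambda>z::'a::euclidean_space. norm z ^ m * gauss z)"
proof -
  obtain C where C: "\<And>z::'a. (1 + (norm z)\<^sup>2) ^ m * gauss z \<le> C * decay_weight z"
    using polynomial_gauss_le_decay_weight[of m] by blast
  show ?thesis
  proof (rule Bochner_Integration.integrable_bound)
    show "integrable lborel (\<lambda>z::'a. C * decay_weight z)"
      by (simp add: integrable_decay_weight)
    show "AE z::'a in lborel. norm (norm z ^ m * gauss z) \<le> norm (C * decay_weight z)"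
    proof (rule AE_I2)
      fix z :: 'a
      have "norm z \<le> 1 + (norm z)\<^sup>2"
        using zero_le_power2[of "norm z - 1 / 2"] by (simp add: power2_eq_square algebra_simps)
      then have "norm z ^ m * gauss z \<le> (1 + (norm z)\<^sup>2) ^ m * gauss z"
        by (intro mult_right_mono power_mono) auto
      also have "\<dots> \<le> C * decay_weight z" by (rule C)
      finally show "norm (norm z ^ m * gauss z) \<le> norm (C * decay_weight z)"
        by (simp add: order_trans[OF _ abs_ge_self] del: abs_mult)
    qed
  qed measurable
qed

section \<open>The Fourier transform of integrable functions\<close>

lemma cmod_phase [simp]: "cmod (exp (- (\<i> * complex_of_real t))) = 1"
  using norm_exp_i_times[of "- t"] by simp

lemma borel_measurable_phase [measurable]:
  assumes "f \<in> borel_measurable M"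
  shows "(\<lambda>x. exp (- (\<i> * complex_of_real (f x)))) \<in> borel_measurable M"
  using assms by measurable

lemma integrable_fourier:
  fixes f :: "'a::euclidean_space \<Rightarrow> complex"
  assumes "integrable lborel f"
  shows "integrable lborel (\<lambda>x. exp (- (\<i> * complex_of_real (x \<bullet> \<xi>))) * f x)"
proof (rule Bochner_Integration.integrable_bound)
  show "integrable lborel f" by fact
  have [measurable]: "f \<in> borel_measurable borel" using assms by auto
  show "(\<lambda>x. exp (- (\<i> * complex_of_real (x \<bullet> \<xi>))) * f x) \<in> borel_measurable lborel"
    by measurable
qed (simp add: norm_mult)

lemma norm_fourier_le:
  fixes f :: "'a::euclidean_space \<Rightarrow> complex"
  shows "cmod (fourier f \<xi>) \<le> (LINT x|lborel. cmod (f x))"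
proof -
  have "cmod (fourier f \<xi>) \<le> (LINT x|lborel. cmod (exp (- (\<i> * complex_of_real (x \<bullet> \<xi>))) * f x))"
    unfolding fourier_def by (rule integral_norm_bound)
  then show ?thesis by (simp add: norm_mult)
qed

lemma fourier_diff:
  fixes f g :: "'a::euclidean_space \<Rightarrow> complex"
  assumes "integrable lborel f" "integrable lborel g"
  shows "fourier (\<lambda>x. f x - g x) \<xi> = fourier f \<xi> - fourier g \<xi>"
  using integrable_fourier[OF assms(1), of \<xi>] integrable_fourier[OF assms(2), of \<xi>]
  by (simp add: fourier_def right_diff_distrib)

lemma isCont_fourier:
  fixes f :: "'a::euclidean_space \<Rightarrow> complex"
  assumes f: "integrable lborel f"
  shows "isCont (fourier f) \<xi>"
  unfolding continuous_at_sequentially comp_def fourier_def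
proof safe
  fix X :: "nat \<Rightarrow> 'a" assume X: "X \<longlonglongrightarrow> \<xi>"
  have [measurable]: "f \<in> borel_measurable borel" using f by auto
  show "(\<lambda>n. LINT x|lborel. exp (- (\<i> * complex_of_real (x \<bullet> X n))) * f x)
      \<longlonglongrightarrow> (LINT x|lborel. exp (- (\<i> * complex_of_real (x \<bullet> \<xi>))) * f x)"
  proof (rule integral_dominated_convergence[where w="\<lambda>x. cmod (f x)"])
    show "AE x in lborel. (\<lambda>n. exp (- (\<i> * complex_of_real (x \<bullet> X n))) * f x)
        \<longlonglongrightarrow> exp (- (\<i> * complex_of_real (x \<bullet> \<xi>))) * f x"
      by (intro AE_I2 tendsto_intros X)
  qed (use f in \<open>auto simp: norm_mult\<close>)
qed

lemma continuous_on_fourier: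
  fixes f :: "'a::euclidean_space \<Rightarrow> complex"
  assumes "integrable lborel f"
  shows "continuous_on S (fourier f)"
  using isCont_fourier[OF assms] by (simp add: continuous_at_imp_continuous_on)

lemma borel_measurable_fourier:
  fixes f :: "'a::euclidean_space \<Rightarrow> complex"
  assumes "integrable lborel f"
  shows "fourier f \<in> borel_measurable borel"
  by (rule borel_measurable_continuous_onI[OF continuous_on_fourier[OF assms]])

lemma integrable_pair_mult:
  fixes f :: "'a::euclidean_space \<Rightarrow> 'c::{real_normed_field,banach,second_countable_topology}"
    and g :: "'b::euclidean_space \<Rightarrow> 'c"
  assumes f: "integrable lborel f" and g: "integrable lborel g"
  shows "integrable (lborel \<Otimes>\<^sub>M lborel) (\<lambda>(x, y). f x * g y)"
proof (rule lborel_pair.Fubini_integrable)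
  have [measurable]: "f \<in> borel_measurable borel" "g \<in> borel_measurable borel" using f g by auto
  show "(\<lambda>(x, y). f x * g y) \<in> borel_measurable (lborel \<Otimes>\<^sub>M lborel)" by measurable
  show "integrable lborel (\<lambda>x. LINT y|lborel. norm (case (x, y) of (x, y) \<Rightarrow> f x * g y))"
    using f by (simp add: norm_mult)
  show "AE x in lborel. integrable lborel (\<lambda>y. case (x, y) of (x, y) \<Rightarrow> f x * g y)"
    using g by simp
qed

text \<open>
  The multiplication formula for the transform, with a rescaled and translated argument: it turns
  means of a transform near \<open>a\<close> into integrals of the function itself.
\<close>

lemma integral_fourier_affine_mult:
  fixes f h :: "'a::euclidean_space \<Rightarrow> complex"
  assumes f: "integrable lborel f" and h: "integrable lborel h"
  shows "(LINT z|lborel. fourier f (a + b *\<^sub>R z) * h z)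
    = (LINT x|lborel. exp (- (\<i> * complex_of_real (x \<bullet> a))) * f x * fourier h (b *\<^sub>R x))"
proof -
  have [measurable]: "f \<in> borel_measurable borel" "h \<in> borel_measurable borel" using f h by auto
  let ?k = "\<lambda>x z. exp (- (\<i> * complex_of_real (x \<bullet> (a + b *\<^sub>R z)))) * f x * h z"
  have int: "integrable (lborel \<Otimes>\<^sub>M lborel) (\<lambda>(x, z). ?k x z)"
    by (rule Bochner_Integration.integrable_bound[OF integrable_pair_mult[OF f h]])
       (auto simp: norm_mult)
  have "(LINT z|lborel. fourier f (a + b *\<^sub>R z) * h z) = (LINT z|lborel. LINT x|lborel. ?k x z)"
    unfolding fourier_def
    by (intro Bochner_Integration.integral_cong refl integral_mult_left_zero[symmetric])
  also have "\<dots> = (LINT x|lborel. LINT z|lborel. ?k x z)"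
    by (rule lborel_pair.Fubini_integral[OF int])
  also have "\<dots> = (LINT x|lborel. exp (- (\<i> * complex_of_real (x \<bullet> a))) * f x * fourier h (b *\<^sub>R x))"
  proof (rule Bochner_Integration.integral_cong[OF refl])
    fix x :: 'a
    have "?k x z = (exp (- (\<i> * complex_of_real (x \<bullet> a))) * f x)
        * (exp (- (\<i> * complex_of_real (z \<bullet> (b *\<^sub>R x)))) * h z)" for z
      by (simp add: inner_add_right inner_commute[of z] ring_distribs exp_add exp_diff exp_minus divide_simps)
    then have "(LINT z|lborel. ?k x z) = (LINT z|lborel. (exp (- (\<i> * complex_of_real (x \<bullet> a))) * f x)
        * (exp (- (\<i> * complex_of_real (z \<bullet> (b *\<^sub>R x)))) * h z))"
      by (intro Bochner_Integration.integral_cong refl)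
    then show "(LINT z|lborel. ?k x z)
        = exp (- (\<i> * complex_of_real (x \<bullet> a))) * f x * fourier h (b *\<^sub>R x)"
      unfolding fourier_def by (simp only: integral_mult_right_zero)
  qed
  finally show ?thesis .
qed

lemma fourier_gauss:
  "fourier (\<lambda>z. complex_of_real (gauss z)) (x::'a::euclidean_space) = complex_of_real (exp (- (norm x)\<^sup>2 / 2))"
proof -
  have one: "(LINT y|lborel. exp (- (\<i> * complex_of_real (y * t))) * complex_of_real (std_normal_density y))
      = complex_of_real (exp (- t\<^sup>2 / 2))" for t
  proof -
    have "(LINT y|lborel. std_normal_density y *\<^sub>R iexp (- t * y)) = complex_of_real (exp (- t\<^sup>2 / 2))"
      using fun_cong[OF char_std_normal_distribution, of "- t"]
      unfolding char_def by (subst (asm) integral_density) auto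
    then show ?thesis
      by (simp add: scaleR_conv_of_real mult.commute)
  qed
  have int: "integrable lborel (\<lambda>y. exp (- (\<i> * complex_of_real (y * t))) * complex_of_real (std_normal_density y))" for t
    using integrable_fourier[of "\<lambda>y. complex_of_real (std_normal_density y)" t] by simp
  have "fourier (\<lambda>z. complex_of_real (gauss z)) x
      = (LINT z|lborel. (\<Prod>b\<in>Basis. exp (- (\<i> * complex_of_real ((z \<bullet> b) * (x \<bullet> b)))) * complex_of_real (std_normal_density (z \<bullet> b))))"
    unfolding fourier_def gauss_def
    by (intro Bochner_Integration.integral_cong refl)
       (simp add: prod.distrib exp_sum[symmetric] sum_negf sum_distrib_left[symmetric] euclidean_inner[of _ x])
  also have "\<dots> = (\<Prod>b\<in>Basis. complex_of_real (exp (- (x \<bullet> b)\<^sup>2 / 2)))"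
    by (subst integral_lborel_prod_coords
          [where f="\<lambda>b y. exp (- (\<i> * complex_of_real (y * (x \<bullet> b)))) * complex_of_real (std_normal_density y)"])
       (auto simp: int one simp del: of_real_mult of_real_exp)
  also have "\<dots> = complex_of_real (exp (\<Sum>b\<in>Basis. - (x \<bullet> b)\<^sup>2 / 2))"
    by (simp add: exp_sum)
  also have "(\<Sum>b\<in>Basis. - (x \<bullet> b)\<^sup>2 / 2) = - (norm x)\<^sup>2 / 2"
    unfolding power2_norm_eq_inner
    by (subst euclidean_inner) (simp add: power2_eq_square sum_negf sum_divide_distrib)
  finally show ?thesis .
qed

lemma integrable_gauss_complex: "integrable lborel (\<lambda>z. complex_of_real (gauss z))"
  by (rule integrable_of_real[OF integrable_gauss])

lemma integral_fourier_gauss: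
  fixes f :: "'a::euclidean_space \<Rightarrow> complex"
  assumes f: "integrable lborel f"
  shows "(LINT z|lborel. fourier f (a + b *\<^sub>R z) * complex_of_real (gauss z))
    = (LINT x|lborel. exp (- (\<i> * complex_of_real (x \<bullet> a))) * f x * complex_of_real (exp (- b\<^sup>2 * (norm x)\<^sup>2 / 2)))"
  by (subst integral_fourier_affine_mult[OF f integrable_gauss_complex])
     (simp add: fourier_gauss power_mult_distrib)

section \<open>Uniqueness and inversion\<close>

text \<open>
  The open sets are stable under intersection and generate the Borel sets, so by Dynkin's theorem the
  integral vanishes over every Borel set.
\<close>

lemma AE_eq_0_if_integral_open_eq_0:
  fixes f :: "'a::euclidean_space \<Rightarrow> real"
  assumes f: "integrable lborel f"
    and zero: "\<And>U. open U \<Longrightarrow> (LINT x|lborel. indicator U x * f x) = 0"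
  shows "AE x in lborel. f x = 0"
proof -
  have all: "(LINT x|lborel. indicator A x * f x) = 0" if "A \<in> sets lborel" for A
  proof -
    have "Int_stable {S::'a set. open S}" by (auto simp: Int_stable_def)
    moreover have "{S::'a set. open S} \<subseteq> Pow UNIV" by auto
    moreover have "A \<in> sigma_sets UNIV {S. open S}"
      using that by (simp add: borel_def)
    ultimately show ?thesis
    proof (induction rule: sigma_sets_induct_disjoint)
      case (basic A) then show ?case using zero by auto
    next
      case empty show ?case by simp
    next
      case (compl A)
      then have A: "A \<in> sets borel" by (simp add: borel_def)
      have "(LINT x|lborel. indicator (UNIV - A) x * f x)
          = (LINT x|lborel. indicator UNIV x * f x - indicator A x * f x)"
        by (intro Bochner_Integration.integral_cong) (auto simp: indicator_def)
      also have "\<dots> = (LINT x|lborel. indicator UNIV x * f x) - (LINT x|lborel. indicator A x * f x)"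
        using f A integrable_mult_indicator[of A lborel f] by (intro Bochner_Integration.integral_diff) auto
      also have "\<dots> = 0" using compl zero[of UNIV] by simp
      finally show ?case .
    next
      case (union A)
      have "A i \<in> sets lborel" for i using union by (auto simp: borel_def)
      moreover have "set_integrable lborel (\<Union>i. A i) f"
        unfolding set_integrable_def using f calculation
        by (intro integrable_mult_indicator) auto
      ultimately have "(LINT x:(\<Union>i. A i)|lborel. f x) = (\<Sum>i. (LINT x:(A i)|lborel. f x))"
        using union(1) by (intro lebesgue_integral_countable_add) (auto simp: disjoint_family_on_def)
      then show ?case
        using union(3) by (simp add: set_lebesgue_integral_def)
    qed
  qed
  have "AE x in lborel. f x = (\<lambda>_. 0) x"
    by (rule density_unique_real[OF f]) (use all in \<open>auto simp: set_lebesgue_integral_def\<close>)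
  then show ?thesis by simp
qed

text \<open>
  The functions \<open>min 1 (n * dist x (- U))\<close> increase to the indicator function of \<open>U\<close>, so continuous
  test functions determine the integrals over bounded open sets.
\<close>

lemma AE_eq_0_if_integral_test_eq_0:
  fixes f :: "'a::euclidean_space \<Rightarrow> real"
  assumes f: "f \<in> borel_measurable borel"
    and int: "\<And>R. integrable lborel (\<lambda>x. indicator (cball 0 R) x * f x)"
    and zero: "\<And>\<psi> R. continuous_on UNIV \<psi> \<Longrightarrow> (\<And>x. \<bar>\<psi> x\<bar> \<le> indicator (cball 0 R) x) \<Longrightarrow>
                 (LINT x|lborel. \<psi> x * f x) = 0"
  shows "AE x in lborel. f x = 0"
proof -
  have open0: "(LINT x|lborel. indicator U x * f x) = 0" if U: "open U" "U \<subseteq> cball 0 R" for U R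
  proof -
    define \<psi> where "\<psi> n x = min 1 (real n * infdist x (- U))" for n and x :: 'a
    have "U \<noteq> UNIV"
      using U bounded_subset[OF bounded_cball, of U 0 R] not_bounded_UNIV[where 'a='a] by auto
    then have ne: "- U \<noteq> {}" by auto
    have cl: "closed (- U)" using U by auto
    have bd: "\<bar>\<psi> n x\<bar> \<le> indicator (cball 0 R) x" for n x
    proof (cases "x \<in> U")
      case True
      then show ?thesis using U infdist_nonneg[of x "- U"] by (auto simp: \<psi>_def indicator_def)
    next
      case False
      then show ?thesis by (simp add: \<psi>_def)
    qed
    have 0: "(LINT x|lborel. \<psi> n x * f x) = 0" for n
      by (rule zero[OF _ bd]) (auto simp: \<psi>_def intro!: continuous_intros)
    have "(\<lambda>n. LINT x|lborel. \<psi> n x * f x) \<longlonglongrightarrow> (LINT x|lborel. indicator U x * f x)"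
    proof (rule integral_dominated_convergence[where w="\<lambda>x. \<bar>indicator (cball 0 R) x * f x\<bar>"])
      show "integrable lborel (\<lambda>x. \<bar>indicator (cball 0 R) x * f x\<bar>)" using int by auto
      show "AE x in lborel. (\<lambda>n. \<psi> n x * f x) \<longlonglongrightarrow> indicator U x * f x"
      proof (rule AE_I2)
        fix x :: 'a
        have "(\<lambda>n. \<psi> n x) \<longlonglongrightarrow> indicator U x"
        proof (cases "x \<in> U")
          case True
          then have "infdist x (- U) > 0"
            using infdist_pos_not_in_closed[OF cl ne] by simp
          then obtain N where N: "1 < real N * infdist x (- U)"
            using reals_Archimedean3 by blast
          have "\<forall>\<^sub>F n in sequentially. \<psi> n x = 1"
            using eventually_ge_at_top[of N]
          proof eventually_elim
            case (elim n)
            have "real N * infdist x (- U) \<le> real n * infdist x (- U)"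
              using elim by (intro mult_right_mono) (auto simp: infdist_nonneg)
            then show ?case using N by (simp add: \<psi>_def)
          qed
          then show ?thesis using True by (simp add: tendsto_eventually)
        next
          case False
          then show ?thesis by (simp add: \<psi>_def)
        qed
        then show "(\<lambda>n. \<psi> n x * f x) \<longlonglongrightarrow> indicator U x * f x"
          by (intro tendsto_mult tendsto_const)
      qed
      show "AE x in lborel. norm (\<psi> n x * f x) \<le> \<bar>indicator (cball 0 R) x * f x\<bar>" for n
        using bd[of n] by (intro AE_I2) (auto simp: abs_mult intro!: mult_right_mono)
      show "(\<lambda>x. indicator U x * f x) \<in> borel_measurable lborel"
        using U f by auto
      show "(\<lambda>x. \<psi> n x * f x) \<in> borel_measurable lborel" for n
      proof -
        have "continuous_on UNIV (\<psi> n)" unfolding \<psi>_def by (intro continuous_intros)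
        then show ?thesis using f borel_measurable_continuous_onI by (intro borel_measurable_times) auto
      qed
    qed
    then show ?thesis
      using 0 by (simp add: LIMSEQ_const_iff)
  qed
  have "AE x in lborel. indicator (ball 0 (real n)) x * f x = 0" for n
  proof (rule AE_eq_0_if_integral_open_eq_0)
    show "integrable lborel (\<lambda>x. indicator (ball 0 (real n)) x * f x)"
      by (rule Bochner_Integration.integrable_bound[OF int[of n]]) (use f in \<open>auto simp: indicator_def\<close>)
    fix U :: "'a set" assume "open U"
    then have "(LINT x|lborel. indicator (U \<inter> ball 0 (real n)) x * f x) = 0"
      by (intro open0[where R=n]) auto
    then show "(LINT x|lborel. indicator U x * (indicator (ball 0 (real n)) x * f x)) = 0"
      by (simp add: indicator_inter_arith mult.assoc)
  qed
  then have "AE x in lborel. \<forall>n. indicator (ball 0 (real n)) x * f x = 0"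
    by (intro AE_all_countable[THEN iffD2] allI)
  then show ?thesis
  proof eventually_elim
    case (elim x)
    obtain n where "norm x < real n" using reals_Archimedean2 by blast
    then show ?case using elim[rule_format, of n] by simp
  qed
qed

definition inverse_fourier :: "('a::euclidean_space \<Rightarrow> complex) \<Rightarrow> 'a \<Rightarrow> complex" where
  "inverse_fourier F x = complex_of_real ((1 / (2 * pi)) ^ DIM('a)) * fourier F (- x)"

lemma gauss_eq_fourier_gauss:
  "complex_of_real (gauss (w::'a::euclidean_space))
    = complex_of_real ((1 / sqrt (2 * pi)) ^ DIM('a)) * fourier (\<lambda>z. complex_of_real (gauss z)) w"
  by (simp only: fourier_gauss) (simp add: gauss_eq)

lemma gauss_0: "gauss (0::'a::euclidean_space) = (1 / sqrt (2 * pi)) ^ DIM('a)"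
  by (simp add: gauss_eq)

lemma gauss_le_gauss_0: "gauss (z::'a::euclidean_space) \<le> (1 / sqrt (2 * pi)) ^ DIM('a)"
  by (simp add: gauss_eq mult_le_cancel_left1)

text \<open>
  The Gaussian is its own transform up to a constant, so the multiplication formula applies to \<open>f\<close> and
  a rescaled, modulated Gaussian.
\<close>

lemma gaussian_mean_eq_fourier_integral:
  fixes f :: "'a::euclidean_space \<Rightarrow> complex"
  assumes f: "integrable lborel f" and e: "e > 0"
  shows "(LINT z|lborel. f (y + e *\<^sub>R z) * complex_of_real (gauss z))
    = complex_of_real ((1 / sqrt (2 * pi)) ^ DIM('a)) *
      (LINT \<xi>|lborel. fourier f \<xi> * exp (\<i> * complex_of_real (\<xi> \<bullet> y)) * complex_of_real (gauss (e *\<^sub>R \<xi>)))"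
    (is "?L = ?c * ?R")
proof -
  have [measurable]: "f \<in> borel_measurable borel" using f by auto
  have [measurable]: "fourier f \<in> borel_measurable borel" by (rule borel_measurable_fourier[OF f])
  define h where "h z = exp (\<i> * complex_of_real (z \<bullet> (inverse e *\<^sub>R y))) * complex_of_real (gauss z)" for z :: 'a
  have h: "integrable lborel h"
    unfolding h_def
    by (rule Bochner_Integration.integrable_bound[OF integrable_gauss_complex]) (auto simp: norm_mult)
  have fh: "fourier h (inverse e *\<^sub>R x) = fourier (\<lambda>z. complex_of_real (gauss z)) (inverse e *\<^sub>R (x - y))" for x
    unfolding fourier_def h_def
    by (intro Bochner_Integration.integral_cong refl)
       (simp add: inner_diff_right mult.assoc[symmetric] exp_add[symmetric] ring_distribs)
  have "complex_of_real (e ^ DIM('a)) * ?L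
      = (LINT x|lborel. f x * complex_of_real (gauss (inverse e *\<^sub>R (x - y))))"
    using e by (subst integral_lborel_affine[of e _ y]) auto
  also have "\<dots> = (LINT x|lborel. ?c * (f x * fourier h (inverse e *\<^sub>R x)))"
    by (intro Bochner_Integration.integral_cong refl) (subst gauss_eq_fourier_gauss, simp add: fh)
  also have "\<dots> = ?c * (LINT x|lborel. f x * fourier h (inverse e *\<^sub>R x))"
    by (rule integral_mult_right_zero)
  also have "(LINT x|lborel. f x * fourier h (inverse e *\<^sub>R x)) = (LINT z|lborel. fourier f (inverse e *\<^sub>R z) * h z)"
    using integral_fourier_affine_mult[OF f h, of 0 "inverse e"] by simp
  also have "\<dots> = complex_of_real (e ^ DIM('a)) *
      (LINT \<xi>|lborel. fourier f \<xi> * exp (\<i> * complex_of_real (\<xi> \<bullet> y)) * complex_of_real (gauss (e *\<^sub>R \<xi>)))"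
  proof -
    have inner: "(e *\<^sub>R \<xi>) \<bullet> (inverse e *\<^sub>R y) = \<xi> \<bullet> y" for \<xi> :: 'a
      using e by simp
    have shape: "fourier f (inverse e *\<^sub>R (0 + e *\<^sub>R \<xi>)) * h (0 + e *\<^sub>R \<xi>)
        = fourier f \<xi> * exp (\<i> * complex_of_real (\<xi> \<bullet> y)) * complex_of_real (gauss (e *\<^sub>R \<xi>))" for \<xi>
      using e unfolding h_def by (simp del: inner_scaleR_left inner_scaleR_right add: inner)
    have "(\<lambda>z. fourier f (inverse e *\<^sub>R z) * h z) \<in> borel_measurable borel"
      unfolding h_def by measurable
    then have "(LINT z|lborel. fourier f (inverse e *\<^sub>R z) * h z) = complex_of_real (\<bar>e\<bar> ^ DIM('a)) *
        (LINT \<xi>|lborel. fourier f (inverse e *\<^sub>R (0 + e *\<^sub>R \<xi>)) * h (0 + e *\<^sub>R \<xi>))"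
      using e by (intro integral_lborel_affine) auto
    then show ?thesis
      unfolding shape using e by simp
  qed
  finally have "complex_of_real (e ^ DIM('a)) * ?L = complex_of_real (e ^ DIM('a)) * (?c * ?R)"
    by (simp only: mult.left_commute)
  moreover have "complex_of_real (e ^ DIM('a)) \<noteq> 0" using e by simp
  ultimately show ?thesis by (rule mult_left_cancel[THEN iffD1, rotated])
qed

text \<open>
  Averaged against a Gaussian of width tending to zero, the function is the inverse transform of its
  transform with a Gaussian cut-off.  In the limit the cut-off disappears, while the averages
  converge to the function when tested against continuous functions of compact support.
\<close>

theorem fourier_inversion:
  fixes f :: "'a::euclidean_space \<Rightarrow> complex"
  assumes f: "integrable lborel f" and F: "integrable lborel (fourier f)"
  shows "AE x in lborel. f x = inverse_fourier (fourier f) x"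
proof -
  have [measurable]: "f \<in> borel_measurable borel" using f by auto
  have [measurable]: "fourier f \<in> borel_measurable borel" by (rule borel_measurable_fourier[OF f])
  define c where "c = (1 / sqrt (2 * pi)) ^ DIM('a)"
  have c: "c > 0" by (simp add: c_def)
  have cc: "c * c = (1 / (2 * pi)) ^ DIM('a)"
    by (simp add: c_def power_mult_distrib[symmetric])
  define e where "e n = inverse (real (Suc n))" for n
  have e: "e n > 0" for n by (simp add: e_def)
  have e0: "e \<longlonglongrightarrow> 0" unfolding e_def by (rule LIMSEQ_inverse_real_of_nat)
  define h where "h = inverse_fourier (fourier f)"
  have ch: "continuous_on UNIV h"
    unfolding h_def inverse_fourier_def
    by (intro continuous_intros continuous_on_compose2[OF continuous_on_fourier[OF F, of UNIV]]) auto
  have [measurable]: "h \<in> borel_measurable borel" by (rule borel_measurable_continuous_onI[OF ch])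
  define M where "M n y = (LINT z|lborel. f (y + e n *\<^sub>R z) * complex_of_real (gauss z))" for n y
  have M_eq: "M n y = complex_of_real c *
      (LINT \<xi>|lborel. fourier f \<xi> * exp (\<i> * complex_of_real (\<xi> \<bullet> y)) * complex_of_real (gauss (e n *\<^sub>R \<xi>)))" for n y
    unfolding M_def c_def by (rule gaussian_mean_eq_fourier_integral[OF f e])
  have [measurable]: "M n \<in> borel_measurable borel" for n
    unfolding M_eq[abs_def] by measurable
  define B where "B = c * c * (LINT \<xi>|lborel. cmod (fourier f \<xi>))"
  have M_bound: "cmod (M n y) \<le> B" for n y
  proof -
    have "cmod (LINT \<xi>|lborel. fourier f \<xi> * exp (\<i> * complex_of_real (\<xi> \<bullet> y)) * complex_of_real (gauss (e n *\<^sub>R \<xi>)))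
        \<le> (LINT \<xi>|lborel. cmod (fourier f \<xi> * exp (\<i> * complex_of_real (\<xi> \<bullet> y)) * complex_of_real (gauss (e n *\<^sub>R \<xi>))))"
      by (rule integral_norm_bound)
    also have "\<dots> \<le> (LINT \<xi>|lborel. cmod (fourier f \<xi>) * c)"
    proof (rule integral_mono_AE')
      show "integrable lborel (\<lambda>\<xi>. cmod (fourier f \<xi>) * c)" using F by auto
    qed (auto simp: norm_mult c_def intro!: mult_left_mono gauss_le_gauss_0 AE_I2)
    finally show ?thesis
      using c by (simp add: M_eq B_def norm_mult mult.assoc) (simp add: mult.commute)
  qed
  have M_lim: "(\<lambda>n. M n y) \<longlonglongrightarrow> h y" for y
  proof -
    have "(\<lambda>n. LINT \<xi>|lborel. fourier f \<xi> * exp (\<i> * complex_of_real (\<xi> \<bullet> y)) * complex_of_real (gauss (e n *\<^sub>R \<xi>)))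
       \<longlonglongrightarrow> (LINT \<xi>|lborel. fourier f \<xi> * exp (\<i> * complex_of_real (\<xi> \<bullet> y)) * complex_of_real c)"
    proof (rule integral_dominated_convergence[where w="\<lambda>\<xi>. cmod (fourier f \<xi>) * c"])
      show "integrable lborel (\<lambda>\<xi>. cmod (fourier f \<xi>) * c)" using F by auto
      show "AE \<xi> in lborel. (\<lambda>n. fourier f \<xi> * exp (\<i> * complex_of_real (\<xi> \<bullet> y)) * complex_of_real (gauss (e n *\<^sub>R \<xi>)))
          \<longlonglongrightarrow> fourier f \<xi> * exp (\<i> * complex_of_real (\<xi> \<bullet> y)) * complex_of_real c"
      proof (rule AE_I2)
        fix \<xi> :: 'a
        have "(\<lambda>n. gauss (e n *\<^sub>R \<xi>)) \<longlonglongrightarrow> c * exp (- (norm (0 *\<^sub>R \<xi>))\<^sup>2 / 2)"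
          unfolding gauss_eq c_def by (intro tendsto_intros e0) auto
        then show "(\<lambda>n. fourier f \<xi> * exp (\<i> * complex_of_real (\<xi> \<bullet> y)) * complex_of_real (gauss (e n *\<^sub>R \<xi>)))
          \<longlonglongrightarrow> fourier f \<xi> * exp (\<i> * complex_of_real (\<xi> \<bullet> y)) * complex_of_real c"
          by (intro tendsto_intros) simp
      qed
    qed (auto simp: norm_mult c_def intro!: mult_left_mono gauss_le_gauss_0 AE_I2)
    then have "(\<lambda>n. M n y) \<longlonglongrightarrow> complex_of_real c * (LINT \<xi>|lborel. fourier f \<xi> * exp (\<i> * complex_of_real (\<xi> \<bullet> y)) * complex_of_real c)"
      unfolding M_eq by (intro tendsto_mult tendsto_const)
    also have "complex_of_real c * (LINT \<xi>|lborel. fourier f \<xi> * exp (\<i> * complex_of_real (\<xi> \<bullet> y)) * complex_of_real c) = h y"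
      unfolding h_def inverse_fourier_def fourier_def[of "fourier f"] cc[symmetric]
      by (simp add: mult_ac)
    finally show ?thesis .
  qed
  have test: "(LINT x|lborel. complex_of_real (\<psi> x) * f x) = (LINT x|lborel. complex_of_real (\<psi> x) * h x)"
    if \<psi>: "continuous_on UNIV \<psi>" "\<And>x. \<bar>\<psi> x\<bar> \<le> indicator (cball 0 R) x" for \<psi> :: "'a \<Rightarrow> real" and R
  proof (rule LIMSEQ_unique)
    have [measurable]: "\<psi> \<in> borel_measurable borel" by (rule borel_measurable_continuous_onI[OF \<psi>(1)])
    have \<psi>1: "\<bar>\<psi> x\<bar> \<le> 1" for x using order_trans[OF \<psi>(2)[of x] indicator_le_1] by simp
    have ball: "integrable lborel (indicator (cball 0 R) :: 'a \<Rightarrow> real)"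
      using emeasure_lborel_cball_finite[of "0::'a" R] by simp
    show "(\<lambda>n. LINT y|lborel. complex_of_real (\<psi> y) * M n y) \<longlonglongrightarrow> (LINT x|lborel. complex_of_real (\<psi> x) * h x)"
    proof (rule integral_dominated_convergence[where w="\<lambda>y. indicator (cball 0 R) y * B"])
      show "integrable lborel (\<lambda>y::'a. indicator (cball 0 R) y * B)" using ball by auto
      show "AE y in lborel. (\<lambda>n. complex_of_real (\<psi> y) * M n y) \<longlonglongrightarrow> complex_of_real (\<psi> y) * h y"
        by (intro AE_I2 tendsto_intros M_lim)
      show "AE y in lborel. norm (complex_of_real (\<psi> y) * M n y) \<le> indicator (cball 0 R) y * B" for n
        by (intro AE_I2) (auto simp: norm_mult intro!: mult_mono \<psi>(2) M_bound)
    qed auto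
    \<comment> \<open>The translation is moved to \<open>\<psi>\<close>, which is continuous, while \<open>f\<close> need not be.\<close>
    define \<Phi> where "\<Phi> n z = (LINT x|lborel. complex_of_real (\<psi> (x - e n *\<^sub>R z)) * f x)" for n z
    have [measurable]: "\<Phi> n \<in> borel_measurable borel" for n unfolding \<Phi>_def by measurable
    have swap: "(LINT y|lborel. complex_of_real (\<psi> y) * M n y) = (LINT z|lborel. \<Phi> n z * complex_of_real (gauss z))" for n
    proof -
      let ?k = "\<lambda>z y. complex_of_real (\<psi> y) * (f (y + e n *\<^sub>R z) * complex_of_real (gauss z))"
      note shift = integrable_lborel_shift[OF f]
      have int: "integrable (lborel \<Otimes>\<^sub>M lborel) (\<lambda>(z, y). ?k z y)"
      proof (rule lborel_pair.Fubini_integrable)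
        show "(\<lambda>(z, y). ?k z y) \<in> borel_measurable (lborel \<Otimes>\<^sub>M lborel)" by measurable
        show "AE z in lborel. integrable lborel (\<lambda>y. case (z, y) of (z, y) \<Rightarrow> ?k z y)"
        proof (rule AE_I2)
          fix z :: 'a
          show "integrable lborel (\<lambda>y. case (z, y) of (z, y) \<Rightarrow> ?k z y)"
            by (rule Bochner_Integration.integrable_bound[OF integrable_mult_left[OF shift[of "e n *\<^sub>R z"], where c="complex_of_real (gauss z)"]])
               (use \<psi>1 in \<open>auto simp: norm_mult intro!: mult_left_le_one_le\<close>)
        qed
        show "integrable lborel (\<lambda>z. LINT y|lborel. norm (case (z, y) of (z, y) \<Rightarrow> ?k z y))"
        proof (rule Bochner_Integration.integrable_bound)
          show "integrable lborel (\<lambda>z::'a. gauss z * (LINT x|lborel. cmod (f x)))"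
            using integrable_gauss by auto
          show "AE z::'a in lborel. norm (LINT y|lborel. norm (case (z, y) of (z, y) \<Rightarrow> ?k z y))
              \<le> norm (gauss z * (LINT x|lborel. cmod (f x)))"
          proof (rule AE_I2)
            fix z :: 'a
            have "(LINT y|lborel. norm (?k z y)) \<le> (LINT y|lborel. cmod (f (y + e n *\<^sub>R z)) * gauss z)"
            proof (rule integral_mono_AE')
              show "integrable lborel (\<lambda>y. cmod (f (y + e n *\<^sub>R z)) * gauss z)"
                using shift by auto
            qed (use \<psi>1 in \<open>auto simp: norm_mult intro!: mult_left_le_one_le\<close>)
            also have "\<dots> = gauss z * (LINT x|lborel. cmod (f x))"
              using integral_lborel_affine[of 1 "\<lambda>x. cmod (f x)" "e n *\<^sub>R z"] by (simp add: add.commute)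
            finally show "norm (LINT y|lborel. norm (case (z, y) of (z, y) \<Rightarrow> ?k z y))
              \<le> norm (gauss z * (LINT x|lborel. cmod (f x)))"
              by (simp add: integral_nonneg_AE)
          qed
        qed measurable
      qed
      have "(LINT y|lborel. complex_of_real (\<psi> y) * M n y) = (LINT y|lborel. LINT z|lborel. ?k z y)"
        unfolding M_def by simp
      also have "\<dots> = (LINT z|lborel. LINT y|lborel. ?k z y)"
        by (rule lborel_pair.Fubini_integral[OF int])
      also have "\<dots> = (LINT z|lborel. \<Phi> n z * complex_of_real (gauss z))"
      proof (rule Bochner_Integration.integral_cong[OF refl])
        fix z :: 'a
        have "\<Phi> n z = (LINT y|lborel. complex_of_real (\<psi> y) * f (y + e n *\<^sub>R z))"
          unfolding \<Phi>_def by (subst integral_lborel_affine[of 1 _ "e n *\<^sub>R z"]) (auto simp: add.commute)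
        then show "(LINT y|lborel. ?k z y) = \<Phi> n z * complex_of_real (gauss z)"
          by (simp add: mult.assoc[symmetric])
      qed
      finally show ?thesis .
    qed
    have "(\<lambda>n. LINT z|lborel. \<Phi> n z * complex_of_real (gauss z))
        \<longlonglongrightarrow> (LINT z|lborel. (LINT x|lborel. complex_of_real (\<psi> x) * f x) * complex_of_real (gauss (z::'a)))"
    proof (rule integral_dominated_convergence[where w="\<lambda>z::'a. (LINT x|lborel. cmod (f x)) * gauss z"])
      show "integrable lborel (\<lambda>z::'a. (LINT x|lborel. cmod (f x)) * gauss z)"
        using integrable_gauss by auto
      show "AE z in lborel. (\<lambda>n. \<Phi> n z * complex_of_real (gauss z))
          \<longlonglongrightarrow> (LINT x|lborel. complex_of_real (\<psi> x) * f x) * complex_of_real (gauss z)"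
      proof (intro AE_I2 tendsto_mult tendsto_const)
        fix z :: 'a
        show "(\<lambda>n. \<Phi> n z) \<longlonglongrightarrow> (LINT x|lborel. complex_of_real (\<psi> x) * f x)"
          unfolding \<Phi>_def
        proof (rule integral_dominated_convergence[where w="\<lambda>x. cmod (f x)"])
          show "AE x in lborel. (\<lambda>n. complex_of_real (\<psi> (x - e n *\<^sub>R z)) * f x) \<longlonglongrightarrow> complex_of_real (\<psi> x) * f x"
          proof (intro AE_I2 tendsto_mult tendsto_const tendsto_of_real)
            fix x :: 'a
            have "(\<lambda>n. x - e n *\<^sub>R z) \<longlonglongrightarrow> x - 0 *\<^sub>R z" by (intro tendsto_intros e0)
            then show "(\<lambda>n. \<psi> (x - e n *\<^sub>R z)) \<longlonglongrightarrow> \<psi> x"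
              using continuous_on_tendsto_compose[OF \<psi>(1)] by simp
          qed
        qed (use f \<psi>1 in \<open>auto simp: norm_mult intro!: mult_left_le_one_le\<close>)
      qed
      show "AE z in lborel. norm (\<Phi> n z * complex_of_real (gauss z)) \<le> (LINT x|lborel. cmod (f x)) * gauss z" for n
      proof (rule AE_I2)
        fix z :: 'a
        have "cmod (\<Phi> n z) \<le> (LINT x|lborel. cmod (complex_of_real (\<psi> (x - e n *\<^sub>R z)) * f x))"
          unfolding \<Phi>_def by (rule integral_norm_bound)
        also have "\<dots> \<le> (LINT x|lborel. cmod (f x))"
          by (rule integral_mono_AE') (use f \<psi>1 in \<open>auto simp: norm_mult intro!: mult_left_le_one_le\<close>)
        finally show "norm (\<Phi> n z * complex_of_real (gauss z)) \<le> (LINT x|lborel. cmod (f x)) * gauss z"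
          by (auto simp: norm_mult intro!: mult_right_mono)
      qed
    qed auto
    then show "(\<lambda>n. LINT y|lborel. complex_of_real (\<psi> y) * M n y) \<longlonglongrightarrow> (LINT x|lborel. complex_of_real (\<psi> x) * f x)"
      unfolding swap by (simp add: integral_gauss)
  qed
  define g where "g x = f x - h x" for x
  have gball: "integrable lborel (\<lambda>x. indicator (cball 0 R) x *\<^sub>R g x)" for R
  proof -
    have "integrable lborel (\<lambda>x. indicator (cball 0 R) x *\<^sub>R h x)"
      using ch borel_integrable_compact[of "cball 0 R" h] continuous_on_subset[of UNIV h]
      by auto
    moreover have "integrable lborel (\<lambda>x. indicator (cball 0 R) x *\<^sub>R f x)"
      using f by (intro integrable_mult_indicator) auto
    ultimately show ?thesis by (simp add: g_def scaleR_diff_right)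
  qed
  have g0: "(LINT x|lborel. \<psi> x *\<^sub>R g x) = 0 \<and> integrable lborel (\<lambda>x. \<psi> x *\<^sub>R g x)"
    if \<psi>: "continuous_on UNIV \<psi>" "\<And>x. \<bar>\<psi> x\<bar> \<le> indicator (cball 0 R) x" for \<psi> :: "'a \<Rightarrow> real" and R
  proof -
    have [measurable]: "\<psi> \<in> borel_measurable borel" by (rule borel_measurable_continuous_onI[OF \<psi>(1)])
    have *: "integrable lborel (\<lambda>x. \<psi> x *\<^sub>R k x)"
      if "integrable lborel (\<lambda>x. indicator (cball 0 R) x *\<^sub>R k x)" "k \<in> borel_measurable borel" for k :: "'a \<Rightarrow> complex"
      by (rule Bochner_Integration.integrable_bound[OF that(1)])
         (use \<psi>(2) that(2) in \<open>auto intro!: mult_right_mono\<close>)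
    have "integrable lborel (\<lambda>x. \<psi> x *\<^sub>R h x)"
      using ch borel_integrable_compact[of "cball 0 R" h] continuous_on_subset[of UNIV h]
      by (intro *) auto
    moreover have "integrable lborel (\<lambda>x. \<psi> x *\<^sub>R f x)"
      using f by (intro * integrable_mult_indicator) auto
    ultimately show ?thesis
      using test[OF \<psi>] by (simp add: g_def scaleR_diff_right) (simp add: scaleR_conv_of_real)
  qed
  have "AE x in lborel. Re (g x) = 0"
  proof (rule AE_eq_0_if_integral_test_eq_0)
    show "integrable lborel (\<lambda>x. indicator (cball 0 R) x * Re (g x))" for R
      using integrable_Re[OF gball[of R]] by simp
    fix \<psi> :: "'a \<Rightarrow> real" and R
    assume "continuous_on UNIV \<psi>" "\<And>x. \<bar>\<psi> x\<bar> \<le> indicator (cball 0 R) x"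
    from g0[OF this] show "(LINT x|lborel. \<psi> x * Re (g x)) = 0"
      using integral_Re[of lborel "\<lambda>x. \<psi> x *\<^sub>R g x"] by simp
  qed (simp add: g_def)
  moreover have "AE x in lborel. Im (g x) = 0"
  proof (rule AE_eq_0_if_integral_test_eq_0)
    show "integrable lborel (\<lambda>x. indicator (cball 0 R) x * Im (g x))" for R
      using integrable_Im[OF gball[of R]] by simp
    fix \<psi> :: "'a \<Rightarrow> real" and R
    assume "continuous_on UNIV \<psi>" "\<And>x. \<bar>\<psi> x\<bar> \<le> indicator (cball 0 R) x"
    from g0[OF this] show "(LINT x|lborel. \<psi> x * Im (g x)) = 0"
      using integral_Im[of lborel "\<lambda>x. \<psi> x *\<^sub>R g x"] by simp
  qed (simp add: g_def)
  ultimately show ?thesis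
    by eventually_elim (simp add: g_def h_def complex_eq_iff)
qed

corollary AE_eq_0_if_fourier_eq_0:
  fixes f :: "'a::euclidean_space \<Rightarrow> complex"
  assumes f: "integrable lborel f" and 0: "\<And>\<xi>. fourier f \<xi> = 0"
  shows "AE x in lborel. f x = 0"
proof -
  have "fourier f = (\<lambda>_. 0)" using 0 by auto
  then show ?thesis
    using fourier_inversion[OF f] by (simp add: inverse_fourier_def fourier_def)
qed

lemma norm_inverse_fourier_le:
  "cmod (inverse_fourier F (x::'a::euclidean_space)) \<le> (1 / (2 * pi)) ^ DIM('a) * (LINT \<xi>|lborel. cmod (F \<xi>))"
  using norm_fourier_le[of F "- x"] by (simp add: inverse_fourier_def norm_mult norm_power mult_left_mono divide_right_mono norm_divide)

text \<open>Insert the inversion formula for one of the factors and exchange the integrals.\<close>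

theorem plancherel:
  fixes f h :: "'a::euclidean_space \<Rightarrow> complex"
  assumes f: "integrable lborel f" and F: "integrable lborel (fourier f)" and h: "integrable lborel h"
  shows "(LINT x|lborel. f x * cnj (h x))
    = complex_of_real ((1 / (2 * pi)) ^ DIM('a)) * (LINT \<xi>|lborel. fourier f \<xi> * cnj (fourier h \<xi>))"
proof -
  have [measurable]: "f \<in> borel_measurable borel" "h \<in> borel_measurable borel" using f h by auto
  have [measurable]: "fourier f \<in> borel_measurable borel" "fourier (fourier f) \<in> borel_measurable borel"
    by (intro borel_measurable_fourier f F)+
  have ch: "integrable lborel (\<lambda>x. cnj (h x))" using h by simp
  have cnj_F: "fourier (\<lambda>x. cnj (h x)) (- \<xi>) = cnj (fourier h \<xi>)" for \<xi>
    unfolding fourier_def Bochner_Integration.integral_cnj[symmetric] by (simp add: exp_cnj)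
  have "(LINT x|lborel. f x * cnj (h x)) = (LINT x|lborel. inverse_fourier (fourier f) x * cnj (h x))"
  proof (rule integral_cong_AE)
    show "AE x in lborel. f x * cnj (h x) = inverse_fourier (fourier f) x * cnj (h x)"
      using fourier_inversion[OF f F] by eventually_elim simp
    have [measurable]: "(\<lambda>x. cnj (h x)) \<in> borel_measurable borel"
      using borel_measurable_integrable[OF ch] by simp
    show "(\<lambda>x. inverse_fourier (fourier f) x * cnj (h x)) \<in> borel_measurable lborel"
      unfolding inverse_fourier_def by (intro borel_measurable_times) auto
    show "(\<lambda>x. f x * cnj (h x)) \<in> borel_measurable lborel"
      using f ch by (intro borel_measurable_times) auto
  qed
  also have "\<dots> = complex_of_real ((1 / (2 * pi)) ^ DIM('a)) * (LINT x|lborel. fourier (fourier f) (0 + (- 1) *\<^sub>R x) * cnj (h x))"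
    by (simp add: inverse_fourier_def mult.assoc del: of_real_power)
  also have "(LINT x|lborel. fourier (fourier f) (0 + (- 1) *\<^sub>R x) * cnj (h x)) = (LINT \<xi>|lborel. fourier f \<xi> * cnj (fourier h \<xi>))"
    unfolding integral_fourier_affine_mult[OF F ch, of 0 "-1"] by (simp add: cnj_F)
  finally show ?thesis .
qed

section \<open>Square integrable functions\<close>

definition square_integrable :: "('a::euclidean_space \<Rightarrow> 'b::{real_normed_field,banach,second_countable_topology}) \<Rightarrow> bool" where
  "square_integrable f \<longleftrightarrow> f \<in> borel_measurable borel \<and> integrable lborel (\<lambda>x. (norm (f x))\<^sup>2)"

definition square_integral :: "('a::euclidean_space \<Rightarrow> 'b::{real_normed_field,banach,second_countable_topology}) \<Rightarrow> real" where
  "square_integral f = (LINT x|lborel. (norm (f x))\<^sup>2)"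

lemma square_integrable_measurable: "square_integrable f \<Longrightarrow> f \<in> borel_measurable borel"
  by (simp add: square_integrable_def)

lemma square_integral_nonneg [simp]: "0 \<le> square_integral f"
  by (simp add: square_integral_def)

lemma square_integrable_bound:
  fixes f :: "'a::euclidean_space \<Rightarrow> 'b::{real_normed_field,banach,second_countable_topology}"
    and g :: "'a \<Rightarrow> 'c::{real_normed_field,banach,second_countable_topology}"
  assumes "square_integrable g" "f \<in> borel_measurable borel" "\<And>x. norm (f x) \<le> norm (g x)"
  shows "square_integrable f"
  unfolding square_integrable_def
proof
  show "integrable lborel (\<lambda>x. (norm (f x))\<^sup>2)"
  proof (rule Bochner_Integration.integrable_bound)
    show "integrable lborel (\<lambda>x. (norm (g x))\<^sup>2)" using assms(1) by (simp add: square_integrable_def)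
    show "AE x in lborel. norm ((norm (f x))\<^sup>2) \<le> norm ((norm (g x))\<^sup>2)"
      using assms(3) by (auto intro!: power_mono)
  qed (use assms(2) in auto)
qed fact

lemma sum_power2_le: "((a::real) + b)\<^sup>2 \<le> 2 * a\<^sup>2 + 2 * b\<^sup>2"
  using zero_le_power2[of "a - b"] by (simp add: power2_eq_square algebra_simps)

lemma square_integrable_add:
  fixes f g :: "'a::euclidean_space \<Rightarrow> 'b::{real_normed_field,banach,second_countable_topology}"
  assumes f: "square_integrable f" and g: "square_integrable g"
  shows "square_integrable (\<lambda>x. f x + g x)"
proof -
  have [measurable]: "f \<in> borel_measurable borel" "g \<in> borel_measurable borel"
    using f g by (auto simp: square_integrable_def)
  have le: "(norm (f x + g x))\<^sup>2 \<le> 2 * (norm (f x))\<^sup>2 + 2 * (norm (g x))\<^sup>2" for x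
    by (rule order_trans[OF power_mono[OF norm_triangle_ineq norm_ge_zero] sum_power2_le])
  have int: "integrable lborel (\<lambda>x. 2 * (norm (f x))\<^sup>2 + 2 * (norm (g x))\<^sup>2)"
    using f g by (auto simp: square_integrable_def)
  show "square_integrable (\<lambda>x. f x + g x)"
    unfolding square_integrable_def
  proof
    show "integrable lborel (\<lambda>x. (norm (f x + g x))\<^sup>2)"
    proof (rule Bochner_Integration.integrable_bound[OF int])
      show "AE x in lborel. norm ((norm (f x + g x))\<^sup>2) \<le> norm (2 * (norm (f x))\<^sup>2 + 2 * (norm (g x))\<^sup>2)"
        using le by (auto intro: order_trans[OF _ abs_ge_self])
    qed auto
  qed auto
qed

lemma square_integrable_cmult:
  fixes f :: "'a::euclidean_space \<Rightarrow> 'b::{real_normed_field,banach,second_countable_topology}"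
  assumes "square_integrable f"
  shows "square_integrable (\<lambda>x. c * f x)"
proof -
  have [measurable]: "f \<in> borel_measurable borel" using assms by (simp add: square_integrable_def)
  have "(\<lambda>x. c * f x) \<in> borel_measurable borel" by measurable
  then show ?thesis using assms by (simp add: square_integrable_def norm_mult power_mult_distrib)
qed

lemma square_integrable_diff:
  fixes f g :: "'a::euclidean_space \<Rightarrow> 'b::{real_normed_field,banach,second_countable_topology}"
  assumes "square_integrable f" "square_integrable g"
  shows "square_integrable (\<lambda>x. f x - g x)"
  using square_integrable_add[OF assms(1) square_integrable_cmult[OF assms(2), of "-1"]] by simp

lemma square_integrable_sum:
  fixes f :: "'i \<Rightarrow> 'a::euclidean_space \<Rightarrow> 'b::{real_normed_field,banach,second_countable_topology}"
  assumes "\<And>i. i \<in> I \<Longrightarrow> square_integrable (f i)"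
  shows "square_integrable (\<lambda>x. \<Sum>i\<in>I. f i x)"
  using assms
proof (induction I rule: infinite_finite_induct)
  case (insert i I)
  then have "square_integrable (\<lambda>x. f i x + (\<Sum>i\<in>I. f i x))"
    by (intro square_integrable_add) auto
  then show ?case using insert by simp
qed (auto simp: square_integrable_def)

lemma square_integrable_mult:
  fixes f g :: "'a::euclidean_space \<Rightarrow> 'b::{real_normed_field,banach,second_countable_topology}"
  assumes f: "square_integrable f" and g: "square_integrable g"
  shows "integrable lborel (\<lambda>x. f x * g x)"
proof (rule Bochner_Integration.integrable_bound)
  show "integrable lborel (\<lambda>x. (norm (f x))\<^sup>2 + (norm (g x))\<^sup>2)"
    using f g by (auto simp: square_integrable_def)
  show "AE x in lborel. norm (f x * g x) \<le> norm ((norm (f x))\<^sup>2 + (norm (g x))\<^sup>2)"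
  proof (rule AE_I2)
    fix x
    have "2 * (norm (f x) * norm (g x)) \<le> (norm (f x))\<^sup>2 + (norm (g x))\<^sup>2"
      using zero_le_power2[of "norm (f x) - norm (g x)"] by (simp add: power2_eq_square algebra_simps)
    moreover have "0 \<le> norm (f x) * norm (g x)" by simp
    ultimately show "norm (f x * g x) \<le> norm ((norm (f x))\<^sup>2 + (norm (g x))\<^sup>2)"
      unfolding norm_mult real_norm_def by linarith
  qed
qed (use f g in \<open>auto simp: square_integrable_def\<close>)

lemma cauchy_schwarz_integral:
  fixes f :: "'a::euclidean_space \<Rightarrow> 'b::{real_normed_field,banach,second_countable_topology}"
    and g :: "'a \<Rightarrow> 'c::{real_normed_field,banach,second_countable_topology}"
  assumes f: "square_integrable f" and g: "square_integrable g"
  shows "(LINT x|lborel. norm (f x) * norm (g x)) \<le> sqrt (square_integral f) * sqrt (square_integral g)"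
proof -
  have [measurable]: "f \<in> borel_measurable borel" "g \<in> borel_measurable borel"
    using f g by (auto simp: square_integrable_def)
  have nf: "square_integrable (\<lambda>x. norm (f x))" "square_integrable (\<lambda>x. norm (g x))"
    using f g by (auto simp: square_integrable_def)
  have sq: "ennreal a ^ 2 = ennreal (a\<^sup>2)" if "0 \<le> a" for a :: real
    using that by (simp add: ennreal_power)
  have "ennreal ((LINT x|lborel. norm (f x) * norm (g x))\<^sup>2) = (\<integral>\<^sup>+x. ennreal (norm (f x) * norm (g x)) \<partial>lborel)\<^sup>2"
    using square_integrable_mult[OF nf] by (subst nn_integral_eq_integral) (auto simp: sq)
  also have "\<dots> = (\<integral>\<^sup>+x. ennreal (norm (f x)) * ennreal (norm (g x)) \<partial>lborel)\<^sup>2"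
    by (simp add: ennreal_mult)
  also have "\<dots> \<le> (\<integral>\<^sup>+x. ennreal (norm (f x)) ^ 2 \<partial>lborel) * (\<integral>\<^sup>+x. ennreal (norm (g x)) ^ 2 \<partial>lborel)"
    by (intro Cauchy_Schwarz_nn_integral) auto
  also have "\<dots> = ennreal (square_integral f) * ennreal (square_integral g)"
    using f g unfolding square_integral_def
    by (simp add: sq nn_integral_eq_integral square_integrable_def)
  also have "\<dots> = ennreal (square_integral f * square_integral g)"
    by (simp add: ennreal_mult)
  finally have "(LINT x|lborel. norm (f x) * norm (g x))\<^sup>2 \<le> square_integral f * square_integral g"
    by (simp add: ennreal_le_iff)
  then show ?thesis
    by (simp add: real_le_rsqrt real_sqrt_mult[symmetric])
qed

lemma norm_integral_mult_le:
  fixes f g :: "'a::euclidean_space \<Rightarrow> 'b::{real_normed_field,banach,second_countable_topology}"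
  assumes f: "square_integrable f" and g: "square_integrable g"
  shows "norm (LINT x|lborel. f x * g x) \<le> sqrt (square_integral f) * sqrt (square_integral g)"
proof -
  have "norm (LINT x|lborel. f x * g x) \<le> (LINT x|lborel. norm (f x * g x))"
    by (rule integral_norm_bound)
  then show ?thesis
    using cauchy_schwarz_integral[OF f g] by (simp add: norm_mult)
qed

lemma square_integrable_affine:
  fixes f :: "'a::euclidean_space \<Rightarrow> 'b::{real_normed_field,banach,second_countable_topology}"
  assumes f: "square_integrable f" and b: "b \<noteq> 0"
  shows "square_integrable (\<lambda>x. f (a + b *\<^sub>R x))"
    and "square_integral f = \<bar>b\<bar> ^ DIM('a) * square_integral (\<lambda>x. f (a + b *\<^sub>R x))"
proof -
  have [measurable]: "f \<in> borel_measurable borel"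
    using f by (auto simp: square_integrable_def)
  show "square_integrable (\<lambda>x. f (a + b *\<^sub>R x))"
    using f integrable_lborel_affine[OF b, of "\<lambda>x. (norm (f x))\<^sup>2" a] by (auto simp: square_integrable_def)
  show "square_integral f = \<bar>b\<bar> ^ DIM('a) * square_integral (\<lambda>x. f (a + b *\<^sub>R x))"
    unfolding square_integral_def using integral_lborel_affine[OF b, of "\<lambda>x. (norm (f x))\<^sup>2" a] by simp
qed

lemma l2_sq_finite_iff:
  assumes "f \<in> borel_measurable borel"
  shows "l2_sq f < \<infinity> \<longleftrightarrow> square_integrable f"
  using assms unfolding l2_sq_def square_integrable_def integrable_iff_bounded by auto

lemma L2_iff: "f \<in> L2 \<longleftrightarrow> square_integrable f"
  using l2_sq_finite_iff[of f] by (auto simp: L2_def square_integrable_def)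

lemma l2_sq_eq: "square_integrable f \<Longrightarrow> l2_sq f = ennreal (square_integral f)"
  unfolding l2_sq_def square_integral_def square_integrable_def
  by (intro nn_integral_eq_integral) auto

lemma square_integrable_gauss: "square_integrable (\<lambda>z. complex_of_real (gauss z))"
  unfolding square_integrable_def
proof
  show "integrable lborel (\<lambda>z::'a. (cmod (complex_of_real (gauss z)))\<^sup>2)"
  proof (rule Bochner_Integration.integrable_bound)
    show "integrable lborel (\<lambda>z::'a. gauss (0::'a) * gauss z)" using integrable_gauss by auto
    show "AE z::'a in lborel. norm ((cmod (complex_of_real (gauss z)))\<^sup>2) \<le> norm (gauss (0::'a) * gauss z)"
      by (auto simp: power2_eq_square gauss_0 intro!: mult_right_mono gauss_le_gauss_0 AE_I2)
  qed simp
qed simp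

section \<open>The Fourier transform on \<open>L\<^sup>2\<close> and Gaussian tests\<close>

lemma cball_measurable [measurable]: "cball a r \<in> sets borel"
  by simp

lemma eventually_norm_le_sequentially: "\<forall>\<^sub>F n in sequentially. norm x \<le> real n"
  using eventually_ge_at_top[of "nat \<lceil>norm x\<rceil>"] by eventually_elim linarith

lemma integrable_truncation:
  fixes f :: "'a::euclidean_space \<Rightarrow> complex"
  assumes "square_integrable f"
  shows "integrable lborel (\<lambda>x. indicator (cball 0 R) x * f x)"
proof (rule square_integrable_mult[OF _ assms])
  have "integrable lborel (indicator (cball 0 R) :: 'a \<Rightarrow> real)"
    using emeasure_lborel_cball_finite[of "0::'a" R] by simp
  moreover have "(norm (indicator (cball 0 R) x :: complex))\<^sup>2 = indicator (cball 0 R) x" for x :: 'a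
    by (simp add: indicator_def)
  moreover have "(indicator (cball 0 R) :: 'a \<Rightarrow> complex) \<in> borel_measurable borel"
    by (intro borel_measurable_indicator) auto
  ultimately show "square_integrable (indicator (cball 0 R) :: 'a \<Rightarrow> complex)"
    by (simp add: square_integrable_def)
qed

lemma has_fourier_L2_truncations:
  fixes f :: "'a::euclidean_space \<Rightarrow> complex"
  assumes F: "has_fourier_L2 f F" and e: "e > 0"
  defines "D \<equiv> \<lambda>n \<xi>. fourier (\<lambda>x. indicator (cball 0 (real n)) x * f x) \<xi> - F \<xi>"
  shows "\<forall>\<^sub>F n in sequentially. square_integrable (D n) \<and> square_integral (D n) < e"
proof -
  have f: "square_integrable f" "square_integrable F"
    using F by (auto simp: has_fourier_L2_def L2_iff)
  have meas: "D n \<in> borel_measurable borel" for n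
    unfolding D_def using f
    by (intro borel_measurable_diff borel_measurable_fourier integrable_truncation) (auto simp: square_integrable_def)
  have "((\<lambda>R::real. l2_sq (\<lambda>\<xi>. fourier (\<lambda>x. indicator (cball 0 R) x * f x) \<xi> - F \<xi>)) \<longlongrightarrow> 0) at_top"
    using F by (simp add: has_fourier_L2_def)
  from filterlim_compose[OF this filterlim_real_sequentially]
  have "(\<lambda>n. l2_sq (D n)) \<longlonglongrightarrow> 0" by (simp add: D_def)
  then have "\<forall>\<^sub>F n in sequentially. l2_sq (D n) < ennreal e"
    by (rule order_tendstoD) (use e in simp)
  then show ?thesis
  proof eventually_elim
    case (elim n)
    then have "square_integrable (D n)"
      using l2_sq_finite_iff[OF meas] by (metis ennreal_less_top infinity_ennreal_def less_trans)
    then show ?case using elim e by (simp add: l2_sq_eq ennreal_less_iff)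
  qed
qed

text \<open>Fatou's lemma, since the transforms of the truncations also converge pointwise.\<close>

lemma has_fourier_L2_integrable:
  fixes f :: "'a::euclidean_space \<Rightarrow> complex"
  assumes F: "has_fourier_L2 f F" and int: "integrable lborel f"
  shows "AE \<xi> in lborel. F \<xi> = fourier f \<xi>"
proof -
  define D where "D n \<xi> = fourier (\<lambda>x. indicator (cball 0 (real n)) x * f x) \<xi> - F \<xi>" for n :: nat and \<xi>
  have f: "square_integrable f" "square_integrable F"
    using F by (auto simp: has_fourier_L2_def L2_iff)
  have [measurable]: "D n \<in> borel_measurable borel" for n
    unfolding D_def using f
    by (intro borel_measurable_diff borel_measurable_fourier integrable_truncation) (auto simp: square_integrable_def)
  have [measurable]: "fourier f \<in> borel_measurable borel" "F \<in> borel_measurable borel" "f \<in> borel_measurable borel"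
    using f int by (auto simp: square_integrable_def intro: borel_measurable_fourier)
  have lim: "(\<lambda>n. D n \<xi>) \<longlonglongrightarrow> fourier f \<xi> - F \<xi>" for \<xi>
    unfolding D_def
  proof (intro tendsto_diff tendsto_const)
    show "(\<lambda>n. fourier (\<lambda>x. indicator (cball 0 (real n)) x * f x) \<xi>) \<longlonglongrightarrow> fourier f \<xi>"
      unfolding fourier_def
    proof (rule integral_dominated_convergence[where w="\<lambda>x. cmod (f x)"])
      show "AE x in lborel. (\<lambda>n. exp (- (\<i> * complex_of_real (x \<bullet> \<xi>))) * (indicator (cball 0 (real n)) x * f x))
          \<longlonglongrightarrow> exp (- (\<i> * complex_of_real (x \<bullet> \<xi>))) * f x"
      proof (rule AE_I2)
        fix x :: 'a
        have "\<forall>\<^sub>F n in sequentially. exp (- (\<i> * complex_of_real (x \<bullet> \<xi>))) * (indicator (cball 0 (real n)) x * f x)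
            = exp (- (\<i> * complex_of_real (x \<bullet> \<xi>))) * f x"
          using eventually_norm_le_sequentially[of x] by eventually_elim simp
        then show "(\<lambda>n. exp (- (\<i> * complex_of_real (x \<bullet> \<xi>))) * (indicator (cball 0 (real n)) x * f x))
          \<longlonglongrightarrow> exp (- (\<i> * complex_of_real (x \<bullet> \<xi>))) * f x"
          by (rule tendsto_eventually)
      qed
    qed (use int in \<open>auto simp: norm_mult indicator_def\<close>)
  qed
  have "((\<lambda>R::real. l2_sq (\<lambda>\<xi>. fourier (\<lambda>x. indicator (cball 0 R) x * f x) \<xi> - F \<xi>)) \<longlongrightarrow> 0) at_top"
    using F by (simp add: has_fourier_L2_def)
  from filterlim_compose[OF this filterlim_real_sequentially]
  have 0: "(\<lambda>n. l2_sq (D n)) \<longlonglongrightarrow> 0" unfolding D_def[abs_def] .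
  have "(\<integral>\<^sup>+\<xi>. ennreal ((cmod (fourier f \<xi> - F \<xi>))\<^sup>2) \<partial>lborel)
      = (\<integral>\<^sup>+\<xi>. liminf (\<lambda>n. ennreal ((cmod (D n \<xi>))\<^sup>2)) \<partial>lborel)"
  proof (rule nn_integral_cong)
    fix \<xi> :: 'a
    have "(\<lambda>n. ennreal ((cmod (D n \<xi>))\<^sup>2)) \<longlonglongrightarrow> ennreal ((cmod (fourier f \<xi> - F \<xi>))\<^sup>2)"
      by (intro tendsto_ennrealI tendsto_intros lim)
    then show "ennreal ((cmod (fourier f \<xi> - F \<xi>))\<^sup>2) = liminf (\<lambda>n. ennreal ((cmod (D n \<xi>))\<^sup>2))"
      by (rule lim_imp_Liminf[OF sequentially_bot, symmetric])
  qed
  also have "\<dots> \<le> liminf (\<lambda>n. l2_sq (D n))"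
    unfolding l2_sq_def by (rule nn_integral_liminf) auto
  also have "\<dots> = 0"
    using 0 by (simp add: lim_imp_Liminf)
  finally have "AE \<xi> in lborel. ennreal ((cmod (fourier f \<xi> - F \<xi>))\<^sup>2) = 0"
    by (subst (asm) le_zero_eq) (subst (asm) nn_integral_0_iff_AE, auto)
  then show ?thesis
    by eventually_elim (simp add: ennreal_eq_0_iff)
qed

lemma has_fourier_L2_cong_AE:
  fixes f g :: "'a::euclidean_space \<Rightarrow> complex"
  assumes F: "has_fourier_L2 f F" and g: "g \<in> borel_measurable borel" and eq: "AE x in lborel. f x = g x"
  shows "has_fourier_L2 g F"
proof -
  have [measurable]: "f \<in> borel_measurable borel" "g \<in> borel_measurable borel"
    using F g by (auto simp: has_fourier_L2_def L2_def)
  have "l2_sq f = l2_sq g"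
    unfolding l2_sq_def by (rule nn_integral_cong_AE) (use eq in eventually_elim, simp)
  moreover have "fourier (\<lambda>x. indicator (cball 0 R) x * f x) = fourier (\<lambda>x. indicator (cball 0 R) x * g x)" for R
  proof
    fix \<xi>
    show "fourier (\<lambda>x. indicator (cball 0 R) x * f x) \<xi> = fourier (\<lambda>x. indicator (cball 0 R) x * g x) \<xi>"
      unfolding fourier_def
    proof (rule integral_cong_AE)
      show "AE x in lborel. exp (- (\<i> * complex_of_real (x \<bullet> \<xi>))) * (indicator (cball 0 R) x * f x)
          = exp (- (\<i> * complex_of_real (x \<bullet> \<xi>))) * (indicator (cball 0 R) x * g x)"
        using eq by eventually_elim simp
    qed measurable
  qed
  ultimately show ?thesis
    using F g by (simp add: has_fourier_L2_def L2_def)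
qed

text \<open>
  Only pairings with Gaussians are ever taken of an \<open>L\<^sup>2\<close> transform, and for these the integrable
  case passes to the limit by the Cauchy--Schwarz inequality.
\<close>

lemma square_integrable_gaussian_kernel:
  assumes b: "b \<noteq> 0"
  shows "square_integrable (\<lambda>x::'a::euclidean_space. exp (- (\<i> * complex_of_real (x \<bullet> a))) * complex_of_real (exp (- b\<^sup>2 * (norm x)\<^sup>2 / 2)))"
proof (rule square_integrable_bound)
  show "square_integrable (\<lambda>x::'a. complex_of_real (sqrt (2 * pi) ^ DIM('a)) * complex_of_real (gauss (0 + b *\<^sub>R x)))"
    by (intro square_integrable_cmult square_integrable_affine square_integrable_gauss b)
  show "cmod (exp (- (\<i> * complex_of_real (x \<bullet> a))) * complex_of_real (exp (- b\<^sup>2 * (norm x)\<^sup>2 / 2)))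
      \<le> cmod (complex_of_real (sqrt (2 * pi) ^ DIM('a)) * complex_of_real (gauss (0 + b *\<^sub>R x)))" for x :: 'a
    by (simp add: norm_mult gauss_eq norm_power norm_divide power_mult_distrib power_divide)
qed measurable

theorem integral_fourier_L2_gauss:
  fixes f :: "'a::euclidean_space \<Rightarrow> complex"
  assumes F: "has_fourier_L2 f F" and b: "b \<noteq> 0"
  shows "(LINT z|lborel. F (a + b *\<^sub>R z) * complex_of_real (gauss z))
    = (LINT x|lborel. f x * (exp (- (\<i> * complex_of_real (x \<bullet> a))) * complex_of_real (exp (- b\<^sup>2 * (norm x)\<^sup>2 / 2))))"
    (is "_ = (LINT x|lborel. f x * ?k x)")
proof (rule LIMSEQ_unique)
  have f: "square_integrable f" "square_integrable F"
    using F by (auto simp: has_fourier_L2_def L2_iff)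
  have [measurable]: "f \<in> borel_measurable borel" using f by (auto simp: square_integrable_def)
  define f' where "f' n x = indicator (cball 0 (real n)) x * f x" for n :: nat and x
  have f': "integrable lborel (f' n)" for n unfolding f'_def by (rule integrable_truncation[OF f(1)])
  have k: "square_integrable ?k" by (rule square_integrable_gaussian_kernel[OF b])
  have [measurable]: "?k \<in> borel_measurable borel" using k by (auto simp: square_integrable_def)
  have fk: "integrable lborel (\<lambda>x. f x * ?k x)" by (rule square_integrable_mult[OF f(1) k])
  let ?I = "\<lambda>n. LINT z|lborel. fourier (f' n) (a + b *\<^sub>R z) * complex_of_real (gauss z)"
  have I: "?I n = (LINT x|lborel. f' n x * ?k x)" for n
    unfolding integral_fourier_gauss[OF f'] by (simp add: mult_ac)
  show "?I \<longlonglongrightarrow> (LINT x|lborel. f x * ?k x)"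
    unfolding I
  proof (rule integral_dominated_convergence[where w="\<lambda>x. cmod (f x * ?k x)"])
    show "AE x in lborel. (\<lambda>n. f' n x * ?k x) \<longlonglongrightarrow> f x * ?k x"
    proof (intro AE_I2 tendsto_mult tendsto_const tendsto_eventually)
      fix x :: 'a
      show "\<forall>\<^sub>F n in sequentially. f' n x = f x"
        using eventually_norm_le_sequentially[of x] by eventually_elim (simp add: f'_def)
    qed
    show "AE x in lborel. norm (f' n x * ?k x) \<le> cmod (f x * ?k x)" for n
      by (auto simp: f'_def norm_mult indicator_def)
    show "integrable lborel (\<lambda>x. cmod (f x * ?k x))" using fk by simp
    show "(\<lambda>x. f' n x * ?k x) \<in> borel_measurable lborel" for n
      unfolding f'_def by measurable
  qed measurable
  show "?I \<longlonglongrightarrow> (LINT z|lborel. F (a + b *\<^sub>R z) * complex_of_real (gauss z))"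
    unfolding tendsto_iff
  proof (intro allI impI)
    fix e :: real assume e: "e > 0"
    define G where "G = square_integral (\<lambda>z::'a. complex_of_real (gauss z))"
    define d where "d = \<bar>b\<bar> ^ DIM('a) * (e\<^sup>2 / (G + 1))"
    have G: "G \<ge> 0" by (simp add: G_def)
    have d: "d > 0" using b e G by (simp add: d_def)
    from has_fourier_L2_truncations[OF F d]
    show "\<forall>\<^sub>F n in sequentially. dist (?I n) (LINT z|lborel. F (a + b *\<^sub>R z) * complex_of_real (gauss z)) < e"
    proof eventually_elim
      case (elim n)
      define D where "D \<xi> = fourier (f' n) \<xi> - F \<xi>" for \<xi>
      have D: "square_integrable D" "square_integral D < d"
        using elim by (auto simp: D_def[abs_def] f'_def[abs_def])
      note D' = square_integrable_affine[OF D(1) b, of a]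
      have FA: "integrable lborel (\<lambda>z. F (a + b *\<^sub>R z) * complex_of_real (gauss z))"
        by (rule square_integrable_mult[OF square_integrable_affine(1)[OF f(2) b] square_integrable_gauss])
      have DA: "integrable lborel (\<lambda>z. D (a + b *\<^sub>R z) * complex_of_real (gauss z))"
        by (rule square_integrable_mult[OF D'(1) square_integrable_gauss])
      have "?I n = (LINT z|lborel. D (a + b *\<^sub>R z) * complex_of_real (gauss z) + F (a + b *\<^sub>R z) * complex_of_real (gauss z))"
        by (simp add: D_def ring_distribs)
      then have "?I n - (LINT z|lborel. F (a + b *\<^sub>R z) * complex_of_real (gauss z))
          = (LINT z|lborel. D (a + b *\<^sub>R z) * complex_of_real (gauss z))"
        using FA DA by simp
      then have "dist (?I n) (LINT z|lborel. F (a + b *\<^sub>R z) * complex_of_real (gauss z))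
          \<le> sqrt (square_integral (\<lambda>z. D (a + b *\<^sub>R z))) * sqrt G"
        unfolding dist_norm G_def using norm_integral_mult_le[OF D'(1) square_integrable_gauss] by simp
      also have "\<dots> = sqrt (square_integral (\<lambda>z. D (a + b *\<^sub>R z)) * G)" by (simp add: real_sqrt_mult)
      also have "\<dots> < sqrt (e\<^sup>2)"
      proof (rule real_sqrt_less_mono)
        have "\<bar>b\<bar> ^ DIM('a) * square_integral (\<lambda>z. D (a + b *\<^sub>R z)) < \<bar>b\<bar> ^ DIM('a) * (e\<^sup>2 / (G + 1))"
          using D(2) D'(2) by (simp add: d_def)
        then have "square_integral (\<lambda>z. D (a + b *\<^sub>R z)) < e\<^sup>2 / (G + 1)"
          using b by (subst (asm) mult_less_cancel_left_pos) auto
        then have "square_integral (\<lambda>z. D (a + b *\<^sub>R z)) * (G + 1) < e\<^sup>2"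
          using G by (simp add: pos_less_divide_eq)
        moreover have "square_integral (\<lambda>z. D (a + b *\<^sub>R z)) * G \<le> square_integral (\<lambda>z. D (a + b *\<^sub>R z)) * (G + 1)"
          by (intro mult_left_mono) auto
        ultimately show "square_integral (\<lambda>z. D (a + b *\<^sub>R z)) * G < e\<^sup>2" by linarith
      qed
      finally show ?case using e by simp
    qed
  qed
qed

text \<open>
  By the Cauchy--Schwarz inequality the pairing with \<open>k\<close> is continuous on \<open>L\<^sup>2\<close>, so Riemann sums that
  converge in \<open>L\<^sup>2\<close> are mapped to convergent Riemann sums of a scalar function.
\<close>

lemma has_L2_integral_pairing:
  fixes w :: "real \<Rightarrow> 'a::euclidean_space \<Rightarrow> complex"
  assumes J: "has_L2_integral w a b J" and k: "square_integrable k"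
  shows "((\<lambda>\<tau>. LINT x|lborel. w \<tau> x * k x) has_integral (LINT x|lborel. J x * k x)) {a..b}"
proof -
  have w: "square_integrable (w \<tau>)" if "\<tau> \<in> {a..b}" for \<tau>
    using J that by (auto simp: has_L2_integral_def L2_iff)
  have J2: "square_integrable J" using J by (auto simp: has_L2_integral_def L2_iff)
  have "\<exists>\<gamma>. gauge \<gamma> \<and> (\<forall>p. p tagged_division_of cbox a b \<and> \<gamma> fine p \<longrightarrow>
      norm ((\<Sum>(\<tau>, K)\<in>p. measure lborel K *\<^sub>R (LINT x|lborel. w \<tau> x * k x)) - (LINT x|lborel. J x * k x)) < e)"
    if e: "e > 0" for e
  proof -
    define c where "c = e\<^sup>2 / (square_integral k + 1)"
    have c: "c > 0" using e unfolding c_def by (intro divide_pos_pos add_nonneg_pos) auto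
    then have "ennreal c > 0" by simp
    then obtain \<delta> where \<delta>: "\<delta> > 0" and
      R: "\<And>p. p tagged_division_of {a..b} \<Longrightarrow> (\<lambda>\<tau>. ball \<tau> \<delta>) fine p \<Longrightarrow>
        l2_sq (\<lambda>x. (\<Sum>(\<tau>, K)\<in>p. complex_of_real (measure lborel K) * w \<tau> x) - J x) < ennreal c"
      using J unfolding has_L2_integral_def by meson
    show ?thesis
    proof (intro exI conjI allI impI)
      show "gauge (\<lambda>\<tau>. ball \<tau> \<delta>)" using \<delta> by (simp add: gauge_def)
      fix p assume p: "p tagged_division_of cbox a b \<and> (\<lambda>\<tau>. ball \<tau> \<delta>) fine p"
      then have pd: "p tagged_division_of {a..b}" by simp
      have tag: "\<tau> \<in> {a..b}" if "(\<tau>, K) \<in> p" for \<tau> K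
        using tagged_division_ofD(2,3)[OF pd that] by auto
      define S where "S x = (\<Sum>(\<tau>, K)\<in>p. complex_of_real (measure lborel K) * w \<tau> x)" for x
      have S: "square_integrable S"
        unfolding S_def by (rule square_integrable_sum) (auto intro!: square_integrable_cmult w tag)
      have SJ: "square_integrable (\<lambda>x. S x - J x)" by (rule square_integrable_diff[OF S J2])
      have "l2_sq (\<lambda>x. S x - J x) < ennreal c"
        using R[OF pd] p by (simp add: S_def)
      then have lt: "square_integral (\<lambda>x. S x - J x) < c"
        using c by (simp add: l2_sq_eq[OF SJ] ennreal_less_iff)
      have "(LINT x|lborel. S x * k x) = (\<Sum>(\<tau>, K)\<in>p. measure lborel K *\<^sub>R (LINT x|lborel. w \<tau> x * k x))"
      proof -
        have "(LINT x|lborel. S x * k x) = (LINT x|lborel. (\<Sum>i\<in>p. complex_of_real (measure lborel (snd i)) * (w (fst i) x * k x)))"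
          unfolding S_def by (simp add: sum_distrib_right case_prod_unfold mult.assoc)
        also have "\<dots> = (\<Sum>i\<in>p. (LINT x|lborel. complex_of_real (measure lborel (snd i)) * (w (fst i) x * k x)))"
          by (intro Bochner_Integration.integral_sum integrable_mult_right square_integrable_mult k w)
             (use tag in force)
        also have "\<dots> = (\<Sum>(\<tau>, K)\<in>p. measure lborel K *\<^sub>R (LINT x|lborel. w \<tau> x * k x))"
          by (simp add: case_prod_unfold scaleR_conv_of_real)
        finally show ?thesis .
      qed
      then have "norm ((\<Sum>(\<tau>, K)\<in>p. measure lborel K *\<^sub>R (LINT x|lborel. w \<tau> x * k x)) - (LINT x|lborel. J x * k x))
          = norm (LINT x|lborel. (S x - J x) * k x)"
        using square_integrable_mult[OF S k] square_integrable_mult[OF J2 k] by (simp add: left_diff_distrib)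
      also have "\<dots> \<le> sqrt (square_integral (\<lambda>x. S x - J x)) * sqrt (square_integral k)"
        by (rule norm_integral_mult_le[OF SJ k])
      also have "\<dots> = sqrt (square_integral (\<lambda>x. S x - J x) * square_integral k)" by (simp add: real_sqrt_mult)
      also have "\<dots> < sqrt (e\<^sup>2)"
      proof (rule real_sqrt_less_mono)
        have "square_integral (\<lambda>x. S x - J x) * (square_integral k + 1) < e\<^sup>2"
          using lt square_integral_nonneg[of k] by (simp add: c_def pos_less_divide_eq add_nonneg_pos)
        moreover have "square_integral (\<lambda>x. S x - J x) * square_integral k
            \<le> square_integral (\<lambda>x. S x - J x) * (square_integral k + 1)"
          by (intro mult_left_mono) auto
        ultimately show "square_integral (\<lambda>x. S x - J x) * square_integral k < e\<^sup>2" by linarith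
      qed
      finally show "norm ((\<Sum>(\<tau>, K)\<in>p. measure lborel K *\<^sub>R (LINT x|lborel. w \<tau> x * k x)) - (LINT x|lborel. J x * k x)) < e"
        using e by simp
    qed
  qed
  then show ?thesis
    using has_integral[of "\<lambda>\<tau>. LINT x|lborel. w \<tau> x * k x" "LINT x|lborel. J x * k x" a b] by simp
qed

section \<open>Regularity and the weak derivative\<close>

text \<open>
  The integral of \<open>h (x + e) - h x\<close> vanishes by translation invariance, and it equals the integral
  of the derivative of \<open>h\<close> along \<open>e\<close> by the fundamental theorem of calculus and Fubini's theorem.
\<close>

lemma integral_directional_derivative_eq_0:
  fixes h h' :: "'a::euclidean_space \<Rightarrow> real"
  assumes h: "integrable lborel h" and h': "integrable lborel h'" and cont: "continuous_on UNIV h'"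
    and deriv: "\<And>x. ((\<lambda>s. h (x + s *\<^sub>R e)) has_real_derivative h' x) (at 0)"
  shows "(LINT x|lborel. h' x) = 0"
proof -
  have [measurable]: "h \<in> borel_measurable borel" "h' \<in> borel_measurable borel" using h h' by auto
  have deriv': "((\<lambda>s. h (x + s *\<^sub>R e)) has_real_derivative h' (x + s *\<^sub>R e)) (at s)" for x s
  proof -
    have "((\<lambda>t. h (x + (t + s) *\<^sub>R e)) has_real_derivative h' (x + s *\<^sub>R e)) (at 0)"
      using deriv[of "x + s *\<^sub>R e"] by (simp add: scaleR_add_left add.assoc add.commute add.left_commute)
    then show ?thesis
      using DERIV_shift[of "\<lambda>s. h (x + s *\<^sub>R e)" "h' (x + s *\<^sub>R e)" 0 s] by simp
  qed
  have ftc: "(LINT s|lborel. indicator {0..1} s * h' (x + s *\<^sub>R e)) = h (x + e) - h x" for x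
  proof -
    have "(LINT s|lborel. h' (x + s *\<^sub>R e) * indicator {0..1} s) = h (x + 1 *\<^sub>R e) - h (x + 0 *\<^sub>R e)"
    proof (rule integral_FTC_Icc_real)
      fix s :: real
      have "continuous_on UNIV (\<lambda>s. h' (x + s *\<^sub>R e))"
        by (intro continuous_on_compose2[OF cont] continuous_intros) auto
      then show "isCont (\<lambda>s. h' (x + s *\<^sub>R e)) s"
        by (simp add: continuous_on_eq_continuous_at)
    qed (use deriv' in auto)
    then show ?thesis by (simp add: mult.commute)
  qed
  note shift = integrable_lborel_shift integral_lborel_shift
  let ?k = "\<lambda>s x. indicator {0..1} s * h' (x + s *\<^sub>R e)"
  have int: "integrable (lborel \<Otimes>\<^sub>M lborel) (\<lambda>(s, x). ?k s x)"
  proof (rule lborel_pair.Fubini_integrable)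
    show "(\<lambda>(s, x). ?k s x) \<in> borel_measurable (lborel \<Otimes>\<^sub>M lborel)" by measurable
    have "(LINT x|lborel. norm (?k s x)) = indicator {0..1} s * (LINT x|lborel. \<bar>h' x\<bar>)" for s
      using shift(2)[of "\<lambda>x. \<bar>h' x\<bar>" "s *\<^sub>R e"] h' by (simp add: abs_mult)
    then show "integrable lborel (\<lambda>s. LINT x|lborel. norm (case (s, x) of (s, x) \<Rightarrow> ?k s x))"
      by simp
    show "AE s in lborel. integrable lborel (\<lambda>x. case (s, x) of (s, x) \<Rightarrow> ?k s x)"
      using shift(1)[OF h'] by simp
  qed
  have "(LINT x|lborel. h' x) = (LINT s|lborel. indicator {0..1::real} s * (LINT x|lborel. h' x))"
    by (simp add: content_real)
  also have "\<dots> = (LINT s|lborel. LINT x|lborel. ?k s x)"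
    using shift(2)[OF h'] by simp
  also have "\<dots> = (LINT x|lborel. LINT s|lborel. ?k s x)"
    by (rule lborel_pair.Fubini_integral[OF int, symmetric])
  also have "\<dots> = (LINT x|lborel. h (x + e)) - (LINT x|lborel. h x)"
    unfolding ftc using shift(1)[OF h] h by simp
  also have "\<dots> = 0" using shift(2)[OF h] by simp
  finally show ?thesis .
qed

lemma norm_exp_minus_one_le: "cmod (exp (\<i> * complex_of_real t) - 1) \<le> \<bar>t\<bar>"
  using iexp_approx1[of t 0] by simp

lemma exp_difference_quotient_tendsto:
  fixes w :: complex
  assumes s: "s \<longlonglongrightarrow> 0" "\<And>n. s n \<noteq> 0"
  shows "(\<lambda>n. (exp (complex_of_real (s n) * w) - 1) / complex_of_real (s n)) \<longlonglongrightarrow> w"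
proof -
  have "((\<lambda>z. exp (z * w)) has_field_derivative w) (at 0)"
    by (auto intro!: derivative_eq_intros)
  then have "((\<lambda>z. (exp (z * w) - 1) / z) \<longlongrightarrow> w) (at 0)"
    by (simp add: has_field_derivative_iff)
  moreover have "(\<lambda>n. complex_of_real (s n)) \<longlonglongrightarrow> 0"
    using tendsto_of_real[OF s(1), where 'a=complex] by simp
  ultimately show ?thesis
    using s(2) unfolding tendsto_at_iff_sequentially comp_def by auto
qed

lemma inverse_fourier_altdef:
  "inverse_fourier F (x::'a::euclidean_space) = complex_of_real ((1 / (2 * pi)) ^ DIM('a)) *
    (LINT \<xi>|lborel. exp (\<i> * complex_of_real (\<xi> \<bullet> x)) * F \<xi>)"
  by (simp add: inverse_fourier_def fourier_def)

lemma continuous_on_inverse_fourier: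
  assumes "integrable lborel F"
  shows "continuous_on UNIV (inverse_fourier F)"
  unfolding inverse_fourier_def
  by (intro continuous_intros continuous_on_compose2[OF continuous_on_fourier[OF assms, of UNIV]]) auto

lemma integrable_inner_mult:
  fixes F :: "'a::euclidean_space \<Rightarrow> complex"
  assumes F: "F \<in> borel_measurable borel" and F1: "integrable lborel (\<lambda>\<xi>. norm \<xi> * cmod (F \<xi>))"
  shows "integrable lborel (\<lambda>\<xi>. \<i> * complex_of_real (\<xi> \<bullet> e) * F \<xi>)"
proof (rule Bochner_Integration.integrable_bound)
  show "integrable lborel (\<lambda>\<xi>. norm e * (norm \<xi> * cmod (F \<xi>)))"
    using F1 by (rule integrable_mult_right)
  show "AE \<xi> in lborel. norm (\<i> * complex_of_real (\<xi> \<bullet> e) * F \<xi>) \<le> norm (norm e * (norm \<xi> * cmod (F \<xi>)))"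
  proof (rule AE_I2)
    fix \<xi> :: 'a
    have "\<bar>\<xi> \<bullet> e\<bar> * cmod (F \<xi>) \<le> (norm \<xi> * norm e) * cmod (F \<xi>)"
      by (intro mult_right_mono Cauchy_Schwarz_ineq2) auto
    then show "norm (\<i> * complex_of_real (\<xi> \<bullet> e) * F \<xi>) \<le> norm (norm e * (norm \<xi> * cmod (F \<xi>)))"
      by (simp add: norm_mult mult_ac)
  qed
qed (use F in measurable)

text \<open>Differentiate under the integral, with dominating function \<open>|\<xi>| |e| |F \<xi>|\<close>.\<close>

lemma Re_inverse_fourier_has_derivative:
  fixes F :: "'a::euclidean_space \<Rightarrow> complex"
  assumes F: "integrable lborel F" and F1: "integrable lborel (\<lambda>\<xi>. norm \<xi> * cmod (F \<xi>))"
  shows "((\<lambda>s. Re (inverse_fourier F (x + s *\<^sub>R e))) has_real_derivative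
           Re (inverse_fourier (\<lambda>\<xi>. \<i> * complex_of_real (\<xi> \<bullet> e) * F \<xi>) x)) (at 0)"
proof -
  have [measurable]: "F \<in> borel_measurable borel" using F by auto
  define c where "c = complex_of_real ((1 / (2 * pi)) ^ DIM('a))"
  let ?G = "\<lambda>\<xi>. \<i> * complex_of_real (\<xi> \<bullet> e) * F \<xi>"
  let ?E = "\<lambda>y \<xi>. exp (\<i> * complex_of_real (\<xi> \<bullet> y))"
  have int: "integrable lborel (\<lambda>\<xi>. ?E y \<xi> * F \<xi>)" for y
    by (rule Bochner_Integration.integrable_bound[OF F]) (auto simp: norm_mult)
  have lim: "(\<lambda>n. (inverse_fourier F (x + s n *\<^sub>R e) - inverse_fourier F x) / complex_of_real (s n))
      \<longlonglongrightarrow> inverse_fourier ?G x"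
    if s: "s \<longlonglongrightarrow> 0" "\<And>n. s n \<noteq> 0" for s :: "nat \<Rightarrow> real"
  proof -
    let ?Q = "\<lambda>n \<xi>. ?E x \<xi> * ((exp (\<i> * complex_of_real (s n * (\<xi> \<bullet> e))) - 1) / complex_of_real (s n)) * F \<xi>"
    have eq: "(inverse_fourier F (x + s n *\<^sub>R e) - inverse_fourier F x) / complex_of_real (s n)
        = c * (LINT \<xi>|lborel. ?Q n \<xi>)" for n
    proof -
      have "(LINT \<xi>|lborel. ?Q n \<xi>) = (LINT \<xi>|lborel. (?E (x + s n *\<^sub>R e) \<xi> * F \<xi> - ?E x \<xi> * F \<xi>) / complex_of_real (s n))"
        by (intro Bochner_Integration.integral_cong refl)
           (simp add: inner_add_right exp_add ring_distribs divide_simps)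
      also have "\<dots> = ((LINT \<xi>|lborel. ?E (x + s n *\<^sub>R e) \<xi> * F \<xi>) - (LINT \<xi>|lborel. ?E x \<xi> * F \<xi>)) / complex_of_real (s n)"
        by (subst integral_divide_zero) (simp only: Bochner_Integration.integral_diff[OF int int])
      finally show ?thesis
        by (simp add: inverse_fourier_altdef c_def right_diff_distrib diff_divide_distrib)
    qed
    have "(\<lambda>n. LINT \<xi>|lborel. ?Q n \<xi>) \<longlonglongrightarrow> (LINT \<xi>|lborel. ?E x \<xi> * (\<i> * complex_of_real (\<xi> \<bullet> e)) * F \<xi>)"
    proof (rule integral_dominated_convergence[where w="\<lambda>\<xi>. norm e * (norm \<xi> * cmod (F \<xi>))"])
      show "integrable lborel (\<lambda>\<xi>. norm e * (norm \<xi> * cmod (F \<xi>)))"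
        using F1 by (rule integrable_mult_right)
      show "AE \<xi> in lborel. (\<lambda>n. ?Q n \<xi>) \<longlonglongrightarrow> ?E x \<xi> * (\<i> * complex_of_real (\<xi> \<bullet> e)) * F \<xi>"
      proof (intro AE_I2 tendsto_mult tendsto_const)
        fix \<xi> :: 'a
        show "(\<lambda>n. (exp (\<i> * complex_of_real (s n * (\<xi> \<bullet> e))) - 1) / complex_of_real (s n))
            \<longlonglongrightarrow> \<i> * complex_of_real (\<xi> \<bullet> e)"
          using exp_difference_quotient_tendsto[OF s, of "\<i> * complex_of_real (\<xi> \<bullet> e)"] by (simp add: mult_ac)
      qed
      show "AE \<xi> in lborel. norm (?Q n \<xi>) \<le> norm e * (norm \<xi> * cmod (F \<xi>))" for n
      proof (rule AE_I2)
        fix \<xi> :: 'a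
        have "cmod (exp (\<i> * complex_of_real (s n * (\<xi> \<bullet> e))) - 1) \<le> \<bar>s n\<bar> * \<bar>\<xi> \<bullet> e\<bar>"
          using norm_exp_minus_one_le[of "s n * (\<xi> \<bullet> e)"] by (simp only: abs_mult)
        then have "cmod ((exp (\<i> * complex_of_real (s n * (\<xi> \<bullet> e))) - 1) / complex_of_real (s n)) \<le> \<bar>\<xi> \<bullet> e\<bar>"
          using s(2)[of n] by (simp add: norm_divide pos_divide_le_eq mult.commute)
        also have "\<dots> \<le> norm \<xi> * norm e" by (rule Cauchy_Schwarz_ineq2)
        finally have "cmod ((exp (\<i> * complex_of_real (s n * (\<xi> \<bullet> e))) - 1) / complex_of_real (s n)) * cmod (F \<xi>)
            \<le> (norm \<xi> * norm e) * cmod (F \<xi>)"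
          by (intro mult_right_mono) auto
        then show "norm (?Q n \<xi>) \<le> norm e * (norm \<xi> * cmod (F \<xi>))"
          unfolding norm_mult norm_exp_i_times by (simp only: mult_1_left mult_ac)
      qed
    qed measurable
    then have "(\<lambda>n. c * (LINT \<xi>|lborel. ?Q n \<xi>)) \<longlonglongrightarrow> c * (LINT \<xi>|lborel. ?E x \<xi> * (\<i> * complex_of_real (\<xi> \<bullet> e)) * F \<xi>)"
      by (rule tendsto_mult_left)
    then have "(\<lambda>n. (inverse_fourier F (x + s n *\<^sub>R e) - inverse_fourier F x) / complex_of_real (s n))
        \<longlonglongrightarrow> c * (LINT \<xi>|lborel. ?E x \<xi> * (\<i> * complex_of_real (\<xi> \<bullet> e)) * F \<xi>)"
      by (simp only: eq)
    then show ?thesis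
      unfolding inverse_fourier_altdef[of ?G] c_def by (simp only: mult.assoc)
  qed
  show ?thesis
    unfolding has_field_derivative_iff tendsto_at_iff_sequentially comp_def
  proof safe
    fix s :: "nat \<Rightarrow> real" assume s: "\<forall>i. s i \<in> UNIV - {0}" "s \<longlonglongrightarrow> 0"
    from tendsto_Re[OF lim[OF s(2)]] s(1)
    show "(\<lambda>n. (Re (inverse_fourier F (x + s n *\<^sub>R e)) - Re (inverse_fourier F (x + 0 *\<^sub>R e))) / (s n - 0))
        \<longlonglongrightarrow> Re (inverse_fourier ?G x)"
      by (simp add: Re_divide_of_real)
  qed
qed

definition fhat :: "('a::euclidean_space \<Rightarrow> real) \<Rightarrow> 'a \<Rightarrow> complex" where
  "fhat f = fourier (\<lambda>x. complex_of_real (f x))"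

lemma fhat_diff:
  assumes "integrable lborel f" "integrable lborel g"
  shows "fhat (\<lambda>x. f x - g x) \<xi> = fhat f \<xi> - fhat g \<xi>"
  using fourier_diff[of "\<lambda>x. complex_of_real (f x)" "\<lambda>x. complex_of_real (g x)"] assms by (simp add: fhat_def)

lemma isCont_fhat: "integrable lborel f \<Longrightarrow> isCont (fhat f) \<xi>"
  unfolding fhat_def by (rule isCont_fourier) simp

lemma borel_measurable_fhat: "integrable lborel f \<Longrightarrow> fhat f \<in> borel_measurable borel"
  unfolding fhat_def by (rule borel_measurable_fourier) simp

lemma norm_fhat_le: "cmod (fhat f \<xi>) \<le> (LINT x|lborel. \<bar>f x\<bar>)"
  unfolding fhat_def using norm_fourier_le[of "\<lambda>x. complex_of_real (f x)"] by simp

text \<open>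
  These decay conditions on the transform ensure that \<open>f\<close> agrees almost everywhere with a bounded function
  of class \<open>C\<^sup>1\<close> whose gradient is bounded and square integrable.
\<close>

definition fourier_regular :: "('a::euclidean_space \<Rightarrow> real) \<Rightarrow> bool" where
  "fourier_regular f \<longleftrightarrow> integrable lborel f \<and> integrable lborel (fhat f) \<and>
     integrable lborel (\<lambda>\<xi>. norm \<xi> * cmod (fhat f \<xi>)) \<and>
     integrable lborel (\<lambda>\<xi>. (norm \<xi>)\<^sup>2 * (cmod (fhat f \<xi>))\<^sup>2)"

text \<open>The \<open>C\<^sup>1\<close> representative and its derivative in the direction \<open>e\<close>.\<close>

definition regularized :: "('a::euclidean_space \<Rightarrow> real) \<Rightarrow> 'a \<Rightarrow> real" where
  "regularized f x = Re (inverse_fourier (fhat f) x)"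

definition partial :: "'a::euclidean_space \<Rightarrow> ('a \<Rightarrow> real) \<Rightarrow> 'a \<Rightarrow> real" where
  "partial e f x = Re (inverse_fourier (\<lambda>\<xi>. \<i> * complex_of_real (\<xi> \<bullet> e) * fhat f \<xi>) x)"

lemma AE_eq_regularized:
  assumes "integrable lborel f" "integrable lborel (fhat f)"
  shows "AE x in lborel. f x = regularized f x"
proof -
  have "AE x in lborel. complex_of_real (f x) = inverse_fourier (fhat f) x"
    using assms unfolding fhat_def by (intro fourier_inversion) auto
  then show ?thesis
    by eventually_elim (metis Re_complex_of_real regularized_def)
qed

lemma integrable_partial_symbol:
  assumes "fourier_regular f"
  shows "integrable lborel (\<lambda>\<xi>. \<i> * complex_of_real (\<xi> \<bullet> e) * fhat f \<xi>)"
  using assms by (intro integrable_inner_mult) (auto simp: fourier_regular_def intro: borel_measurable_fhat)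

lemma continuous_on_regularized: "fourier_regular f \<Longrightarrow> continuous_on UNIV (regularized f)"
  unfolding regularized_def[abs_def]
  by (intro continuous_on_Re continuous_on_inverse_fourier) (auto simp: fourier_regular_def)

lemma continuous_on_partial: "fourier_regular f \<Longrightarrow> continuous_on UNIV (partial e f)"
  unfolding partial_def[abs_def]
  by (intro continuous_on_Re continuous_on_inverse_fourier integrable_partial_symbol)

lemma borel_measurable_regularized: "fourier_regular f \<Longrightarrow> regularized f \<in> borel_measurable borel"
  by (intro borel_measurable_continuous_onI continuous_on_regularized)

lemma borel_measurable_partial: "fourier_regular f \<Longrightarrow> partial e f \<in> borel_measurable borel"
  by (intro borel_measurable_continuous_onI continuous_on_partial)

lemma regularized_has_derivative:
  assumes "fourier_regular f"
  shows "((\<lambda>s. regularized f (x + s *\<^sub>R e)) has_real_derivative partial e f x) (at 0)"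
  using assms unfolding regularized_def partial_def
  by (intro Re_inverse_fourier_has_derivative) (auto simp: fourier_regular_def)

lemma abs_regularized_le:
  "\<bar>regularized f (x::'a::euclidean_space)\<bar> \<le> (1 / (2 * pi)) ^ DIM('a) * (LINT \<xi>|lborel. cmod (fhat f \<xi>))"
  unfolding regularized_def by (rule order_trans[OF abs_Re_le_cmod norm_inverse_fourier_le])

lemma partial_diff:
  assumes f: "fourier_regular f" and g: "fourier_regular g"
  shows "partial e (\<lambda>x. f x - g x) x = partial e f x - partial e g x"
proof -
  have fg: "integrable lborel f" "integrable lborel g" using f g by (auto simp: fourier_regular_def)
  have "(\<lambda>\<xi>. \<i> * complex_of_real (\<xi> \<bullet> e) * fhat (\<lambda>x. f x - g x) \<xi>)
      = (\<lambda>\<xi>. \<i> * complex_of_real (\<xi> \<bullet> e) * fhat f \<xi> - \<i> * complex_of_real (\<xi> \<bullet> e) * fhat g \<xi>)"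
    by (simp add: fhat_diff[OF fg] right_diff_distrib)
  then show ?thesis
    unfolding partial_def inverse_fourier_def
    by (simp add: fourier_diff[OF integrable_partial_symbol[OF f] integrable_partial_symbol[OF g]] right_diff_distrib
             del: of_real_power)
qed

lemma fhat_regularized:
  assumes f: "fourier_regular f"
  shows "fhat (regularized f) = fhat f"
  unfolding fhat_def fourier_def
proof (intro ext integral_cong_AE)
  fix \<xi> :: 'a
  have [measurable]: "f \<in> borel_measurable borel" "regularized f \<in> borel_measurable borel"
    using f by (auto simp: fourier_regular_def borel_measurable_regularized)
  show "AE x in lborel. exp (- (\<i> * complex_of_real (x \<bullet> \<xi>))) * complex_of_real (regularized f x)
      = exp (- (\<i> * complex_of_real (x \<bullet> \<xi>))) * complex_of_real (f x)"
  proof -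
    have "AE x in lborel. f x = regularized f x"
      using f AE_eq_regularized[of f] by (auto simp: fourier_regular_def)
    then show ?thesis by eventually_elim simp
  qed
  show "(\<lambda>x. exp (- (\<i> * complex_of_real (x \<bullet> \<xi>))) * complex_of_real (regularized f x)) \<in> borel_measurable lborel"
    "(\<lambda>x. exp (- (\<i> * complex_of_real (x \<bullet> \<xi>))) * complex_of_real (f x)) \<in> borel_measurable lborel"
    by measurable
qed

lemma integrable_regularized:
  assumes f: "fourier_regular f"
  shows "integrable lborel (regularized f)"
  by (rule integrable_cong_AE_imp[where g=f])
     (use f AE_eq_regularized[of f] in \<open>auto simp: fourier_regular_def borel_measurable_regularized\<close>)

text \<open>By inversion the function is essentially bounded, so it is square integrable.\<close>

lemma
  fixes f :: "'a::euclidean_space \<Rightarrow> real"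
  assumes i: "integrable lborel f" "integrable lborel (fhat f)"
  shows square_integrable_if_integrable_fhat: "square_integrable f"
    and square_integrable_fhat_if_integrable_fhat: "square_integrable (fhat f)"
    and square_integral_eq_fhat: "square_integral f = (1 / (2 * pi)) ^ DIM('a) * square_integral (fhat f)"
proof -
  have [measurable]: "f \<in> borel_measurable borel" "fhat f \<in> borel_measurable borel" using i by auto
  define B where "B = (1 / (2 * pi)) ^ DIM('a) * (LINT \<xi>|lborel. cmod (fhat f \<xi>))"
  show sf: "square_integrable f"
    unfolding square_integrable_def
  proof
    show "integrable lborel (\<lambda>x. (norm (f x))\<^sup>2)"
    proof (rule Bochner_Integration.integrable_bound)
      show "integrable lborel (\<lambda>x. B * \<bar>f x\<bar>)" using i by auto
      show "AE x in lborel. norm ((norm (f x))\<^sup>2) \<le> norm (B * \<bar>f x\<bar>)"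
        using AE_eq_regularized[OF i]
      proof eventually_elim
        case (elim x)
        have "\<bar>f x\<bar> \<le> B" using abs_regularized_le[of f x] elim by (simp add: B_def)
        then have "\<bar>f x\<bar> * \<bar>f x\<bar> \<le> B * \<bar>f x\<bar>" by (intro mult_right_mono) auto
        then show ?case by (simp add: power2_eq_square order_trans[OF _ abs_ge_self])
      qed
    qed simp
  qed simp
  show "square_integrable (fhat f)"
    unfolding square_integrable_def
  proof
    show "integrable lborel (\<lambda>x. (norm (fhat f x))\<^sup>2)"
    proof (rule Bochner_Integration.integrable_bound)
      show "integrable lborel (\<lambda>\<xi>. (LINT x|lborel. \<bar>f x\<bar>) * cmod (fhat f \<xi>))" using i by auto
      show "AE \<xi> in lborel. norm ((norm (fhat f \<xi>))\<^sup>2) \<le> norm ((LINT x|lborel. \<bar>f x\<bar>) * cmod (fhat f \<xi>))"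
        by (intro AE_I2) (auto simp: power2_eq_square abs_mult intro!: mult_right_mono norm_fhat_le)
    qed simp
  qed simp
  have "complex_of_real (square_integral f) = (LINT x|lborel. complex_of_real (f x) * cnj (complex_of_real (f x)))"
    unfolding square_integral_def integral_complex_of_real[symmetric]
    by (intro Bochner_Integration.integral_cong refl) (simp add: power2_eq_square)
  also have "\<dots> = complex_of_real ((1 / (2 * pi)) ^ DIM('a)) * (LINT \<xi>|lborel. fhat f \<xi> * cnj (fhat f \<xi>))"
    unfolding fhat_def by (rule plancherel) (use i in \<open>auto simp: fhat_def\<close>)
  also have "(LINT \<xi>|lborel. fhat f \<xi> * cnj (fhat f \<xi>)) = complex_of_real (square_integral (fhat f))"
    unfolding square_integral_def integral_complex_of_real[symmetric]
    by (intro Bochner_Integration.integral_cong refl complex_norm_square[symmetric])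
  finally show "square_integral f = (1 / (2 * pi)) ^ DIM('a) * square_integral (fhat f)"
    by (simp only: of_real_mult[symmetric] of_real_eq_iff)
qed

lemma fourier_shift:
  fixes f :: "'a::euclidean_space \<Rightarrow> complex"
  assumes f: "integrable lborel f"
  shows "fourier (\<lambda>x. f (x + a)) \<xi> = exp (\<i> * complex_of_real (a \<bullet> \<xi>)) * fourier f \<xi>"
proof -
  have [measurable]: "f \<in> borel_measurable borel" using f by auto
  have "fourier f \<xi> = (LINT x|lborel. exp (- (\<i> * complex_of_real ((a + 1 *\<^sub>R x) \<bullet> \<xi>))) * f (a + 1 *\<^sub>R x))"
    unfolding fourier_def by (subst integral_lborel_affine[of 1 _ a]) auto
  also have "\<dots> = (LINT x|lborel. exp (- (\<i> * complex_of_real (a \<bullet> \<xi>))) * (exp (- (\<i> * complex_of_real (x \<bullet> \<xi>))) * f (x + a)))"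
    by (intro Bochner_Integration.integral_cong refl)
       (simp add: inner_add_left ring_distribs exp_diff exp_minus divide_simps add.commute exp_add)
  also have "\<dots> = exp (- (\<i> * complex_of_real (a \<bullet> \<xi>))) * fourier (\<lambda>x. f (x + a)) \<xi>"
    unfolding fourier_def by (rule integral_mult_right_zero)
  finally show ?thesis by (simp add: exp_minus)
qed

text \<open>
  By Plancherel, the difference quotients are bounded in \<open>L\<^sup>2\<close> by the norm of \<open>|\<xi>|\<close> times the
  transform; Fatou's lemma passes this bound to the derivative.
\<close>

lemma
  fixes f :: "'a::euclidean_space \<Rightarrow> real"
  assumes f: "fourier_regular f" and e: "norm e \<le> 1"
  shows square_integrable_partial: "square_integrable (partial e f)"
    and square_integral_partial_le: "square_integral (partial e f)
      \<le> (1 / (2 * pi)) ^ DIM('a) * (LINT \<xi>|lborel. (norm \<xi>)\<^sup>2 * (cmod (fhat f \<xi>))\<^sup>2)"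
proof -
  define r where "r = regularized f"
  have r: "integrable lborel r" unfolding r_def by (rule integrable_regularized[OF f])
  have rc: "integrable lborel (\<lambda>x. complex_of_real (r x))" using r by simp
  have rh: "fourier (\<lambda>x. complex_of_real (r x)) = fhat f"
    using fhat_regularized[OF f] by (simp add: fhat_def r_def)
  have f2: "integrable lborel (\<lambda>\<xi>. (norm \<xi>)\<^sup>2 * (cmod (fhat f \<xi>))\<^sup>2)"
    and f1: "integrable lborel (\<lambda>\<xi>. norm \<xi> * cmod (fhat f \<xi>))"
    and f0: "integrable lborel (fhat f)"
    using f by (auto simp: fourier_regular_def)
  have [measurable]: "fhat f \<in> borel_measurable borel" "partial e f \<in> borel_measurable borel" "r \<in> borel_measurable borel"
    using f0 r borel_measurable_partial[OF f] by auto
  define K where "K = (1 / (2 * pi)) ^ DIM('a) * (LINT \<xi>|lborel. (norm \<xi>)\<^sup>2 * (cmod (fhat f \<xi>))\<^sup>2)"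
  define s where "s n = inverse (real (Suc n))" for n
  have s: "s n > 0" for n by (simp add: s_def)
  have s0: "s \<longlonglongrightarrow> 0" unfolding s_def by (rule LIMSEQ_inverse_real_of_nat)
  define q where "q n x = (r (x + s n *\<^sub>R e) - r x) / s n" for n x
  note shift = integrable_lborel_shift[OF r]
  have q: "integrable lborel (q n)" for n
    unfolding q_def using shift r by auto
  have qh: "fhat (q n) \<xi> = (exp (\<i> * complex_of_real (s n * (e \<bullet> \<xi>))) - 1) / complex_of_real (s n) * fhat f \<xi>" for n \<xi>
  proof -
    have "fhat (q n) \<xi> = fourier (\<lambda>x. complex_of_real (r (x + s n *\<^sub>R e)) - complex_of_real (r x)) \<xi> / complex_of_real (s n)"
      unfolding fhat_def fourier_def q_def
      by (subst integral_divide_zero[symmetric]) simp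
    also have "\<dots> = (exp (\<i> * complex_of_real (s n * (e \<bullet> \<xi>))) * fhat f \<xi> - fhat f \<xi>) / complex_of_real (s n)"
      using fourier_diff[of "\<lambda>x. complex_of_real (r (x + s n *\<^sub>R e))" "\<lambda>x. complex_of_real (r x)" \<xi>] shift rc
        fourier_shift[OF rc, of "s n *\<^sub>R e" \<xi>]
      by (simp add: rh)
    finally show ?thesis by (simp add: left_diff_distrib)
  qed
  have qh_le: "cmod (fhat (q n) \<xi>) \<le> norm \<xi> * cmod (fhat f \<xi>)" for n \<xi>
  proof -
    have "cmod (exp (\<i> * complex_of_real (s n * (e \<bullet> \<xi>))) - 1) \<le> s n * \<bar>e \<bullet> \<xi>\<bar>"
      using norm_exp_minus_one_le[of "s n * (e \<bullet> \<xi>)"] s[of n] by (simp only: abs_mult abs_of_pos)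
    also have "\<bar>e \<bullet> \<xi>\<bar> \<le> norm \<xi>"
      using Cauchy_Schwarz_ineq2[of e \<xi>] mult_right_mono[OF e, of "norm \<xi>"] by simp
    finally have "cmod ((exp (\<i> * complex_of_real (s n * (e \<bullet> \<xi>))) - 1) / complex_of_real (s n)) \<le> norm \<xi>"
      using s[of n] by (simp add: norm_divide pos_divide_le_eq mult.commute)
    then show ?thesis unfolding qh norm_mult by (intro mult_right_mono) auto
  qed
  have q_le: "square_integrable (q n) \<and> square_integral (q n) \<le> K" for n
  proof -
    have [measurable]: "fhat (q n) \<in> borel_measurable borel" by (rule borel_measurable_fhat[OF q])
    have h0: "integrable lborel (fhat (q n))"
      by (rule Bochner_Integration.integrable_bound[OF f1]) (use qh_le in auto)
    have "square_integral (fhat (q n)) \<le> (LINT \<xi>|lborel. (norm \<xi>)\<^sup>2 * (cmod (fhat f \<xi>))\<^sup>2)"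
      unfolding square_integral_def
      by (rule integral_mono_AE'[OF f2]) (use power_mono[OF qh_le norm_ge_zero, of n _ 2] in \<open>auto simp: power_mult_distrib\<close>)
    then show ?thesis
      using square_integrable_if_integrable_fhat[OF q h0] square_integral_eq_fhat[OF q h0]
      by (auto simp: K_def intro!: divide_right_mono)
  qed
  have lim: "(\<lambda>n. q n x) \<longlonglongrightarrow> partial e f x" for x
  proof -
    have "((\<lambda>t. (r (x + t *\<^sub>R e) - r x) / t) \<longlongrightarrow> partial e f x) (at 0)"
      using regularized_has_derivative[OF f, of x e] by (simp add: has_field_derivative_iff r_def)
    then show ?thesis
      using s s0 unfolding tendsto_at_iff_sequentially comp_def q_def by (auto simp: less_le)
  qed
  have K: "K \<ge> 0" unfolding K_def by (intro mult_nonneg_nonneg) auto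
  have "(\<integral>\<^sup>+x. ennreal ((norm (partial e f x))\<^sup>2) \<partial>lborel)
      = (\<integral>\<^sup>+x. liminf (\<lambda>n. ennreal ((norm (q n x))\<^sup>2)) \<partial>lborel)"
  proof (rule nn_integral_cong)
    fix x :: 'a
    have "(\<lambda>n. ennreal ((norm (q n x))\<^sup>2)) \<longlonglongrightarrow> ennreal ((norm (partial e f x))\<^sup>2)"
      by (intro tendsto_ennrealI tendsto_intros lim)
    then show "ennreal ((norm (partial e f x))\<^sup>2) = liminf (\<lambda>n. ennreal ((norm (q n x))\<^sup>2))"
      by (rule lim_imp_Liminf[OF sequentially_bot, symmetric])
  qed
  also have "\<dots> \<le> liminf (\<lambda>n. \<integral>\<^sup>+x. ennreal ((norm (q n x))\<^sup>2) \<partial>lborel)"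
    by (rule nn_integral_liminf) (simp add: q_def)
  also have "\<dots> \<le> liminf (\<lambda>n. ennreal K)"
  proof (intro Liminf_mono always_eventually allI)
    fix n
    have "(\<integral>\<^sup>+x. ennreal ((norm (q n x))\<^sup>2) \<partial>lborel) = ennreal (square_integral (q n))"
      using q_le[of n] unfolding square_integral_def square_integrable_def
      by (intro nn_integral_eq_integral) auto
    then show "(\<integral>\<^sup>+x. ennreal ((norm (q n x))\<^sup>2) \<partial>lborel) \<le> ennreal K"
      using q_le[of n] by (simp add: ennreal_leI)
  qed
  also have "\<dots> = ennreal K" by (simp add: Liminf_const)
  finally have nn: "(\<integral>\<^sup>+x. ennreal ((norm (partial e f x))\<^sup>2) \<partial>lborel) \<le> ennreal K" .
  then have int: "integrable lborel (\<lambda>x. (norm (partial e f x))\<^sup>2)"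
    by (intro integrableI_bounded) (auto simp: le_less_trans[OF _ ennreal_less_top])
  then show "square_integrable (partial e f)"
    by (simp add: square_integrable_def)
  show "square_integral (partial e f)
      \<le> (1 / (2 * pi)) ^ DIM('a) * (LINT \<xi>|lborel. (norm \<xi>)\<^sup>2 * (cmod (fhat f \<xi>))\<^sup>2)"
    using nn int K unfolding square_integral_def K_def[symmetric]
    by (subst (asm) nn_integral_eq_integral) (auto simp: ennreal_le_iff)
qed

text \<open>A cut-off of class \<open>C\<^sup>1\<close> that is positive exactly on the open ball of radius \<open>|R|\<close>.\<close>

definition ball_bump :: "real \<Rightarrow> 'a::euclidean_space \<Rightarrow> real" where
  "ball_bump R x = (max 0 (R\<^sup>2 - x \<bullet> x))\<^sup>2"

lemma DERIV_max_0_power2: "((\<lambda>t::real. (max 0 t)\<^sup>2) has_real_derivative 2 * max 0 t) (at t)"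
proof -
  consider "t > 0" | "t < 0" | "t = 0" by linarith
  then show ?thesis
  proof cases
    case 1
    have "((\<lambda>t::real. t\<^sup>2) has_real_derivative 2 * max 0 t) (at t)"
      using 1 by (auto intro!: derivative_eq_intros)
    then show ?thesis
      by (rule has_field_derivative_transform_within_open[where S="{0<..}"]) (use 1 in auto)
  next
    case 2
    have "((\<lambda>t::real. 0) has_real_derivative 2 * max 0 t) (at t)"
      using 2 by (auto intro!: derivative_eq_intros)
    then show ?thesis
      by (rule has_field_derivative_transform_within_open[where S="{..<0}"]) (use 2 in auto)
  next
    case 3
    have "((\<lambda>h::real. (max 0 h)\<^sup>2 / h) \<longlongrightarrow> 0) (at 0)"
    proof (rule Lim_null_comparison)
      show "\<forall>\<^sub>F h in at (0::real). norm ((max 0 h)\<^sup>2 / h) \<le> \<bar>h\<bar>"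
        by (intro always_eventually allI) (auto simp: max_def power2_eq_square)
      show "((\<lambda>h::real. \<bar>h\<bar>) \<longlongrightarrow> 0) (at 0)"
        by (rule tendsto_rabs_zero) simp
    qed
    then show ?thesis using 3 by (simp add: has_field_derivative_iff)
  qed
qed

lemma ball_bump_has_derivative:
  "(ball_bump R has_derivative (\<lambda>v. - (4 * max 0 (R\<^sup>2 - x \<bullet> x)) * (x \<bullet> v))) (at x)"
proof -
  have "((\<lambda>y. R\<^sup>2 - y \<bullet> y) has_derivative (\<lambda>v. - 2 * (x \<bullet> v))) (at x)"
    by (auto intro!: derivative_eq_intros simp: inner_commute)
  moreover have "((\<lambda>t::real. (max 0 t)\<^sup>2) has_derivative (\<lambda>h. 2 * max 0 (R\<^sup>2 - x \<bullet> x) * h)) (at (R\<^sup>2 - x \<bullet> x))"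
    using DERIV_max_0_power2[of "R\<^sup>2 - x \<bullet> x"] by (simp add: has_field_derivative_def)
  ultimately have "((\<lambda>y. (max 0 (R\<^sup>2 - y \<bullet> y))\<^sup>2) has_derivative (\<lambda>v. 2 * max 0 (R\<^sup>2 - x \<bullet> x) * (- 2 * (x \<bullet> v)))) (at x)"
    by (rule has_derivative_compose)
  then show ?thesis
    unfolding ball_bump_def[abs_def] by (simp add: mult_ac)
qed

lemma ball_bump_outside:
  assumes "R \<ge> 0" "x \<notin> ball 0 R"
  shows "max 0 (R\<^sup>2 - x \<bullet> x) = 0"
proof -
  have "R\<^sup>2 \<le> (norm x)\<^sup>2" using assms by (intro power_mono) auto
  then show ?thesis by (simp add: power2_norm_eq_inner)
qed

lemma ball_bump_pos:
  assumes "norm x < R"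
  shows "ball_bump R x > 0"
proof -
  have "(norm x)\<^sup>2 < R\<^sup>2" using assms by (intro power_strict_mono) auto
  then show ?thesis by (simp add: ball_bump_def power2_norm_eq_inner)
qed

lemma integrable_continuous_compact_support:
  fixes h :: "'a::euclidean_space \<Rightarrow> real"
  assumes "continuous_on UNIV h" "\<And>x. x \<notin> cball 0 R \<Longrightarrow> h x = 0"
  shows "integrable lborel h"
proof -
  have "integrable lborel (\<lambda>x. indicator (cball 0 R) x *\<^sub>R h x)"
    using borel_integrable_compact[of "cball 0 R" h] continuous_on_subset[OF assms(1)] by auto
  also have "(\<lambda>x. indicator (cball 0 R) x *\<^sub>R h x) = h"
    using assms(2) by (auto simp: indicator_def fun_eq_iff)
  finally show ?thesis .
qed

text \<open>
  The difference of the two derivatives, multiplied by a cut-off, is orthogonal to all sines and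
  cosines, since cut-offs of these are test functions.  Hence its Fourier transform vanishes.
\<close>

theorem weak_partial_eq_partial:
  fixes f g :: "real^'d::finite \<Rightarrow> real"
  assumes w: "has_weak_partial k f g" and f: "fourier_regular f"
  shows "AE x in lborel. g x = partial (axis k 1) f x"
proof -
  let ?e = "axis k 1 :: real^'d"
  have i: "integrable lborel f" "integrable lborel (fhat f)" using f by (auto simp: fourier_regular_def)
  have lg: "g \<in> borel_measurable borel" "\<And>K. compact K \<Longrightarrow> set_integrable lborel K g"
    using w by (auto simp: has_weak_partial_def locally_integrable_def)
  have [measurable]: "g \<in> borel_measurable borel" "partial ?e f \<in> borel_measurable borel"
      "regularized f \<in> borel_measurable borel" "f \<in> borel_measurable borel"
    using lg f i borel_measurable_partial[OF f] borel_measurable_regularized[OF f] by auto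
  have bump_cont: "continuous_on UNIV (ball_bump R :: real^'d \<Rightarrow> real)" for R
    unfolding ball_bump_def by (intro continuous_intros)
  have [measurable]: "(ball_bump R :: real^'d \<Rightarrow> real) \<in> borel_measurable borel" for R
    by (rule borel_measurable_continuous_onI[OF bump_cont])
  define m where "m R x = (g x - partial ?e f x) * ball_bump R x" for R x
  have m_int: "integrable lborel (m R)" if R: "R \<ge> 0" for R
  proof -
    have zero: "ball_bump R x = 0" if "x \<notin> cball 0 R" for x :: "real^'d"
      using ball_bump_outside[OF R, of x] that by (simp add: ball_bump_def)
    have bound: "\<bar>ball_bump R x\<bar> \<le> R ^ 4" for x :: "real^'d"
    proof -
      have "(max 0 (R\<^sup>2 - x \<bullet> x))\<^sup>2 \<le> (R\<^sup>2)\<^sup>2" by (intro power_mono) auto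
      then show ?thesis by (simp add: ball_bump_def)
    qed
    have 1: "integrable lborel (\<lambda>x. g x * ball_bump R x)"
    proof (rule Bochner_Integration.integrable_bound)
      show "integrable lborel (\<lambda>x. R ^ 4 * (indicator (cball 0 R) x *\<^sub>R g x))"
        using lg(2)[of "cball 0 R"] unfolding set_integrable_def by (intro integrable_mult_right) auto
      show "AE x in lborel. norm (g x * ball_bump R x) \<le> norm (R ^ 4 * (indicator (cball 0 R) x *\<^sub>R g x))"
      proof (rule AE_I2)
        fix x :: "real^'d"
        show "norm (g x * ball_bump R x) \<le> norm (R ^ 4 * (indicator (cball 0 R) x *\<^sub>R g x))"
          using zero[of x] mult_left_mono[OF bound[of x], of "\<bar>g x\<bar>"] R
          by (cases "x \<in> cball 0 R") (auto simp: abs_mult mult.commute)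
      qed
    qed measurable
    have 2: "integrable lborel (\<lambda>x. partial ?e f x * ball_bump R x)"
      by (rule integrable_continuous_compact_support[of _ R])
         (auto intro!: continuous_on_mult continuous_on_partial f bump_cont simp: zero)
    show ?thesis
      using Bochner_Integration.integrable_diff[OF 1 2] by (simp add: m_def[abs_def] left_diff_distrib)
  qed
  have test: "(LINT x|lborel. m R x * cos (x \<bullet> \<xi> + c)) = 0" if R: "R > 0" for R c \<xi>
  proof -
    define \<phi> where "\<phi> x = ball_bump R x * cos (x \<bullet> \<xi> + c)" for x :: "real^'d"
    \<comment> \<open>\<open>W\<close> is the gradient of \<open>\<phi>\<close>.\<close>
    define W where "W x = (- (4 * max 0 (R\<^sup>2 - x \<bullet> x)) * cos (x \<bullet> \<xi> + c)) *\<^sub>R x + (- (ball_bump R x * sin (x \<bullet> \<xi> + c))) *\<^sub>R \<xi>" for x :: "real^'d"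
    have deriv: "(\<phi> has_derivative blinfun_apply (blinfun_inner_right (W x))) (at x)" for x
    proof -
      have "(\<phi> has_derivative (\<lambda>v. ball_bump R x * (- sin (x \<bullet> \<xi> + c) * (v \<bullet> \<xi>))
          + (- (4 * max 0 (R\<^sup>2 - x \<bullet> x)) * (x \<bullet> v)) * cos (x \<bullet> \<xi> + c))) (at x)"
        unfolding \<phi>_def[abs_def]
        by (rule has_derivative_mult[OF ball_bump_has_derivative]) (auto intro!: derivative_eq_intros)
      moreover have "(\<lambda>v. ball_bump R x * (- sin (x \<bullet> \<xi> + c) * (v \<bullet> \<xi>))
          + (- (4 * max 0 (R\<^sup>2 - x \<bullet> x)) * (x \<bullet> v)) * cos (x \<bullet> \<xi> + c)) = blinfun_apply (blinfun_inner_right (W x))"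
        by (auto simp: W_def inner_add_left inner_commute algebra_simps)
      ultimately show ?thesis by simp
    qed
    have Wc: "continuous_on UNIV W"
      unfolding W_def ball_bump_def by (intro continuous_intros)
    have Dc: "continuous_on UNIV (\<lambda>x. blinfun_inner_right (W x))"
      by (intro bounded_linear.continuous_on[OF bounded_linear_blinfun_inner_right] Wc)
    have \<phi>0: "\<phi> x = 0" "W x = 0" if "x \<notin> cball 0 R" for x
      using ball_bump_outside[of R x] that R by (auto simp: \<phi>_def W_def ball_bump_def)
    have "{x. \<phi> x \<noteq> 0} \<subseteq> cball 0 R" using \<phi>0(1) by blast
    then have comp: "compact (closure {x. \<phi> x \<noteq> 0})"
      using bounded_subset[OF bounded_cball] by (simp add: compact_closure)
    have \<phi>c: "continuous_on UNIV \<phi>"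
      unfolding \<phi>_def by (intro continuous_intros bump_cont)
    have weak: "(LINT x|lborel. f x * (W x \<bullet> ?e)) = - (LINT x|lborel. g x * \<phi> x)"
    proof -
      have "(\<forall>x. (\<phi> has_derivative blinfun_apply (blinfun_inner_right (W x))) (at x)) \<and>
          continuous_on UNIV (\<lambda>x. blinfun_inner_right (W x)) \<and> compact (closure {x. \<phi> x \<noteq> 0})"
        using deriv Dc comp by blast
      moreover have "\<forall>\<phi> D. (\<forall>x. (\<phi> has_derivative blinfun_apply (D x)) (at x)) \<and> continuous_on UNIV D \<and>
          compact (closure {x. \<phi> x \<noteq> 0}) \<longrightarrow>
          (LINT x|lborel. f x * blinfun_apply (D x) (axis k 1)) = - (LINT x|lborel. g x * \<phi> x)"
        using w unfolding has_weak_partial_def by simp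
      ultimately have "(LINT x|lborel. f x * blinfun_apply (blinfun_inner_right (W x)) (axis k 1)) = - (LINT x|lborel. g x * \<phi> x)"
        by (elim allE[where x=\<phi>] allE[where x="\<lambda>x. blinfun_inner_right (W x)"]) simp
      then show ?thesis by simp
    qed
    have classical: "(LINT x|lborel. partial ?e f x * \<phi> x + regularized f x * (W x \<bullet> ?e)) = 0"
    proof (rule integral_directional_derivative_eq_0[where h="\<lambda>x. regularized f x * \<phi> x" and e="?e"])
      show "integrable lborel (\<lambda>x. regularized f x * \<phi> x)"
        by (rule integrable_continuous_compact_support[of _ R])
           (auto intro!: continuous_on_mult continuous_on_regularized f \<phi>c simp: \<phi>0)
      show c2: "continuous_on UNIV (\<lambda>x. partial ?e f x * \<phi> x + regularized f x * (W x \<bullet> ?e))"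
        by (intro continuous_intros continuous_on_regularized continuous_on_partial f \<phi>c Wc)
      show "integrable lborel (\<lambda>x. partial ?e f x * \<phi> x + regularized f x * (W x \<bullet> ?e))"
        by (rule integrable_continuous_compact_support[OF c2, of R]) (auto simp: \<phi>0)
      fix x
      have "((\<lambda>s. \<phi> (x + s *\<^sub>R ?e)) has_derivative (\<lambda>s. W x \<bullet> (s *\<^sub>R ?e))) (at 0)"
        by (rule has_derivative_compose[where g=\<phi> and f="\<lambda>s. x + s *\<^sub>R ?e"])
           (use deriv[of x] in \<open>auto intro!: derivative_eq_intros\<close>)
      then have "((\<lambda>s. \<phi> (x + s *\<^sub>R ?e)) has_real_derivative W x \<bullet> ?e) (at 0)"
        by (simp add: has_field_derivative_def mult_commute_abs)
      from DERIV_mult[OF regularized_has_derivative[OF f, of x ?e] this]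
      show "((\<lambda>s. regularized f (x + s *\<^sub>R ?e) * \<phi> (x + s *\<^sub>R ?e)) has_real_derivative
          partial ?e f x * \<phi> x + regularized f x * (W x \<bullet> ?e)) (at 0)"
        by (simp add: mult.commute add.commute)
    qed
    have [measurable]: "W \<in> borel_measurable borel" "\<phi> \<in> borel_measurable borel"
      using Wc \<phi>c by (auto intro: borel_measurable_continuous_onI)
    have eqf: "(LINT x|lborel. f x * (W x \<bullet> ?e)) = (LINT x|lborel. regularized f x * (W x \<bullet> ?e))"
    proof (rule integral_cong_AE)
      show "AE x in lborel. f x * (W x \<bullet> ?e) = regularized f x * (W x \<bullet> ?e)"
        using AE_eq_regularized[OF i] by eventually_elim simp
    qed measurable
    have i1: "integrable lborel (\<lambda>x. partial ?e f x * \<phi> x)"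
      by (rule integrable_continuous_compact_support[of _ R])
         (auto intro!: continuous_on_mult continuous_on_partial f \<phi>c simp: \<phi>0)
    have i2: "integrable lborel (\<lambda>x. regularized f x * (W x \<bullet> ?e))"
      by (rule integrable_continuous_compact_support[of _ R])
         (auto intro!: continuous_intros continuous_on_regularized f Wc simp: \<phi>0)
    have i3: "integrable lborel (\<lambda>x. m R x * cos (x \<bullet> \<xi> + c))"
      using m_int[of R] R by (intro Bochner_Integration.integrable_bound[OF m_int[of R]])
        (auto simp: abs_mult mult_left_le m_def)
    have i4: "integrable lborel (\<lambda>x. g x * \<phi> x)"
      using Bochner_Integration.integrable_add[OF i3 i1] by (simp add: m_def \<phi>_def algebra_simps)
    have "(LINT x|lborel. m R x * cos (x \<bullet> \<xi> + c)) = (LINT x|lborel. g x * \<phi> x - partial ?e f x * \<phi> x)"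
      by (simp add: m_def \<phi>_def algebra_simps)
    also have "\<dots> = - (LINT x|lborel. regularized f x * (W x \<bullet> ?e)) - (LINT x|lborel. partial ?e f x * \<phi> x)"
      using weak eqf i4 i1 by simp
    also have "\<dots> = 0"
      using classical i1 i2 by simp
    finally show ?thesis .
  qed
  have "AE x in lborel. m (real (Suc n)) x = 0" for n
  proof -
    let ?R = "real (Suc n)"
    have R: "?R > 0" by simp
    have mi: "integrable lborel (\<lambda>x. complex_of_real (m ?R x))" using m_int[of ?R] by simp
    have "fourier (\<lambda>x. complex_of_real (m ?R x)) \<xi> = 0" for \<xi>
    proof (rule complex_eqI)
      have "Re (fourier (\<lambda>x. complex_of_real (m ?R x)) \<xi>) = (LINT x|lborel. m ?R x * cos (x \<bullet> \<xi> + 0))"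
        unfolding fourier_def integral_Re[OF integrable_fourier[OF mi], symmetric]
        by (intro Bochner_Integration.integral_cong refl) (simp add: Re_exp)
      then show "Re (fourier (\<lambda>x. complex_of_real (m ?R x)) \<xi>) = Re 0" using test[OF R, of \<xi> 0] by simp
      have "Im (fourier (\<lambda>x. complex_of_real (m ?R x)) \<xi>) = (LINT x|lborel. m ?R x * cos (x \<bullet> \<xi> + pi / 2))"
        unfolding fourier_def integral_Im[OF integrable_fourier[OF mi], symmetric]
        by (intro Bochner_Integration.integral_cong refl) (simp add: Im_exp cos_add)
      then show "Im (fourier (\<lambda>x. complex_of_real (m ?R x)) \<xi>) = Im 0" using test[OF R, of \<xi> "pi / 2"] by simp
    qed
    from AE_eq_0_if_fourier_eq_0[OF mi this] show ?thesis by simp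
  qed
  then have "AE x in lborel. \<forall>n. m (real (Suc n)) x = 0"
    by (intro AE_all_countable[THEN iffD2] allI)
  then show ?thesis
  proof eventually_elim
    case (elim x)
    obtain n where n: "norm x < real n" using reals_Archimedean2 by blast
    then have "ball_bump (real (Suc n)) x > 0" by (intro ball_bump_pos) auto
    then show ?case using elim[rule_format, of n] by (simp add: m_def)
  qed
qed

section \<open>Weighted Sobolev spaces\<close>

definition Z_regular :: "('a::euclidean_space \<Rightarrow> real) \<Rightarrow> bool" where
  "Z_regular f \<longleftrightarrow> integrable lborel f \<and> (LINT x|lborel. f x) = 0 \<and>
     integrable lborel (\<lambda>\<xi>. (1 + (norm \<xi>)\<^sup>2) ^ (DIM('a) + 1) * (cmod (fhat f \<xi>))\<^sup>2) \<and>
     integrable lborel (\<lambda>x. norm x ^ (2 * (DIM('a) + 1)) * (f x)\<^sup>2)"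

text \<open>
  On functions as above this quadratic form is equivalent to the square of the norm of \<open>Z\<^sub>s\<^sub>,\<^sub>s\<close> for the
  exponent \<open>s = d + 1\<close>, a sum of two square roots.
\<close>

definition Z_form :: "('a::euclidean_space \<Rightarrow> real) \<Rightarrow> real" where
  "Z_form f = (LINT \<xi>|lborel. (1 + (norm \<xi>)\<^sup>2) ^ (DIM('a) + 1) * (cmod (fhat f \<xi>))\<^sup>2)
     + (LINT x|lborel. norm x ^ (2 * (DIM('a) + 1)) * (f x)\<^sup>2)"

lemma Z_form_nonneg: "0 \<le> Z_form f"
  unfolding Z_form_def by (intro add_nonneg_nonneg integral_nonneg_AE) (auto intro!: AE_I2 mult_nonneg_nonneg)

text \<open>
  The Cauchy--Schwarz inequality with the integrable weight \<open>(1 + |x|\<^sup>2)\<^bsup>-d\<^esup>\<close>.  Of the squared weights of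
  order \<open>2 d + 2\<close> in the quadratic form it uses up the order \<open>2 d\<close>, which leaves one factor \<open>|x|\<close> or
  \<open>|\<xi>|\<close> in the \<open>L\<^sup>1\<close> bounds derived from it.
\<close>

lemma integrable_by_decay_weight:
  fixes h :: "'a::euclidean_space \<Rightarrow> real" and H :: "'a \<Rightarrow> real"
  assumes h: "h \<in> borel_measurable borel" and H: "integrable lborel H"
    and le: "\<And>x. (h x)\<^sup>2 \<le> c * decay_weight x * H x" and c: "c \<ge> 0" and H0: "\<And>x. H x \<ge> 0"
  shows "integrable lborel h"
    and "(LINT x|lborel. \<bar>h x\<bar>) \<le> sqrt c * sqrt (LINT x|lborel. decay_weight (x::'a)) * sqrt (LINT x|lborel. H x)"
proof -
  have [measurable]: "H \<in> borel_measurable borel" "(decay_weight :: 'a \<Rightarrow> real) \<in> borel_measurable borel"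
    using H integrable_decay_weight[where 'a='a] by auto
  define a where "a x = sqrt (c * decay_weight x)" for x :: 'a
  define b where "b x = sqrt (H x)" for x
  have a2: "(norm (a x))\<^sup>2 = c * decay_weight x" for x
    using c decay_weight_pos[of x] by (simp add: a_def)
  have "a \<in> borel_measurable borel" unfolding a_def by measurable
  then have a: "square_integrable a" "square_integral a = c * (LINT x|lborel. decay_weight (x::'a))"
    unfolding square_integrable_def square_integral_def a2
    using integrable_decay_weight[where 'a='a] by auto
  have [measurable]: "b \<in> borel_measurable borel" unfolding b_def by measurable
  have b: "square_integrable b" "square_integral b = (LINT x|lborel. H x)"
    using H H0 by (auto simp: square_integrable_def square_integral_def b_def)
  have hab: "\<bar>h x\<bar> \<le> a x * b x" for x
    using real_sqrt_le_mono[OF le[of x]] by (simp add: a_def b_def real_sqrt_mult)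
  have ab: "integrable lborel (\<lambda>x. a x * b x)" by (rule square_integrable_mult[OF a(1) b(1)])
  show "integrable lborel h"
    by (rule Bochner_Integration.integrable_bound[OF ab]) (use h hab in \<open>auto intro: order_trans[OF _ abs_ge_self]\<close>)
  have "(LINT x|lborel. \<bar>h x\<bar>) \<le> (LINT x|lborel. a x * b x)"
    by (rule integral_mono_AE'[OF ab]) (use hab in \<open>auto intro: order_trans[OF abs_ge_zero hab]\<close>)
  also have "\<dots> = (LINT x|lborel. norm (a x) * norm (b x))"
  proof -
    have "a x \<ge> 0" "b x \<ge> 0" for x
      using c H0[of x] decay_weight_pos[of x] by (auto simp: a_def b_def)
    then show ?thesis by simp
  qed
  also have "\<dots> \<le> sqrt (square_integral a) * sqrt (square_integral b)"
    by (rule cauchy_schwarz_integral[OF a(1) b(1)])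
  finally show "(LINT x|lborel. \<bar>h x\<bar>) \<le> sqrt c * sqrt (LINT x|lborel. decay_weight (x::'a)) * sqrt (LINT x|lborel. H x)"
    unfolding a(2) b(2) by (simp add: real_sqrt_mult)
qed

lemma integral_decay_weight_nonneg: "0 \<le> (LINT x|lborel. decay_weight (x::'a::euclidean_space))"
  by (intro integral_nonneg_AE AE_I2) (simp add: decay_weight_pos less_imp_le)

lemma one_plus_power_le:
  fixes a :: real
  assumes "a \<ge> 0"
  shows "(1 + a) ^ n \<le> 2 ^ n * (1 + a ^ n)"
proof -
  have "(1 + a) ^ n \<le> (2 * max 1 a) ^ n" using assms by (intro power_mono) auto
  also have "\<dots> \<le> 2 ^ n * (1 + a ^ n)"
    using assms by (auto simp: power_mult_distrib max_def)
  finally show ?thesis .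
qed

lemma inverse_two_pi_power_le: "(1 / (2 * pi)) ^ n \<le> (1::real)"
  using pi_gt3 by (intro power_le_one) (auto simp: divide_le_eq)

lemma one_le_power_one_plus: "(1::real) \<le> (1 + a\<^sup>2) ^ n"
  by (intro one_le_power) simp

context
  fixes f :: "'a::euclidean_space \<Rightarrow> real"
  assumes f: "Z_regular f"
begin

lemma Z_regular_integrable: "integrable lborel f"
  using f by (simp add: Z_regular_def)

private lemma m: "f \<in> borel_measurable borel" "fhat f \<in> borel_measurable borel"
  using Z_regular_integrable borel_measurable_fhat[OF Z_regular_integrable] by auto

private lemma H1: "integrable lborel (\<lambda>\<xi>. (1 + (norm \<xi>)\<^sup>2) ^ (DIM('a) + 1) * (cmod (fhat f \<xi>))\<^sup>2)"
  using f by (simp add: Z_regular_def)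

private lemma H2: "integrable lborel (\<lambda>x. norm x ^ (2 * (DIM('a) + 1)) * (f x)\<^sup>2)"
  using f by (simp add: Z_regular_def)

private lemma H1_le: "(LINT \<xi>|lborel. (1 + (norm \<xi>)\<^sup>2) ^ (DIM('a) + 1) * (cmod (fhat f \<xi>))\<^sup>2) \<le> Z_form f"
  unfolding Z_form_def by (simp add: integral_nonneg_AE)

private lemma H2_le: "(LINT x|lborel. norm x ^ (2 * (DIM('a) + 1)) * (f x)\<^sup>2) \<le> Z_form f"
  unfolding Z_form_def by (simp add: integral_nonneg_AE)

private lemma fhat_weight:
  "((1 + norm \<xi>) * cmod (fhat f \<xi>))\<^sup>2 \<le> 2 * decay_weight \<xi> * ((1 + (norm \<xi>)\<^sup>2) ^ (DIM('a) + 1) * (cmod (fhat f \<xi>))\<^sup>2)"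
proof -
  have p: "(1 + (norm \<xi>)\<^sup>2) > 0" by (simp add: add_pos_nonneg)
  have "(1 + norm \<xi>)\<^sup>2 \<le> 2 * (1 + (norm \<xi>)\<^sup>2)"
    using sum_power2_le[of 1 "norm \<xi>"] by simp
  then have "(1 + norm \<xi>)\<^sup>2 * (cmod (fhat f \<xi>))\<^sup>2 \<le> 2 * (1 + (norm \<xi>)\<^sup>2) * (cmod (fhat f \<xi>))\<^sup>2"
    by (rule mult_right_mono) simp
  also have "\<dots> = 2 * decay_weight \<xi> * ((1 + (norm \<xi>)\<^sup>2) ^ (DIM('a) + 1) * (cmod (fhat f \<xi>))\<^sup>2)"
    using p by (simp add: decay_weight_def)
  finally show ?thesis
    by (simp only: power_mult_distrib)
qed

lemma Z_regular_fhat: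
  shows "integrable lborel (\<lambda>\<xi>. (1 + norm \<xi>) * cmod (fhat f \<xi>))"
    and "(LINT \<xi>|lborel. (1 + norm \<xi>) * cmod (fhat f \<xi>))
      \<le> sqrt 2 * sqrt (LINT x|lborel. decay_weight (x::'a)) * sqrt (Z_form f)"
proof -
  note [measurable] = m
  show "integrable lborel (\<lambda>\<xi>. (1 + norm \<xi>) * cmod (fhat f \<xi>))"
    by (rule integrable_by_decay_weight(1)[OF _ H1 fhat_weight]) auto
  have "(LINT \<xi>|lborel. \<bar>(1 + norm \<xi>) * cmod (fhat f \<xi>)\<bar>) \<le> sqrt 2 * sqrt (LINT x|lborel. decay_weight (x::'a))
      * sqrt (LINT \<xi>|lborel. (1 + (norm \<xi>)\<^sup>2) ^ (DIM('a) + 1) * (cmod (fhat f \<xi>))\<^sup>2)"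
    by (rule integrable_by_decay_weight(2)[OF _ H1 fhat_weight]) auto
  also have "\<dots> \<le> sqrt 2 * sqrt (LINT x|lborel. decay_weight (x::'a)) * sqrt (Z_form f)"
    using H1_le integral_decay_weight_nonneg by (intro mult_left_mono mult_nonneg_nonneg real_sqrt_le_mono) auto
  finally show "(LINT \<xi>|lborel. (1 + norm \<xi>) * cmod (fhat f \<xi>))
      \<le> sqrt 2 * sqrt (LINT x|lborel. decay_weight (x::'a)) * sqrt (Z_form f)"
    by (simp add: abs_mult)
qed

lemma Z_regular_imp_fourier_regular: "fourier_regular f"
  unfolding fourier_regular_def
proof (intro conjI Z_regular_integrable)
  note [measurable] = m
  show "integrable lborel (fhat f)"
    by (rule Bochner_Integration.integrable_bound[OF Z_regular_fhat(1)]) (auto simp: ring_distribs abs_mult)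
  show "integrable lborel (\<lambda>\<xi>. norm \<xi> * cmod (fhat f \<xi>))"
    by (rule Bochner_Integration.integrable_bound[OF Z_regular_fhat(1)]) (auto simp: ring_distribs abs_mult)
  show "integrable lborel (\<lambda>\<xi>. (norm \<xi>)\<^sup>2 * (cmod (fhat f \<xi>))\<^sup>2)"
  proof (rule Bochner_Integration.integrable_bound[OF H1])
    show "AE \<xi> in lborel. norm ((norm \<xi>)\<^sup>2 * (cmod (fhat f \<xi>))\<^sup>2)
        \<le> norm ((1 + (norm \<xi>)\<^sup>2) ^ (DIM('a) + 1) * (cmod (fhat f \<xi>))\<^sup>2)"
    proof (rule AE_I2)
      fix \<xi> :: 'a
      have "(norm \<xi>)\<^sup>2 \<le> (1 + (norm \<xi>)\<^sup>2) ^ (DIM('a) + 1)"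
        using self_le_power[of "1 + (norm \<xi>)\<^sup>2" "DIM('a) + 1"] by simp
      then show "norm ((norm \<xi>)\<^sup>2 * (cmod (fhat f \<xi>))\<^sup>2) \<le> norm ((1 + (norm \<xi>)\<^sup>2) ^ (DIM('a) + 1) * (cmod (fhat f \<xi>))\<^sup>2)"
        by (simp add: abs_mult mult_right_mono del: power_Suc)
    qed
    show "(\<lambda>\<xi>. (norm \<xi>)\<^sup>2 * (cmod (fhat f \<xi>))\<^sup>2) \<in> borel_measurable lborel" by measurable
  qed
qed

lemma Z_regular_square_integrable: "square_integrable f"
  using Z_regular_imp_fourier_regular by (intro square_integrable_if_integrable_fhat) (auto simp: fourier_regular_def)

lemma Z_regular_square_integral_le: "square_integral f \<le> Z_form f"
proof -
  have "square_integral (fhat f) \<le> (LINT \<xi>|lborel. (1 + (norm \<xi>)\<^sup>2) ^ (DIM('a) + 1) * (cmod (fhat f \<xi>))\<^sup>2)"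
    unfolding square_integral_def
    by (rule integral_mono_AE'[OF H1])
       (auto intro!: AE_I2 mult_right_mono simp: mult_le_cancel_right1 one_le_power_one_plus simp del: power_Suc)
  also have "\<dots> \<le> Z_form f" by (rule H1_le)
  finally have "square_integral (fhat f) \<le> Z_form f" .
  moreover have "square_integral f = (1 / (2 * pi)) ^ DIM('a) * square_integral (fhat f)"
    using Z_regular_imp_fourier_regular by (intro square_integral_eq_fhat) (auto simp: fourier_regular_def)
  moreover have "(1 / (2 * pi)) ^ DIM('a) * square_integral (fhat f) \<le> square_integral (fhat f)"
    using inverse_two_pi_power_le by (intro mult_left_le_one_le) auto
  ultimately show ?thesis by linarith
qed

lemma Z_regular_square_integral_partial_le:
  assumes e: "norm e \<le> 1"
  shows "square_integral (partial e f) \<le> Z_form f"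
proof -
  let ?I = "LINT \<xi>|lborel. (norm \<xi>)\<^sup>2 * (cmod (fhat f \<xi>))\<^sup>2"
  have "?I \<le> (LINT \<xi>|lborel. (1 + (norm \<xi>)\<^sup>2) ^ (DIM('a) + 1) * (cmod (fhat f \<xi>))\<^sup>2)"
  proof (rule integral_mono_AE'[OF H1])
    show "AE \<xi> in lborel. (norm \<xi>)\<^sup>2 * (cmod (fhat f \<xi>))\<^sup>2 \<le> (1 + (norm \<xi>)\<^sup>2) ^ (DIM('a) + 1) * (cmod (fhat f \<xi>))\<^sup>2"
    proof (intro AE_I2 mult_right_mono)
      fix \<xi> :: 'a
      show "(norm \<xi>)\<^sup>2 \<le> (1 + (norm \<xi>)\<^sup>2) ^ (DIM('a) + 1)"
        using self_le_power[of "1 + (norm \<xi>)\<^sup>2" "DIM('a) + 1"] by simp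
    qed simp
  qed auto
  also have "\<dots> \<le> Z_form f" by (rule H1_le)
  finally have "?I \<le> Z_form f" .
  moreover have "(1 / (2 * pi)) ^ DIM('a) * ?I \<le> ?I"
    using inverse_two_pi_power_le by (intro mult_left_le_one_le) (auto intro!: integral_nonneg_AE)
  ultimately show ?thesis
    using square_integral_partial_le[OF Z_regular_imp_fourier_regular e] by linarith
qed

lemma Z_regular_weight:
  shows "square_integrable (\<lambda>x. norm x ^ (DIM('a) + 1) * f x)"
    and "square_integral (\<lambda>x. norm x ^ (DIM('a) + 1) * f x) \<le> Z_form f"
proof -
  note [measurable] = m
  have eq: "(norm (norm x ^ (DIM('a) + 1) * f x))\<^sup>2 = norm x ^ (2 * (DIM('a) + 1)) * (f x)\<^sup>2" for x
    by (simp only: real_norm_def power2_abs power_mult_distrib power_mult[symmetric] mult.commute[of 2])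
  show "square_integrable (\<lambda>x. norm x ^ (DIM('a) + 1) * f x)"
    unfolding square_integrable_def eq using H2 by simp
  show "square_integral (\<lambda>x. norm x ^ (DIM('a) + 1) * f x) \<le> Z_form f"
    unfolding square_integral_def eq by (rule H2_le)
qed

lemma Z_regular_first_moment:
  shows "integrable lborel (\<lambda>x. (1 + norm x) * \<bar>f x\<bar>)"
    and "(LINT x|lborel. (1 + norm x) * \<bar>f x\<bar>)
      \<le> sqrt (2 ^ (DIM('a) + 2)) * sqrt (LINT x|lborel. decay_weight (x::'a)) * sqrt (2 * Z_form f)"
proof -
  note [measurable] = m
  let ?H = "\<lambda>x. (f x)\<^sup>2 + norm x ^ (2 * (DIM('a) + 1)) * (f x)\<^sup>2"
  have f2: "integrable lborel (\<lambda>x. (f x)\<^sup>2)"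
    using Z_regular_square_integrable by (simp add: square_integrable_def)
  have H: "integrable lborel ?H" using f2 H2 by (rule Bochner_Integration.integrable_add)
  have le: "((1 + norm x) * \<bar>f x\<bar>)\<^sup>2 \<le> 2 ^ (DIM('a) + 2) * decay_weight x * ?H x" for x
  proof -
    let ?D = "DIM('a)"
    have p: "(1 + (norm x)\<^sup>2) > 0" by (simp add: add_pos_nonneg)
    have "(1 + norm x)\<^sup>2 * (1 + (norm x)\<^sup>2) ^ ?D \<le> (2 * (1 + (norm x)\<^sup>2)) * (1 + (norm x)\<^sup>2) ^ ?D"
      using sum_power2_le[of 1 "norm x"] by (intro mult_right_mono) auto
    also have "\<dots> = 2 * (1 + (norm x)\<^sup>2) ^ (?D + 1)" by simp
    also have "\<dots> \<le> 2 * (2 ^ (?D + 1) * (1 + ((norm x)\<^sup>2) ^ (?D + 1)))"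
      by (intro mult_left_mono one_plus_power_le) auto
    also have "\<dots> = 2 ^ (?D + 2) * (1 + norm x ^ (2 * (?D + 1)))"
      by (simp only: power_mult[symmetric]) (simp add: mult.assoc)
    finally have "(1 + norm x)\<^sup>2 \<le> 2 ^ (?D + 2) * decay_weight x * (1 + norm x ^ (2 * (?D + 1)))"
      using p by (simp add: decay_weight_def pos_le_divide_eq)
    then have "(1 + norm x)\<^sup>2 * (f x)\<^sup>2 \<le> 2 ^ (?D + 2) * decay_weight x * (1 + norm x ^ (2 * (?D + 1))) * (f x)\<^sup>2"
      by (rule mult_right_mono) simp
    also have "\<dots> = 2 ^ (?D + 2) * decay_weight x * ?H x" by (simp only: ring_distribs mult_1_left mult.assoc)
    finally show ?thesis by (simp only: power_mult_distrib power2_abs)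
  qed
  have H0: "?H x \<ge> 0" for x by simp
  show "integrable lborel (\<lambda>x. (1 + norm x) * \<bar>f x\<bar>)"
    by (rule integrable_by_decay_weight(1)[OF _ H le _ H0]) auto
  have "(LINT x|lborel. \<bar>(1 + norm x) * \<bar>f x\<bar>\<bar>) \<le> sqrt (2 ^ (DIM('a) + 2)) * sqrt (LINT x|lborel. decay_weight (x::'a))
      * sqrt (LINT x|lborel. ?H x)"
    by (rule integrable_by_decay_weight(2)[OF _ H le _ H0]) auto
  also have "\<dots> \<le> sqrt (2 ^ (DIM('a) + 2)) * sqrt (LINT x|lborel. decay_weight (x::'a)) * sqrt (2 * Z_form f)"
  proof (intro mult_left_mono mult_nonneg_nonneg real_sqrt_le_mono real_sqrt_ge_zero)
    have "(LINT x|lborel. ?H x) = square_integral f + (LINT x|lborel. norm x ^ (2 * (DIM('a) + 1)) * (f x)\<^sup>2)"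
      using f2 H2 by (subst Bochner_Integration.integral_add) (auto simp: square_integral_def)
    then show "(LINT x|lborel. ?H x) \<le> 2 * Z_form f"
      using Z_regular_square_integral_le H2_le by linarith
  qed (auto simp: integral_decay_weight_nonneg)
  finally show "(LINT x|lborel. (1 + norm x) * \<bar>f x\<bar>)
      \<le> sqrt (2 ^ (DIM('a) + 2)) * sqrt (LINT x|lborel. decay_weight (x::'a)) * sqrt (2 * Z_form f)"
    by (simp add: abs_mult)
qed

end

lemma bessel_weight_square:
  assumes "s = real n"
  shows "(cmod (bessel_weight s \<xi> * z))\<^sup>2 = (1 + (norm \<xi>)\<^sup>2) ^ n * (cmod z)\<^sup>2"
proof -
  have p: "(1 + (norm \<xi>)\<^sup>2) > 0" by (simp add: add_pos_nonneg)
  have "((1 + (norm \<xi>)\<^sup>2) powr (s / 2))\<^sup>2 = (1 + (norm \<xi>)\<^sup>2) ^ n"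
    using p assms by (simp add: power2_eq_square powr_add[symmetric] powr_realpow)
  then show ?thesis
    by (simp add: bessel_weight_def norm_mult power_mult_distrib)
qed

lemma norm_powr_square:
  assumes "s = real (Suc n)"
  shows "(cmod (complex_of_real (norm x powr s * y)))\<^sup>2 = norm x ^ (2 * Suc n) * y\<^sup>2"
proof -
  have "norm x powr s = norm x ^ Suc n"
  proof (cases "x = 0")
    case False
    then show ?thesis unfolding assms by (intro powr_realpow) simp
  qed simp
  then show ?thesis
    by (simp only: norm_of_real power2_abs power_mult_distrib power_mult[symmetric] mult.commute[of 2])
qed

lemma
  fixes f :: "'a::euclidean_space \<Rightarrow> real"
  assumes f: "f \<in> Z_dot s s" and s: "s = real (DIM('a) + 1)"
  shows Z_dot_imp_Z_regular: "Z_regular f"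
    and Z_form_le_Z_norm: "Z_form f \<le> (Z_norm s s f)\<^sup>2"
proof -
  let ?c = "\<lambda>x. complex_of_real (f x)"
  have int: "integrable lborel f" using f by (simp add: Z_dot_def)
  then have intc: "integrable lborel ?c" by simp
  have [measurable]: "f \<in> borel_measurable borel" "fhat f \<in> borel_measurable borel"
    using int borel_measurable_fhat[OF int] by auto
  obtain F where F: "has_fourier_L2 ?c F" "l2_sq (\<lambda>\<xi>. bessel_weight s \<xi> * F \<xi>) < \<infinity>"
    using f by (auto simp: Z_dot_def Z_space_def sobolev_def)
  have "has_fourier_L2 ?c (fourier_L2 ?c)"
    unfolding fourier_L2_def using F(1) by (rule someI[where P="has_fourier_L2 ?c"])
  then have ae: "AE \<xi> in lborel. fourier_L2 ?c \<xi> = fhat f \<xi>" "AE \<xi> in lborel. F \<xi> = fhat f \<xi>"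
    using has_fourier_L2_integrable[OF _ intc] F(1) by (auto simp: fhat_def)
  define A where "A \<xi> = (1 + (norm \<xi>)\<^sup>2) ^ (DIM('a) + 1) * (cmod (fhat f \<xi>))\<^sup>2" for \<xi>
  define B where "B x = norm x ^ (2 * (DIM('a) + 1)) * (f x)\<^sup>2" for x
  have A0: "A \<xi> \<ge> 0" and B0: "B \<xi> \<ge> 0" for \<xi>
    by (auto simp: A_def B_def intro!: mult_nonneg_nonneg)
  have [measurable]: "A \<in> borel_measurable borel" "B \<in> borel_measurable borel"
    unfolding A_def[abs_def] B_def[abs_def] by measurable
  have lA: "l2_sq (\<lambda>\<xi>. bessel_weight s \<xi> * G \<xi>) = (\<integral>\<^sup>+\<xi>. ennreal (A \<xi>) \<partial>lborel)"
    if "AE \<xi> in lborel. G \<xi> = fhat f \<xi>" for G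
    unfolding l2_sq_def A_def bessel_weight_square[OF s]
    by (rule nn_integral_cong_AE) (use that in eventually_elim, simp)
  have lB: "l2_sq (\<lambda>x. complex_of_real (norm x powr s * f x)) = (\<integral>\<^sup>+x. ennreal (B x) \<partial>lborel)"
  proof -
    have s': "s = real (Suc DIM('a))" using s by simp
    have "(cmod (complex_of_real (norm x powr s * f x)))\<^sup>2 = B x" for x
      by (simp only: norm_powr_square[OF s'] B_def Suc_eq_plus1)
    then show ?thesis unfolding l2_sq_def by (simp only:)
  qed
  have iA: "integrable lborel A"
    using F(2) lA[OF ae(2)] A0 by (intro integrableI_bounded) auto
  have iB: "integrable lborel B"
    using f lB B0 by (intro integrableI_bounded) (auto simp: Z_dot_def Z_space_def)
  have "complex_of_real (LINT x|lborel. f x) = 0"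
    using f by (simp add: Z_dot_def fourier_def)
  then show "Z_regular f"
    using int iA iB by (simp add: Z_regular_def A_def[abs_def] B_def[abs_def])
  have nA: "(\<integral>\<^sup>+\<xi>. ennreal (A \<xi>) \<partial>lborel) = ennreal (LINT \<xi>|lborel. A \<xi>)"
    using iA A0 by (intro nn_integral_eq_integral) auto
  have nB: "(\<integral>\<^sup>+\<xi>. ennreal (B \<xi>) \<partial>lborel) = ennreal (LINT \<xi>|lborel. B \<xi>)"
    using iB B0 by (intro nn_integral_eq_integral) auto
  have IA: "(LINT \<xi>|lborel. A \<xi>) \<ge> 0" and IB: "(LINT \<xi>|lborel. B \<xi>) \<ge> 0"
    using A0 B0 by (auto intro!: integral_nonneg_AE)
  have "Z_norm s s f = sqrt (LINT \<xi>|lborel. A \<xi>) + sqrt (LINT x|lborel. B x)"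
    unfolding Z_norm_def sobolev_norm_def lA[OF ae(1)] lB nA nB using IA IB by simp
  moreover have "(LINT \<xi>|lborel. A \<xi>) + (LINT x|lborel. B x) \<le> (sqrt (LINT \<xi>|lborel. A \<xi>) + sqrt (LINT x|lborel. B x))\<^sup>2"
    using IA IB by (simp add: power2_sum)
  ultimately show "Z_form f \<le> (Z_norm s s f)\<^sup>2"
    by (simp add: Z_form_def A_def B_def)
qed

section \<open>The nonlinearity\<close>

definition advection :: "'a::euclidean_space \<Rightarrow> ('a \<Rightarrow> real) \<Rightarrow> 'a \<Rightarrow> real" where
  "advection e f x = f x * partial e f x"

lemma power_le_one_plus_power:
  fixes a :: real
  assumes "0 \<le> a" "m \<le> n"
  shows "a ^ m \<le> 1 + a ^ n"
proof (cases "a \<le> 1")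
  case True
  then have "a ^ m \<le> 1" using assms by (intro power_le_one) auto
  then show ?thesis using assms by (simp add: add_increasing2)
next
  case False
  then have "a ^ m \<le> a ^ n" using assms by (intro power_increasing) auto
  then show ?thesis by simp
qed

context
  fixes e :: "'a::euclidean_space"
  assumes e: "norm e \<le> 1"
begin

lemma borel_measurable_advection:
  assumes f: "Z_regular f"
  shows "advection e f \<in> borel_measurable borel"
proof -
  have [measurable]: "f \<in> borel_measurable borel" "partial e f \<in> borel_measurable borel"
    using Z_regular_integrable[OF f] borel_measurable_partial[OF Z_regular_imp_fourier_regular[OF f]] by auto
  show ?thesis unfolding advection_def[abs_def] by measurable
qed

lemma integrable_advection:
  assumes f: "Z_regular f"
  shows "integrable lborel (advection e f)"
  unfolding advection_def[abs_def]
  by (intro square_integrable_mult Z_regular_square_integrable[OF f]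
        square_integrable_partial[OF Z_regular_imp_fourier_regular[OF f] e])

text \<open>
  Split \<open>f \<partial>f - g \<partial>g = (f - g) \<partial>f + g \<partial>(f - g)\<close>; the result is continuity of the nonlinearity from
  \<open>Z\<^sub>s\<^sub>,\<^sub>s\<close> to \<open>L\<^sup>1\<close>.
\<close>

lemma integral_advection_diff_le:
  assumes f: "Z_regular f" and g: "Z_regular g" and fg: "Z_regular (\<lambda>x. f x - g x)"
  shows "(LINT x|lborel. \<bar>advection e f x - advection e g x\<bar>)
    \<le> sqrt (Z_form (\<lambda>x. f x - g x)) * (sqrt (Z_form f) + sqrt (Z_form g))"
proof -
  let ?d = "\<lambda>x. f x - g x"
  note F = Z_regular_imp_fourier_regular
  have s: "square_integrable ?d" "square_integrable (partial e f)" "square_integrable g" "square_integrable (partial e ?d)"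
    using Z_regular_square_integrable[OF fg] Z_regular_square_integrable[OF g]
      square_integrable_partial[OF F[OF f] e] square_integrable_partial[OF F[OF fg] e] by auto
  have b: "square_integral ?d \<le> Z_form ?d" "square_integral (partial e f) \<le> Z_form f"
    "square_integral g \<le> Z_form g" "square_integral (partial e ?d) \<le> Z_form ?d"
    using Z_regular_square_integral_le[OF fg] Z_regular_square_integral_le[OF g]
      Z_regular_square_integral_partial_le[OF f e] Z_regular_square_integral_partial_le[OF fg e] by auto
  have n: "square_integrable (\<lambda>x. norm (h x))" if "square_integrable h" for h :: "'a \<Rightarrow> real"
    using that by (auto simp: square_integrable_def)
  have i1: "integrable lborel (\<lambda>x. norm (?d x) * norm (partial e f x))"
    and i2: "integrable lborel (\<lambda>x. norm (g x) * norm (partial e ?d x))"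
    by (intro square_integrable_mult n s)+
  have "(LINT x|lborel. \<bar>advection e f x - advection e g x\<bar>)
      \<le> (LINT x|lborel. norm (?d x) * norm (partial e f x) + norm (g x) * norm (partial e ?d x))"
  proof (rule integral_mono_AE'[OF Bochner_Integration.integrable_add[OF i1 i2]])
    show "AE x in lborel. \<bar>advection e f x - advection e g x\<bar> \<le> norm (?d x) * norm (partial e f x) + norm (g x) * norm (partial e ?d x)"
    proof (rule AE_I2)
      fix x
      have "advection e f x - advection e g x = ?d x * partial e f x + g x * partial e ?d x"
        unfolding advection_def partial_diff[OF F[OF f] F[OF g]] by (simp add: algebra_simps)
      then show "\<bar>advection e f x - advection e g x\<bar> \<le> norm (?d x) * norm (partial e f x) + norm (g x) * norm (partial e ?d x)"
        using abs_triangle_ineq[of "?d x * partial e f x" "g x * partial e ?d x"] by (simp add: abs_mult)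
    qed
  qed auto
  also have "\<dots> = (LINT x|lborel. norm (?d x) * norm (partial e f x)) + (LINT x|lborel. norm (g x) * norm (partial e ?d x))"
    by (rule Bochner_Integration.integral_add[OF i1 i2])
  also have "\<dots> \<le> sqrt (Z_form ?d) * sqrt (Z_form f) + sqrt (Z_form g) * sqrt (Z_form ?d)"
  proof (rule add_mono)
    show "(LINT x|lborel. norm (?d x) * norm (partial e f x)) \<le> sqrt (Z_form ?d) * sqrt (Z_form f)"
      using b by (intro order_trans[OF cauchy_schwarz_integral[OF s(1,2)]] mult_mono real_sqrt_le_mono) (auto simp: Z_form_nonneg)
    show "(LINT x|lborel. norm (g x) * norm (partial e ?d x)) \<le> sqrt (Z_form g) * sqrt (Z_form ?d)"
      using b by (intro order_trans[OF cauchy_schwarz_integral[OF s(3,4)]] mult_mono real_sqrt_le_mono) (auto simp: Z_form_nonneg)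
  qed
  finally show ?thesis by (simp add: algebra_simps)
qed

text \<open>
  Three moments are just within reach in dimension two, because there \<open>|x|\<^sup>3 f\<close> is square integrable, and
  so is the derivative.
\<close>

lemma advection_third_moment:
  assumes f: "Z_regular f" and d: "DIM('a) \<ge> 2"
  shows "integrable lborel (\<lambda>x. (1 + norm x ^ 3) * \<bar>advection e f x\<bar>)"
    and "(LINT x|lborel. (1 + norm x ^ 3) * \<bar>advection e f x\<bar>) \<le> 3 * Z_form f"
proof -
  let ?w = "\<lambda>x. norm x ^ (DIM('a) + 1) * f x"
  note F = Z_regular_imp_fourier_regular[OF f]
  have s: "square_integrable f" "square_integrable ?w" "square_integrable (partial e f)"
    using Z_regular_square_integrable[OF f] Z_regular_weight(1)[OF f] square_integrable_partial[OF F e] by auto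
  have b: "square_integral f \<le> Z_form f" "square_integral ?w \<le> Z_form f" "square_integral (partial e f) \<le> Z_form f"
    using Z_regular_square_integral_le[OF f] Z_regular_weight(2)[OF f] Z_regular_square_integral_partial_le[OF f e] by auto
  have n: "square_integrable (\<lambda>x. norm (h x))" if "square_integrable h" for h :: "'a \<Rightarrow> real"
    using that by (auto simp: square_integrable_def)
  let ?A = "\<lambda>x. norm (f x) * norm (partial e f x)" and ?B = "\<lambda>x. norm (?w x) * norm (partial e f x)"
  have i: "integrable lborel ?A" "integrable lborel ?B"
    by (intro square_integrable_mult n s)+
  have le: "(1 + norm x ^ 3) * \<bar>advection e f x\<bar> \<le> 2 * ?A x + ?B x" for x
  proof -
    have "1 + norm x ^ 3 \<le> 2 + norm x ^ (DIM('a) + 1)"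
      using power_le_one_plus_power[of "norm x" 3 "DIM('a) + 1"] d by simp
    then have "(1 + norm x ^ 3) * \<bar>advection e f x\<bar> \<le> (2 + norm x ^ (DIM('a) + 1)) * \<bar>advection e f x\<bar>"
      by (rule mult_right_mono) simp
    also have "\<dots> = 2 * ?A x + ?B x" by (simp add: advection_def abs_mult algebra_simps)
    finally show ?thesis .
  qed
  have iAB: "integrable lborel (\<lambda>x. 2 * ?A x + ?B x)" using i by auto
  have [measurable]: "advection e f \<in> borel_measurable borel" by (rule borel_measurable_advection[OF f])
  show "integrable lborel (\<lambda>x. (1 + norm x ^ 3) * \<bar>advection e f x\<bar>)"
    by (rule Bochner_Integration.integrable_bound[OF iAB])
       (use le in \<open>auto simp: abs_mult intro: order_trans[OF _ abs_ge_self]\<close>)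
  have "(LINT x|lborel. (1 + norm x ^ 3) * \<bar>advection e f x\<bar>) \<le> (LINT x|lborel. 2 * ?A x + ?B x)"
    by (rule integral_mono_AE'[OF iAB]) (use le in auto)
  also have "\<dots> = 2 * (LINT x|lborel. ?A x) + (LINT x|lborel. ?B x)"
    using i by simp
  also have "\<dots> \<le> 2 * (sqrt (Z_form f) * sqrt (Z_form f)) + sqrt (Z_form f) * sqrt (Z_form f)"
    using b by (intro add_mono mult_left_mono order_trans[OF cauchy_schwarz_integral] mult_mono real_sqrt_le_mono s)
      (auto simp: Z_form_nonneg)
  also have "\<dots> = 3 * Z_form f" using Z_form_nonneg[of f] by simp
  finally show "(LINT x|lborel. (1 + norm x ^ 3) * \<bar>advection e f x\<bar>) \<le> 3 * Z_form f" .
qed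

text \<open>
  All three identities integrate the derivative along \<open>e\<close> of a function of the \<open>C\<^sup>1\<close> representative
  \<open>R\<close>, namely of \<open>R\<^sup>2 / 2\<close>, of \<open>R\<^sup>3 / 3\<close> and of \<open>(x \<bullet> z) R\<^sup>2 / 2\<close>.
\<close>

lemma
  assumes f: "Z_regular f" and d: "DIM('a) \<ge> 2"
  shows integral_advection: "(LINT x|lborel. advection e f x) = 0"
    and integral_mult_advection: "(LINT x|lborel. f x * advection e f x) = 0"
    and integral_moment_advection: "(LINT x|lborel. (x \<bullet> z) * advection e f x) = - (e \<bullet> z) / 2 * square_integral f"
proof -
  note F = Z_regular_imp_fourier_regular[OF f]
  define R where "R = regularized f"
  define P where "P = partial e f"
  have Rf: "AE x in lborel. f x = R x"
    unfolding R_def using F by (intro AE_eq_regularized) (auto simp: fourier_regular_def)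
  have Rc: "continuous_on UNIV R" and Pc: "continuous_on UNIV P"
    unfolding R_def P_def by (intro continuous_on_regularized continuous_on_partial F)+
  have [measurable]: "f \<in> borel_measurable borel" "R \<in> borel_measurable borel" "P \<in> borel_measurable borel"
    "advection e f \<in> borel_measurable borel"
    using Z_regular_integrable[OF f] Rc Pc borel_measurable_advection[OF f] by (auto intro: borel_measurable_continuous_onI)
  have deriv: "((\<lambda>s. R (x + s *\<^sub>R e)) has_real_derivative P x) (at 0)" for x
    unfolding R_def P_def by (rule regularized_has_derivative[OF F])
  obtain B where B: "\<And>x. \<bar>R x\<bar> \<le> B" unfolding R_def using abs_regularized_le by blast
  have AF: "AE x in lborel. advection e f x = R x * P x"
    using Rf by eventually_elim (simp add: advection_def P_def)
  have i0: "integrable lborel (\<lambda>x. R x * P x)"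
    using integrable_cong_AE_imp[OF integrable_advection[OF f] _ AF] by simp
  have i1: "integrable lborel (\<lambda>x. norm x * \<bar>R x * P x\<bar>)"
  proof (rule integrable_cong_AE_imp)
    show "integrable lborel (\<lambda>x. norm x * \<bar>advection e f x\<bar>)"
    proof (rule Bochner_Integration.integrable_bound[OF advection_third_moment(1)[OF f d]])
      show "AE x in lborel. norm (norm x * \<bar>advection e f x\<bar>) \<le> norm ((1 + norm x ^ 3) * \<bar>advection e f x\<bar>)"
        using power_le_one_plus_power[of _ 1 3] by (auto simp: abs_mult intro!: mult_right_mono)
    qed auto
    show "AE x in lborel. norm x * \<bar>advection e f x\<bar> = norm x * \<bar>R x * P x\<bar>"
      using AF by eventually_elim simp
  qed auto
  have r0: "integrable lborel R"
    using integrable_cong_AE_imp[OF Z_regular_integrable[OF f] _ Rf] by simp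
  have r1: "integrable lborel (\<lambda>x. norm x * \<bar>R x\<bar>)"
  proof (rule integrable_cong_AE_imp)
    show "integrable lborel (\<lambda>x. norm x * \<bar>f x\<bar>)"
      by (rule Bochner_Integration.integrable_bound[OF Z_regular_first_moment(1)[OF f]])
         (auto simp: abs_mult intro!: mult_right_mono)
    show "AE x in lborel. norm x * \<bar>f x\<bar> = norm x * \<bar>R x\<bar>"
      using Rf by eventually_elim simp
  qed auto
  have r2: "integrable lborel (\<lambda>x. (R x)\<^sup>2)"
  proof (rule Bochner_Integration.integrable_bound)
    show "integrable lborel (\<lambda>x. B * R x)" using r0 by auto
    show "AE x in lborel. norm ((R x)\<^sup>2) \<le> norm (B * R x)"
    proof (rule AE_I2)
      fix x
      have "\<bar>R x\<bar> * \<bar>R x\<bar> \<le> \<bar>B\<bar> * \<bar>R x\<bar>"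
        by (intro mult_right_mono order_trans[OF B abs_ge_self]) auto
      then show "norm ((R x)\<^sup>2) \<le> norm (B * R x)" by (simp add: power2_eq_square abs_mult)
    qed
  qed auto
  show "(LINT x|lborel. advection e f x) = 0"
  proof -
    have "(LINT x|lborel. advection e f x) = (LINT x|lborel. R x * P x)"
      by (rule integral_cong_AE) (use AF in auto)
    also have "\<dots> = 0"
    proof (rule integral_directional_derivative_eq_0[where h="\<lambda>x. (R x)\<^sup>2 / 2" and e=e])
      show "((\<lambda>s. (R (x + s *\<^sub>R e))\<^sup>2 / 2) has_real_derivative R x * P x) (at 0)" for x
        by (auto intro!: derivative_eq_intros deriv)
    qed (use r2 i0 in \<open>auto intro!: continuous_intros Rc Pc\<close>)
    finally show ?thesis .
  qed
  have AF2: "AE x in lborel. f x * advection e f x = R x * (R x * P x)"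
    using Rf AF by eventually_elim simp
  have i2: "integrable lborel (\<lambda>x. R x * (R x * P x))"
  proof (rule Bochner_Integration.integrable_bound)
    show "integrable lborel (\<lambda>x. B * (R x * P x))" using i0 by auto
    show "AE x in lborel. norm (R x * (R x * P x)) \<le> norm (B * (R x * P x))"
      unfolding real_norm_def abs_mult[of "R _" "R _ * P _"] abs_mult[of B]
      by (intro AE_I2 mult_right_mono order_trans[OF B abs_ge_self]) auto
  qed auto

  show "(LINT x|lborel. f x * advection e f x) = 0"
  proof -
    have "(LINT x|lborel. f x * advection e f x) = (LINT x|lborel. R x * (R x * P x))"
      by (rule integral_cong_AE) (use AF2 in auto)
    also have "\<dots> = 0"
    proof (rule integral_directional_derivative_eq_0[where h="\<lambda>x. (R x) ^ 3 / 3" and e=e])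
      show "((\<lambda>s. (R (x + s *\<^sub>R e)) ^ 3 / 3) has_real_derivative R x * (R x * P x)) (at 0)" for x
        by (auto intro!: derivative_eq_intros deriv simp: power2_eq_square)
      show "integrable lborel (\<lambda>x. R x ^ 3 / 3)"
      proof (rule Bochner_Integration.integrable_bound)
        show "integrable lborel (\<lambda>x. B * (R x)\<^sup>2)" using r2 by auto
        show "AE x in lborel. norm (R x ^ 3 / 3) \<le> norm (B * (R x)\<^sup>2)"
        proof (rule AE_I2)
          fix x
          have "\<bar>R x\<bar> * (R x)\<^sup>2 \<le> \<bar>B\<bar> * (R x)\<^sup>2"
            by (intro mult_right_mono order_trans[OF B abs_ge_self]) auto
          moreover have "\<bar>R x ^ 3\<bar> = \<bar>R x\<bar> * (R x)\<^sup>2" by (simp add: power3_eq_cube power2_eq_square abs_mult)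
          ultimately show "norm (R x ^ 3 / 3) \<le> norm (B * (R x)\<^sup>2)" by (simp add: abs_mult)
        qed
      qed auto
    qed (use i2 in \<open>auto intro!: continuous_intros Rc Pc\<close>)
    finally show ?thesis .
  qed
  have AF3: "AE x in lborel. (x \<bullet> z) * advection e f x = (x \<bullet> z) * (R x * P x)"
    using AF by eventually_elim simp
  have i3: "integrable lborel (\<lambda>x. (x \<bullet> z) * (R x * P x))"
  proof (rule Bochner_Integration.integrable_bound)
    show "integrable lborel (\<lambda>x. norm z * (norm x * \<bar>R x * P x\<bar>))" using i1 by (rule integrable_mult_right)
    show "AE x in lborel. norm ((x \<bullet> z) * (R x * P x)) \<le> norm (norm z * (norm x * \<bar>R x * P x\<bar>))"
    proof (rule AE_I2)
      fix x
      have "\<bar>x \<bullet> z\<bar> * \<bar>R x * P x\<bar> \<le> (norm x * norm z) * \<bar>R x * P x\<bar>"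
        by (intro mult_right_mono Cauchy_Schwarz_ineq2) auto
      then show "norm ((x \<bullet> z) * (R x * P x)) \<le> norm (norm z * (norm x * \<bar>R x * P x\<bar>))"
        by (simp add: abs_mult mult_ac)
    qed
  qed auto

  show "(LINT x|lborel. (x \<bullet> z) * advection e f x) = - (e \<bullet> z) / 2 * square_integral f"
  proof -
    have i4: "integrable lborel (\<lambda>x. (x \<bullet> z) * (R x)\<^sup>2 / 2)"
    proof (rule Bochner_Integration.integrable_bound)
      show "integrable lborel (\<lambda>x. (\<bar>B\<bar> * norm z) * (norm x * \<bar>R x\<bar>))" using r1 by (rule integrable_mult_right)
      show "AE x in lborel. norm ((x \<bullet> z) * (R x)\<^sup>2 / 2) \<le> norm ((\<bar>B\<bar> * norm z) * (norm x * \<bar>R x\<bar>))"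
      proof (rule AE_I2)
        fix x
        have "\<bar>x \<bullet> z\<bar> * (\<bar>R x\<bar> * \<bar>R x\<bar>) \<le> (norm x * norm z) * (\<bar>B\<bar> * \<bar>R x\<bar>)"
          by (intro mult_mono Cauchy_Schwarz_ineq2 mult_nonneg_nonneg order_trans[OF B abs_ge_self]) auto
        moreover have "norm ((x \<bullet> z) * (R x)\<^sup>2 / 2) = \<bar>x \<bullet> z\<bar> * (\<bar>R x\<bar> * \<bar>R x\<bar>) / 2"
          by (simp add: abs_mult power2_eq_square)
        moreover have "0 \<le> \<bar>x \<bullet> z\<bar> * (\<bar>R x\<bar> * \<bar>R x\<bar>)" by (intro mult_nonneg_nonneg abs_ge_zero)
        moreover have "norm ((\<bar>B\<bar> * norm z) * (norm x * \<bar>R x\<bar>)) = (norm x * norm z) * (\<bar>B\<bar> * \<bar>R x\<bar>)"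
          by (simp add: abs_mult mult_ac)
        ultimately show "norm ((x \<bullet> z) * (R x)\<^sup>2 / 2) \<le> norm ((\<bar>B\<bar> * norm z) * (norm x * \<bar>R x\<bar>))"
          by linarith
      qed
    qed auto
    have i5: "integrable lborel (\<lambda>x. (e \<bullet> z) * (R x)\<^sup>2 / 2)" using r2 by auto
    have "(LINT x|lborel. (e \<bullet> z) * (R x)\<^sup>2 / 2 + (x \<bullet> z) * (R x * P x)) = 0"
    proof (rule integral_directional_derivative_eq_0[where h="\<lambda>x. (x \<bullet> z) * (R x)\<^sup>2 / 2" and e=e])
      show "((\<lambda>s. ((x + s *\<^sub>R e) \<bullet> z) * (R (x + s *\<^sub>R e))\<^sup>2 / 2) has_real_derivative
          (e \<bullet> z) * (R x)\<^sup>2 / 2 + (x \<bullet> z) * (R x * P x)) (at 0)" for x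
        unfolding inner_add_left inner_scaleR_left
        by (auto intro!: derivative_eq_intros deriv simp: field_simps)
    qed (use i3 i4 i5 in \<open>auto intro!: continuous_intros Rc Pc\<close>)
    then have "(LINT x|lborel. (x \<bullet> z) * (R x * P x)) = - (e \<bullet> z) / 2 * (LINT x|lborel. (R x)\<^sup>2)"
      using i3 i5 by (simp add: Bochner_Integration.integral_add)
    also have "(LINT x|lborel. (R x)\<^sup>2) = square_integral f"
      unfolding square_integral_def
    proof (rule integral_cong_AE)
      show "AE x in lborel. (R x)\<^sup>2 = (norm (f x))\<^sup>2" using Rf by eventually_elim simp
    qed auto
    also have "(LINT x|lborel. (x \<bullet> z) * (R x * P x)) = (LINT x|lborel. (x \<bullet> z) * advection e f x)"
      by (rule integral_cong_AE) (use AF3 in auto)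
    finally show ?thesis .
  qed
qed

end

section \<open>Continuous families\<close>

lemma l2_sq_diff_le:
  assumes [measurable]: "f \<in> borel_measurable borel" "g \<in> borel_measurable borel"
  shows "l2_sq (\<lambda>x. f x - g x) \<le> 2 * l2_sq f + 2 * l2_sq g"
proof -
  have "l2_sq (\<lambda>x. f x - g x) \<le> (\<integral>\<^sup>+x. 2 * ennreal ((cmod (f x))\<^sup>2) + 2 * ennreal ((cmod (g x))\<^sup>2) \<partial>lborel)"
    unfolding l2_sq_def
  proof (rule nn_integral_mono)
    fix x
    have "(cmod (f x - g x))\<^sup>2 \<le> 2 * (cmod (f x))\<^sup>2 + 2 * (cmod (g x))\<^sup>2"
      by (rule order_trans[OF power_mono[OF norm_triangle_ineq4 norm_ge_zero] sum_power2_le])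
    then have "ennreal ((cmod (f x - g x))\<^sup>2) \<le> ennreal (2 * (cmod (f x))\<^sup>2 + 2 * (cmod (g x))\<^sup>2)"
      by (rule ennreal_leI)
    then show "ennreal ((cmod (f x - g x))\<^sup>2) \<le> 2 * ennreal ((cmod (f x))\<^sup>2) + 2 * ennreal ((cmod (g x))\<^sup>2)"
      by (simp add: ennreal_mult)
  qed
  also have "\<dots> = 2 * l2_sq f + 2 * l2_sq g"
    unfolding l2_sq_def by (simp add: nn_integral_add nn_integral_cmult)
  finally show ?thesis .
qed

lemma has_fourier_L2_measurable:
  assumes "has_fourier_L2 f F"
  shows "f \<in> borel_measurable borel" "F \<in> borel_measurable borel"
    "fourier (\<lambda>x. indicator (cball 0 R) x * f x) \<in> borel_measurable borel"
  using assms by (auto simp: has_fourier_L2_def L2_iff square_integrable_def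
      intro!: borel_measurable_fourier integrable_truncation)

lemma has_fourier_L2_diff:
  fixes f g :: "'a::euclidean_space \<Rightarrow> complex"
  assumes f: "has_fourier_L2 f F" and g: "has_fourier_L2 g G"
  shows "has_fourier_L2 (\<lambda>x. f x - g x) (\<lambda>x. F x - G x)"
proof -
  have s: "square_integrable f" "square_integrable F" "square_integrable g" "square_integrable G"
    using f g by (auto simp: has_fourier_L2_def L2_iff)
  let ?t = "\<lambda>R f. fourier (\<lambda>x. indicator (cball 0 R) x * f x)"
  have eq: "?t R (\<lambda>x. f x - g x) \<xi> - (F \<xi> - G \<xi>) = (?t R f \<xi> - F \<xi>) - (?t R g \<xi> - G \<xi>)" for R \<xi>
    using fourier_diff[OF integrable_truncation[OF s(1)] integrable_truncation[OF s(3)], of R R \<xi>]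
    by (simp add: right_diff_distrib)
  have "((\<lambda>R. l2_sq (\<lambda>\<xi>. ?t R (\<lambda>x. f x - g x) \<xi> - (F \<xi> - G \<xi>))) \<longlongrightarrow> 0) at_top"
  proof (rule tendsto_sandwich[OF _ _ tendsto_const])
    show "\<forall>\<^sub>F R in at_top. l2_sq (\<lambda>\<xi>. ?t R (\<lambda>x. f x - g x) \<xi> - (F \<xi> - G \<xi>))
        \<le> 2 * l2_sq (\<lambda>\<xi>. ?t R f \<xi> - F \<xi>) + 2 * l2_sq (\<lambda>\<xi>. ?t R g \<xi> - G \<xi>)"
      unfolding eq
      by (intro always_eventually allI l2_sq_diff_le borel_measurable_diff has_fourier_L2_measurable(2,3)[OF f] has_fourier_L2_measurable(2,3)[OF g])
    have "((\<lambda>R. 2 * l2_sq (\<lambda>\<xi>. ?t R f \<xi> - F \<xi>) + 2 * l2_sq (\<lambda>\<xi>. ?t R g \<xi> - G \<xi>)) \<longlongrightarrow> 2 * 0 + 2 * 0) at_top"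
      using f g unfolding has_fourier_L2_def by (intro tendsto_add ennreal_tendsto_cmult) auto
    then show "((\<lambda>R. 2 * l2_sq (\<lambda>\<xi>. ?t R f \<xi> - F \<xi>) + 2 * l2_sq (\<lambda>\<xi>. ?t R g \<xi> - G \<xi>)) \<longlongrightarrow> 0) at_top"
      by simp
  qed auto
  then show ?thesis
    using s unfolding has_fourier_L2_def by (auto simp: L2_iff intro!: square_integrable_diff)
qed

lemma has_fourier_L2_unique:
  assumes f: "has_fourier_L2 f F" and g: "has_fourier_L2 f G"
  shows "AE \<xi> in lborel. F \<xi> = G \<xi>"
proof -
  have "has_fourier_L2 (\<lambda>x. 0) (\<lambda>\<xi>. F \<xi> - G \<xi>)"
    using has_fourier_L2_diff[OF f g] by simp
  from has_fourier_L2_integrable[OF this] have "AE \<xi> in lborel. F \<xi> - G \<xi> = fourier (\<lambda>x. 0) \<xi>" by simp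
  then show ?thesis by eventually_elim (simp add: fourier_def)
qed

lemma Z_space_diff:
  assumes f: "f \<in> Z_space s r" and g: "g \<in> Z_space s r"
  shows "(\<lambda>x. f x - g x) \<in> Z_space s r"
proof -
  obtain F where F: "has_fourier_L2 (\<lambda>x. complex_of_real (f x)) F" "l2_sq (\<lambda>\<xi>. bessel_weight s \<xi> * F \<xi>) < \<infinity>"
    using f by (auto simp: Z_space_def sobolev_def)
  obtain G where G: "has_fourier_L2 (\<lambda>x. complex_of_real (g x)) G" "l2_sq (\<lambda>\<xi>. bessel_weight s \<xi> * G \<xi>) < \<infinity>"
    using g by (auto simp: Z_space_def sobolev_def)
  have fg: "(\<lambda>x. complex_of_real (f x)) \<in> borel_measurable borel" "(\<lambda>x. complex_of_real (g x)) \<in> borel_measurable borel"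
    and [measurable]: "F \<in> borel_measurable borel" "G \<in> borel_measurable borel"
    using has_fourier_L2_measurable[OF F(1)] has_fourier_L2_measurable[OF G(1)] by auto
  have [measurable]: "f \<in> borel_measurable borel" "g \<in> borel_measurable borel"
    using borel_measurable_Re[THEN measurable_compose[rotated], OF fg(1)]
      borel_measurable_Re[THEN measurable_compose[rotated], OF fg(2)] by auto
  have fin: "2 * a + 2 * b < \<infinity>" if "a < \<infinity>" "b < \<infinity>" for a b :: ennreal
    using that by (simp add: ennreal_mult_less_top)
  have "l2_sq (\<lambda>\<xi>. bessel_weight s \<xi> * F \<xi> - bessel_weight s \<xi> * G \<xi>) < \<infinity>"
    by (rule le_less_trans[OF l2_sq_diff_le fin[OF F(2) G(2)]]) (simp_all add: bessel_weight_def)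
  then have 1: "(\<lambda>x. complex_of_real (f x - g x)) \<in> sobolev s"
    using has_fourier_L2_diff[OF F(1) G(1)] unfolding sobolev_def
    by (auto intro!: exI[of _ "\<lambda>x. F x - G x"] simp: right_diff_distrib)
  have "l2_sq (\<lambda>x. complex_of_real (norm x powr r * f x) - complex_of_real (norm x powr r * g x)) < \<infinity>"
    by (rule le_less_trans[OF l2_sq_diff_le fin]) (use f g in \<open>auto simp: Z_space_def\<close>)
  then have 2: "l2_sq (\<lambda>x. complex_of_real (norm x powr r * (f x - g x))) < \<infinity>"
    by (simp add: right_diff_distrib)
  show ?thesis using 1 2 by (simp add: Z_space_def)
qed

lemma Z_dot_diff:
  assumes f: "f \<in> Z_dot s r" and g: "g \<in> Z_dot s r"
  shows "(\<lambda>x. f x - g x) \<in> Z_dot s r"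
  using Z_space_diff[of f s r g] f g
    fourier_diff[of "\<lambda>x. complex_of_real (f x)" "\<lambda>x. complex_of_real (g x)" 0]
  by (auto simp: Z_dot_def)

lemma Z_form_le_diff:
  assumes f: "Z_regular f" and g: "Z_regular g" and fg: "Z_regular (\<lambda>x. f x - g x)"
  shows "Z_form f \<le> 2 * Z_form g + 2 * Z_form (\<lambda>x. f x - g x)"
proof -
  let ?w = "\<lambda>\<xi>::'a. (1 + (norm \<xi>)\<^sup>2) ^ (DIM('a) + 1)" and ?v = "\<lambda>x::'a. norm x ^ (2 * (DIM('a) + 1))"
  let ?d = "\<lambda>x. f x - g x"
  have i: "integrable lborel (\<lambda>\<xi>. ?w \<xi> * (cmod (fhat h \<xi>))\<^sup>2)" "integrable lborel (\<lambda>x. ?v x * (h x)\<^sup>2)"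
    if "Z_regular h" for h using that by (auto simp: Z_regular_def)
  have 1: "(LINT \<xi>|lborel. ?w \<xi> * (cmod (fhat f \<xi>))\<^sup>2)
      \<le> (LINT \<xi>|lborel. 2 * (?w \<xi> * (cmod (fhat g \<xi>))\<^sup>2) + 2 * (?w \<xi> * (cmod (fhat ?d \<xi>))\<^sup>2))"
  proof (rule integral_mono_AE[OF i(1)[OF f]])
    show "integrable lborel (\<lambda>\<xi>. 2 * (?w \<xi> * (cmod (fhat g \<xi>))\<^sup>2) + 2 * (?w \<xi> * (cmod (fhat ?d \<xi>))\<^sup>2))"
      using i(1)[OF g] i(1)[OF fg] by (intro Bochner_Integration.integrable_add integrable_mult_right)
    show "AE \<xi> in lborel. ?w \<xi> * (cmod (fhat f \<xi>))\<^sup>2 \<le> 2 * (?w \<xi> * (cmod (fhat g \<xi>))\<^sup>2) + 2 * (?w \<xi> * (cmod (fhat ?d \<xi>))\<^sup>2)"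
    proof (rule AE_I2)
      fix \<xi>
      have "fhat f \<xi> = fhat g \<xi> + fhat ?d \<xi>"
        using fhat_diff[OF Z_regular_integrable[OF f] Z_regular_integrable[OF g]] by simp
      then have "(cmod (fhat f \<xi>))\<^sup>2 \<le> 2 * (cmod (fhat g \<xi>))\<^sup>2 + 2 * (cmod (fhat ?d \<xi>))\<^sup>2"
        using order_trans[OF power_mono[OF norm_triangle_ineq norm_ge_zero] sum_power2_le, of "fhat g \<xi>" "fhat ?d \<xi>"] by simp
      then have "?w \<xi> * (cmod (fhat f \<xi>))\<^sup>2 \<le> ?w \<xi> * (2 * (cmod (fhat g \<xi>))\<^sup>2 + 2 * (cmod (fhat ?d \<xi>))\<^sup>2)"
        by (intro mult_left_mono) auto
      then show "?w \<xi> * (cmod (fhat f \<xi>))\<^sup>2 \<le> 2 * (?w \<xi> * (cmod (fhat g \<xi>))\<^sup>2) + 2 * (?w \<xi> * (cmod (fhat ?d \<xi>))\<^sup>2)"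
        by (simp only: distrib_left mult.left_commute)
    qed
  qed
  also have "\<dots> = 2 * (LINT \<xi>|lborel. ?w \<xi> * (cmod (fhat g \<xi>))\<^sup>2) + 2 * (LINT \<xi>|lborel. ?w \<xi> * (cmod (fhat ?d \<xi>))\<^sup>2)"
    using i(1)[OF g] i(1)[OF fg] by (subst Bochner_Integration.integral_add) (auto simp del: power_Suc)
  finally have A: "(LINT \<xi>|lborel. ?w \<xi> * (cmod (fhat f \<xi>))\<^sup>2)
      \<le> 2 * (LINT \<xi>|lborel. ?w \<xi> * (cmod (fhat g \<xi>))\<^sup>2) + 2 * (LINT \<xi>|lborel. ?w \<xi> * (cmod (fhat ?d \<xi>))\<^sup>2)" .
  have 2: "(LINT x|lborel. ?v x * (f x)\<^sup>2) \<le> (LINT x|lborel. 2 * (?v x * (g x)\<^sup>2) + 2 * (?v x * (?d x)\<^sup>2))"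
  proof (rule integral_mono_AE[OF i(2)[OF f]])
    show "integrable lborel (\<lambda>x. 2 * (?v x * (g x)\<^sup>2) + 2 * (?v x * (?d x)\<^sup>2))"
      using i(2)[OF g] i(2)[OF fg] by (intro Bochner_Integration.integrable_add integrable_mult_right)
    show "AE x in lborel. ?v x * (f x)\<^sup>2 \<le> 2 * (?v x * (g x)\<^sup>2) + 2 * (?v x * (?d x)\<^sup>2)"
    proof (rule AE_I2)
      fix x
      have "?v x * (f x)\<^sup>2 \<le> ?v x * (2 * (g x)\<^sup>2 + 2 * (?d x)\<^sup>2)"
        using sum_power2_le[of "g x" "?d x"] by (intro mult_left_mono) auto
      then show "?v x * (f x)\<^sup>2 \<le> 2 * (?v x * (g x)\<^sup>2) + 2 * (?v x * (?d x)\<^sup>2)"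
        by (simp only: distrib_left mult.left_commute)
    qed
  qed
  also have "\<dots> = 2 * (LINT x|lborel. ?v x * (g x)\<^sup>2) + 2 * (LINT x|lborel. ?v x * (?d x)\<^sup>2)"
    using i(2)[OF g] i(2)[OF fg] by (subst Bochner_Integration.integral_add) (auto simp del: power_Suc)
  finally have B: "(LINT x|lborel. ?v x * (f x)\<^sup>2)
      \<le> 2 * (LINT x|lborel. ?v x * (g x)\<^sup>2) + 2 * (LINT x|lborel. ?v x * (?d x)\<^sup>2)" .
  from add_mono[OF A B] show ?thesis
    unfolding Z_form_def by (simp only: distrib_left[of 2] add_ac)
qed

text \<open>
  Joint continuity in time and frequency, when each member is continuous and the dependence on time is
  uniform in the frequency.
\<close>

lemma continuous_on_family:
  fixes g :: "real \<Rightarrow> 'a::euclidean_space \<Rightarrow> complex"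
  assumes cont: "\<And>t \<xi>. t \<in> S \<Longrightarrow> isCont (g t) \<xi>"
    and bound: "\<And>t \<tau> \<xi>. t \<in> S \<Longrightarrow> \<tau> \<in> S \<Longrightarrow> cmod (g \<tau> \<xi> - g t \<xi>) \<le> \<omega> t \<tau>"
    and lim: "\<And>t. t \<in> S \<Longrightarrow> (\<omega> t \<longlongrightarrow> 0) (at t within S)" and refl: "\<And>t. \<omega> t t = 0"
  shows "continuous_on (S \<times> UNIV) (\<lambda>(t, \<xi>). g t \<xi>)"
  unfolding continuous_on_sequentially
proof (intro allI ballI impI)
  fix X and p :: "real \<times> 'a" assume p: "p \<in> S \<times> UNIV" and X: "(\<forall>n. X n \<in> S \<times> UNIV) \<and> X \<longlonglongrightarrow> p"
  obtain t \<xi> where t: "p = (t, \<xi>)" "t \<in> S" using p by auto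
  have X1: "(\<lambda>n. fst (X n)) \<longlonglongrightarrow> t" "fst (X n) \<in> S" and X2: "(\<lambda>n. snd (X n)) \<longlonglongrightarrow> \<xi>" for n
    using X tendsto_fst[of X p sequentially] tendsto_snd[of X p sequentially] t by (auto simp: mem_Times_iff)
  have "continuous (at t within S) (\<omega> t)"
    using lim[OF t(2)] refl[of t] by (simp add: continuous_within)
  then have "(\<lambda>n. \<omega> t (fst (X n))) \<longlonglongrightarrow> \<omega> t t"
    by (rule continuous_within_tendsto_compose') (use X1 in auto)
  moreover have "(\<lambda>n. g t (snd (X n))) \<longlonglongrightarrow> g t \<xi>"
    by (rule isCont_tendsto_compose[OF cont[OF t(2)] X2])
  then have "(\<lambda>n. cmod (g t (snd (X n)) - g t \<xi>)) \<longlonglongrightarrow> 0"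
    by (simp add: tendsto_norm_zero LIM_zero)
  ultimately have 0: "(\<lambda>n. \<omega> t (fst (X n)) + cmod (g t (snd (X n)) - g t \<xi>)) \<longlonglongrightarrow> 0"
    using refl[of t] tendsto_add by fastforce
  have "(\<lambda>n. g (fst (X n)) (snd (X n)) - g t \<xi>) \<longlonglongrightarrow> 0"
  proof (rule Lim_null_comparison[OF always_eventually 0], rule allI)
    fix n
    have "cmod (g (fst (X n)) (snd (X n)) - g t \<xi>) \<le> cmod (g (fst (X n)) (snd (X n)) - g t (snd (X n))) + cmod (g t (snd (X n)) - g t \<xi>)"
      using norm_triangle_ineq[of "g (fst (X n)) (snd (X n)) - g t (snd (X n))" "g t (snd (X n)) - g t \<xi>"] by simp
    then show "norm (g (fst (X n)) (snd (X n)) - g t \<xi>) \<le> \<omega> t (fst (X n)) + cmod (g t (snd (X n)) - g t \<xi>)"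
      using bound[OF t(2) X1(2)] by (meson add_right_mono order_trans)
  qed
  then show "((\<lambda>(t, \<xi>). g t \<xi>) \<circ> X) \<longlonglongrightarrow> (\<lambda>(t, \<xi>). g t \<xi>) p"
    using LIM_zero_cancel t by (simp add: comp_def case_prod_unfold)
qed

text \<open>
  Supplies the hypothesis of Fubini's theorem whenever integrals over time and frequency are exchanged.
\<close>

lemma integrable_time_space:
  fixes g :: "real \<Rightarrow> 'a::euclidean_space \<Rightarrow> complex"
  assumes cont: "continuous_on ({a..b} \<times> UNIV) (\<lambda>(\<tau>, z). g \<tau> z)"
    and int: "\<And>\<tau>. \<tau> \<in> {a..b} \<Longrightarrow> integrable lborel (g \<tau>)"
    and bound: "\<And>\<tau>. \<tau> \<in> {a..b} \<Longrightarrow> (LINT z|lborel. cmod (g \<tau> z)) \<le> M"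
  shows "integrable (lborel \<Otimes>\<^sub>M lborel) (\<lambda>(\<tau>, z). indicator {a..b} \<tau> *\<^sub>R g \<tau> z)"
proof (rule lborel_pair.Fubini_integrable)
  have "(\<lambda>p. indicator ({a..b} \<times> UNIV) p *\<^sub>R (case p of (\<tau>, z) \<Rightarrow> g \<tau> z)) \<in> borel_measurable borel"
    by (rule borel_measurable_continuous_on_indicator[OF _ cont]) (auto intro!: borel_closed closed_Times)
  also have "(\<lambda>p. indicator ({a..b} \<times> UNIV) p *\<^sub>R (case p of (\<tau>, z) \<Rightarrow> g \<tau> z)) = (\<lambda>(\<tau>, z). indicator {a..b} \<tau> *\<^sub>R g \<tau> z)"
    by (auto simp: indicator_def fun_eq_iff)
  finally show [measurable]: "(\<lambda>(\<tau>, z). indicator {a..b} \<tau> *\<^sub>R g \<tau> z) \<in> borel_measurable (lborel \<Otimes>\<^sub>M lborel)"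
    by (simp add: lborel_prod)
  show "AE \<tau> in lborel. integrable lborel (\<lambda>z. case (\<tau>, z) of (\<tau>, z) \<Rightarrow> indicator {a..b} \<tau> *\<^sub>R g \<tau> z)"
    using int by (intro AE_I2) (auto simp: indicator_def)
  show "integrable lborel (\<lambda>\<tau>. LINT z|lborel. norm (case (\<tau>, z) of (\<tau>, z) \<Rightarrow> indicator {a..b} \<tau> *\<^sub>R g \<tau> z))"
  proof (rule Bochner_Integration.integrable_bound)
    show "integrable lborel (\<lambda>\<tau>::real. indicator {a..b} \<tau> * M)" by (simp add: emeasure_lborel_Icc_eq)
    show "AE \<tau> in lborel. norm (LINT z|lborel. norm (case (\<tau>, z) of (\<tau>, z) \<Rightarrow> indicator {a..b} \<tau> *\<^sub>R g \<tau> z))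
        \<le> norm (indicator {a..b} \<tau> * M)"
      using bound by (intro AE_I2) (auto simp: indicator_def integral_nonneg_AE intro: order_trans[OF _ abs_ge_self])
  qed measurable
qed

text \<open>
  The exponent \<open>d + 1\<close> equals \<open>3\<close> in dimension two and \<open>4\<close> in dimension three.  The equation enters only
  in the extension of this locale below.
\<close>

locale Z_solution =
  fixes k :: "'d::finite" and T :: real and u :: "real \<Rightarrow> real^'d \<Rightarrow> real"
  assumes cont: "continuous_in_Z_dot (real CARD('d) + 1) (real CARD('d) + 1) T u"
    and dim: "CARD('d) \<ge> 2" and T: "T > 0"
begin

abbreviation e1 :: "real^'d" where "e1 \<equiv> axis k 1"

abbreviation Fh :: "real \<Rightarrow> real^'d \<Rightarrow> complex" where "Fh \<tau> \<equiv> fhat (advection e1 (u \<tau>))"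

lemma e1: "norm e1 \<le> 1"
  by (simp add: norm_axis_1)

lemma in_Z_dot: "t \<in> {0..T} \<Longrightarrow> u t \<in> Z_dot (real CARD('d) + 1) (real CARD('d) + 1)"
  using cont by (simp add: continuous_in_Z_dot_def)

lemma Z_reg: "t \<in> {0..T} \<Longrightarrow> Z_regular (u t)"
  by (rule Z_dot_imp_Z_regular[OF in_Z_dot]) auto

lemma Z_reg_diff:
  assumes "t \<in> {0..T}" "\<tau> \<in> {0..T}"
  shows "Z_regular (\<lambda>x. u \<tau> x - u t x)"
    and "Z_form (\<lambda>x. u \<tau> x - u t x) \<le> (Z_norm (real CARD('d) + 1) (real CARD('d) + 1) (\<lambda>x. u \<tau> x - u t x))\<^sup>2"
proof -
  have s: "real CARD('d) + 1 = real (DIM(real^'d) + 1)" by simp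
  note d = Z_dot_diff[OF in_Z_dot[OF assms(2)] in_Z_dot[OF assms(1)]]
  show "Z_regular (\<lambda>x. u \<tau> x - u t x)" by (rule Z_dot_imp_Z_regular[OF d s])
  show "Z_form (\<lambda>x. u \<tau> x - u t x) \<le> (Z_norm (real CARD('d) + 1) (real CARD('d) + 1) (\<lambda>x. u \<tau> x - u t x))\<^sup>2"
    by (rule Z_form_le_Z_norm[OF d s])
qed

lemma Z_form_diff_tendsto:
  assumes t: "t \<in> {0..T}"
  shows "((\<lambda>\<tau>. Z_form (\<lambda>x. u \<tau> x - u t x)) \<longlongrightarrow> 0) (at t within {0..T})"
proof (rule Lim_null_comparison)
  let ?N = "\<lambda>\<tau>. Z_norm (real CARD('d) + 1) (real CARD('d) + 1) (\<lambda>x. u \<tau> x - u t x)"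
  have "(?N \<longlongrightarrow> 0) (at t within {0..T})" using cont t by (simp add: continuous_in_Z_dot_def)
  then have "((\<lambda>\<tau>. (?N \<tau>)\<^sup>2) \<longlongrightarrow> 0\<^sup>2) (at t within {0..T})" by (rule tendsto_power)
  then show "((\<lambda>\<tau>. (?N \<tau>)\<^sup>2) \<longlongrightarrow> 0) (at t within {0..T})" by simp
  show "\<forall>\<^sub>F \<tau> in at t within {0..T}. norm (Z_form (\<lambda>x. u \<tau> x - u t x)) \<le> (?N \<tau>)\<^sup>2"
    using Z_reg_diff(2)[OF t] unfolding eventually_at by (auto intro!: exI[of _ 1] simp: abs_of_nonneg Z_form_nonneg)
qed

lemma Z_form_diff_refl: "Z_form (\<lambda>x. u t x - u t x) = 0"
  by (simp add: Z_form_def fhat_def fourier_def)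

text \<open>
  The family is continuous on a compact interval, and \<open>Z_form\<close> obeys the quasi-triangle inequality
  \<open>Z_form_le_diff\<close>.
\<close>

lemma Z_form_bounded: "\<exists>B\<ge>0. \<forall>t\<in>{0..T}. Z_form (u t) \<le> B"
proof (rule ccontr)
  assume "\<not> ?thesis"
  then have "\<forall>n::nat. \<exists>t\<in>{0..T}. Z_form (u t) > real n" by (meson of_nat_0_le_iff linorder_not_le)
  then obtain s where s: "\<And>n. s n \<in> {0..T}" "\<And>n::nat. Z_form (u (s n)) > real n" by metis
  have "compact {0..T}" by simp
  then obtain t \<sigma> where t: "t \<in> {0..T}" "strict_mono \<sigma>" "(s \<circ> \<sigma>) \<longlonglongrightarrow> t"
    using s(1) unfolding compact_def by blast
  have "continuous (at t within {0..T}) (\<lambda>\<tau>. Z_form (\<lambda>x. u \<tau> x - u t x))"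
    unfolding continuous_within Z_form_diff_refl by (rule Z_form_diff_tendsto[OF t(1)])
  then have "(\<lambda>n. Z_form (\<lambda>x. u ((s \<circ> \<sigma>) n) x - u t x)) \<longlonglongrightarrow> Z_form (\<lambda>x. u t x - u t x)"
    by (rule continuous_within_tendsto_compose') (use s(1) t(3) in \<open>auto simp: comp_def\<close>)
  then have "\<forall>\<^sub>F n in sequentially. Z_form (\<lambda>x. u ((s \<circ> \<sigma>) n) x - u t x) < 1"
    unfolding Z_form_diff_refl by (rule order_tendstoD) simp
  moreover obtain N :: nat where N: "2 * Z_form (u t) + 2 < real N" using reals_Archimedean2 by blast
  ultimately have "\<forall>\<^sub>F n in sequentially. Z_form (\<lambda>x. u ((s \<circ> \<sigma>) n) x - u t x) < 1 \<and> n \<ge> N"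
    by (intro eventually_conj eventually_ge_at_top)
  then obtain n where n: "Z_form (\<lambda>x. u (s (\<sigma> n)) x - u t x) < 1" "n \<ge> N"
    unfolding eventually_sequentially by auto
  have "Z_form (u (s (\<sigma> n))) \<le> 2 * Z_form (u t) + 2 * Z_form (\<lambda>x. u (s (\<sigma> n)) x - u t x)"
    by (rule Z_form_le_diff[OF Z_reg Z_reg Z_reg_diff(1)]) (use s(1) t(1) in auto)
  moreover have "real (\<sigma> n) \<ge> real N" using n(2) seq_suble[OF t(2), of n] by simp
  ultimately show False using s(2)[of "\<sigma> n"] n(1) N by linarith
qed

lemma cmod_fhat_u_diff_le:
  assumes "t \<in> {0..T}" "\<tau> \<in> {0..T}"
  shows "cmod (fhat (u \<tau>) \<xi> - fhat (u t) \<xi>) \<le> sqrt (2 ^ (CARD('d) + 2)) *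
    sqrt (LINT x|lborel. decay_weight (x::real^'d)) * sqrt (2 * Z_form (\<lambda>x. u \<tau> x - u t x))"
proof -
  note d = Z_reg_diff(1)[OF assms]
  have "cmod (fhat (u \<tau>) \<xi> - fhat (u t) \<xi>) = cmod (fhat (\<lambda>x. u \<tau> x - u t x) \<xi>)"
    by (simp add: fhat_diff[OF Z_regular_integrable[OF Z_reg[OF assms(2)]] Z_regular_integrable[OF Z_reg[OF assms(1)]]])
  also have "\<dots> \<le> (LINT x|lborel. \<bar>u \<tau> x - u t x\<bar>)" by (rule norm_fhat_le)
  also have "\<dots> \<le> (LINT x|lborel. (1 + norm x) * \<bar>u \<tau> x - u t x\<bar>)"
    by (rule integral_mono_AE'[OF Z_regular_first_moment(1)[OF d]]) (auto simp: algebra_simps)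
  also note Z_regular_first_moment(2)[OF d]
  finally show ?thesis by simp
qed

lemma continuous_on_fhat_u: "continuous_on ({0..T} \<times> UNIV) (\<lambda>(t, \<xi>). fhat (u t) \<xi>)"
proof (rule continuous_on_family)
  show "isCont (fhat (u t)) \<xi>" if "t \<in> {0..T}" for t \<xi>
    by (rule isCont_fhat[OF Z_regular_integrable[OF Z_reg[OF that]]])
  show "((\<lambda>\<tau>. sqrt (2 ^ (CARD('d) + 2)) * sqrt (LINT x|lborel. decay_weight (x::real^'d)) * sqrt (2 * Z_form (\<lambda>x. u \<tau> x - u t x)))
      \<longlongrightarrow> 0) (at t within {0..T})" if t: "t \<in> {0..T}" for t
  proof -
    have "((\<lambda>\<tau>. sqrt (2 ^ (CARD('d) + 2)) * sqrt (LINT x|lborel. decay_weight (x::real^'d)) * sqrt (2 * Z_form (\<lambda>x. u \<tau> x - u t x)))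
      \<longlongrightarrow> sqrt (2 ^ (CARD('d) + 2)) * sqrt (LINT x|lborel. decay_weight (x::real^'d)) * sqrt (2 * 0)) (at t within {0..T})"
      by (intro tendsto_intros Z_form_diff_tendsto[OF t])
    then show ?thesis by simp
  qed
qed (use cmod_fhat_u_diff_le Z_form_diff_refl in auto)

lemma integral_advection_u_diff_le:
  assumes B: "\<forall>t\<in>{0..T}. Z_form (u t) \<le> B" and t: "t \<in> {0..T}" "\<tau> \<in> {0..T}"
  shows "(LINT x|lborel. \<bar>advection e1 (u \<tau>) x - advection e1 (u t) x\<bar>) \<le> sqrt (Z_form (\<lambda>x. u \<tau> x - u t x)) * (2 * sqrt B)"
proof -
  have "sqrt (Z_form (u \<tau>)) \<le> sqrt B" "sqrt (Z_form (u t)) \<le> sqrt B" using B t by auto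
  then have "sqrt (Z_form (\<lambda>x. u \<tau> x - u t x)) * (sqrt (Z_form (u \<tau>)) + sqrt (Z_form (u t)))
      \<le> sqrt (Z_form (\<lambda>x. u \<tau> x - u t x)) * (2 * sqrt B)"
    by (intro mult_left_mono) (linarith, simp add: Z_form_nonneg)
  then show ?thesis
    using integral_advection_diff_le[OF e1 Z_reg[OF t(2)] Z_reg[OF t(1)] Z_reg_diff(1)[OF t]] by linarith
qed

lemma continuous_on_Fh: "continuous_on ({0..T} \<times> UNIV) (\<lambda>(t, \<xi>). Fh t \<xi>)"
proof -
  obtain B where B: "\<forall>t\<in>{0..T}. Z_form (u t) \<le> B" using Z_form_bounded by blast
  note ia = integrable_advection[OF e1 Z_reg]
  show ?thesis
  proof (rule continuous_on_family[where \<omega>="\<lambda>t \<tau>. sqrt (Z_form (\<lambda>x. u \<tau> x - u t x)) * (2 * sqrt B)"])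
    show "isCont (Fh t) \<xi>" if "t \<in> {0..T}" for t \<xi>
      by (rule isCont_fhat[OF ia[OF that]])
    show "cmod (Fh \<tau> \<xi> - Fh t \<xi>) \<le> sqrt (Z_form (\<lambda>x. u \<tau> x - u t x)) * (2 * sqrt B)"
      if t: "t \<in> {0..T}" "\<tau> \<in> {0..T}" for t \<tau> \<xi>
    proof -
      have "cmod (Fh \<tau> \<xi> - Fh t \<xi>) = cmod (fhat (\<lambda>x. advection e1 (u \<tau>) x - advection e1 (u t) x) \<xi>)"
        by (simp add: fhat_diff[OF ia[OF t(2)] ia[OF t(1)]])
      also have "\<dots> \<le> (LINT x|lborel. \<bar>advection e1 (u \<tau>) x - advection e1 (u t) x\<bar>)" by (rule norm_fhat_le)
      also have "\<dots> \<le> sqrt (Z_form (\<lambda>x. u \<tau> x - u t x)) * (2 * sqrt B)" by (rule integral_advection_u_diff_le[OF B t])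
      finally show ?thesis .
    qed
    show "((\<lambda>\<tau>. sqrt (Z_form (\<lambda>x. u \<tau> x - u t x)) * (2 * sqrt B)) \<longlongrightarrow> 0) (at t within {0..T})"
      if t: "t \<in> {0..T}" for t
    proof -
      have "((\<lambda>\<tau>. sqrt (Z_form (\<lambda>x. u \<tau> x - u t x)) * (2 * sqrt B)) \<longlongrightarrow> sqrt 0 * (2 * sqrt B)) (at t within {0..T})"
        by (intro tendsto_intros Z_form_diff_tendsto[OF t])
      then show ?thesis by simp
    qed
  qed (use Z_form_diff_refl in auto)
qed

lemma integral_abs_advection_le:
  assumes "t \<in> {0..T}"
  shows "(LINT x|lborel. \<bar>advection e1 (u t) x\<bar>) \<le> 3 * Z_form (u t)"
proof -
  have d: "DIM(real^'d) \<ge> 2" using dim by simp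
  have "(LINT x|lborel. \<bar>advection e1 (u t) x\<bar>) \<le> (LINT x|lborel. (1 + norm x ^ 3) * \<bar>advection e1 (u t) x\<bar>)"
    by (rule integral_mono_AE'[OF advection_third_moment(1)[OF e1 Z_reg[OF assms] d]]) (auto simp: algebra_simps)
  also have "\<dots> \<le> 3 * Z_form (u t)" by (rule advection_third_moment(2)[OF e1 Z_reg[OF assms] d])
  finally show ?thesis .
qed

lemma cmod_Fh_le: "t \<in> {0..T} \<Longrightarrow> cmod (Fh t \<xi>) \<le> 3 * Z_form (u t)"
  using norm_fhat_le integral_abs_advection_le by (rule order_trans)

end

section \<open>Duhamel's formula for the Fourier transforms\<close>

lemma AE_eq_lborel_affine:
  fixes F G :: "'a::euclidean_space \<Rightarrow> complex"
  assumes [measurable]: "F \<in> borel_measurable borel" "G \<in> borel_measurable borel"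
    and eq: "AE \<xi> in lborel. F \<xi> = G \<xi>" and b: "b \<noteq> 0"
  shows "AE z in lborel. F (a + b *\<^sub>R z) = G (a + b *\<^sub>R z)"
proof -
  let ?h = "\<lambda>\<xi>. ennreal (cmod (F \<xi> - G \<xi>))"
  have "(\<integral>\<^sup>+\<xi>. ?h \<xi> \<partial>lborel) = 0"
    by (subst nn_integral_0_iff_AE) (use eq in auto)
  then have "ennreal (\<bar>b\<bar> ^ DIM('a)) * (\<integral>\<^sup>+z. ?h (a + b *\<^sub>R z) \<partial>lborel) = 0"
    using nn_integral_lborel_affine[OF b, of ?h a] by simp
  then have "(\<integral>\<^sup>+z. ?h (a + b *\<^sub>R z) \<partial>lborel) = 0"   proof -
    have "ennreal (\<bar>b\<bar> ^ DIM('a)) \<noteq> 0" using b by (simp add: ennreal_eq_0_iff not_le)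
    then show ?thesis using \<open>ennreal (\<bar>b\<bar> ^ DIM('a)) * (\<integral>\<^sup>+z. ?h (a + b *\<^sub>R z) \<partial>lborel) = 0\<close> by simp
  qed
  then show ?thesis
    by (subst (asm) nn_integral_0_iff_AE) (auto simp: ennreal_eq_0_iff)
qed

abbreviation gaussian_kernel :: "'a::euclidean_space \<Rightarrow> real \<Rightarrow> 'a \<Rightarrow> complex" where
  "gaussian_kernel a b x \<equiv> exp (- (\<i> * complex_of_real (x \<bullet> a))) * complex_of_real (exp (- b\<^sup>2 * (norm x)\<^sup>2 / 2))"

lemma integral_fourier_L2_gauss_AE:
  fixes f :: "'a::euclidean_space \<Rightarrow> complex"
  assumes F: "has_fourier_L2 f F" and G: "G \<in> borel_measurable borel" and eq: "AE \<xi> in lborel. F \<xi> = G \<xi>" and b: "b \<noteq> 0"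
  shows "(LINT x|lborel. f x * gaussian_kernel a b x) = (LINT z|lborel. G (a + b *\<^sub>R z) * complex_of_real (gauss z))"
proof -
  have [measurable]: "F \<in> borel_measurable borel" "G \<in> borel_measurable borel"
    using has_fourier_L2_measurable[OF F] G by auto
  have "(LINT z|lborel. F (a + b *\<^sub>R z) * complex_of_real (gauss z)) = (LINT z|lborel. G (a + b *\<^sub>R z) * complex_of_real (gauss z))"
  proof (rule integral_cong_AE)
    show "AE z in lborel. F (a + b *\<^sub>R z) * complex_of_real (gauss z) = G (a + b *\<^sub>R z) * complex_of_real (gauss z)"
      using AE_eq_lborel_affine[OF \<open>F \<in> borel_measurable borel\<close> G eq b, of a] by eventually_elim simp
  qed measurable
  then show ?thesis using integral_fourier_L2_gauss[OF F b, of a] by simp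
qed

text \<open>
  As the width tends to zero, the Gaussian means of a continuous function tend to its value.
\<close>

lemma eq_0_if_gaussian_means_eq_0:
  fixes H :: "'a::euclidean_space \<Rightarrow> complex"
  assumes cont: "continuous_on UNIV H" and bound: "\<And>\<xi>. cmod (H \<xi>) \<le> B"
    and zero: "\<And>b. b > 0 \<Longrightarrow> (LINT z|lborel. H (a + b *\<^sub>R z) * complex_of_real (gauss z)) = 0"
  shows "H a = 0"
proof -
  have [measurable]: "H \<in> borel_measurable borel" by (rule borel_measurable_continuous_onI[OF cont])
  define e where "e n = inverse (real (Suc n))" for n
  have e: "e n > 0" for n by (simp add: e_def)
  have e0: "e \<longlonglongrightarrow> 0" unfolding e_def by (rule LIMSEQ_inverse_real_of_nat)
  have "(\<lambda>n. LINT z|lborel. H (a + e n *\<^sub>R z) * complex_of_real (gauss z)) \<longlonglongrightarrow> (LINT z|lborel. H a * complex_of_real (gauss (z::'a)))"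
  proof (rule integral_dominated_convergence[where w="\<lambda>z::'a. B * gauss z"])
    show "integrable lborel (\<lambda>z::'a. B * gauss z)" using integrable_gauss by auto
    show "AE z in lborel. (\<lambda>n. H (a + e n *\<^sub>R z) * complex_of_real (gauss z)) \<longlonglongrightarrow> H a * complex_of_real (gauss z)"
    proof (intro AE_I2 tendsto_mult tendsto_const)
      fix z :: 'a
      have "(\<lambda>n. a + e n *\<^sub>R z) \<longlonglongrightarrow> a + 0 *\<^sub>R z" by (intro tendsto_intros e0)
      then show "(\<lambda>n. H (a + e n *\<^sub>R z)) \<longlonglongrightarrow> H a"
        using continuous_on_tendsto_compose[OF cont] by simp
    qed
    show "AE z in lborel. norm (H (a + e n *\<^sub>R z) * complex_of_real (gauss z)) \<le> B * gauss z" for n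
      using bound by (auto simp: norm_mult intro!: mult_right_mono)
  qed auto
  then have "(LINT z|lborel. H a * complex_of_real (gauss (z::'a))) = 0"
    using zero[OF e] by (simp add: LIMSEQ_const_iff)
  then show ?thesis by (simp add: integral_gauss)
qed

lemma propagator_symbol_norm [simp]: "cmod (propagator_symbol k t \<xi>) = 1"
  by (simp add: propagator_symbol_def)

lemma propagator_symbol_0 [simp]: "propagator_symbol k 0 \<xi> = 1"
  by (simp add: propagator_symbol_def)

lemma propagator_symbol_add: "propagator_symbol k (s + t) \<xi> = propagator_symbol k s \<xi> * propagator_symbol k t \<xi>"
  by (simp add: propagator_symbol_def exp_add[symmetric] ring_distribs)

lemma propagator_symbol_cnj_mult: "cnj (propagator_symbol k t \<xi>) * propagator_symbol k t \<xi> = 1"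
  using complex_norm_square[of "propagator_symbol k t \<xi>"] by (simp add: mult.commute)

lemma continuous_on_propagator_symbol [continuous_intros]:
  fixes f :: "'x::topological_space \<Rightarrow> real" and g :: "'x \<Rightarrow> real^'d::finite"
  assumes "continuous_on S f" "continuous_on S g"
  shows "continuous_on S (\<lambda>x. propagator_symbol k (f x) (g x))"
  unfolding propagator_symbol_def using assms by (intro continuous_intros)

lemma borel_measurable_propagator_symbol [measurable]: "propagator_symbol k t \<in> borel_measurable borel"
  by (intro borel_measurable_continuous_onI continuous_intros)

lemma integral_eq_lebesgue_Icc:
  fixes g :: "real \<Rightarrow> complex"
  assumes g: "continuous_on {a..b} g"
  shows "integrable lborel (\<lambda>\<tau>. indicator {a..b} \<tau> *\<^sub>R g \<tau>)"
    and "integral {a..b} g = (LINT \<tau>|lborel. indicator {a..b} \<tau> *\<^sub>R g \<tau>)"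
proof -
  show i: "integrable lborel (\<lambda>\<tau>. indicator {a..b} \<tau> *\<^sub>R g \<tau>)"
    using borel_integrable_compact[of "{a..b}" g] g by simp
  show "integral {a..b} g = (LINT \<tau>|lborel. indicator {a..b} \<tau> *\<^sub>R g \<tau>)"
    using set_borel_integral_eq_integral(2)[of "{a..b}" g] i by (simp add: set_integrable_def set_lebesgue_integral_def)
qed

locale Z_duhamel_solution = Z_solution k T u
  for k :: "'d::finite" and T :: real and u :: "real \<Rightarrow> real^'d \<Rightarrow> real" +
  fixes u0 :: "real^'d \<Rightarrow> real"
  assumes duhamel: "duhamel_solution k T u0 u"
begin

abbreviation P :: "real \<Rightarrow> real^'d \<Rightarrow> complex" where "P \<equiv> propagator_symbol k"

lemma
  assumes S: "S \<subseteq> {0..T}"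
  shows continuous_on_Fh_time: "continuous_on S (\<lambda>\<tau>. Fh \<tau> \<xi>)"
    and continuous_on_fhat_u_time: "continuous_on S (\<lambda>\<tau>. fhat (u \<tau>) \<xi>)"
proof -
  have pair: "continuous_on S (\<lambda>\<tau>. (\<tau>, \<xi>))"
    by (intro continuous_on_Pair continuous_on_id continuous_on_const)
  have sub: "(\<lambda>\<tau>. (\<tau>, \<xi>)) ` S \<subseteq> {0..T} \<times> UNIV" using S by auto
  show "continuous_on S (\<lambda>\<tau>. Fh \<tau> \<xi>)"
    using continuous_on_compose2[OF continuous_on_Fh pair sub] by simp
  show "continuous_on S (\<lambda>\<tau>. fhat (u \<tau>) \<xi>)"
    using continuous_on_compose2[OF continuous_on_fhat_u pair sub] by simp
qed

lemma borel_measurable_Fh: "t \<in> {0..T} \<Longrightarrow> Fh t \<in> borel_measurable borel"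
  by (intro borel_measurable_fhat integrable_advection e1 Z_reg)

lemma borel_measurable_fhat_u: "t \<in> {0..T} \<Longrightarrow> fhat (u t) \<in> borel_measurable borel"
  by (intro borel_measurable_fhat Z_regular_integrable Z_reg)

text \<open>
  At time zero the Duhamel integral is over a degenerate interval and vanishes.  This identifies the
  datum with \<open>u 0\<close> on the side of the transforms.
\<close>

lemma initial_datum:
  assumes F0: "has_fourier_L2 (\<lambda>x. complex_of_real (u0 x)) F0"
  shows "AE \<xi> in lborel. F0 \<xi> = fhat (u 0) \<xi>"
proof -
  have 0: "0 \<in> {0..T}" using T by simp
  obtain v w J where v: "has_multiplier (P 0) (\<lambda>x. complex_of_real (u0 x)) v"
    and J: "has_L2_integral w 0 0 J" and eq: "AE x in lborel. complex_of_real (u 0 x) = v x - J x"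
    using duhamel 0 unfolding duhamel_solution_def by blast
  obtain F V where F: "has_fourier_L2 (\<lambda>x. complex_of_real (u0 x)) F" "has_fourier_L2 v V" "AE \<xi> in lborel. V \<xi> = P 0 \<xi> * F \<xi>"
    using v unfolding has_multiplier_def by blast
  have J2: "square_integrable J" using J by (auto simp: has_L2_integral_def L2_iff)
  then have Jc: "square_integrable (\<lambda>x. cnj (J x))"
  proof -
    have "(\<lambda>x. cnj (J x)) \<in> borel_measurable borel"
      using square_integrable_measurable[OF J2] by (intro borel_measurable_continuous_on[OF _, where f=cnj]) (auto intro: continuous_intros)
    then show ?thesis using J2 by (simp add: square_integrable_def)
  qed
  have "((\<lambda>\<tau>. LINT x|lborel. w \<tau> x * cnj (J x)) has_integral (LINT x|lborel. J x * cnj (J x))) {0..0}"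
    by (rule has_L2_integral_pairing[OF J Jc])
  then have "((\<lambda>\<tau>. LINT x|lborel. w \<tau> x * cnj (J x)) has_integral (LINT x|lborel. J x * cnj (J x))) {0}"
    by simp
  then have "(LINT x|lborel. J x * cnj (J x)) = 0"
    using has_integral_refl(2) by (rule has_integral_unique)
  moreover have "(LINT x|lborel. J x * cnj (J x)) = complex_of_real (square_integral J)"
    unfolding square_integral_def integral_complex_of_real[symmetric]
    by (intro Bochner_Integration.integral_cong refl complex_norm_square[symmetric])
  ultimately have "square_integral J = 0" by simp
  then have "AE x in lborel. (norm (J x))\<^sup>2 = 0"
    using J2 unfolding square_integral_def square_integrable_def
    by (subst (asm) integral_nonneg_eq_0_iff_AE) auto
  then have "AE x in lborel. v x = complex_of_real (u 0 x)"
    using eq by eventually_elim simp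
  then have "has_fourier_L2 (\<lambda>x. complex_of_real (u 0 x)) V"
    using F(2) Z_regular_integrable[OF Z_reg[OF 0]] by (intro has_fourier_L2_cong_AE[OF F(2)]) auto
  then have "AE \<xi> in lborel. V \<xi> = fhat (u 0) \<xi>"
    unfolding fhat_def using Z_regular_integrable[OF Z_reg[OF 0]] by (intro has_fourier_L2_integrable) auto
  moreover note F(3)
  moreover have "AE \<xi> in lborel. F0 \<xi> = F \<xi>" by (rule has_fourier_L2_unique[OF F0 F(1)])
  ultimately show ?thesis by eventually_elim simp
qed

text \<open>
  The \<open>L\<^sup>2\<close> transform of the product of \<open>u \<tau>\<close> with its weak derivative is represented by the
  continuous function \<open>Fh \<tau>\<close>, which has a value at each single frequency.
\<close>

lemma nonlinearity_AE:
  assumes w: "has_weak_partial k (u \<tau>) g" and \<tau>: "\<tau> \<in> {0..T}"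
    and G: "has_fourier_L2 (\<lambda>x. complex_of_real (u \<tau> x * g x)) G"
  shows "AE \<xi> in lborel. G \<xi> = Fh \<tau> \<xi>"
proof -
  note adv = integrable_advection[OF e1 Z_reg[OF \<tau>]]
  have "AE x in lborel. g x = partial e1 (u \<tau>) x"
    by (rule weak_partial_eq_partial[OF w Z_regular_imp_fourier_regular[OF Z_reg[OF \<tau>]]])
  then have "AE x in lborel. complex_of_real (u \<tau> x * g x) = complex_of_real (advection e1 (u \<tau>) x)"
    by eventually_elim (simp add: advection_def)
  then have "has_fourier_L2 (\<lambda>x. complex_of_real (advection e1 (u \<tau>) x)) G"
    using adv by (intro has_fourier_L2_cong_AE[OF G]) auto
  then show ?thesis
    unfolding fhat_def using adv by (intro has_fourier_L2_integrable) auto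
qed

text \<open>
  Both sides are continuous functions of \<open>\<xi>\<close>, and their means against Gaussians agree: pairing
  Duhamel's formula with the transforms of Gaussians only involves the \<open>L\<^sup>2\<close> convergence of the
  Riemann sums, and the order of the integrations over \<open>\<tau>\<close> and \<open>\<xi>\<close> can be exchanged.
\<close>

theorem duhamel_fourier:
  assumes t: "t \<in> {0..T}"
  shows "fhat (u t) a = P t a * fhat (u 0) a - integral {0..t} (\<lambda>\<tau>. P (t - \<tau>) a * Fh \<tau> a)"
proof -
  have t0: "0 \<in> {0..T}" and sub: "\<tau> \<in> {0..t} \<Longrightarrow> \<tau> \<in> {0..T}" for \<tau> using T t by auto
  obtain B where B: "\<forall>t\<in>{0..T}. Z_form (u t) \<le> B" using Z_form_bounded by blast
  have FB: "cmod (Fh \<tau> \<xi>) \<le> 3 * B" if "\<tau> \<in> {0..T}" for \<tau> \<xi>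
    using cmod_Fh_le[OF that, of \<xi>] bspec[OF B that] by linarith
  obtain ux where ux: "\<forall>\<tau>\<in>{0..T}. has_weak_partial k (u \<tau>) (ux \<tau>)" and
    ex: "\<forall>t\<in>{0..T}. \<exists>v w J. has_multiplier (P t) (\<lambda>x. complex_of_real (u0 x)) v \<and>
          (\<forall>\<tau>\<in>{0..t}. has_multiplier (P (t - \<tau>)) (\<lambda>x. complex_of_real (u \<tau> x * ux \<tau> x)) (w \<tau>)) \<and>
          has_L2_integral w 0 t J \<and> (AE x in lborel. complex_of_real (u t x) = v x - J x)"
    using duhamel unfolding duhamel_solution_def by (elim exE conjE)
  from bspec[OF ex t] obtain v w J where v: "has_multiplier (P t) (\<lambda>x. complex_of_real (u0 x)) v"
    and w: "\<forall>\<tau>\<in>{0..t}. has_multiplier (P (t - \<tau>)) (\<lambda>x. complex_of_real (u \<tau> x * ux \<tau> x)) (w \<tau>)"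
    and J: "has_L2_integral w 0 t J" and eq: "AE x in lborel. complex_of_real (u t x) = v x - J x"
    by (elim exE conjE)
  let ?g = "\<lambda>\<tau> \<xi>. P (t - \<tau>) \<xi> * Fh \<tau> \<xi>"
  define D where "D \<xi> = integral {0..t} (\<lambda>\<tau>. ?g \<tau> \<xi>)" for \<xi>
  have gt: "continuous_on {0..t} (\<lambda>\<tau>. ?g \<tau> \<xi>)" for \<xi>
    using t by (intro continuous_intros continuous_on_Fh_time) auto
  have D: "D \<xi> = (LINT \<tau>|lborel. indicator {0..t} \<tau> *\<^sub>R ?g \<tau> \<xi>)" for \<xi>
    unfolding D_def by (rule integral_eq_lebesgue_Icc(2)[OF gt])
  have iB: "integrable lborel (\<lambda>\<tau>::real. indicator {0..t} \<tau> * (3 * B))" by (simp add: emeasure_lborel_Icc_eq)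
  have D_seq: "(\<lambda>n. D (X n)) \<longlonglongrightarrow> D \<xi>" if X: "X \<longlonglongrightarrow> \<xi>" for X :: "nat \<Rightarrow> real^'d" and \<xi>
  proof -
    have "(\<lambda>n. LINT \<tau>|lborel. indicator {0..t} \<tau> *\<^sub>R ?g \<tau> (X n)) \<longlonglongrightarrow> (LINT \<tau>|lborel. indicator {0..t} \<tau> *\<^sub>R ?g \<tau> \<xi>)"
    proof (rule integral_dominated_convergence[OF _ _ iB])
      show "AE \<tau> in lborel. (\<lambda>n. indicator {0..t} \<tau> *\<^sub>R ?g \<tau> (X n)) \<longlonglongrightarrow> indicator {0..t} \<tau> *\<^sub>R ?g \<tau> \<xi>"
      proof (rule AE_I2)
        fix \<tau>
        show "(\<lambda>n. indicator {0..t} \<tau> *\<^sub>R ?g \<tau> (X n)) \<longlonglongrightarrow> indicator {0..t} \<tau> *\<^sub>R ?g \<tau> \<xi>"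
        proof (cases "\<tau> \<in> {0..t}")
          case True
          have "isCont (Fh \<tau>) \<xi>"
            by (rule isCont_fhat[OF integrable_advection[OF e1 Z_reg[OF sub[OF True]]]])
          then have "(\<lambda>n. Fh \<tau> (X n)) \<longlonglongrightarrow> Fh \<tau> \<xi>" using X by (simp add: isCont_tendsto_compose)
          moreover have "(\<lambda>n. P (t - \<tau>) (X n)) \<longlonglongrightarrow> P (t - \<tau>) \<xi>"
          proof -
            have "continuous_on UNIV (P (t - \<tau>))" by (intro continuous_intros)
            then show ?thesis using X continuous_on_tendsto_compose by fastforce
          qed
          ultimately show ?thesis by (intro tendsto_scaleR tendsto_mult tendsto_const)
        qed simp
      qed
      show "AE \<tau> in lborel. norm (indicator {0..t} \<tau> *\<^sub>R ?g \<tau> (X n)) \<le> indicator {0..t} \<tau> * (3 * B)" for n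
        using FB sub by (intro AE_I2) (auto simp: norm_mult indicator_def)
    qed (rule borel_measurable_integrable[OF integral_eq_lebesgue_Icc(1)[OF gt]])+
    then show ?thesis unfolding D .
  qed
  have D_cont: "continuous_on UNIV D"
    unfolding continuous_on_sequentially using D_seq by (auto simp: comp_def)
  have D_bound: "cmod (D \<xi>) \<le> (LINT \<tau>|lborel. indicator {0..t} \<tau> * (3 * B))" for \<xi>
  proof -
    have "0 \<le> 3 * B" by (rule order_trans[OF norm_ge_zero FB[OF t0, of 0]])
    then have "(LINT \<tau>|lborel. norm (indicator {0..t} \<tau> *\<^sub>R ?g \<tau> \<xi>)) \<le> (LINT \<tau>|lborel. indicator {0..t} \<tau> * (3 * B))"
      using FB[OF sub, of _ \<xi>] by (intro integral_mono_AE'[OF iB] AE_I2) (auto simp: norm_mult indicator_def)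
    then show ?thesis
      unfolding D by (rule order_trans[OF integral_norm_bound])
  qed
  \<comment> \<open>It remains to see that the Gaussian means of the bounded continuous function \<open>H\<close> vanish.\<close>
  define H where "H \<xi> = fhat (u t) \<xi> - (P t \<xi> * fhat (u 0) \<xi> - D \<xi>)" for \<xi>
  have ci: "integrable lborel (u s)" if "s \<in> {0..T}" for s by (rule Z_regular_integrable[OF Z_reg[OF that]])
  have fc: "continuous_on UNIV (fhat (u s))" if "s \<in> {0..T}" for s
    using isCont_fhat[OF ci[OF that]] by (simp add: continuous_at_imp_continuous_on)
  have "H a = 0"
  proof (rule eq_0_if_gaussian_means_eq_0[where H=H and a=a and
        B="(LINT x|lborel. \<bar>u t x\<bar>) + ((LINT x|lborel. \<bar>u 0 x\<bar>) + (LINT \<tau>|lborel. indicator {0..t} \<tau> * (3 * B)))"])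
    show "continuous_on UNIV H" unfolding H_def by (intro continuous_intros fc t t0 D_cont)
    show "cmod (H \<xi>) \<le> (LINT x|lborel. \<bar>u t x\<bar>) + ((LINT x|lborel. \<bar>u 0 x\<bar>) + (LINT \<tau>|lborel. indicator {0..t} \<tau> * (3 * B)))" for \<xi>
    proof -
      have "cmod (P t \<xi> * fhat (u 0) \<xi> - D \<xi>) \<le> (LINT x|lborel. \<bar>u 0 x\<bar>) + (LINT \<tau>|lborel. indicator {0..t} \<tau> * (3 * B))"
        by (rule order_trans[OF norm_triangle_ineq4 add_mono[OF _ D_bound]]) (simp add: norm_mult norm_fhat_le)
      then show ?thesis
        unfolding H_def by (intro order_trans[OF norm_triangle_ineq4 add_mono[OF norm_fhat_le]])
    qed
    fix b :: real assume b: "b > 0"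
    let ?K = "gaussian_kernel a b"
    have K: "square_integrable ?K" using b by (intro square_integrable_gaussian_kernel) auto
    have [measurable]: "?K \<in> borel_measurable borel" by (rule square_integrable_measurable[OF K])
    have [measurable]: "fhat (u t) \<in> borel_measurable borel" "fhat (u 0) \<in> borel_measurable borel" "D \<in> borel_measurable borel"
      by (intro borel_measurable_fhat_u t t0 borel_measurable_continuous_onI[OF D_cont])+
    obtain F0 V where F0: "has_fourier_L2 (\<lambda>x. complex_of_real (u0 x)) F0" "has_fourier_L2 v V" "AE \<xi> in lborel. V \<xi> = P t \<xi> * F0 \<xi>"
      using v unfolding has_multiplier_def by blast
    have v2: "square_integrable v" using F0(2) by (auto simp: has_fourier_L2_def L2_iff)
    have J2: "square_integrable J" using J by (auto simp: has_L2_integral_def L2_iff)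
    have "AE \<xi> in lborel. V \<xi> = P t \<xi> * fhat (u 0) \<xi>"
      using F0(3) initial_datum[OF F0(1)] by eventually_elim simp
    then have vK: "(LINT x|lborel. v x * ?K x) = (LINT z|lborel. (P t (a + b *\<^sub>R z) * fhat (u 0) (a + b *\<^sub>R z)) * complex_of_real (gauss z))"
      using b by (intro integral_fourier_L2_gauss_AE[OF F0(2), where G="\<lambda>\<xi>. P t \<xi> * fhat (u 0) \<xi>"]) auto
    have uK: "(LINT x|lborel. complex_of_real (u t x) * ?K x) = (LINT z|lborel. fhat (u t) (a + b *\<^sub>R z) * complex_of_real (gauss z))"
      unfolding fhat_def using ci[OF t] by (subst integral_fourier_gauss) (auto simp: mult_ac)
    define \<beta> where "\<beta> \<tau> = (LINT z|lborel. ?g \<tau> (a + b *\<^sub>R z) * complex_of_real (gauss z))" for \<tau>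
    have wK: "(LINT x|lborel. w \<tau> x * ?K x) = \<beta> \<tau>" if \<tau>: "\<tau> \<in> {0..t}" for \<tau>
    proof -
      obtain G W where G: "has_fourier_L2 (\<lambda>x. complex_of_real (u \<tau> x * ux \<tau> x)) G" "has_fourier_L2 (w \<tau>) W"
          "AE \<xi> in lborel. W \<xi> = P (t - \<tau>) \<xi> * G \<xi>"
        using bspec[OF w \<tau>] unfolding has_multiplier_def by blast
      have "AE \<xi> in lborel. W \<xi> = ?g \<tau> \<xi>"
        using G(3) nonlinearity_AE[OF bspec[OF ux sub[OF \<tau>]] sub[OF \<tau>] G(1)] by eventually_elim simp
      then show ?thesis
        unfolding \<beta>_def using b borel_measurable_Fh[OF sub[OF \<tau>]]
        by (intro integral_fourier_L2_gauss_AE[OF G(2), where G="?g \<tau>"]) auto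
    qed
    have int: "integrable (lborel \<Otimes>\<^sub>M lborel) (\<lambda>(\<tau>, z). indicator {0..t} \<tau> *\<^sub>R (?g \<tau> (a + b *\<^sub>R z) * complex_of_real (gauss z)))"
    proof (rule integrable_time_space)
      have gc: "continuous_on ({0..t} \<times> UNIV) (\<lambda>p. Fh (fst p) (a + b *\<^sub>R snd p))"
      proof -
        have "continuous_on ({0..t} \<times> UNIV) (\<lambda>p. (\<lambda>(t, \<xi>). Fh t \<xi>) (fst p, a + b *\<^sub>R snd p))"
          by (rule continuous_on_compose2[OF continuous_on_Fh]) (use t in \<open>auto intro!: continuous_intros\<close>)
        then show ?thesis by simp
      qed
      have gauss_cont: "continuous_on ({0..t} \<times> UNIV) (\<lambda>p. gauss (snd p :: real^'d))"
        unfolding gauss_eq by (intro continuous_intros) auto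
      have pc: "continuous_on ({0..t} \<times> UNIV) (\<lambda>p. P (t - fst p) (a + b *\<^sub>R snd p))"
        by (rule continuous_on_propagator_symbol) (intro continuous_intros)+
      show "continuous_on ({0..t} \<times> UNIV) (\<lambda>(\<tau>, z). ?g \<tau> (a + b *\<^sub>R z) * complex_of_real (gauss z))"
        unfolding case_prod_unfold by (intro continuous_on_mult continuous_on_of_real pc gc gauss_cont)
      have le: "cmod (?g \<tau> (a + b *\<^sub>R z) * complex_of_real (gauss z)) \<le> 3 * B * gauss z" if "\<tau> \<in> {0..t}" for \<tau> z
        using FB[OF sub[OF that]] by (auto simp: norm_mult intro!: mult_right_mono)
      have ig: "integrable lborel (\<lambda>z::real^'d. 3 * B * gauss z)" using integrable_gauss by auto
      fix \<tau> assume \<tau>: "\<tau> \<in> {0..t}"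
      have [measurable]: "Fh \<tau> \<in> borel_measurable borel" by (rule borel_measurable_Fh[OF sub[OF \<tau>]])
      show "integrable lborel (\<lambda>z. ?g \<tau> (a + b *\<^sub>R z) * complex_of_real (gauss z))"
        by (rule Bochner_Integration.integrable_bound[OF ig])
           (use le[OF \<tau>] in \<open>auto intro: order_trans[OF _ abs_ge_self]\<close>)
      show "(LINT z|lborel. cmod (?g \<tau> (a + b *\<^sub>R z) * complex_of_real (gauss z))) \<le> (LINT z|lborel. 3 * B * gauss (z::real^'d))"
        by (rule integral_mono_AE'[OF ig]) (use le[OF \<tau>] order_trans[OF norm_ge_zero le[OF \<tau>]] in auto)
    qed
    have \<beta>i: "(LINT z|lborel. indicator {0..t} \<tau> *\<^sub>R (?g \<tau> (a + b *\<^sub>R z) * complex_of_real (gauss z))) = indicator {0..t} \<tau> *\<^sub>R \<beta> \<tau>" for \<tau>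
      unfolding \<beta>_def by (cases "\<tau> \<in> {0..t}") auto
    have bi: "set_integrable lborel {0..t} \<beta>"
      using lborel_pair.integrable_fst[OF int] unfolding set_integrable_def \<beta>i .
    have "((\<lambda>\<tau>. LINT x|lborel. w \<tau> x * ?K x) has_integral (LINT x|lborel. J x * ?K x)) {0..t}"
      by (rule has_L2_integral_pairing[OF J K])
    then have "(\<beta> has_integral (LINT x|lborel. J x * ?K x)) {0..t}"
      using has_integral_cong[of "{0..t}" "\<lambda>\<tau>. LINT x|lborel. w \<tau> x * ?K x" \<beta>] wK by auto
    then have "(LINT x|lborel. J x * ?K x) = (LINT \<tau>|lborel. indicator {0..t} \<tau> *\<^sub>R \<beta> \<tau>)"
      using set_borel_integral_eq_integral(2)[OF bi] by (simp add: set_lebesgue_integral_def integral_unique)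
    also have "\<dots> = (LINT \<tau>|lborel. LINT z|lborel. indicator {0..t} \<tau> *\<^sub>R (?g \<tau> (a + b *\<^sub>R z) * complex_of_real (gauss z)))"
      unfolding \<beta>i ..
    also have "\<dots> = (LINT z|lborel. LINT \<tau>|lborel. indicator {0..t} \<tau> *\<^sub>R (?g \<tau> (a + b *\<^sub>R z) * complex_of_real (gauss z)))"
      by (rule lborel_pair.Fubini_integral[OF int, symmetric])
    also have "\<dots> = (LINT z|lborel. D (a + b *\<^sub>R z) * complex_of_real (gauss z))"
      unfolding D by (simp add: mult_scaleR_left[symmetric] del: mult_scaleR_left)
    finally have JK: "(LINT x|lborel. J x * ?K x) = (LINT z|lborel. D (a + b *\<^sub>R z) * complex_of_real (gauss z))" .
    have "(LINT x|lborel. complex_of_real (u t x) * ?K x) = (LINT x|lborel. v x * ?K x - J x * ?K x)"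
    proof (rule integral_cong_AE)
      show "AE x in lborel. complex_of_real (u t x) * ?K x = v x * ?K x - J x * ?K x"
        using eq by eventually_elim (simp add: left_diff_distrib)
      show "(\<lambda>x. complex_of_real (u t x) * ?K x) \<in> borel_measurable lborel"
        using ci[OF t] by auto
      show "(\<lambda>x. v x * ?K x - J x * ?K x) \<in> borel_measurable lborel"
        using square_integrable_measurable[OF v2] square_integrable_measurable[OF J2] by auto
    qed
    also have "\<dots> = (LINT x|lborel. v x * ?K x) - (LINT x|lborel. J x * ?K x)"
      by (intro Bochner_Integration.integral_diff square_integrable_mult v2 J2 K)
    finally have main: "(LINT z|lborel. fhat (u t) (a + b *\<^sub>R z) * complex_of_real (gauss z))
        = (LINT z|lborel. (P t (a + b *\<^sub>R z) * fhat (u 0) (a + b *\<^sub>R z)) * complex_of_real (gauss z))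
          - (LINT z|lborel. D (a + b *\<^sub>R z) * complex_of_real (gauss z))"
      unfolding uK vK JK .
    have gi: "integrable lborel (\<lambda>z. h (a + b *\<^sub>R z) * complex_of_real (gauss z))"
      if [measurable]: "h \<in> borel_measurable borel" and h: "\<And>\<xi>. cmod (h \<xi>) \<le> M" for h :: "real^'d \<Rightarrow> complex" and M
    proof (rule Bochner_Integration.integrable_bound)
      show "integrable lborel (\<lambda>z::real^'d. M * gauss z)" using integrable_gauss by auto
      show "AE z in lborel. norm (h (a + b *\<^sub>R z) * complex_of_real (gauss z)) \<le> norm (M * gauss z)"
      proof (rule AE_I2)
        fix z
        have "cmod (h (a + b *\<^sub>R z)) * gauss z \<le> \<bar>M\<bar> * gauss z"
          by (intro mult_right_mono order_trans[OF h abs_ge_self]) simp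
        then show "norm (h (a + b *\<^sub>R z) * complex_of_real (gauss z)) \<le> norm (M * gauss z)"
          by (simp add: norm_mult abs_mult)
      qed
    qed measurable
    have i1: "integrable lborel (\<lambda>z. fhat (u t) (a + b *\<^sub>R z) * complex_of_real (gauss z))"
      by (rule gi[where h="fhat (u t)"]) (auto intro: norm_fhat_le)
    have i2: "integrable lborel (\<lambda>z. (P t (a + b *\<^sub>R z) * fhat (u 0) (a + b *\<^sub>R z)) * complex_of_real (gauss z))"
      by (rule gi[where h="\<lambda>\<xi>. P t \<xi> * fhat (u 0) \<xi>"]) (auto simp: norm_mult intro: norm_fhat_le)
    have i3: "integrable lborel (\<lambda>z. D (a + b *\<^sub>R z) * complex_of_real (gauss z))"
      by (rule gi[where h=D]) (auto intro: D_bound)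
    show "(LINT z|lborel. H (a + b *\<^sub>R z) * complex_of_real (gauss z)) = 0"
      unfolding H_def left_diff_distrib using i1 i2 i3 main by simp
  qed
  then show ?thesis by (simp add: H_def D_def)
qed

end

section \<open>Conservation of the \<open>L\<^sup>2\<close> norm\<close>

context Z_duhamel_solution
begin

lemma continuous_on_duhamel_integrand:
  assumes "S \<subseteq> {0..T}"
  shows "continuous_on S (\<lambda>\<tau>. P (t - \<tau>) \<xi> * Fh \<tau> \<xi>)"
  by (intro continuous_intros continuous_on_Fh_time assms)

text \<open>
  The group property allows the evolution to be restarted at time \<open>s\<close>.
\<close>

lemma duhamel_fourier_from:
  assumes s: "0 \<le> s" "s \<le> t" and t: "t \<le> T"
  shows "fhat (u t) \<xi> = P (t - s) \<xi> * fhat (u s) \<xi> - integral {s..t} (\<lambda>\<tau>. P (t - \<tau>) \<xi> * Fh \<tau> \<xi>)"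
proof -
  let ?g = "\<lambda>t \<tau>. P (t - \<tau>) \<xi> * Fh \<tau> \<xi>"
  have st: "s \<in> {0..T}" "t \<in> {0..T}" using s t by auto
  have "?g t integrable_on {0..t}"
    by (rule integrable_continuous_real[OF continuous_on_duhamel_integrand]) (use t in auto)
  then have split: "integral {0..s} (?g t) + integral {s..t} (?g t) = integral {0..t} (?g t)"
    by (rule Henstock_Kurzweil_Integration.integral_combine[OF s])
  have shift: "integral {0..s} (?g t) = P (t - s) \<xi> * integral {0..s} (?g s)"
  proof -
    have "?g t \<tau> = P (t - s) \<xi> * ?g s \<tau>" for \<tau>
      using propagator_symbol_add[of k "t - s" "s - \<tau>" \<xi>] by simp
    then have "?g t = (\<lambda>\<tau>. P (t - s) \<xi> * ?g s \<tau>)" by (rule ext)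
    then show ?thesis by (simp only: integral_mult_right)
  qed
  have "P t \<xi> = P (t - s) \<xi> * P s \<xi>"
    using propagator_symbol_add[of k "t - s" s \<xi>] by simp
  then have "fhat (u t) \<xi> = P (t - s) \<xi> * P s \<xi> * fhat (u 0) \<xi>
      - (P (t - s) \<xi> * integral {0..s} (?g s) + integral {s..t} (?g t))"
    using duhamel_fourier[OF st(2), of \<xi>] split shift by simp
  then show ?thesis
    unfolding duhamel_fourier[OF st(1), of \<xi>] by (simp add: right_diff_distrib)
qed

text \<open>
  The free evolution has modulus one.  Undoing it turns \<open>u^(\<tau>)\<close> into a function of \<open>\<tau>\<close> with the same
  modulus, whose derivative is the nonlinearity alone, multiplied by a factor of modulus one.
\<close>

lemma square_cmod_fhat_u:
  assumes t: "t \<in> {0..T}"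
  shows "(cmod (fhat (u t) \<xi>))\<^sup>2 - (cmod (fhat (u 0) \<xi>))\<^sup>2 = - 2 * Re (integral {0..t} (\<lambda>\<tau>. fhat (u \<tau>) \<xi> * cnj (Fh \<tau> \<xi>)))"
proof -
  have sub: "{0..t} \<subseteq> {0..T}" using t by auto
  let ?q = "\<lambda>\<tau>. P (0 - \<tau>) \<xi> * Fh \<tau> \<xi>"
  define Q where "Q \<tau> = fhat (u 0) \<xi> - integral {0..\<tau>} ?q" for \<tau>
  have Q: "Q \<tau> = P (- \<tau>) \<xi> * fhat (u \<tau>) \<xi>" if "\<tau> \<in> {0..T}" for \<tau>
  proof -
    have "P (- \<tau>) \<xi> * P \<tau> \<xi> = 1" using propagator_symbol_add[of k "- \<tau>" \<tau> \<xi>] by simp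
    moreover have "P (- \<tau>) \<xi> * integral {0..\<tau>} (\<lambda>\<sigma>. P (\<tau> - \<sigma>) \<xi> * Fh \<sigma> \<xi>) = integral {0..\<tau>} ?q"
    proof -
      have "?q \<sigma> = P (- \<tau>) \<xi> * (P (\<tau> - \<sigma>) \<xi> * Fh \<sigma> \<xi>)" for \<sigma>
        using propagator_symbol_add[of k "- \<tau>" "\<tau> - \<sigma>" \<xi>] by simp
      then have "?q = (\<lambda>\<sigma>. P (- \<tau>) \<xi> * (P (\<tau> - \<sigma>) \<xi> * Fh \<sigma> \<xi>))" by (rule ext)
      then show ?thesis by (simp only: integral_mult_right)
    qed
    ultimately show ?thesis
      unfolding Q_def duhamel_fourier[OF that, of \<xi>] by (simp add: right_diff_distrib mult.assoc[symmetric])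
  qed
  have dQ: "(Q has_vector_derivative - ?q \<tau>) (at \<tau> within {0..t})" if "\<tau> \<in> {0..t}" for \<tau>
  proof -
    have "((\<lambda>\<tau>. integral {0..\<tau>} ?q) has_vector_derivative ?q \<tau>) (at \<tau> within {0..t})"
      by (rule integral_has_vector_derivative[OF continuous_on_duhamel_integrand[OF sub] that])
    from has_vector_derivative_diff[OF has_vector_derivative_const[of "fhat (u 0) \<xi>"] this]
    show ?thesis by (simp add: Q_def[abs_def])
  qed
  have "((\<lambda>\<tau>. Q \<tau> \<bullet> Q \<tau>) has_vector_derivative - 2 * Re (fhat (u \<tau>) \<xi> * cnj (Fh \<tau> \<xi>))) (at \<tau> within {0..t})"
    if \<tau>: "\<tau> \<in> {0..t}" for \<tau>
  proof -
    have "((\<lambda>\<tau>. Q \<tau> \<bullet> Q \<tau>) has_vector_derivative Q \<tau> \<bullet> (- ?q \<tau>) + (- ?q \<tau>) \<bullet> Q \<tau>) (at \<tau> within {0..t})"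
      by (rule bounded_bilinear.has_vector_derivative[OF bounded_bilinear_inner dQ[OF \<tau>] dQ[OF \<tau>]])
    moreover have "Q \<tau> \<bullet> (- ?q \<tau>) + (- ?q \<tau>) \<bullet> Q \<tau> = - 2 * Re (fhat (u \<tau>) \<xi> * cnj (Fh \<tau> \<xi>))"
    proof -
      have inner: "x \<bullet> y = Re (x * cnj y)" for x y :: complex by (simp add: inner_complex_def)
      have "P (- \<tau>) \<xi> * cnj (P (- \<tau>) \<xi>) = 1"
        using propagator_symbol_cnj_mult[of k "- \<tau>" \<xi>] by (simp add: mult.commute)
      then have "P (- \<tau>) \<xi> * fhat (u \<tau>) \<xi> * cnj (P (- \<tau>) \<xi> * Fh \<tau> \<xi>) = fhat (u \<tau>) \<xi> * cnj (Fh \<tau> \<xi>)"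
        by (simp add: mult_ac)
      then have "Q \<tau> \<bullet> ?q \<tau> = Re (fhat (u \<tau>) \<xi> * cnj (Fh \<tau> \<xi>))"
      proof -
        have "Q \<tau> = P (- \<tau>) \<xi> * fhat (u \<tau>) \<xi>" by (rule Q) (use \<tau> sub in auto)
        moreover have "?q \<tau> = P (- \<tau>) \<xi> * Fh \<tau> \<xi>" by simp
        ultimately show ?thesis
          using \<open>P (- \<tau>) \<xi> * fhat (u \<tau>) \<xi> * cnj (P (- \<tau>) \<xi> * Fh \<tau> \<xi>) = fhat (u \<tau>) \<xi> * cnj (Fh \<tau> \<xi>)\<close>
          by (simp only: inner)
      qed
      then show ?thesis by (simp add: inner_commute)
    qed
    ultimately show ?thesis by simp
  qed
  then have "((\<lambda>\<tau>. - 2 * Re (fhat (u \<tau>) \<xi> * cnj (Fh \<tau> \<xi>))) has_integral Q t \<bullet> Q t - Q 0 \<bullet> Q 0) {0..t}"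
    using t by (intro fundamental_theorem_of_calculus) auto
  moreover have "((\<lambda>\<tau>. - 2 * Re (fhat (u \<tau>) \<xi> * cnj (Fh \<tau> \<xi>))) has_integral
      - 2 * Re (integral {0..t} (\<lambda>\<tau>. fhat (u \<tau>) \<xi> * cnj (Fh \<tau> \<xi>)))) {0..t}"
  proof -
    have "(\<lambda>\<tau>. fhat (u \<tau>) \<xi> * cnj (Fh \<tau> \<xi>)) integrable_on {0..t}"
      by (intro integrable_continuous_real continuous_intros continuous_on_Fh_time continuous_on_fhat_u_time sub)
    from has_integral_linear[OF integrable_integral[OF this] bounded_linear_Re]
    show ?thesis unfolding comp_def by (rule has_integral_mult_right)
  qed
  ultimately have "Q t \<bullet> Q t - Q 0 \<bullet> Q 0 = - 2 * Re (integral {0..t} (\<lambda>\<tau>. fhat (u \<tau>) \<xi> * cnj (Fh \<tau> \<xi>)))"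
    by (rule has_integral_unique)
  moreover have "Q t \<bullet> Q t = (cmod (fhat (u t) \<xi>))\<^sup>2" "Q 0 \<bullet> Q 0 = (cmod (fhat (u 0) \<xi>))\<^sup>2"
    using Q[OF t] Q[of 0] T by (auto simp: power2_norm_eq_inner[symmetric] norm_mult)
  ultimately show ?thesis by simp
qed

text \<open>
  Integrate the previous identity over \<open>\<xi>\<close> and exchange the integrals.  By Plancherel the inner
  integral becomes \<open>\<integral> u\<^sup>2 \<partial>\<^sub>k u = 0\<close>.
\<close>

theorem square_integral_conserved:
  assumes t: "t \<in> {0..T}"
  shows "square_integral (u t) = square_integral (u 0)"
proof -
  have sub: "\<tau> \<in> {0..T}" if "\<tau> \<in> {0..t}" for \<tau> using that t by auto
  have 0: "0 \<in> {0..T}" using T by simp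
  have d: "DIM(real^'d) \<ge> 2" using dim by simp
  obtain B where B: "B \<ge> 0" "\<forall>t\<in>{0..T}. Z_form (u t) \<le> B" using Z_form_bounded by blast
  let ?g = "\<lambda>\<tau> \<xi>. fhat (u \<tau>) \<xi> * cnj (Fh \<tau> \<xi>)"
  let ?C = "sqrt 2 * sqrt (LINT x|lborel. decay_weight (x::real^'d)) * sqrt B"
  have reg: "integrable lborel (u \<tau>)" "integrable lborel (fhat (u \<tau>))" "square_integrable (fhat (u \<tau>))"
    if "\<tau> \<in> {0..T}" for \<tau>
    using Z_regular_imp_fourier_regular[OF Z_reg[OF that]] square_integrable_fhat_if_integrable_fhat[of "u \<tau>"]
    by (auto simp: fourier_regular_def)
  have Fh_le: "cmod (Fh \<tau> \<xi>) \<le> 3 * B" if "\<tau> \<in> {0..T}" for \<tau> \<xi>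
    using cmod_Fh_le[OF that, of \<xi>] bspec[OF B(2) that] by linarith
  have le: "cmod (?g \<tau> \<xi>) \<le> 3 * B * ((1 + norm \<xi>) * cmod (fhat (u \<tau>) \<xi>))" if "\<tau> \<in> {0..T}" for \<tau> \<xi>
  proof -
    have "cmod (?g \<tau> \<xi>) \<le> cmod (fhat (u \<tau>) \<xi>) * (3 * B)"
      unfolding norm_mult complex_mod_cnj by (intro mult_left_mono Fh_le that) auto
    also have "\<dots> \<le> ((1 + norm \<xi>) * cmod (fhat (u \<tau>) \<xi>)) * (3 * B)"
      using B(1) by (intro mult_right_mono) (auto simp: algebra_simps)
    finally show ?thesis by (simp only: mult.commute)
  qed
  have ig: "integrable lborel (\<lambda>\<xi>. 3 * B * ((1 + norm \<xi>) * cmod (fhat (u \<tau>) \<xi>)))" if "\<tau> \<in> {0..T}" for \<tau>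
    by (intro integrable_mult_right Z_regular_fhat(1) Z_reg that)
  have int: "integrable (lborel \<Otimes>\<^sub>M lborel) (\<lambda>(\<tau>, \<xi>). indicator {0..t} \<tau> *\<^sub>R ?g \<tau> \<xi>)"
  proof (rule integrable_time_space)
    have c: "continuous_on ({0..t} \<times> UNIV) (\<lambda>p. fhat (u (fst p)) (snd p))" "continuous_on ({0..t} \<times> UNIV) (\<lambda>p. Fh (fst p) (snd p))"
    proof -
      have s: "{0..t} \<times> UNIV \<subseteq> {0..T} \<times> (UNIV :: (real^'d) set)" using t by auto
      show "continuous_on ({0..t} \<times> UNIV) (\<lambda>p. fhat (u (fst p)) (snd p))" "continuous_on ({0..t} \<times> UNIV) (\<lambda>p. Fh (fst p) (snd p))"
        using continuous_on_subset[OF continuous_on_fhat_u s] continuous_on_subset[OF continuous_on_Fh s]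
        by (simp_all add: case_prod_unfold)
    qed
    show "continuous_on ({0..t} \<times> UNIV) (\<lambda>(\<tau>, \<xi>). ?g \<tau> \<xi>)"
      unfolding case_prod_unfold by (intro continuous_on_mult continuous_on_cnj c)
    fix \<tau> assume \<tau>: "\<tau> \<in> {0..t}"
    have [measurable]: "fhat (u \<tau>) \<in> borel_measurable borel" "Fh \<tau> \<in> borel_measurable borel"
      by (intro borel_measurable_fhat_u borel_measurable_Fh sub \<tau>)+
    show "integrable lborel (?g \<tau>)"
    proof (rule Bochner_Integration.integrable_bound[OF ig[OF sub[OF \<tau>]]])
      have "(\<lambda>\<xi>. cnj (Fh \<tau> \<xi>)) \<in> borel_measurable borel"
        by (intro borel_measurable_continuous_on[where f=cnj]) (auto intro: continuous_intros)
      then show "?g \<tau> \<in> borel_measurable lborel" by simp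
    qed (use le[OF sub[OF \<tau>]] in \<open>auto intro: order_trans[OF _ abs_ge_self]\<close>)
    have "(LINT \<xi>|lborel. cmod (?g \<tau> \<xi>)) \<le> (LINT \<xi>|lborel. 3 * B * ((1 + norm \<xi>) * cmod (fhat (u \<tau>) \<xi>)))"
      by (rule integral_mono_AE'[OF ig[OF sub[OF \<tau>]]]) (use le[OF sub[OF \<tau>]] order_trans[OF norm_ge_zero le[OF sub[OF \<tau>]]] in auto)
    also have "\<dots> = 3 * B * (LINT \<xi>|lborel. (1 + norm \<xi>) * cmod (fhat (u \<tau>) \<xi>))" by simp
    also have "\<dots> \<le> 3 * B * ?C"
    proof (rule mult_left_mono)
      have "(LINT \<xi>|lborel. (1 + norm \<xi>) * cmod (fhat (u \<tau>) \<xi>)) \<le> sqrt 2 * sqrt (LINT x|lborel. decay_weight (x::real^'d)) * sqrt (Z_form (u \<tau>))"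
        by (rule Z_regular_fhat(2)[OF Z_reg[OF sub[OF \<tau>]]])
      also have "\<dots> \<le> ?C"
        using bspec[OF B(2) sub[OF \<tau>]] by (intro mult_left_mono mult_nonneg_nonneg) (auto simp: integral_decay_weight_nonneg)
      finally show "(LINT \<xi>|lborel. (1 + norm \<xi>) * cmod (fhat (u \<tau>) \<xi>)) \<le> ?C" .
    qed (use B in auto)
    finally show "(LINT \<xi>|lborel. cmod (?g \<tau> \<xi>)) \<le> 3 * B * ?C" .
  qed
  have zero: "(LINT \<xi>|lborel. ?g \<tau> \<xi>) = 0" if \<tau>: "\<tau> \<in> {0..T}" for \<tau>
  proof -
    have "(LINT x|lborel. complex_of_real (u \<tau> x) * cnj (complex_of_real (advection e1 (u \<tau>) x)))
        = complex_of_real ((1 / (2 * pi)) ^ DIM(real^'d)) * (LINT \<xi>|lborel. ?g \<tau> \<xi>)"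
      unfolding fhat_def
      by (rule plancherel) (use reg[OF \<tau>] integrable_advection[OF e1 Z_reg[OF \<tau>]] in \<open>auto simp: fhat_def\<close>)
    also have "(LINT x|lborel. complex_of_real (u \<tau> x) * cnj (complex_of_real (advection e1 (u \<tau>) x)))
        = complex_of_real (LINT x|lborel. u \<tau> x * advection e1 (u \<tau>) x)"
      unfolding integral_complex_of_real[symmetric] by (intro Bochner_Integration.integral_cong refl) simp
    also have "\<dots> = 0" using integral_mult_advection[OF e1 Z_reg[OF \<tau>] d] by simp
    finally show ?thesis by simp
  qed
  have cont: "continuous_on {0..t} (\<lambda>\<tau>. ?g \<tau> \<xi>)" for \<xi>
    by (intro continuous_intros continuous_on_Fh_time continuous_on_fhat_u_time) (use t in auto)
  let ?I = "\<lambda>\<xi>. LINT \<tau>|lborel. indicator {0..t} \<tau> *\<^sub>R ?g \<tau> \<xi>"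
  have I: "integrable lborel ?I" by (rule lborel_pair.integrable_snd[OF int])
  have "(LINT \<xi>|lborel. ?I \<xi>) = (LINT \<tau>|lborel. LINT \<xi>|lborel. indicator {0..t} \<tau> *\<^sub>R ?g \<tau> \<xi>)"
    by (rule lborel_pair.Fubini_integral[OF int])
  also have "\<dots> = 0"
  proof (rule integral_eq_zero_AE, rule AE_I2)
    fix \<tau>
    show "(LINT \<xi>|lborel. indicator {0..t} \<tau> *\<^sub>R ?g \<tau> \<xi>) = 0"
      using zero[OF sub] by (cases "\<tau> \<in> {0..t}") auto
  qed
  finally have "(LINT \<xi>|lborel. Re (?I \<xi>)) = 0" using integral_Re[OF I] by simp
  moreover have "square_integral (fhat (u t)) - square_integral (fhat (u 0)) = (LINT \<xi>|lborel. - 2 * Re (?I \<xi>))"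
  proof -
    have "square_integral (fhat (u t)) - square_integral (fhat (u 0)) = (LINT \<xi>|lborel. (cmod (fhat (u t) \<xi>))\<^sup>2 - (cmod (fhat (u 0) \<xi>))\<^sup>2)"
      using reg(3)[OF t] reg(3)[OF 0] unfolding square_integral_def square_integrable_def
      by (intro Bochner_Integration.integral_diff[symmetric]) auto
    also have "\<dots> = (LINT \<xi>|lborel. - 2 * Re (?I \<xi>))"
      unfolding square_cmod_fhat_u[OF t] integral_eq_lebesgue_Icc(2)[OF cont] ..
    finally show ?thesis .
  qed
  ultimately have "square_integral (fhat (u t)) = square_integral (fhat (u 0))" by simp
  then show ?thesis
    using square_integral_eq_fhat[OF reg(1,2)[OF t]] square_integral_eq_fhat[OF reg(1,2)[OF 0]] by simp
qed

end

section \<open>Cancelling Gaussian means\<close>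

text \<open>
  The weights \<open>-7, 14, -9, 2\<close> are, up to a common factor, those of the divided difference of order
  three in the variable \<open>j\<^sup>2\<close> at the nodes \<open>1, 4, 9, 16\<close>.  They therefore annihilate the powers
  \<open>j\<^sup>0\<close>, \<open>j\<^sup>2\<close>, \<open>j\<^sup>4\<close>, but not the odd power \<open>j\<^sup>3\<close>, for which the weighted sum is \<open>-10\<close>.
  Accordingly \<open>cancelling_symbol\<close> vanishes to order six at the origin, whereas the combination of
  means detects functions that are homogeneous of degree three.
\<close>

definition gaussian_mean :: "('a::euclidean_space \<Rightarrow> complex) \<Rightarrow> real \<Rightarrow> complex" where
  "gaussian_mean H b = (LINT z|lborel. H (b *\<^sub>R z) * complex_of_real (gauss z))"

definition cancelling_mean :: "('a::euclidean_space \<Rightarrow> complex) \<Rightarrow> real \<Rightarrow> complex" where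
  "cancelling_mean H b = - 7 * gaussian_mean H b + 14 * gaussian_mean H (2 * b)
     - 9 * gaussian_mean H (3 * b) + 2 * gaussian_mean H (4 * b)"

definition cancelling_symbol :: "real \<Rightarrow> real" where
  "cancelling_symbol s = - 7 * exp (- s\<^sup>2 / 2) + 14 * exp (- (2 * s)\<^sup>2 / 2)
     - 9 * exp (- (3 * s)\<^sup>2 / 2) + 2 * exp (- (4 * s)\<^sup>2 / 2)"

lemma continuous_on_cancelling_symbol [continuous_intros]:
  "continuous_on S f \<Longrightarrow> continuous_on S (\<lambda>x. cancelling_symbol (f x))"
  unfolding cancelling_symbol_def by (intro continuous_intros) auto

lemma borel_measurable_cancelling_symbol [measurable]: "cancelling_symbol \<in> borel_measurable borel"
  by (intro borel_measurable_continuous_onI continuous_on_cancelling_symbol continuous_on_id)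

lemma abs_cancelling_symbol_le: "\<bar>cancelling_symbol s\<bar> \<le> 32"
proof -
  have b: "0 \<le> exp (- x\<^sup>2 / 2) \<and> exp (- x\<^sup>2 / 2) \<le> (1::real)" for x :: real by simp
  show ?thesis
    unfolding cancelling_symbol_def using b[of s] b[of "2 * s"] b[of "3 * s"] b[of "4 * s"] by linarith
qed

text \<open>In terms of \<open>y = exp (- s\<^sup>2 / 2)\<close> the symbol is a polynomial with a triple zero at \<open>y = 1\<close>.\<close>

lemma abs_cancelling_symbol_le_power: "\<bar>cancelling_symbol s\<bar> \<le> 420 * s ^ 6"
proof -
  define y where "y = exp (- s\<^sup>2 / 2)"
  have y: "0 < y" "y \<le> 1" by (auto simp: y_def)
  have pow: "exp (- (real n * s)\<^sup>2 / 2) = y ^ (n\<^sup>2)" for n :: nat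
    by (simp add: y_def exp_of_nat_mult[symmetric] power_mult_distrib)
  \<comment> \<open>The cofactor of the triple zero has positive coefficients, whose sum is \<open>420\<close>.\<close>
  define q where "q = 7 + 21 * y + 42 * y^2 + 56 * y^3 + 63 * y^4 + 63 * y^5 + 56 * y^6 + 42 * y^7
    + 30 * y^8 + 20 * y^9 + 12 * y^10 + 6 * y^11 + 2 * y^12"
  have "cancelling_symbol s = - 7 * y + 14 * y ^ 4 - 9 * y ^ 9 + 2 * y ^ 16"
    using pow[of 1] pow[of 2] pow[of 3] pow[of 4] by (simp add: cancelling_symbol_def)
  also have "\<dots> = - (y * (1 - y) ^ 3 * q)"
    unfolding q_def by algebra
  finally have eq: "cancelling_symbol s = - (y * (1 - y) ^ 3 * q)" .
  have q: "0 \<le> q" "q \<le> 420"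
  proof -
    have p: "0 \<le> y ^ n" "y ^ n \<le> 1" for n using y by (auto intro: power_le_one)
    show "0 \<le> q" unfolding q_def using y by (intro add_nonneg_nonneg mult_nonneg_nonneg p) auto
    show "q \<le> 420" unfolding q_def
      using y(2) p(2)[of 2] p(2)[of 3] p(2)[of 4] p(2)[of 5] p(2)[of 6] p(2)[of 7] p(2)[of 8] p(2)[of 9] p(2)[of 10] p(2)[of 11] p(2)[of 12]
      by linarith
  qed
  have "1 - y \<le> s\<^sup>2 / 2"
    using exp_ge_add_one_self[of "- s\<^sup>2 / 2"] by (simp add: y_def)
  also have "\<dots> \<le> s\<^sup>2" by simp
  finally have "(1 - y) ^ 3 \<le> (s\<^sup>2) ^ 3" using y by (intro power_mono) auto
  then have "(1 - y) ^ 3 \<le> s ^ 6" by (simp add: power_mult[symmetric])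
  then have "y * (1 - y) ^ 3 * q \<le> 1 * s ^ 6 * 420"
    using y q by (intro mult_mono) auto
  moreover have "0 \<le> y * (1 - y) ^ 3 * q" using y q by (intro mult_nonneg_nonneg) auto
  ultimately show ?thesis by (simp add: eq)
qed

text \<open>
  The zero of order six at the origin makes the left-hand side \<open>O(|y|\<^bsup>12\<^esup>)\<close>, which is enough for
  \<open>|y|\<^bsup>d + 6\<^esup>\<close> as long as \<open>d \<le> 6\<close>.
\<close>

lemma cancelling_symbol_le_decay:
  fixes y :: "'a::euclidean_space"
  assumes d: "DIM('a) \<le> 6"
  shows "(cancelling_symbol (norm y))\<^sup>2 \<le> 420\<^sup>2 * 2 ^ DIM('a) * (norm y ^ (DIM('a) + 6) * decay_weight y)"
proof -
  let ?n = "norm y" and ?D = "DIM('a)"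
  have p: "(1 + ?n\<^sup>2) > 0" by (simp add: add_pos_nonneg)
  have key: "(cancelling_symbol ?n)\<^sup>2 * (1 + ?n\<^sup>2) ^ ?D \<le> 420\<^sup>2 * 2 ^ ?D * ?n ^ (?D + 6)"
  proof (cases "?n \<le> 1")
    case True
    have "(1 + ?n\<^sup>2) ^ ?D \<le> 2 ^ ?D" using True by (intro power_mono) (auto simp: power_le_one)
    moreover have "(cancelling_symbol ?n)\<^sup>2 \<le> 420\<^sup>2 * ?n ^ (?D + 6)"
    proof -
      have "(cancelling_symbol ?n)\<^sup>2 \<le> (420 * ?n ^ 6)\<^sup>2"
        using power_mono[OF abs_cancelling_symbol_le_power[of ?n] abs_ge_zero, of 2] by simp
      also have "\<dots> = 420\<^sup>2 * ?n ^ 12" by (simp add: power_mult_distrib power_mult[symmetric])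
      also have "\<dots> \<le> 420\<^sup>2 * ?n ^ (?D + 6)" using True d by (intro mult_left_mono power_decreasing) auto
      finally show ?thesis .
    qed
    ultimately have "(cancelling_symbol ?n)\<^sup>2 * (1 + ?n\<^sup>2) ^ ?D \<le> (420\<^sup>2 * ?n ^ (?D + 6)) * 2 ^ ?D"
      using p by (intro mult_mono) auto
    then show ?thesis by (simp only: mult_ac)
  next
    case False
    then have n1: "1 \<le> ?n" by simp
    have "(1 + ?n\<^sup>2) ^ ?D \<le> (2 * ?n\<^sup>2) ^ ?D" using n1 by (intro power_mono) (auto simp: one_le_power)
    also have "\<dots> = 2 ^ ?D * ?n ^ (2 * ?D)" by (simp add: power_mult_distrib power_mult)
    also have "\<dots> \<le> 2 ^ ?D * ?n ^ (?D + 6)" using n1 d by (intro mult_left_mono power_increasing) auto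
    finally have 1: "(1 + ?n\<^sup>2) ^ ?D \<le> 2 ^ ?D * ?n ^ (?D + 6)" .
    have 2: "(cancelling_symbol ?n)\<^sup>2 \<le> 420\<^sup>2"
      using power_mono[OF abs_cancelling_symbol_le[of ?n] abs_ge_zero, of 2] by simp
    have "(cancelling_symbol ?n)\<^sup>2 * (1 + ?n\<^sup>2) ^ ?D \<le> 420\<^sup>2 * (2 ^ ?D * ?n ^ (?D + 6))"
      using p by (intro mult_mono 1 2) auto
    then show ?thesis by (simp only: mult_ac)
  qed
  then have "(cancelling_symbol ?n)\<^sup>2 \<le> 420\<^sup>2 * 2 ^ ?D * ?n ^ (?D + 6) / (1 + ?n\<^sup>2) ^ ?D"
    using p by (simp add: pos_le_divide_eq)
  then show ?thesis by (simp add: decay_weight_def)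
qed

lemma cancelling_mean_fourier:
  fixes f :: "'a::euclidean_space \<Rightarrow> complex"
  assumes f: "integrable lborel f"
  shows "cancelling_mean (fourier f) b = (LINT x|lborel. f x * complex_of_real (cancelling_symbol (b * norm x)))"
proof -
  have [measurable]: "f \<in> borel_measurable borel" using f by auto
  have m: "gaussian_mean (fourier f) c = (LINT x|lborel. f x * complex_of_real (exp (- (c * norm x)\<^sup>2 / 2)))" for c
    unfolding gaussian_mean_def using integral_fourier_gauss[OF f, of 0 c] by (simp add: power_mult_distrib)
  have i: "integrable lborel (\<lambda>x. f x * complex_of_real (exp (- (c * norm x)\<^sup>2 / 2)))" for c
    by (rule Bochner_Integration.integrable_bound[OF f]) (auto simp: norm_mult intro!: mult_left_le)
  let ?h = "\<lambda>c x. f x * complex_of_real (exp (- (c * norm x)\<^sup>2 / 2))"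
  have "cancelling_mean (fourier f) b = (LINT x|lborel. - 7 * ?h b x + 14 * ?h (2 * b) x - 9 * ?h (3 * b) x + 2 * ?h (4 * b) x)"
    unfolding cancelling_mean_def m using i by (simp only: Bochner_Integration.integral_add Bochner_Integration.integral_diff
        Bochner_Integration.integrable_add Bochner_Integration.integrable_diff integrable_mult_right integral_mult_right_zero)
  also have "\<dots> = (LINT x|lborel. f x * complex_of_real (cancelling_symbol (b * norm x)))"
    by (intro Bochner_Integration.integral_cong refl) (simp add: cancelling_symbol_def algebra_simps)
  finally show ?thesis .
qed

lemma abs_cancelling_symbol_le_cube:
  assumes "s \<ge> 0"
  shows "\<bar>cancelling_symbol s\<bar> \<le> 420 * s ^ 3"
proof (cases "s \<le> 1")
  case True
  have "s ^ 6 \<le> s ^ 3" using assms True by (intro power_decreasing) auto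
  then show ?thesis using abs_cancelling_symbol_le_power[of s] by linarith
next
  case False
  then have "1 \<le> s ^ 3" by (intro one_le_power) auto
  then show ?thesis using abs_cancelling_symbol_le[of s] by linarith
qed

text \<open>
  With three moments the function \<open>f\<close> dominates its product with \<open>cancelling_symbol (b |x|) / b\<^sup>3\<close> up to the
  factor \<open>|x|\<^sup>3\<close>, while the zero of order six makes this product tend to zero pointwise.
\<close>

lemma
  fixes f :: "'a::euclidean_space \<Rightarrow> real"
  assumes f: "integrable lborel f" and f3: "integrable lborel (\<lambda>x. (1 + norm x ^ 3) * \<bar>f x\<bar>)"
  shows cancelling_mean_fhat_le: "b > 0 \<Longrightarrow> cmod (cancelling_mean (fhat f) b / complex_of_real (b ^ 3)) \<le> 420 * (LINT x|lborel. (1 + norm x ^ 3) * \<bar>f x\<bar>)"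
    and cancelling_mean_fhat_tendsto: "e \<longlonglongrightarrow> 0 \<Longrightarrow> (\<And>n. e n > 0) \<Longrightarrow>
      (\<lambda>n. cancelling_mean (fhat f) (e n) / complex_of_real (e n ^ 3)) \<longlonglongrightarrow> 0"
proof -
  have [measurable]: "f \<in> borel_measurable borel" using f by auto
  have fc: "integrable lborel (\<lambda>x. complex_of_real (f x))" using f by simp
  let ?k = "\<lambda>b x. complex_of_real (f x) * complex_of_real (cancelling_symbol (b * norm x)) / complex_of_real (b ^ 3)"
  have eq: "cancelling_mean (fhat f) b / complex_of_real (b ^ 3) = (LINT x|lborel. ?k b x)" for b
    unfolding fhat_def cancelling_mean_fourier[OF fc] by (simp add: integral_divide_zero)
  have le: "cmod (?k b x) \<le> 420 * ((1 + norm x ^ 3) * \<bar>f x\<bar>)" if b: "b > 0" for b x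
  proof -
    have "\<bar>cancelling_symbol (b * norm x)\<bar> \<le> 420 * (b * norm x) ^ 3"
      using b by (intro abs_cancelling_symbol_le_cube) auto
    then have "\<bar>cancelling_symbol (b * norm x)\<bar> / b ^ 3 \<le> 420 * norm x ^ 3"
      using b by (simp add: divide_le_eq power_mult_distrib mult_ac)
    also have "\<dots> \<le> 420 * (1 + norm x ^ 3)" by simp
    finally have "\<bar>f x\<bar> * (\<bar>cancelling_symbol (b * norm x)\<bar> / b ^ 3) \<le> \<bar>f x\<bar> * (420 * (1 + norm x ^ 3))"
      by (rule mult_left_mono) simp
    then show ?thesis using b by (simp add: norm_mult norm_divide norm_power mult_ac)
  qed
  have i: "integrable lborel (\<lambda>x. 420 * ((1 + norm x ^ 3) * \<bar>f x\<bar>))" using f3 by (rule integrable_mult_right)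
  show "cmod (cancelling_mean (fhat f) b / complex_of_real (b ^ 3)) \<le> 420 * (LINT x|lborel. (1 + norm x ^ 3) * \<bar>f x\<bar>)" if b: "b > 0"
  proof -
    have "cmod (LINT x|lborel. ?k b x) \<le> (LINT x|lborel. cmod (?k b x))" by (rule integral_norm_bound)
    also have "\<dots> \<le> (LINT x|lborel. 420 * ((1 + norm x ^ 3) * \<bar>f x\<bar>))"
      by (rule integral_mono_AE'[OF i]) (use le[OF b] in auto)
    finally show ?thesis unfolding eq by simp
  qed
  show "(\<lambda>n. cancelling_mean (fhat f) (e n) / complex_of_real (e n ^ 3)) \<longlonglongrightarrow> 0" if e: "e \<longlonglongrightarrow> 0" "\<And>n. e n > 0"
  proof -
    have "(\<lambda>n. LINT x|lborel. ?k (e n) x) \<longlonglongrightarrow> (LINT x|lborel. (0::complex) * complex_of_real (f x))"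
    proof (rule integral_dominated_convergence[OF _ _ i])
      show "AE x in lborel. (\<lambda>n. ?k (e n) x) \<longlonglongrightarrow> 0 * complex_of_real (f x)"
      proof (rule AE_I2)
        fix x :: 'a
        show "(\<lambda>n. ?k (e n) x) \<longlonglongrightarrow> 0 * complex_of_real (f x)"
          unfolding mult_zero_left
        proof (rule Lim_null_comparison)
          show "\<forall>\<^sub>F n in sequentially. norm (?k (e n) x) \<le> \<bar>f x\<bar> * (420 * (e n ^ 3 * norm x ^ 6))"
          proof (intro always_eventually allI)
            fix n
            have "\<bar>cancelling_symbol (e n * norm x)\<bar> / e n ^ 3 \<le> 420 * (e n * norm x) ^ 6 / e n ^ 3"
              using e(2)[of n] abs_cancelling_symbol_le_power by (intro divide_right_mono) auto
            also have "\<dots> = 420 * (e n ^ 3 * norm x ^ 6)"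
              using e(2)[of n] by (simp add: power_mult_distrib field_simps flip: power_add)
            finally have "\<bar>f x\<bar> * (\<bar>cancelling_symbol (e n * norm x)\<bar> / e n ^ 3) \<le> \<bar>f x\<bar> * (420 * (e n ^ 3 * norm x ^ 6))"
              by (rule mult_left_mono) simp
            then show "norm (?k (e n) x) \<le> \<bar>f x\<bar> * (420 * (e n ^ 3 * norm x ^ 6))"
              using e(2)[of n] by (simp add: norm_mult norm_divide norm_power)
          qed
          have "(\<lambda>n. \<bar>f x\<bar> * (420 * (e n ^ 3 * norm x ^ 6))) \<longlonglongrightarrow> \<bar>f x\<bar> * (420 * (0 ^ 3 * norm x ^ 6))"
            by (intro tendsto_intros e)
          then show "(\<lambda>n. \<bar>f x\<bar> * (420 * (e n ^ 3 * norm x ^ 6))) \<longlonglongrightarrow> 0" by simp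
        qed
      qed
      show "AE x in lborel. norm (?k (e n) x) \<le> 420 * ((1 + norm x ^ 3) * \<bar>f x\<bar>)" for n
        using le[OF e(2)] by auto
    qed measurable
    then show ?thesis unfolding eq by simp
  qed
qed

text \<open>
  The weight \<open>|x|\<close> to the power \<open>d/2 + 3\<close> is exactly critical: after division by \<open>b\<^sup>3\<close> the
  Cauchy--Schwarz bound is uniform in \<open>b\<close>, and it tends to zero because the kernels lose their mass
  on every ball, whereas the function has little mass outside a large ball.
\<close>

lemma cancelling_mean_weighted_tendsto:
  fixes f :: "'a::euclidean_space \<Rightarrow> real"
  assumes f: "integrable lborel f" and g: "square_integrable (\<lambda>x. norm x powr (real DIM('a) / 2 + 3) * f x)"
    and d: "DIM('a) \<le> 6" and e: "e \<longlonglongrightarrow> 0" "\<And>n. e n > 0"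
  shows "(\<lambda>n. cancelling_mean (fhat f) (e n) / complex_of_real (e n ^ 3)) \<longlonglongrightarrow> 0"
proof -
  have [measurable]: "f \<in> borel_measurable borel" using f by auto
  have fc: "integrable lborel (\<lambda>x. complex_of_real (f x))" using f by simp
  define g where "g x = norm x powr (real DIM('a) / 2 + 3) * f x" for x
  have g: "square_integrable g" using g by (simp add: g_def[abs_def])
  have [measurable]: "g \<in> borel_measurable borel" by (rule square_integrable_measurable[OF g])
  define C where "C = (420\<^sup>2 * 2 ^ DIM('a) :: real)"
  have C: "C > 0" by (simp add: C_def)
  have [measurable]: "(decay_weight :: 'a \<Rightarrow> real) \<in> borel_measurable borel"
    using integrable_decay_weight[where 'a='a] by auto
  \<comment> \<open>The square of \<open>\<kappa> b\<close> is a fixed integrable profile rescaled to width \<open>1/b\<close>: its integral is independent of \<open>b\<close>.\<close>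
  define \<kappa> where "\<kappa> b x = sqrt (C * (b ^ DIM('a) * decay_weight (b *\<^sub>R x)))" for b and x :: 'a
  have \<kappa>2: "(norm (\<kappa> b x))\<^sup>2 = C * (b ^ DIM('a) * decay_weight (b *\<^sub>R x))" if "b > 0" for b x
    using C that decay_weight_pos[of "b *\<^sub>R x"] by (simp add: \<kappa>_def)
  define c where "c = (LINT x|lborel. decay_weight (x::'a))"
  have c: "c \<ge> 0" unfolding c_def by (rule integral_decay_weight_nonneg)
  have [measurable]: "\<kappa> b \<in> borel_measurable borel" for b unfolding \<kappa>_def[abs_def] by measurable
  have \<kappa>: "square_integrable (\<kappa> b)" "square_integral (\<kappa> b) = C * c" if b: "b > 0" for b
  proof -
    have "integrable lborel (\<lambda>x::'a. decay_weight (b *\<^sub>R x))"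
      using integrable_lborel_affine[OF _ integrable_decay_weight[where 'a='a], of b 0] b by simp
    then show "square_integrable (\<kappa> b)"
      unfolding square_integrable_def \<kappa>2[OF b] by simp
    have "c = b ^ DIM('a) * (LINT x|lborel. decay_weight (b *\<^sub>R x::'a))"
      unfolding c_def using b by (subst integral_lborel_affine[of b _ 0]) auto
    then show "square_integral (\<kappa> b) = C * c"
      unfolding square_integral_def \<kappa>2[OF b] by simp
  qed
  have pw: "\<bar>f x\<bar> * (\<bar>cancelling_symbol (b * norm x)\<bar> / b ^ 3) \<le> \<bar>g x\<bar> * \<kappa> b x" if b: "b > 0" for b x
  proof -
    have k0: "0 \<le> \<kappa> b x" using C b decay_weight_pos[of "b *\<^sub>R x"] by (simp add: \<kappa>_def)
    have w: "(norm x powr (real DIM('a) / 2 + 3))\<^sup>2 = norm x ^ (DIM('a) + 6)"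
    proof (cases "x = 0")
      case False
      have "(norm x powr (real DIM('a) / 2 + 3))\<^sup>2 = norm x powr (real (DIM('a) + 6))"
      proof -
        have "real DIM('a) / 2 + 3 + (real DIM('a) / 2 + 3) = real (DIM('a) + 6)" by simp
        then show ?thesis unfolding power2_eq_square powr_add[symmetric] by (simp only:)
      qed
      also have "\<dots> = norm x ^ (DIM('a) + 6)" using False by (intro powr_realpow) simp
      finally show ?thesis .
    qed simp
    have "(\<bar>cancelling_symbol (b * norm x)\<bar> / b ^ 3)\<^sup>2 = (cancelling_symbol (norm (b *\<^sub>R x)))\<^sup>2 / b ^ 6"
      using b by (simp add: power_divide power_mult[symmetric])
    also have "\<dots> \<le> (420\<^sup>2 * 2 ^ DIM('a) * (norm (b *\<^sub>R x) ^ (DIM('a) + 6) * decay_weight (b *\<^sub>R x))) / b ^ 6"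
      using cancelling_symbol_le_decay[OF d, of "b *\<^sub>R x"] b by (intro divide_right_mono) auto
    also have "\<dots> = norm x ^ (DIM('a) + 6) * (C * (b ^ DIM('a) * decay_weight (b *\<^sub>R x)))"
      using b by (simp add: C_def power_mult_distrib power_add)
    also have "\<dots> = (norm x powr (real DIM('a) / 2 + 3) * \<kappa> b x)\<^sup>2"
      using \<kappa>2[OF b, of x] w by (simp add: power_mult_distrib)
    finally have "\<bar>cancelling_symbol (b * norm x)\<bar> / b ^ 3 \<le> norm x powr (real DIM('a) / 2 + 3) * \<kappa> b x"
      by (rule power2_le_imp_le) (simp add: k0)
    then have "\<bar>f x\<bar> * (\<bar>cancelling_symbol (b * norm x)\<bar> / b ^ 3) \<le> \<bar>f x\<bar> * (norm x powr (real DIM('a) / 2 + 3) * \<kappa> b x)"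
      by (rule mult_left_mono) simp
    then show ?thesis by (simp add: g_def abs_mult mult_ac)
  qed
  define gN where "gN N x = (1 - indicator (cball 0 (real N)) x) * g x" for N and x
  have gN: "square_integrable (gN N)" for N
    by (rule square_integrable_bound[OF g]) (auto simp: gN_def[abs_def] indicator_def)
  have gN0: "(\<lambda>N. square_integral (gN N)) \<longlonglongrightarrow> 0"
  proof -
    have "(\<lambda>N. LINT x|lborel. (norm (gN N x))\<^sup>2) \<longlonglongrightarrow> (LINT x|lborel. 0 * (norm (g x))\<^sup>2)"
    proof (rule integral_dominated_convergence[where w="\<lambda>x. (norm (g x))\<^sup>2"])
      show "AE x in lborel. (\<lambda>N. (norm (gN N x))\<^sup>2) \<longlonglongrightarrow> 0 * (norm (g x))\<^sup>2"
      proof (rule AE_I2)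
        fix x :: 'a
        have "\<forall>\<^sub>F N in sequentially. (norm (gN N x))\<^sup>2 = 0 * (norm (g x))\<^sup>2"
          using eventually_norm_le_sequentially[of x] by eventually_elim (simp add: gN_def)
        then show "(\<lambda>N. (norm (gN N x))\<^sup>2) \<longlonglongrightarrow> 0 * (norm (g x))\<^sup>2" by (rule tendsto_eventually)
      qed
    qed (use g in \<open>auto simp: square_integrable_def gN_def indicator_def\<close>)
    then show ?thesis by (simp add: square_integral_def)
  qed
  define G where "G = square_integral g"
  have G: "G \<ge> 0" by (simp add: G_def)
  have bound: "cmod (cancelling_mean (fhat f) b / complex_of_real (b ^ 3))
      \<le> sqrt G * sqrt (C * (b ^ DIM('a) * measure lborel (cball (0::'a) (real N)))) + sqrt (square_integral (gN N)) * sqrt (C * c)"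
    if b: "b > 0" for b N
  proof -
    define \<kappa>N where "\<kappa>N x = indicator (cball 0 (real N)) x * \<kappa> b x" for x
    have \<kappa>N: "square_integrable \<kappa>N"
      by (rule square_integrable_bound[OF \<kappa>(1)[OF b]]) (auto simp: \<kappa>N_def[abs_def] indicator_def)
    have ib: "integrable lborel (\<lambda>x::'a. indicator (cball 0 (real N)) x * (C * b ^ DIM('a)))"
      using emeasure_lborel_cball_finite[of "0::'a" "real N"] by simp
    have \<kappa>N_le: "square_integral \<kappa>N \<le> C * (b ^ DIM('a) * measure lborel (cball (0::'a) (real N)))"
    proof -
      have "square_integral \<kappa>N \<le> (LINT x|lborel. indicator (cball (0::'a) (real N)) x * (C * b ^ DIM('a)))"
        unfolding square_integral_def
      proof (rule integral_mono_AE'[OF ib])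
        show "AE x in lborel. (norm (\<kappa>N x))\<^sup>2 \<le> indicator (cball 0 (real N)) x * (C * b ^ DIM('a))"
        proof (rule AE_I2)
          fix x :: 'a
          have "decay_weight (b *\<^sub>R x) \<le> 1"
            using one_le_power_one_plus[of "norm (b *\<^sub>R x)" "DIM('a)"] by (simp add: decay_weight_def divide_le_eq)
          then have "C * (b ^ DIM('a) * decay_weight (b *\<^sub>R x)) \<le> C * (b ^ DIM('a) * 1)"
            using C b by (intro mult_left_mono) auto
          then show "(norm (\<kappa>N x))\<^sup>2 \<le> indicator (cball 0 (real N)) x * (C * b ^ DIM('a))"
            using \<kappa>2[OF b, of x] by (simp add: \<kappa>N_def indicator_def)
        qed
      qed (use C b in auto)
      then show ?thesis by (simp add: mult_ac)
    qed
    have n: "square_integrable (\<lambda>x. norm (h x))" if "square_integrable h" for h :: "'a \<Rightarrow> real"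
      using that by (auto simp: square_integrable_def)
    have i1: "integrable lborel (\<lambda>x. norm (g x) * norm (\<kappa>N x))" and i2: "integrable lborel (\<lambda>x. norm (gN N x) * norm (\<kappa> b x))"
      by (intro square_integrable_mult n g \<kappa>N gN \<kappa>(1)[OF b])+
    let ?k = "\<lambda>x. complex_of_real (f x) * complex_of_real (cancelling_symbol (b * norm x)) / complex_of_real (b ^ 3)"
    have "cancelling_mean (fhat f) b / complex_of_real (b ^ 3) = (LINT x|lborel. ?k x)"
      unfolding fhat_def cancelling_mean_fourier[OF fc] by (simp add: integral_divide_zero)
    then have "cmod (cancelling_mean (fhat f) b / complex_of_real (b ^ 3)) \<le> (LINT x|lborel. cmod (?k x))"
      using integral_norm_bound[of lborel ?k] by (simp only:)
    also have "\<dots> \<le> (LINT x|lborel. norm (g x) * norm (\<kappa>N x) + norm (gN N x) * norm (\<kappa> b x))"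
    proof (rule integral_mono_AE'[OF Bochner_Integration.integrable_add[OF i1 i2]])
      show "AE x in lborel. cmod (?k x) \<le> norm (g x) * norm (\<kappa>N x) + norm (gN N x) * norm (\<kappa> b x)"
      proof (rule AE_I2)
        fix x :: 'a
        have "cmod (?k x) = \<bar>f x\<bar> * (\<bar>cancelling_symbol (b * norm x)\<bar> / b ^ 3)"
          using b by (simp add: norm_mult norm_divide norm_power)
        also have "\<dots> \<le> \<bar>g x\<bar> * \<kappa> b x" by (rule pw[OF b])
        also have "\<dots> \<le> \<bar>g x\<bar> * \<bar>\<kappa> b x\<bar>" by (intro mult_left_mono) auto
        also have "\<dots> = norm (g x) * norm (\<kappa>N x) + norm (gN N x) * norm (\<kappa> b x)"
          by (simp add: gN_def \<kappa>N_def indicator_def)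
        finally show "cmod (?k x) \<le> norm (g x) * norm (\<kappa>N x) + norm (gN N x) * norm (\<kappa> b x)" .
      qed
    qed auto
    also have "\<dots> = (LINT x|lborel. norm (g x) * norm (\<kappa>N x)) + (LINT x|lborel. norm (gN N x) * norm (\<kappa> b x))"
      by (rule Bochner_Integration.integral_add[OF i1 i2])
    also have "\<dots> \<le> sqrt G * sqrt (square_integral \<kappa>N) + sqrt (square_integral (gN N)) * sqrt (square_integral (\<kappa> b))"
      unfolding G_def by (intro add_mono cauchy_schwarz_integral g \<kappa>N gN \<kappa>(1)[OF b])
    also have "\<dots> \<le> sqrt G * sqrt (C * (b ^ DIM('a) * measure lborel (cball (0::'a) (real N)))) + sqrt (square_integral (gN N)) * sqrt (C * c)"
      unfolding \<kappa>(2)[OF b] using \<kappa>N_le G by (intro add_mono mult_left_mono) auto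
    finally show ?thesis .
  qed
  show ?thesis
    unfolding tendsto_iff dist_0_norm dist_commute[of _ 0]
  proof (intro allI impI)
    fix r :: real assume r: "r > 0"
    have "(\<lambda>N. sqrt (square_integral (gN N)) * sqrt (C * c)) \<longlonglongrightarrow> sqrt 0 * sqrt (C * c)"
      by (intro tendsto_intros gN0)
    then have "\<forall>\<^sub>F N in sequentially. sqrt (square_integral (gN N)) * sqrt (C * c) < r / 2"
      by (rule order_tendstoD) (use r in simp)
    then obtain N where N: "sqrt (square_integral (gN N)) * sqrt (C * c) < r / 2"
      unfolding eventually_sequentially by blast
    have "(\<lambda>n. sqrt G * sqrt (C * (e n ^ DIM('a) * measure lborel (cball (0::'a) (real N)))))
        \<longlonglongrightarrow> sqrt G * sqrt (C * (0 ^ DIM('a) * measure lborel (cball (0::'a) (real N))))"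
      by (intro tendsto_intros e)
    then have "\<forall>\<^sub>F n in sequentially. sqrt G * sqrt (C * (e n ^ DIM('a) * measure lborel (cball (0::'a) (real N)))) < r / 2"
      by (rule order_tendstoD) (use r in \<open>simp add: zero_power\<close>)
    then show "\<forall>\<^sub>F n in sequentially. norm (cancelling_mean (fhat f) (e n) / complex_of_real (e n ^ 3)) < r"
    proof eventually_elim
      case (elim n)
      then show ?case using bound[OF e(2), of n N] N by linarith
    qed
  qed
qed

text \<open>Rescaling turns the mean of width \<open>j b\<close> into \<open>j\<^sup>3\<close> times the mean of width \<open>b\<close>.\<close>

lemma cancelling_mean_homogeneous_tendsto:
  fixes H L :: "'a::euclidean_space \<Rightarrow> complex"
  assumes H: "H \<in> borel_measurable borel" and L: "L \<in> borel_measurable borel"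
    and bound: "\<And>\<xi>. cmod (H \<xi>) \<le> C * norm \<xi> ^ 3"
    and lim: "\<And>b z. b \<longlonglongrightarrow> 0 \<Longrightarrow> (\<And>n. b n > 0) \<Longrightarrow> (\<lambda>n. H (b n *\<^sub>R z) / complex_of_real (b n ^ 3)) \<longlonglongrightarrow> L z"
    and e: "e \<longlonglongrightarrow> 0" "\<And>n. e n > 0"
  shows "(\<lambda>n. cancelling_mean H (e n) / complex_of_real (e n ^ 3)) \<longlonglongrightarrow> - 10 * (LINT z|lborel. L z * complex_of_real (gauss z))"
proof -
  let ?I = "LINT z|lborel. L z * complex_of_real (gauss z)"
  have one: "(\<lambda>n. gaussian_mean H (b n) / complex_of_real (b n ^ 3)) \<longlonglongrightarrow> ?I"
    if b: "b \<longlonglongrightarrow> 0" "\<And>n. b n > 0" for b :: "nat \<Rightarrow> real"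
  proof -
    have "(\<lambda>n. LINT z|lborel. H (b n *\<^sub>R z) / complex_of_real (b n ^ 3) * complex_of_real (gauss z)) \<longlonglongrightarrow> ?I"
    proof (rule integral_dominated_convergence[where w="\<lambda>z. C * (norm z ^ 3 * gauss z)"])
      show "integrable lborel (\<lambda>z::'a. C * (norm z ^ 3 * gauss z))"
        using integrable_power_norm_gauss[of 3] by (rule integrable_mult_right)
      show "AE z in lborel. (\<lambda>n. H (b n *\<^sub>R z) / complex_of_real (b n ^ 3) * complex_of_real (gauss z)) \<longlonglongrightarrow> L z * complex_of_real (gauss z)"
        by (intro AE_I2 tendsto_mult tendsto_const lim b)
      show "AE z in lborel. norm (H (b n *\<^sub>R z) / complex_of_real (b n ^ 3) * complex_of_real (gauss z)) \<le> C * (norm z ^ 3 * gauss z)" for n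
      proof (rule AE_I2)
        fix z :: 'a
        have "cmod (H (b n *\<^sub>R z)) / b n ^ 3 \<le> C * norm z ^ 3"
          using bound[of "b n *\<^sub>R z"] b(2)[of n] by (simp add: divide_le_eq power_mult_distrib mult_ac)
        then have "cmod (H (b n *\<^sub>R z)) / b n ^ 3 * gauss z \<le> C * norm z ^ 3 * gauss z"
          by (rule mult_right_mono) simp
        then show "norm (H (b n *\<^sub>R z) / complex_of_real (b n ^ 3) * complex_of_real (gauss z)) \<le> C * (norm z ^ 3 * gauss z)"
          using b(2)[of n] by (simp add: norm_mult norm_divide norm_power mult.assoc)
      qed
    qed (use H L in measurable)
    moreover have "(LINT z|lborel. H (b n *\<^sub>R z) / complex_of_real (b n ^ 3) * complex_of_real (gauss z))
        = gaussian_mean H (b n) / complex_of_real (b n ^ 3)" for n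
      unfolding gaussian_mean_def by (subst integral_divide_zero[symmetric]) simp
    ultimately show ?thesis by (simp only:)
  qed
  have scaled: "(\<lambda>n. gaussian_mean H (j * e n) / complex_of_real (e n ^ 3)) \<longlonglongrightarrow> complex_of_real (j ^ 3) * ?I" if j: "j > 0" for j
  proof -
    have "(\<lambda>n. j * e n) \<longlonglongrightarrow> j * 0" by (intro tendsto_intros e)
    then have "(\<lambda>n. complex_of_real (j ^ 3) * (gaussian_mean H (j * e n) / complex_of_real ((j * e n) ^ 3))) \<longlonglongrightarrow> complex_of_real (j ^ 3) * ?I"
      using j e(2) by (intro tendsto_mult tendsto_const one) auto
    moreover have "complex_of_real (j ^ 3) * (gaussian_mean H (j * e n) / complex_of_real ((j * e n) ^ 3)) = gaussian_mean H (j * e n) / complex_of_real (e n ^ 3)" for n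
      using j by (simp add: power_mult_distrib)
    ultimately show ?thesis by simp
  qed
  have "(\<lambda>n. - 7 * (gaussian_mean H (1 * e n) / complex_of_real (e n ^ 3)) + 14 * (gaussian_mean H (2 * e n) / complex_of_real (e n ^ 3))
        - 9 * (gaussian_mean H (3 * e n) / complex_of_real (e n ^ 3)) + 2 * (gaussian_mean H (4 * e n) / complex_of_real (e n ^ 3)))
      \<longlonglongrightarrow> - 7 * (complex_of_real (1 ^ 3) * ?I) + 14 * (complex_of_real (2 ^ 3) * ?I) - 9 * (complex_of_real (3 ^ 3) * ?I) + 2 * (complex_of_real (4 ^ 3) * ?I)"
    by (intro tendsto_add tendsto_diff tendsto_mult tendsto_const scaled) auto
  then show ?thesis
    by (simp add: cancelling_mean_def add_divide_distrib diff_divide_distrib)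
qed

section \<open>Taylor expansions at the origin of frequency space\<close>

text \<open>
  With vanishing integral, \<open>fhat f \<xi>\<close> is the integral of \<open>(exp (- \<i> (x \<bullet> \<xi>)) - 1) f x\<close>, whose first factor is
  bounded by \<open>|x| |\<xi>|\<close>.
\<close>

lemma fhat_first_order:
  fixes f :: "'a::euclidean_space \<Rightarrow> real"
  assumes f: "integrable lborel f" and f1: "integrable lborel (\<lambda>x. norm x * \<bar>f x\<bar>)" and f0: "(LINT x|lborel. f x) = 0"
  shows "cmod (fhat f \<xi>) \<le> norm \<xi> * (LINT x|lborel. norm x * \<bar>f x\<bar>)"
    and "b \<longlonglongrightarrow> 0 \<Longrightarrow> (\<And>n. b n > 0) \<Longrightarrow>
      (\<lambda>n. fhat f (b n *\<^sub>R z) / complex_of_real (b n)) \<longlonglongrightarrow> - \<i> * complex_of_real (LINT x|lborel. (x \<bullet> z) * f x)"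
proof -
  have [measurable]: "f \<in> borel_measurable borel" using f by auto
  have fc: "integrable lborel (\<lambda>x. complex_of_real (f x))" using f by simp
  let ?E = "\<lambda>\<xi> x. (exp (- (\<i> * complex_of_real (x \<bullet> \<xi>))) - 1) * complex_of_real (f x)"
  have eq: "fhat f \<xi> = (LINT x|lborel. ?E \<xi> x)" for \<xi>
  proof -
    have "(LINT x|lborel. ?E \<xi> x) = (LINT x|lborel. exp (- (\<i> * complex_of_real (x \<bullet> \<xi>))) * complex_of_real (f x)) - (LINT x|lborel. complex_of_real (f x))"
      unfolding left_diff_distrib mult_1_left by (rule Bochner_Integration.integral_diff[OF integrable_fourier[OF fc] fc])
    then show ?thesis using f0 by (simp add: fhat_def fourier_def)
  qed
  have le: "cmod (?E \<xi> x) \<le> norm \<xi> * (norm x * \<bar>f x\<bar>)" for \<xi> x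
  proof -
    have "cmod (exp (- (\<i> * complex_of_real (x \<bullet> \<xi>))) - 1) \<le> \<bar>x \<bullet> \<xi>\<bar>"
      using norm_exp_minus_one_le[of "- (x \<bullet> \<xi>)"] by simp
    also have "\<dots> \<le> norm x * norm \<xi>" by (rule Cauchy_Schwarz_ineq2)
    finally have "cmod (exp (- (\<i> * complex_of_real (x \<bullet> \<xi>))) - 1) * \<bar>f x\<bar> \<le> (norm x * norm \<xi>) * \<bar>f x\<bar>"
      by (rule mult_right_mono) simp
    then show ?thesis by (simp add: norm_mult mult_ac)
  qed
  have i: "integrable lborel (\<lambda>x. norm \<xi> * (norm x * \<bar>f x\<bar>))" for \<xi> :: 'a
    using f1 by (rule integrable_mult_right)
  have "cmod (fhat f \<xi>) \<le> (LINT x|lborel. cmod (?E \<xi> x))" unfolding eq by (rule integral_norm_bound)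
  also have "\<dots> \<le> (LINT x|lborel. norm \<xi> * (norm x * \<bar>f x\<bar>))"
    by (rule integral_mono_AE'[OF i]) (use le in auto)
  finally show "cmod (fhat f \<xi>) \<le> norm \<xi> * (LINT x|lborel. norm x * \<bar>f x\<bar>)" by simp
  show "(\<lambda>n. fhat f (b n *\<^sub>R z) / complex_of_real (b n)) \<longlonglongrightarrow> - \<i> * complex_of_real (LINT x|lborel. (x \<bullet> z) * f x)"
    if b: "b \<longlonglongrightarrow> 0" "\<And>n. b n > 0"
  proof -
    let ?Q = "\<lambda>n x. (exp (- (\<i> * complex_of_real (x \<bullet> (b n *\<^sub>R z)))) - 1) / complex_of_real (b n) * complex_of_real (f x)"
    have "(\<lambda>n. LINT x|lborel. ?Q n x) \<longlonglongrightarrow> (LINT x|lborel. - (\<i> * complex_of_real (x \<bullet> z)) * complex_of_real (f x))"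
    proof (rule integral_dominated_convergence[OF _ _ i[of z]])
      show "AE x in lborel. (\<lambda>n. ?Q n x) \<longlonglongrightarrow> - (\<i> * complex_of_real (x \<bullet> z)) * complex_of_real (f x)"
      proof (intro AE_I2 tendsto_mult tendsto_const)
        fix x :: 'a
        show "(\<lambda>n. (exp (- (\<i> * complex_of_real (x \<bullet> (b n *\<^sub>R z)))) - 1) / complex_of_real (b n)) \<longlonglongrightarrow> - (\<i> * complex_of_real (x \<bullet> z))"
          using exp_difference_quotient_tendsto[OF b(1) less_imp_neq[OF b(2), symmetric], of "- (\<i> * complex_of_real (x \<bullet> z))"]
          by (simp add: mult_ac)
      qed
      show "AE x in lborel. norm (?Q n x) \<le> norm z * (norm x * \<bar>f x\<bar>)" for n
      proof (rule AE_I2)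
        fix x :: 'a
        have "cmod (?E (b n *\<^sub>R z) x) / b n \<le> norm (b n *\<^sub>R z) * (norm x * \<bar>f x\<bar>) / b n"
          using b(2)[of n] by (intro divide_right_mono le) auto
        then show "norm (?Q n x) \<le> norm z * (norm x * \<bar>f x\<bar>)"
          using b(2)[of n] by (simp add: norm_mult norm_divide)
      qed
    qed measurable
    moreover have "(LINT x|lborel. ?Q n x) = fhat f (b n *\<^sub>R z) / complex_of_real (b n)" for n
      unfolding eq by (subst integral_divide_zero[symmetric]) simp
    moreover have "(LINT x|lborel. - (\<i> * complex_of_real (x \<bullet> z)) * complex_of_real (f x)) = - \<i> * complex_of_real (LINT x|lborel. (x \<bullet> z) * f x)"
    proof -
      have "(LINT x|lborel. - (\<i> * complex_of_real (x \<bullet> z)) * complex_of_real (f x)) = (LINT x|lborel. - \<i> * complex_of_real ((x \<bullet> z) * f x))"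
        by (intro Bochner_Integration.integral_cong refl) simp
      also have "\<dots> = - \<i> * (LINT x|lborel. complex_of_real ((x \<bullet> z) * f x))" by (rule integral_mult_right_zero)
      finally show ?thesis by (simp only: integral_complex_of_real)
    qed
    ultimately show ?thesis by (simp only:)
  qed
qed

lemma propagator_symbol_minus_one_le: "cmod (propagator_symbol k t \<xi> - 1) \<le> \<bar>t\<bar> * (norm \<xi>)\<^sup>2"
proof -
  have "cmod (propagator_symbol k t \<xi> - 1) \<le> \<bar>t\<bar> * (\<bar>\<xi> $ k\<bar> * norm \<xi>)"
    using norm_exp_minus_one_le[of "t * (\<xi> $ k) * norm \<xi>"] by (simp add: propagator_symbol_def abs_mult mult.assoc)
  also have "\<dots> \<le> \<bar>t\<bar> * (norm \<xi> * norm \<xi>)"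
    by (intro mult_left_mono mult_right_mono component_le_norm_cart) auto
  finally show ?thesis by (simp add: power2_eq_square)
qed

lemma propagator_symbol_second_order:
  assumes b: "b \<longlonglongrightarrow> 0" "\<And>n. b n > 0"
  shows "(\<lambda>n. (propagator_symbol k t (b n *\<^sub>R z) - 1) / complex_of_real ((b n)\<^sup>2)) \<longlonglongrightarrow> \<i> * complex_of_real (t * (z $ k) * norm z)"
proof -
  define w where "w = \<i> * complex_of_real (t * (z $ k) * norm z)"
  have "(\<lambda>n. (b n)\<^sup>2) \<longlonglongrightarrow> 0\<^sup>2" by (intro tendsto_intros b)
  then have "(\<lambda>n. (exp (complex_of_real ((b n)\<^sup>2) * w) - 1) / complex_of_real ((b n)\<^sup>2)) \<longlonglongrightarrow> w"
    by (intro exp_difference_quotient_tendsto) (simp_all add: less_imp_neq[OF b(2), symmetric])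
  moreover have "exp (complex_of_real ((b n)\<^sup>2) * w) = propagator_symbol k t (b n *\<^sub>R z)" for n
    using b(2)[of n] by (simp add: w_def propagator_symbol_def power2_eq_square mult_ac)
  ultimately show ?thesis by (simp only: w_def)
qed

lemma continuous_AE_eq_0:
  fixes f :: "'a::euclidean_space \<Rightarrow> real"
  assumes f: "continuous_on UNIV f" and ae: "AE x in lborel. f x = 0"
  shows "f x = 0"
proof (rule ccontr)
  assume "f x \<noteq> 0"
  have op: "open {x. f x \<noteq> 0}"
    by (intro open_Collect_neq f continuous_on_const)
  have "{x. f x \<noteq> 0} \<in> null_sets lborel"
    using AE_iff_null_sets[of "{x. f x \<noteq> 0}" lborel] ae op by simp
  then have "negligible {x. f x \<noteq> 0}"
    unfolding negligible_iff_null_sets by (rule null_sets_completionI)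
  then show False using open_not_negligible[OF op] \<open>f x \<noteq> 0\<close> by auto
qed

section \<open>The critical weight at three times\<close>

lemma cancelling_mean_diff:
  assumes "\<And>b. integrable lborel (\<lambda>z. H (b *\<^sub>R z) * complex_of_real (gauss z))"
    "\<And>b. integrable lborel (\<lambda>z. K (b *\<^sub>R z) * complex_of_real (gauss z))"
  shows "cancelling_mean (\<lambda>\<xi>. H \<xi> - K \<xi>) b = cancelling_mean H b - cancelling_mean K b"
proof -
  have eq: "gaussian_mean (\<lambda>\<xi>. H \<xi> - K \<xi>) b = gaussian_mean H b - gaussian_mean K b" for b
    unfolding gaussian_mean_def left_diff_distrib by (rule Bochner_Integration.integral_diff[OF assms])
  show ?thesis unfolding cancelling_mean_def eq by (simp add: algebra_simps)
qed

lemma integrable_gauss_mult: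
  fixes H :: "'a::euclidean_space \<Rightarrow> complex"
  assumes [measurable]: "H \<in> borel_measurable borel" and bound: "\<And>\<xi>. cmod (H \<xi>) \<le> M"
  shows "integrable lborel (\<lambda>z. H (b *\<^sub>R z) * complex_of_real (gauss z))"
proof (rule Bochner_Integration.integrable_bound)
  show "integrable lborel (\<lambda>z::'a. M * gauss z)" using integrable_gauss by auto
  show "AE z in lborel. norm (H (b *\<^sub>R z) * complex_of_real (gauss z)) \<le> norm (M * gauss z)"
  proof (rule AE_I2)
    fix z :: 'a
    have "cmod (H (b *\<^sub>R z)) * gauss z \<le> \<bar>M\<bar> * gauss z"
      by (intro mult_right_mono order_trans[OF bound abs_ge_self]) simp
    then show "norm (H (b *\<^sub>R z) * complex_of_real (gauss z)) \<le> norm (M * gauss z)"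
      by (simp add: norm_mult abs_mult)
  qed
qed measurable

context Z_duhamel_solution
begin

abbreviation E :: real where "E \<equiv> square_integral (u 0)"

text \<open>
  The Gaussian means of the two singular cubic terms \<open>\<xi>\<^sub>k |\<xi>| X(\<xi>)\<close> and \<open>\<xi>\<^sub>k\<^sup>2 |\<xi>|\<close>, where \<open>X(\<xi>)\<close> is the
  first moment of \<open>u s\<close> in the direction \<open>\<xi>\<close>.  The second is positive, so the factor \<open>E\<close> in front of it can
  be read off.
\<close>

definition first_moment_mean :: "real \<Rightarrow> real" where
  "first_moment_mean s = (LINT z|lborel. (z $ k * norm z * (LINT x|lborel. (x \<bullet> z) * u s x)) * gauss z)"

definition cubic_mean :: real where
  "cubic_mean = (LINT z|lborel. ((z $ k)\<^sup>2 * norm z) * gauss (z::real^'d))"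

lemma integrable_cubic: "integrable lborel (\<lambda>z::real^'d. ((z $ k)\<^sup>2 * norm z) * gauss z)"
proof (rule Bochner_Integration.integrable_bound[OF integrable_power_norm_gauss[of 3]])
  show "AE z::real^'d in lborel. norm (((z $ k)\<^sup>2 * norm z) * gauss z) \<le> norm (norm z ^ 3 * gauss z)"
  proof (rule AE_I2)
    fix z :: "real^'d"
    have "\<bar>z $ k\<bar>\<^sup>2 \<le> (norm z)\<^sup>2" by (intro power_mono component_le_norm_cart) auto
    then have "(z $ k)\<^sup>2 * norm z \<le> norm z ^ 3"
      using mult_right_mono[of "(z $ k)\<^sup>2" "(norm z)\<^sup>2" "norm z"] by (simp add: power3_eq_cube power2_eq_square)
    then have "((z $ k)\<^sup>2 * norm z) * gauss z \<le> norm z ^ 3 * gauss z" by (rule mult_right_mono) simp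
    then show "norm (((z $ k)\<^sup>2 * norm z) * gauss z) \<le> norm (norm z ^ 3 * gauss z)" by (simp add: abs_mult)
  qed
  have "continuous_on UNIV (\<lambda>z::real^'d. ((z $ k)\<^sup>2 * norm z) * gauss z)"
    unfolding gauss_eq by (intro continuous_intros) auto
  from borel_measurable_continuous_onI[OF this]
  show "(\<lambda>z::real^'d. ((z $ k)\<^sup>2 * norm z) * gauss z) \<in> borel_measurable lborel" by simp
qed

lemma cubic_mean_pos: "cubic_mean > 0"
proof -
  let ?h = "\<lambda>z::real^'d. ((z $ k)\<^sup>2 * norm z) * gauss z"
  have nn: "AE z in lborel. 0 \<le> ?h z" by (auto intro!: AE_I2 mult_nonneg_nonneg)
  have "cubic_mean \<noteq> 0"
  proof
    assume "cubic_mean = 0"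
    then have ae: "AE z in lborel. ?h z = 0"
      using integral_nonneg_eq_0_iff_AE[OF integrable_cubic nn] by (simp add: cubic_mean_def)
    have "continuous_on UNIV ?h" unfolding gauss_eq by (intro continuous_intros) auto
    from continuous_AE_eq_0[OF this ae, of e1] show False
      using gauss_pos[of e1] by simp
  qed
  moreover have "cubic_mean \<ge> 0" unfolding cubic_mean_def by (rule integral_nonneg_AE[OF nn])
  ultimately show ?thesis by simp
qed

text \<open>
  Linear part: \<open>P (t - s) - 1\<close> is \<open>\<i> (t - s) \<xi>\<^sub>k |\<xi>|\<close> to leading order, and the transform of \<open>u s\<close>
  vanishes at the origin.
\<close>

lemma linear_part_tendsto:
  assumes s: "s \<in> {0..T}" and e: "e \<longlonglongrightarrow> 0" "\<And>n. e n > 0"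
  shows "(\<lambda>n. cancelling_mean (\<lambda>\<xi>. (P h \<xi> - 1) * fhat (u s) \<xi>) (e n) / complex_of_real (e n ^ 3))
    \<longlonglongrightarrow> - 10 * complex_of_real (h * first_moment_mean s)"
proof -
  note Z = Z_reg[OF s]
  have f: "integrable lborel (u s)" by (rule Z_regular_integrable[OF Z])
  have [measurable]: "u s \<in> borel_measurable borel" using f by auto
  have f1: "integrable lborel (\<lambda>x. norm x * \<bar>u s x\<bar>)"
    by (rule Bochner_Integration.integrable_bound[OF Z_regular_first_moment(1)[OF Z]])
       (auto simp: abs_mult intro!: mult_right_mono)
  have f0: "(LINT x|lborel. u s x) = 0" using Z by (simp add: Z_regular_def)
  note first = fhat_first_order[OF f f1 f0]
  have [measurable]: "fhat (u s) \<in> borel_measurable borel" by (rule borel_measurable_fhat_u[OF s])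
  let ?X = "\<lambda>z. LINT x|lborel. (x \<bullet> z) * u s x"
  let ?L = "\<lambda>z. complex_of_real (h * (z $ k * norm z * ?X z))"
  have "(\<lambda>n. cancelling_mean (\<lambda>\<xi>. (P h \<xi> - 1) * fhat (u s) \<xi>) (e n) / complex_of_real (e n ^ 3))
      \<longlonglongrightarrow> - 10 * (LINT z|lborel. ?L z * complex_of_real (gauss z))"
  proof (rule cancelling_mean_homogeneous_tendsto[OF _ _ _ _ e])
    show "(\<lambda>\<xi>. (P h \<xi> - 1) * fhat (u s) \<xi>) \<in> borel_measurable borel" by measurable
    show "?L \<in> borel_measurable borel" by measurable
    show "cmod ((P h \<xi> - 1) * fhat (u s) \<xi>) \<le> (\<bar>h\<bar> * (LINT x|lborel. norm x * \<bar>u s x\<bar>)) * norm \<xi> ^ 3" for \<xi>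
    proof -
      have "cmod ((P h \<xi> - 1) * fhat (u s) \<xi>) \<le> (\<bar>h\<bar> * (norm \<xi>)\<^sup>2) * (norm \<xi> * (LINT x|lborel. norm x * \<bar>u s x\<bar>))"
        unfolding norm_mult by (intro mult_mono propagator_symbol_minus_one_le first(1)) auto
      then show ?thesis by (simp add: power2_eq_square power3_eq_cube mult_ac)
    qed
    fix b :: "nat \<Rightarrow> real" and z :: "real^'d" assume b: "b \<longlonglongrightarrow> 0" "\<And>n. b n > 0"
    have "(\<lambda>n. (P h (b n *\<^sub>R z) - 1) / complex_of_real ((b n)\<^sup>2) * (fhat (u s) (b n *\<^sub>R z) / complex_of_real (b n)))
        \<longlonglongrightarrow> (\<i> * complex_of_real (h * (z $ k) * norm z)) * (- \<i> * complex_of_real (?X z))"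
      by (intro tendsto_mult propagator_symbol_second_order first(2) b)
    moreover have "(\<i> * complex_of_real (h * (z $ k) * norm z)) * (- \<i> * complex_of_real (?X z)) = ?L z"
      by (simp add: mult_ac)
    moreover have "(P h (b n *\<^sub>R z) - 1) / complex_of_real ((b n)\<^sup>2) * (fhat (u s) (b n *\<^sub>R z) / complex_of_real (b n))
        = (P h (b n *\<^sub>R z) - 1) * fhat (u s) (b n *\<^sub>R z) / complex_of_real (b n ^ 3)" for n
      by (simp add: power2_eq_square power3_eq_cube)
    ultimately show "(\<lambda>n. (P h (b n *\<^sub>R z) - 1) * fhat (u s) (b n *\<^sub>R z) / complex_of_real (b n ^ 3)) \<longlonglongrightarrow> ?L z"
      by (simp only:)
  qed
  moreover have "(LINT z|lborel. ?L z * complex_of_real (gauss z)) = complex_of_real (h * first_moment_mean s)"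
  proof -
    have "(LINT z|lborel. ?L z * complex_of_real (gauss z)) = (LINT z|lborel. complex_of_real (h * ((z $ k * norm z * ?X z) * gauss z)))"
      by (intro Bochner_Integration.integral_cong refl) simp
    then show ?thesis
      unfolding integral_complex_of_real first_moment_mean_def by (simp only: integral_mult_right_zero)
  qed
  ultimately show ?thesis by (simp only:)
qed

lemma advection_first_moment:
  assumes "t \<in> {0..T}"
  shows "integrable lborel (\<lambda>x. norm x * \<bar>advection e1 (u t) x\<bar>)"
    and "(LINT x|lborel. norm x * \<bar>advection e1 (u t) x\<bar>) \<le> 3 * Z_form (u t)"
proof -
  have d: "DIM(real^'d) \<ge> 2" using dim by simp
  note m = advection_third_moment[OF e1 Z_reg[OF assms] d]
  have [measurable]: "advection e1 (u t) \<in> borel_measurable borel"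
    by (rule borel_measurable_advection[OF e1 Z_reg[OF assms]])
  have le: "norm x * \<bar>advection e1 (u t) x\<bar> \<le> (1 + norm x ^ 3) * \<bar>advection e1 (u t) x\<bar>" for x
    using power_le_one_plus_power[of "norm x" 1 3] by (intro mult_right_mono) auto
  show "integrable lborel (\<lambda>x. norm x * \<bar>advection e1 (u t) x\<bar>)"
    by (rule Bochner_Integration.integrable_bound[OF m(1)]) (use le in \<open>auto simp: abs_mult intro: order_trans[OF _ abs_ge_self]\<close>)
  have "(LINT x|lborel. norm x * \<bar>advection e1 (u t) x\<bar>) \<le> (LINT x|lborel. (1 + norm x ^ 3) * \<bar>advection e1 (u t) x\<bar>)"
    by (rule integral_mono_AE'[OF m(1)]) (use le in auto)
  also note m(2)
  finally show "(LINT x|lborel. norm x * \<bar>advection e1 (u t) x\<bar>) \<le> 3 * Z_form (u t)" .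
qed

lemma Fh_first_order:
  assumes t: "t \<in> {0..T}"
  shows "cmod (Fh t \<xi>) \<le> norm \<xi> * (3 * Z_form (u t))"
    and "b \<longlonglongrightarrow> 0 \<Longrightarrow> (\<And>n. b n > 0) \<Longrightarrow> (\<lambda>n. Fh t (b n *\<^sub>R z) / complex_of_real (b n)) \<longlonglongrightarrow> \<i> * complex_of_real (z $ k * E / 2)"
proof -
  have d: "DIM(real^'d) \<ge> 2" using dim by simp
  note first = fhat_first_order[OF integrable_advection[OF e1 Z_reg[OF t]] advection_first_moment(1)[OF t] integral_advection[OF e1 Z_reg[OF t] d]]
  show "cmod (Fh t \<xi>) \<le> norm \<xi> * (3 * Z_form (u t))"
    by (rule order_trans[OF first(1)]) (intro mult_left_mono advection_first_moment(2) t norm_ge_zero)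
  have "(LINT x|lborel. (x \<bullet> z) * advection e1 (u t) x) = - (z $ k * E / 2)"
    unfolding integral_moment_advection[OF e1 Z_reg[OF t] d] square_integral_conserved[OF t]
    by (simp add: inner_axis')
  then show "(\<lambda>n. Fh t (b n *\<^sub>R z) / complex_of_real (b n)) \<longlonglongrightarrow> \<i> * complex_of_real (z $ k * E / 2)"
    if "b \<longlonglongrightarrow> 0" "\<And>n. b n > 0"
    using first(2)[of b z, OF that] by simp
qed

text \<open>
  Nonlinear part: to leading order the integrand is the product of \<open>\<i> (t - \<tau>) \<xi>\<^sub>k |\<xi>|\<close> and of
  \<open>\<i> \<xi>\<^sub>k E / 2\<close>, where \<open>E\<close> does not depend on \<open>\<tau>\<close>.
\<close>

lemma nonlinear_part_tendsto:
  assumes s: "0 \<le> s" "s \<le> t" and t: "t \<le> T" and e: "e \<longlonglongrightarrow> 0" "\<And>n. e n > 0"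
  shows "(\<lambda>n. cancelling_mean (\<lambda>\<xi>. integral {s..t} (\<lambda>\<tau>. (P (t - \<tau>) \<xi> - 1) * Fh \<tau> \<xi>)) (e n) / complex_of_real (e n ^ 3))
    \<longlonglongrightarrow> - 10 * complex_of_real (- ((t - s)\<^sup>2 * E / 4 * cubic_mean))"
    and "(\<lambda>\<xi>. integral {s..t} (\<lambda>\<tau>. (P (t - \<tau>) \<xi> - 1) * Fh \<tau> \<xi>)) \<in> borel_measurable borel"
    and "\<exists>M. \<forall>\<xi>. cmod (integral {s..t} (\<lambda>\<tau>. (P (t - \<tau>) \<xi> - 1) * Fh \<tau> \<xi>)) \<le> M"
proof -
  have sub: "{s..t} \<subseteq> {0..T}" using s t by auto
  obtain B where B: "B \<ge> 0" "\<forall>t\<in>{0..T}. Z_form (u t) \<le> B" using Z_form_bounded by blast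
  let ?h = "\<lambda>\<tau> \<xi>. (P (t - \<tau>) \<xi> - 1) * Fh \<tau> \<xi>"
  have cont: "continuous_on {s..t} (\<lambda>\<tau>. ?h \<tau> \<xi>)" for \<xi>
    by (intro continuous_intros continuous_on_Fh_time sub)
  have eq: "integral {s..t} (\<lambda>\<tau>. ?h \<tau> \<xi>) = (LINT \<tau>|lborel. indicator {s..t} \<tau> *\<^sub>R ?h \<tau> \<xi>)" for \<xi>
    by (rule integral_eq_lebesgue_Icc(2)[OF cont])
  show meas: "(\<lambda>\<xi>. integral {s..t} (\<lambda>\<tau>. ?h \<tau> \<xi>)) \<in> borel_measurable borel"
  proof -
    have c: "continuous_on ({s..t} \<times> UNIV) (\<lambda>p. Fh (fst p) (snd p))"
    proof -
      have s: "{s..t} \<times> UNIV \<subseteq> {0..T} \<times> (UNIV :: (real^'d) set)" using sub by auto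
      show ?thesis using continuous_on_subset[OF continuous_on_Fh s] by (simp add: case_prod_unfold)
    qed
    have pc: "continuous_on ({s..t} \<times> UNIV) (\<lambda>p. P (t - fst p) (snd p :: real^'d))"
      by (rule continuous_on_propagator_symbol) (intro continuous_intros)+
    have "(\<lambda>p. indicator ({s..t} \<times> UNIV) p *\<^sub>R ?h (fst p) (snd p)) \<in> borel_measurable borel"
      by (rule borel_measurable_continuous_on_indicator)
         (auto intro!: borel_closed closed_Times continuous_on_mult continuous_on_diff continuous_on_const pc c)
    also have "(\<lambda>p. indicator ({s..t} \<times> UNIV) p *\<^sub>R ?h (fst p) (snd p)) = (\<lambda>(\<tau>, \<xi>). indicator {s..t} \<tau> *\<^sub>R ?h \<tau> \<xi>)"
      by (auto simp: indicator_def fun_eq_iff)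
    finally have m: "(\<lambda>(\<tau>, \<xi>). indicator {s..t} \<tau> *\<^sub>R ?h \<tau> \<xi>) \<in> borel_measurable (lborel \<Otimes>\<^sub>M lborel)"
      by (simp add: lborel_prod)
    have "(\<lambda>(\<xi>, \<tau>). indicator {s..t} \<tau> *\<^sub>R ?h \<tau> \<xi>) \<in> borel_measurable (lborel \<Otimes>\<^sub>M lborel)"
      using measurable_compose[OF measurable_pair_swap' m] by (simp add: case_prod_unfold)
    then have "(\<lambda>\<xi>. LINT \<tau>|lborel. indicator {s..t} \<tau> *\<^sub>R ?h \<tau> \<xi>) \<in> borel_measurable lborel"
      by (rule lborel.borel_measurable_lebesgue_integral)
    then show ?thesis unfolding eq by simp
  qed
  have le: "cmod (?h \<tau> \<xi>) \<le> 3 * B * (t - s) * norm \<xi> ^ 3" if \<tau>: "\<tau> \<in> {s..t}" for \<tau> \<xi>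
  proof -
    have \<tau>T: "\<tau> \<in> {0..T}" using sub \<tau> by auto
    have "cmod (P (t - \<tau>) \<xi> - 1) \<le> (t - s) * (norm \<xi>)\<^sup>2"
      using \<tau> by (intro order_trans[OF propagator_symbol_minus_one_le] mult_right_mono) auto
    moreover have "cmod (Fh \<tau> \<xi>) \<le> norm \<xi> * (3 * B)"
      using bspec[OF B(2) \<tau>T] by (intro order_trans[OF Fh_first_order(1)[OF \<tau>T]] mult_left_mono) auto
    ultimately have "cmod (?h \<tau> \<xi>) \<le> ((t - s) * (norm \<xi>)\<^sup>2) * (norm \<xi> * (3 * B))"
      unfolding norm_mult using s by (intro mult_mono) auto
    then show ?thesis by (simp add: power2_eq_square power3_eq_cube mult_ac)
  qed
  have bound3: "cmod (integral {s..t} (\<lambda>\<tau>. ?h \<tau> \<xi>)) \<le> (3 * B * (t - s) * (t - s)) * norm \<xi> ^ 3" for \<xi>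
    using integral_bound[OF s(2) cont[of \<xi>], of "3 * B * (t - s) * norm \<xi> ^ 3"] le by (simp add: mult_ac)
  show "\<exists>M. \<forall>\<xi>. cmod (integral {s..t} (\<lambda>\<tau>. ?h \<tau> \<xi>)) \<le> M"
  proof (intro exI allI)
    fix \<xi>
    have "cmod (?h \<tau> \<xi>) \<le> 2 * (3 * B)" if \<tau>: "\<tau> \<in> {s..t}" for \<tau>
    proof -
      have \<tau>T: "\<tau> \<in> {0..T}" using sub \<tau> by auto
      have "cmod (P (t - \<tau>) \<xi> - 1) \<le> 2" using norm_triangle_ineq4[of "P (t - \<tau>) \<xi>" 1] by simp
      moreover have "cmod (Fh \<tau> \<xi>) \<le> 3 * B" using cmod_Fh_le[OF \<tau>T, of \<xi>] bspec[OF B(2) \<tau>T] by linarith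
      ultimately show ?thesis unfolding norm_mult by (intro mult_mono) auto
    qed
    then show "cmod (integral {s..t} (\<lambda>\<tau>. ?h \<tau> \<xi>)) \<le> 2 * (3 * B) * (t - s)"
      using integral_bound[OF s(2) cont[of \<xi>], of "2 * (3 * B)"] by simp
  qed
  let ?L = "\<lambda>z. complex_of_real (- ((t - s)\<^sup>2 * E / 4) * ((z $ k)\<^sup>2 * norm z))"
  have "(\<lambda>n. cancelling_mean (\<lambda>\<xi>. integral {s..t} (\<lambda>\<tau>. ?h \<tau> \<xi>)) (e n) / complex_of_real (e n ^ 3))
      \<longlonglongrightarrow> - 10 * (LINT z|lborel. ?L z * complex_of_real (gauss z))"
  proof (rule cancelling_mean_homogeneous_tendsto[OF meas _ bound3 _ e])
    show "?L \<in> borel_measurable borel" by measurable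
    fix b :: "nat \<Rightarrow> real" and z :: "real^'d" assume b: "b \<longlonglongrightarrow> 0" "\<And>n. b n > 0"
    let ?c = "(z $ k)\<^sup>2 * norm z * E / 2"
    have "(\<lambda>n. LINT \<tau>|lborel. indicator {s..t} \<tau> *\<^sub>R (?h \<tau> (b n *\<^sub>R z) / complex_of_real (b n ^ 3)))
        \<longlonglongrightarrow> (LINT \<tau>|lborel. indicator {s..t} \<tau> *\<^sub>R complex_of_real (- (?c * (t - \<tau>))))"
    proof (rule integral_dominated_convergence[where w="\<lambda>\<tau>. indicator {s..t} \<tau> * (3 * B * (t - s) * norm z ^ 3)"])
      show "integrable lborel (\<lambda>\<tau>::real. indicator {s..t} \<tau> * (3 * B * (t - s) * norm z ^ 3))"
        by (simp add: emeasure_lborel_Icc_eq)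
      show "AE \<tau> in lborel. (\<lambda>n. indicator {s..t} \<tau> *\<^sub>R (?h \<tau> (b n *\<^sub>R z) / complex_of_real (b n ^ 3)))
          \<longlonglongrightarrow> indicator {s..t} \<tau> *\<^sub>R complex_of_real (- (?c * (t - \<tau>)))"
      proof (rule AE_I2)
        fix \<tau>
        show "(\<lambda>n. indicator {s..t} \<tau> *\<^sub>R (?h \<tau> (b n *\<^sub>R z) / complex_of_real (b n ^ 3)))
          \<longlonglongrightarrow> indicator {s..t} \<tau> *\<^sub>R complex_of_real (- (?c * (t - \<tau>)))"
        proof (cases "\<tau> \<in> {s..t}")
          case True
          then have \<tau>T: "\<tau> \<in> {0..T}" using sub by auto
          have "(\<lambda>n. (P (t - \<tau>) (b n *\<^sub>R z) - 1) / complex_of_real ((b n)\<^sup>2) * (Fh \<tau> (b n *\<^sub>R z) / complex_of_real (b n)))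
              \<longlonglongrightarrow> (\<i> * complex_of_real ((t - \<tau>) * (z $ k) * norm z)) * (\<i> * complex_of_real (z $ k * E / 2))"
            by (intro tendsto_mult propagator_symbol_second_order Fh_first_order(2) b \<tau>T)
          moreover have "(\<i> * complex_of_real ((t - \<tau>) * (z $ k) * norm z)) * (\<i> * complex_of_real (z $ k * E / 2)) = complex_of_real (- (?c * (t - \<tau>)))"
          proof -
            have ii: "(\<i> * complex_of_real x) * (\<i> * complex_of_real y) = complex_of_real (- (x * y))" for x y
              by (simp add: mult_ac)
            show ?thesis unfolding ii by (simp add: power2_eq_square mult_ac)
          qed
          moreover have "(P (t - \<tau>) (b n *\<^sub>R z) - 1) / complex_of_real ((b n)\<^sup>2) * (Fh \<tau> (b n *\<^sub>R z) / complex_of_real (b n))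
              = ?h \<tau> (b n *\<^sub>R z) / complex_of_real (b n ^ 3)" for n
            by (simp add: power2_eq_square power3_eq_cube)
          ultimately have "(\<lambda>n. ?h \<tau> (b n *\<^sub>R z) / complex_of_real (b n ^ 3)) \<longlonglongrightarrow> complex_of_real (- (?c * (t - \<tau>)))"
            by (simp only:)
          then show ?thesis by (intro tendsto_scaleR tendsto_const)
        qed simp
      qed
      show "AE \<tau> in lborel. norm (indicator {s..t} \<tau> *\<^sub>R (?h \<tau> (b n *\<^sub>R z) / complex_of_real (b n ^ 3))) \<le> indicator {s..t} \<tau> * (3 * B * (t - s) * norm z ^ 3)" for n
      proof (rule AE_I2)
        fix \<tau>
        show "norm (indicator {s..t} \<tau> *\<^sub>R (?h \<tau> (b n *\<^sub>R z) / complex_of_real (b n ^ 3))) \<le> indicator {s..t} \<tau> * (3 * B * (t - s) * norm z ^ 3)"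
        proof (cases "\<tau> \<in> {s..t}")
          case True
          have "cmod (?h \<tau> (b n *\<^sub>R z)) / b n ^ 3 \<le> (3 * B * (t - s) * norm (b n *\<^sub>R z) ^ 3) / b n ^ 3"
            using b(2)[of n] by (intro divide_right_mono le True) auto
          also have "\<dots> = 3 * B * (t - s) * norm z ^ 3" using b(2)[of n] by (simp add: power_mult_distrib)
          finally have "cmod (?h \<tau> (b n *\<^sub>R z)) / b n ^ 3 \<le> 3 * B * (t - s) * norm z ^ 3" .
          moreover have "norm (?h \<tau> (b n *\<^sub>R z) / complex_of_real (b n ^ 3)) = cmod (?h \<tau> (b n *\<^sub>R z)) / b n ^ 3"
            using b(2)[of n] by (simp only: norm_divide norm_of_real abs_of_pos zero_less_power)
          ultimately show ?thesis using True by (simp only: indicator_simps scaleR_one mult_1_left)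
        qed simp
      qed
      show "(\<lambda>\<tau>. indicator {s..t} \<tau> *\<^sub>R complex_of_real (- (?c * (t - \<tau>)))) \<in> borel_measurable lborel"
        by (rule borel_measurable_integrable[OF integral_eq_lebesgue_Icc(1)]) (intro continuous_intros)
      show "(\<lambda>\<tau>. indicator {s..t} \<tau> *\<^sub>R (?h \<tau> (b n *\<^sub>R z) / complex_of_real (b n ^ 3))) \<in> borel_measurable lborel" for n
      proof -
        have "continuous_on {s..t} (\<lambda>\<tau>. ?h \<tau> (b n *\<^sub>R z) / complex_of_real (b n ^ 3))"
          using b(2)[of n] by (intro continuous_on_divide cont continuous_on_const) auto
        then show ?thesis by (rule borel_measurable_integrable[OF integral_eq_lebesgue_Icc(1)])
      qed
    qed
    moreover have "(LINT \<tau>|lborel. indicator {s..t} \<tau> *\<^sub>R (?h \<tau> (b n *\<^sub>R z) / complex_of_real (b n ^ 3)))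
        = integral {s..t} (\<lambda>\<tau>. ?h \<tau> (b n *\<^sub>R z)) / complex_of_real (b n ^ 3)" for n
    proof -
      have "(LINT \<tau>|lborel. indicator {s..t} \<tau> *\<^sub>R (?h \<tau> (b n *\<^sub>R z) / complex_of_real (b n ^ 3)))
          = (LINT \<tau>|lborel. (indicator {s..t} \<tau> *\<^sub>R ?h \<tau> (b n *\<^sub>R z)) / complex_of_real (b n ^ 3))"
        by (intro Bochner_Integration.integral_cong refl) (simp add: indicator_def)
      then show ?thesis unfolding eq by (simp only: integral_divide_zero)
    qed
    moreover have "(LINT \<tau>|lborel. indicator {s..t} \<tau> *\<^sub>R complex_of_real (- (?c * (t - \<tau>)))) = ?L z"
    proof -
      have c: "continuous_on {s..t} (\<lambda>\<tau>. complex_of_real (- (?c * (t - \<tau>))))" by (intro continuous_intros)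
      have "((\<lambda>\<tau>. - (?c * (t - \<tau>))) has_integral (?c * (t - t)\<^sup>2 / 2 - ?c * (t - s)\<^sup>2 / 2)) {s..t}"
      proof (rule fundamental_theorem_of_calculus[OF s(2)])
        fix \<tau>
        have "((\<lambda>\<tau>. c * (t - \<tau>)\<^sup>2 / 2) has_real_derivative - (c * (t - \<tau>))) (at \<tau> within {s..t})" for c
          by (auto intro!: derivative_eq_intros simp: field_simps)
        then show "((\<lambda>\<tau>. ?c * (t - \<tau>)\<^sup>2 / 2) has_vector_derivative - (?c * (t - \<tau>))) (at \<tau> within {s..t})"
          by (simp only: has_real_derivative_iff_has_vector_derivative)
      qed
      from has_integral_linear[OF this bounded_linear_of_real[where 'a=complex]]
      have "((\<lambda>\<tau>. complex_of_real (- (?c * (t - \<tau>)))) has_integral complex_of_real (?c * (t - t)\<^sup>2 / 2 - ?c * (t - s)\<^sup>2 / 2)) {s..t}"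
        by (simp only: comp_def)
      then have "integral {s..t} (\<lambda>\<tau>. complex_of_real (- (?c * (t - \<tau>)))) = complex_of_real (?c * (t - t)\<^sup>2 / 2 - ?c * (t - s)\<^sup>2 / 2)"
        by (rule integral_unique)
      also have "\<dots> = ?L z" by (simp add: mult_ac)
      finally show ?thesis unfolding integral_eq_lebesgue_Icc(2)[OF c] .
    qed
    ultimately show "(\<lambda>n. integral {s..t} (\<lambda>\<tau>. ?h \<tau> (b n *\<^sub>R z)) / complex_of_real (b n ^ 3)) \<longlonglongrightarrow> ?L z"
      by (simp only:)
  qed
  moreover have "(LINT z|lborel. ?L z * complex_of_real (gauss z)) = complex_of_real (- ((t - s)\<^sup>2 * E / 4 * cubic_mean))"
  proof -
    have "(LINT z|lborel. ?L z * complex_of_real (gauss z)) = (LINT z|lborel. complex_of_real (- ((t - s)\<^sup>2 * E / 4) * (((z $ k)\<^sup>2 * norm z) * gauss z)))"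
      by (intro Bochner_Integration.integral_cong refl) simp
    then show ?thesis
      unfolding integral_complex_of_real integral_mult_right_zero cubic_mean_def by (simp only: mult_minus_left)
  qed
  ultimately show "(\<lambda>n. cancelling_mean (\<lambda>\<xi>. integral {s..t} (\<lambda>\<tau>. (P (t - \<tau>) \<xi> - 1) * Fh \<tau> \<xi>)) (e n) / complex_of_real (e n ^ 3))
    \<longlonglongrightarrow> - 10 * complex_of_real (- ((t - s)\<^sup>2 * E / 4 * cubic_mean))" by (simp only:)
qed

end

context Z_duhamel_solution
begin

text \<open>
  The remaining part of Duhamel's integral has no singularity at the origin: for each \<open>\<tau>\<close> it is the
  transform of a function with three moments.
\<close>

lemma regular_part_tendsto:
  assumes s: "0 \<le> s" "s \<le> t" and t: "t \<le> T" and e: "e \<longlonglongrightarrow> 0" "\<And>n. e n > 0"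
  shows "(\<lambda>n. cancelling_mean (\<lambda>\<xi>. integral {s..t} (\<lambda>\<tau>. Fh \<tau> \<xi>)) (e n) / complex_of_real (e n ^ 3)) \<longlonglongrightarrow> 0"
proof -
  have sub: "\<tau> \<in> {s..t} \<Longrightarrow> \<tau> \<in> {0..T}" for \<tau> using s t by auto
  have d: "DIM(real^'d) \<ge> 2" using dim by simp
  obtain B where B: "B \<ge> 0" "\<forall>t\<in>{0..T}. Z_form (u t) \<le> B" using Z_form_bounded by blast
  let ?I = "\<lambda>\<tau>. indicator {s..t} \<tau> :: real"
  have Fh_le: "cmod (Fh \<tau> \<xi>) \<le> 3 * B" if "\<tau> \<in> {0..T}" for \<tau> \<xi>
    using cmod_Fh_le[OF that, of \<xi>] bspec[OF B(2) that] by linarith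
  have cont: "continuous_on {s..t} (\<lambda>\<tau>. Fh \<tau> \<xi>)" for \<xi>
    using sub by (intro continuous_on_Fh_time) auto
  have mean: "gaussian_mean (\<lambda>\<xi>. integral {s..t} (\<lambda>\<tau>. Fh \<tau> \<xi>)) b = (LINT \<tau>|lborel. ?I \<tau> *\<^sub>R gaussian_mean (Fh \<tau>) b)"
    "integrable lborel (\<lambda>\<tau>. ?I \<tau> *\<^sub>R gaussian_mean (Fh \<tau>) b)" for b
  proof -
    have int: "integrable (lborel \<Otimes>\<^sub>M lborel) (\<lambda>(\<tau>, z). ?I \<tau> *\<^sub>R (Fh \<tau> (b *\<^sub>R z) * complex_of_real (gauss z)))"
    proof (rule integrable_time_space)
      have "continuous_on ({s..t} \<times> UNIV) (\<lambda>p. (\<lambda>(t, \<xi>). Fh t \<xi>) (fst p, b *\<^sub>R snd p))"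
        by (rule continuous_on_compose2[OF continuous_on_Fh]) (use s t in \<open>auto intro!: continuous_intros\<close>)
      then have c: "continuous_on ({s..t} \<times> UNIV) (\<lambda>p. Fh (fst p) (b *\<^sub>R snd p))" by simp
      have gc: "continuous_on ({s..t} \<times> UNIV) (\<lambda>p. gauss (snd p :: real^'d))"
        unfolding gauss_eq by (intro continuous_intros) auto
      show "continuous_on ({s..t} \<times> UNIV) (\<lambda>(\<tau>, z). Fh \<tau> (b *\<^sub>R z) * complex_of_real (gauss z))"
        unfolding case_prod_unfold by (intro continuous_on_mult continuous_on_of_real c gc)
      fix \<tau> assume \<tau>: "\<tau> \<in> {s..t}"
      show "integrable lborel (\<lambda>z. Fh \<tau> (b *\<^sub>R z) * complex_of_real (gauss z))"
        by (rule integrable_gauss_mult[OF borel_measurable_Fh[OF sub[OF \<tau>]] Fh_le[OF sub[OF \<tau>]]])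
      have ig: "integrable lborel (\<lambda>z::real^'d. 3 * B * gauss z)" using integrable_gauss by auto
      have le: "cmod (Fh \<tau> (b *\<^sub>R z) * complex_of_real (gauss z)) \<le> 3 * B * gauss z" for z
        using Fh_le[OF sub[OF \<tau>]] by (auto simp: norm_mult intro!: mult_right_mono)
      show "(LINT z|lborel. cmod (Fh \<tau> (b *\<^sub>R z) * complex_of_real (gauss z))) \<le> (LINT z|lborel. 3 * B * gauss (z::real^'d))"
        by (rule integral_mono_AE'[OF ig]) (use le B in auto)
    qed
    have slice: "(LINT z|lborel. ?I \<tau> *\<^sub>R (Fh \<tau> (b *\<^sub>R z) * complex_of_real (gauss z))) = ?I \<tau> *\<^sub>R gaussian_mean (Fh \<tau>) b" for \<tau>
      unfolding gaussian_mean_def by (cases "\<tau> \<in> {s..t}") auto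
    have "gaussian_mean (\<lambda>\<xi>. integral {s..t} (\<lambda>\<tau>. Fh \<tau> \<xi>)) b
        = (LINT z|lborel. LINT \<tau>|lborel. ?I \<tau> *\<^sub>R (Fh \<tau> (b *\<^sub>R z) * complex_of_real (gauss z)))"
      unfolding gaussian_mean_def integral_eq_lebesgue_Icc(2)[OF cont]
      by (simp add: mult_scaleR_left[symmetric] del: mult_scaleR_left)
    also have "\<dots> = (LINT \<tau>|lborel. LINT z|lborel. ?I \<tau> *\<^sub>R (Fh \<tau> (b *\<^sub>R z) * complex_of_real (gauss z)))"
      by (rule lborel_pair.Fubini_integral[OF int])
    finally show "gaussian_mean (\<lambda>\<xi>. integral {s..t} (\<lambda>\<tau>. Fh \<tau> \<xi>)) b = (LINT \<tau>|lborel. ?I \<tau> *\<^sub>R gaussian_mean (Fh \<tau>) b)"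
      unfolding slice .
    show "integrable lborel (\<lambda>\<tau>. ?I \<tau> *\<^sub>R gaussian_mean (Fh \<tau>) b)"
      using lborel_pair.integrable_fst[OF int] unfolding slice .
  qed
  let ?m = "\<lambda>b \<tau>. ?I \<tau> *\<^sub>R gaussian_mean (Fh \<tau>) b"
  have combine: "?I \<tau> *\<^sub>R cancelling_mean (Fh \<tau>) b = - 7 * ?m b \<tau> + 14 * ?m (2 * b) \<tau> - 9 * ?m (3 * b) \<tau> + 2 * ?m (4 * b) \<tau>" for b \<tau>
    by (simp add: cancelling_mean_def scaleR_conv_of_real algebra_simps)
  have cm_int: "integrable lborel (\<lambda>\<tau>. ?I \<tau> *\<^sub>R cancelling_mean (Fh \<tau>) b)" for b
    unfolding combine by (intro Bochner_Integration.integrable_add Bochner_Integration.integrable_diff integrable_mult_right mean(2))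
  have cm: "cancelling_mean (\<lambda>\<xi>. integral {s..t} (\<lambda>\<tau>. Fh \<tau> \<xi>)) b = (LINT \<tau>|lborel. ?I \<tau> *\<^sub>R cancelling_mean (Fh \<tau>) b)" for b
    unfolding combine cancelling_mean_def[of "\<lambda>\<xi>. integral {s..t} (\<lambda>\<tau>. Fh \<tau> \<xi>)"] mean(1)
    by (simp only: Bochner_Integration.integral_add Bochner_Integration.integral_diff Bochner_Integration.integrable_add
        Bochner_Integration.integrable_diff integrable_mult_right integral_mult_right_zero mean(2))
  have "(\<lambda>n. LINT \<tau>|lborel. (?I \<tau> *\<^sub>R cancelling_mean (Fh \<tau>) (e n)) / complex_of_real (e n ^ 3)) \<longlonglongrightarrow> (LINT \<tau>|lborel. ?I \<tau> *\<^sub>R (0::complex))"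
  proof (rule integral_dominated_convergence[where w="\<lambda>\<tau>. ?I \<tau> * (420 * (3 * B))"])
    show "integrable lborel (\<lambda>\<tau>. ?I \<tau> * (420 * (3 * B)))" by (simp add: emeasure_lborel_Icc_eq)
    have adv: "integrable lborel (advection e1 (u \<tau>))" "integrable lborel (\<lambda>x. (1 + norm x ^ 3) * \<bar>advection e1 (u \<tau>) x\<bar>)"
        "(LINT x|lborel. (1 + norm x ^ 3) * \<bar>advection e1 (u \<tau>) x\<bar>) \<le> 3 * B" if "\<tau> \<in> {s..t}" for \<tau>
      using integrable_advection[OF e1 Z_reg[OF sub[OF that]]] advection_third_moment[OF e1 Z_reg[OF sub[OF that]] d]
        bspec[OF B(2) sub[OF that]] by auto
    show "AE \<tau> in lborel. (\<lambda>n. (?I \<tau> *\<^sub>R cancelling_mean (Fh \<tau>) (e n)) / complex_of_real (e n ^ 3)) \<longlonglongrightarrow> ?I \<tau> *\<^sub>R 0"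
    proof (rule AE_I2)
      fix \<tau>
      show "(\<lambda>n. (?I \<tau> *\<^sub>R cancelling_mean (Fh \<tau>) (e n)) / complex_of_real (e n ^ 3)) \<longlonglongrightarrow> ?I \<tau> *\<^sub>R 0"
      proof (cases "\<tau> \<in> {s..t}")
        case True
        show ?thesis using cancelling_mean_fhat_tendsto[OF adv(1,2)[OF True] e] True by simp
      qed simp
    qed
    show "AE \<tau> in lborel. norm ((?I \<tau> *\<^sub>R cancelling_mean (Fh \<tau>) (e n)) / complex_of_real (e n ^ 3)) \<le> ?I \<tau> * (420 * (3 * B))" for n
    proof (rule AE_I2)
      fix \<tau>
      show "norm ((?I \<tau> *\<^sub>R cancelling_mean (Fh \<tau>) (e n)) / complex_of_real (e n ^ 3)) \<le> ?I \<tau> * (420 * (3 * B))"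
      proof (cases "\<tau> \<in> {s..t}")
        case True
        have "cmod (cancelling_mean (Fh \<tau>) (e n) / complex_of_real (e n ^ 3)) \<le> 420 * (3 * B)"
          using cancelling_mean_fhat_le[OF adv(1,2)[OF True] e(2), of n] adv(3)[OF True] by linarith
        then show ?thesis using True by simp
      qed simp
    qed
  qed (intro borel_measurable_divide borel_measurable_integrable[OF cm_int] borel_measurable_const | simp)+
  then show ?thesis unfolding cm by (simp only: integral_divide_zero scaleR_zero_right Bochner_Integration.integral_zero)
qed

definition critically_weighted :: "real \<Rightarrow> bool" where
  "critically_weighted t \<longleftrightarrow> square_integrable (\<lambda>x. norm x powr (real CARD('d) / 2 + 3) * u t x)"

text \<open>
  In Duhamel's formula, the cancelling means of \<open>u^(t)\<close> and \<open>u^(s)\<close> are \<open>o(b\<^sup>3)\<close> by the critical decay, and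
  so is that of the regular part.  Comparison of the coefficients of \<open>b\<^sup>3\<close> in the two remaining parts
  gives the identity, after division by \<open>t - s\<close>.
\<close>

theorem critical_weight_identity:
  assumes d6: "CARD('d) \<le> 6" and s: "0 \<le> s" "s < t" and t: "t \<le> T"
    and ws: "critically_weighted s" and wt: "critically_weighted t"
  shows "first_moment_mean s + (t - s) * E / 4 * cubic_mean = 0"
proof -
  have sT: "s \<in> {0..T}" and tT: "t \<in> {0..T}" and st: "s \<le> t" using s t by auto
  define e where "e n = inverse (real (Suc n))" for n
  have e: "e \<longlonglongrightarrow> 0" "\<And>n. e n > 0"
    unfolding e_def by (rule LIMSEQ_inverse_real_of_nat) simp
  have ends: "(\<lambda>n. cancelling_mean (fhat (u \<tau>)) (e n) / complex_of_real (e n ^ 3)) \<longlonglongrightarrow> 0"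
    if "\<tau> \<in> {0..T}" "critically_weighted \<tau>" for \<tau>
    using Z_regular_integrable[OF Z_reg[OF that(1)]] that(2) d6 e unfolding critically_weighted_def
    by (intro cancelling_mean_weighted_tendsto) auto
  define H1 where "H1 \<xi> = (P (t - s) \<xi> - 1) * fhat (u s) \<xi>" for \<xi>
  define H2 where "H2 \<xi> = integral {s..t} (\<lambda>\<tau>. (P (t - \<tau>) \<xi> - 1) * Fh \<tau> \<xi>)" for \<xi>
  define H3 where "H3 \<xi> = integral {s..t} (\<lambda>\<tau>. Fh \<tau> \<xi>)" for \<xi>
  have H3: "H3 \<xi> = (H1 \<xi> - H2 \<xi>) - (fhat (u t) \<xi> - fhat (u s) \<xi>)" for \<xi>
  proof -
    have sub: "{s..t} \<subseteq> {0..T}" using s t by auto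
    have i: "(\<lambda>\<tau>. P (t - \<tau>) \<xi> * Fh \<tau> \<xi>) integrable_on {s..t}" "(\<lambda>\<tau>. Fh \<tau> \<xi>) integrable_on {s..t}"
      by (intro integrable_continuous_real continuous_on_duhamel_integrand continuous_on_Fh_time sub)+
    have "H2 \<xi> = integral {s..t} (\<lambda>\<tau>. P (t - \<tau>) \<xi> * Fh \<tau> \<xi> - Fh \<tau> \<xi>)"
      unfolding H2_def by (simp add: left_diff_distrib)
    also have "\<dots> = integral {s..t} (\<lambda>\<tau>. P (t - \<tau>) \<xi> * Fh \<tau> \<xi>) - H3 \<xi>"
      unfolding H3_def by (rule Henstock_Kurzweil_Integration.integral_diff[OF i])
    finally show ?thesis
      using duhamel_fourier_from[OF s(1) st t, of \<xi>] by (simp add: H1_def left_diff_distrib)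
  qed
  note np = nonlinear_part_tendsto[OF s(1) st t e, folded H2_def]
  obtain M where M: "\<And>\<xi>. cmod (H2 \<xi>) \<le> M" using np(3) by blast
  have ib: "integrable lborel (\<lambda>z. fhat (u \<tau>) (b *\<^sub>R z) * complex_of_real (gauss z))" if "\<tau> \<in> {0..T}" for \<tau> b
    by (rule integrable_gauss_mult[OF borel_measurable_fhat_u[OF that] norm_fhat_le])
  have i2: "integrable lborel (\<lambda>z. H2 (b *\<^sub>R z) * complex_of_real (gauss z))" for b
    using np(2) M by (rule integrable_gauss_mult)
  have i1: "integrable lborel (\<lambda>z. H1 (b *\<^sub>R z) * complex_of_real (gauss z))" for b
  proof (rule integrable_gauss_mult)
    have [measurable]: "fhat (u s) \<in> borel_measurable borel" by (rule borel_measurable_fhat_u[OF sT])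
    show "H1 \<in> borel_measurable borel" unfolding H1_def[abs_def] by measurable
    show "cmod (H1 \<xi>) \<le> 2 * (LINT x|lborel. \<bar>u s x\<bar>)" for \<xi>
      unfolding H1_def norm_mult
      using norm_triangle_ineq4[of "P (t - s) \<xi>" 1] by (intro mult_mono norm_fhat_le) auto
  qed
  have i12: "integrable lborel (\<lambda>z. (H1 (b *\<^sub>R z) - H2 (b *\<^sub>R z)) * complex_of_real (gauss z))" for b
    unfolding left_diff_distrib by (rule Bochner_Integration.integrable_diff[OF i1 i2])
  have its: "integrable lborel (\<lambda>z. (fhat (u t) (b *\<^sub>R z) - fhat (u s) (b *\<^sub>R z)) * complex_of_real (gauss z))" for b
    unfolding left_diff_distrib by (rule Bochner_Integration.integrable_diff[OF ib[OF tT] ib[OF sT]])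
  have cm: "cancelling_mean H3 b = (cancelling_mean H1 b - cancelling_mean H2 b) - (cancelling_mean (fhat (u t)) b - cancelling_mean (fhat (u s)) b)" for b
    unfolding H3[abs_def] cancelling_mean_diff[OF i12 its] cancelling_mean_diff[OF i1 i2] cancelling_mean_diff[OF ib[OF tT] ib[OF sT]] ..
  have "(\<lambda>n. (cancelling_mean H1 (e n) / complex_of_real (e n ^ 3) - cancelling_mean H2 (e n) / complex_of_real (e n ^ 3))
      - (cancelling_mean (fhat (u t)) (e n) / complex_of_real (e n ^ 3) - cancelling_mean (fhat (u s)) (e n) / complex_of_real (e n ^ 3)))
      \<longlonglongrightarrow> (- 10 * complex_of_real ((t - s) * first_moment_mean s) - - 10 * complex_of_real (- ((t - s)\<^sup>2 * E / 4 * cubic_mean))) - (0 - 0)"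
    by (intro tendsto_diff ends sT tT ws wt np(1) linear_part_tendsto[OF sT e, of "t - s", folded H1_def])
  moreover have "(\<lambda>n. cancelling_mean H3 (e n) / complex_of_real (e n ^ 3)) \<longlonglongrightarrow> 0"
    unfolding H3_def[abs_def] by (rule regular_part_tendsto[OF s(1) st t e])
  then have "(\<lambda>n. (cancelling_mean H1 (e n) / complex_of_real (e n ^ 3) - cancelling_mean H2 (e n) / complex_of_real (e n ^ 3))
      - (cancelling_mean (fhat (u t)) (e n) / complex_of_real (e n ^ 3) - cancelling_mean (fhat (u s)) (e n) / complex_of_real (e n ^ 3))) \<longlonglongrightarrow> 0"
    by (simp only: cm diff_divide_distrib)
  ultimately have "(- 10 * complex_of_real ((t - s) * first_moment_mean s) - - 10 * complex_of_real (- ((t - s)\<^sup>2 * E / 4 * cubic_mean))) - (0 - 0) = 0"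
    by (rule LIMSEQ_unique)
  moreover have "(- 10 * complex_of_real a - - 10 * complex_of_real (- c)) - (0 - 0) = complex_of_real (- 10 * (a + c))" for a c
    by simp
  ultimately have "- 10 * ((t - s) * first_moment_mean s + (t - s)\<^sup>2 * E / 4 * cubic_mean) = 0"
    by (simp only: of_real_eq_0_iff)
  then have "(t - s) * first_moment_mean s + (t - s)\<^sup>2 * E / 4 * cubic_mean = 0"
    unfolding mult_eq_0_iff[of "- 10"] by (elim disjE) (simp, assumption)
  moreover have "(t - s) * first_moment_mean s + (t - s)\<^sup>2 * E / 4 * cubic_mean = (t - s) * (first_moment_mean s + (t - s) * E / 4 * cubic_mean)"
    by (simp add: power2_eq_square distrib_left)
  ultimately have "(t - s) * (first_moment_mean s + (t - s) * E / 4 * cubic_mean) = 0" by (simp only:)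
  then show ?thesis using s by simp
qed

text \<open>
  With the smallest of the three times as \<open>s\<close>, the identity holds for two values of \<open>t\<close>, although
  its first term does not depend on \<open>t\<close>.
\<close>

theorem vanishing_if_weighted_at_three_times:
  assumes d6: "CARD('d) \<le> 6" and s: "0 \<le> s" "s < t" "s < t'" and t: "t \<le> T" "t' \<le> T" and ne: "t \<noteq> t'"
    and w: "critically_weighted s" "critically_weighted t" "critically_weighted t'" and \<tau>: "\<tau> \<in> {0..T}"
  shows "AE x in lborel. u \<tau> x = 0"
proof -
  have "first_moment_mean s + (t - s) * E / 4 * cubic_mean = 0" "first_moment_mean s + (t' - s) * E / 4 * cubic_mean = 0"
    by (rule critical_weight_identity[OF d6 s(1,2) t(1) w(1,2)] critical_weight_identity[OF d6 s(1,3) t(2) w(1,3)])+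
  then have "(t - s) * E / 4 * cubic_mean - (t' - s) * E / 4 * cubic_mean = 0" by linarith
  moreover have "(t - s) * E / 4 * cubic_mean - (t' - s) * E / 4 * cubic_mean = (t - t') * (E * cubic_mean) / 4"
    by (simp add: left_diff_distrib diff_divide_distrib)
  ultimately have "E = 0" using ne cubic_mean_pos by simp
  then have "square_integral (u \<tau>) = 0" using square_integral_conserved[OF \<tau>] by simp
  then have "AE x in lborel. (norm (u \<tau> x))\<^sup>2 = 0"
    using Z_regular_square_integrable[OF Z_reg[OF \<tau>]] unfolding square_integral_def square_integrable_def
    by (subst (asm) integral_nonneg_eq_0_iff_AE) auto
  then show ?thesis by eventually_elim simp
qed

end

lemma Z_space_weight:
  fixes f :: "'a::euclidean_space \<Rightarrow> real"
  assumes f: "f \<in> Z_space s r"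
  shows "square_integrable (\<lambda>x. norm x powr r * f x)"
proof -
  have fc: "(\<lambda>x. complex_of_real (f x)) \<in> borel_measurable borel"
    using f by (auto simp: Z_space_def sobolev_def dest: has_fourier_L2_measurable(1))
  have [measurable]: "f \<in> borel_measurable borel"
    using borel_measurable_Re[THEN measurable_compose[rotated], OF fc] by simp
  have "square_integrable (\<lambda>x. complex_of_real (norm x powr r * f x))"
    using f by (subst l2_sq_finite_iff[symmetric]) (auto simp: Z_space_def)
  then show ?thesis by (simp add: square_integrable_def norm_mult power_mult_distrib)
qed

theorem theorem1p3:
  fixes k :: "'d::finite"
    and r T t1 t2 t3 :: real
    and u0 :: "real^'d \<Rightarrow> real"
    and u :: "real \<Rightarrow> real^'d \<Rightarrow> real"
  assumes "(CARD('d) = 2 \<and> r = 3) \<or> (CARD('d) = 3 \<and> r = 4)"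
    and "T > 0"
    and "continuous_in_Z_dot r r T u"
    and "duhamel_solution k T u0 u"
    and "t1 \<in> {0..T}" and "t2 \<in> {0..T}" and "t3 \<in> {0..T}"
    and "t1 \<noteq> t2" and "t1 \<noteq> t3" and "t2 \<noteq> t3"
    and "u t1 \<in> Z_space (real CARD('d) / 2 + 3) (real CARD('d) / 2 + 3)"
    and "u t2 \<in> Z_space (real CARD('d) / 2 + 3) (real CARD('d) / 2 + 3)"
    and "u t3 \<in> Z_space (real CARD('d) / 2 + 3) (real CARD('d) / 2 + 3)"
  shows "\<forall>t\<in>{0..T}. (AE x in lborel. u t x = 0) \<and>
           (continuous_on UNIV (u t) \<longrightarrow> (\<forall>x. u t x = 0))"
proof -
  have r: "r = real CARD('d) + 1" and d: "CARD('d) \<ge> 2" "CARD('d) \<le> 6" using assms(1) by auto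
  interpret Z_duhamel_solution k T u u0
    by unfold_locales (use assms(2-4) r d in auto)
  have w: "critically_weighted t1" "critically_weighted t2" "critically_weighted t3"
    unfolding critically_weighted_def by (intro Z_space_weight[where s="real CARD('d) / 2 + 3"] assms(11-13))+
  consider "t1 < t2 \<and> t1 < t3" | "t2 < t1 \<and> t2 < t3" | "t3 < t1 \<and> t3 < t2"
    using assms(8-10) by linarith
  then have ae: "AE x in lborel. u t x = 0" if "t \<in> {0..T}" for t
  proof cases
    case 1
    then show ?thesis using assms(5-10) w that d by (intro vanishing_if_weighted_at_three_times[of t1 t2 t3]) auto
  next
    case 2
    then show ?thesis using assms(5-10) w that d by (intro vanishing_if_weighted_at_three_times[of t2 t1 t3]) auto
  next
    case 3
    then show ?thesis using assms(5-10) w that d by (intro vanishing_if_weighted_at_three_times[of t3 t1 t2]) auto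
  qed
  then show ?thesis using continuous_AE_eq_0 by blast
qed

end
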